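(* Let $\Omega\subset\mathbb R^n$ be a bounded open set with Lipschitz boundary, let $\alpha,\beta>0$ and $g\in L^\infty(\Omega)$, and let $m$ and $M$ be the (essential) infimum and supremum of $g$ on $\Omega$. Let $u$ be the solution of the Neumann problem $$\Delta u=\beta(u-g)\ \text{ on }\Omega,\qquad \partial_\nu u=0\ \text{ on }\partial\Omega,$$ where $\partial_\nu$ denotes the normal derivative, and assume that $u$ is of class $C^1$ up to the boundary and that $$(M-m)\cdot\sup_\Omega|\nabla u|\le\alpha .$$ Then $u$ is an absolute minimizer on $SBV(\Omega)$ of the Mumford–Shah functional $$F(v):=\int_{\Omega}|\nabla v|^2\,dx+\alpha\,\mathcal H^{n-1}(Sv)+\beta\int_\Omega(v-g)^2\,dx,$$ that is, $F(u)\le F(v)$ for every $v\in SBV(\Omega)$.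
   Context: The solution $u$ of the Neumann problem is the (unique) minimizer of $\int_\Omega[|\nabla v|^2+\beta(v-g)^2]\,dx$ on $W^{1,2}(\Omega)$. For $v\in BV(\Omega)$: $Sv$ is the set of points of $\Omega$ where $v$ has no approximate limit, where $v$ has approximate limit $a$ at $x$ if $\lim_{r\to0}r^{-n}\int_{B(x,r)}|v(y)-a|\,dy=0$; $\nabla v$ is the approximate gradient (density of $Dv$ with respect to Lebesgue measure $\mathcal L^n$). $SBV(\Omega)$ is the space of $v\in BV(\Omega)$ such that $Dv=\nabla v\cdot\mathcal L^n+(v^+-v^-)\nu_v\cdot\mathcal H^{n-1}\llcorner Sv$, with $v^\pm$ the approximate one-sided limits on $Sv$ and $\nu_v$ the approximate unit normal to $Sv$ pointing from the side of $v^-$ to that of $v^+$. *)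

theory Defs
  imports "HOL-Analysis.Analysis" "HOL-Probability.Essential_Supremum"
begin

section \<open>Hausdorff measure\<close>

text \<open>
  The measure is normalised so that in dimension \<open>k\<close> it agrees with Lebesgue measure on
  \<open>k\<close>-dimensional Euclidean space. The empty set has to be singled out because
  \<open>diameter {} = 0\<close> and \<open>0 ^ 0 = 1\<close>.
\<close>

definition hausdorff_gauge :: "nat \<Rightarrow> 'a::metric_space set \<Rightarrow> ennreal" where
  "hausdorff_gauge k C =
     (if C = {} then 0 else ennreal (unit_ball_vol (real k) * (diameter C / 2) ^ k))"

definition hausdorff_covers :: "real \<Rightarrow> 'a::metric_space set \<Rightarrow> (nat \<Rightarrow> 'a set) set" where
  "hausdorff_covers \<delta> A = {C. A \<subseteq> (\<Union>i. C i) \<and> (\<forall>i. bounded (C i) \<and> diameter (C i) \<le> \<delta>)}"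

definition hausdorff_pre :: "nat \<Rightarrow> real \<Rightarrow> 'a::metric_space set \<Rightarrow> ennreal" where
  "hausdorff_pre k \<delta> A = (INF C\<in>hausdorff_covers \<delta> A. \<Sum>i. hausdorff_gauge k (C i))"

definition hausdorff_outer :: "nat \<Rightarrow> 'a::metric_space set \<Rightarrow> ennreal" where
  "hausdorff_outer k A = (SUP \<delta>\<in>{0<..}. hausdorff_pre k \<delta> A)"

definition hausdorff_measure :: "nat \<Rightarrow> 'a::metric_space measure" where
  "hausdorff_measure k = measure_of UNIV (sets borel) (hausdorff_outer k)"

text \<open>
  By Caratheodory's criterion the outer measure is countably additive on Borel sets, so that
  \<open>measure_of\<close> above does not fall back to the zero measure.
\<close>

lemma hausdorff_covers_mono: "A \<subseteq> B \<Longrightarrow> \<delta> \<le> \<epsilon> \<Longrightarrow> hausdorff_covers \<delta> B \<subseteq> hausdorff_covers \<epsilon> A"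
  unfolding hausdorff_covers_def by (rule Collect_mono) (meson order_trans)

lemma hausdorff_pre_mono: "A \<subseteq> B \<Longrightarrow> \<delta> \<le> \<epsilon> \<Longrightarrow> hausdorff_pre k \<epsilon> A \<le> hausdorff_pre k \<delta> B"
  unfolding hausdorff_pre_def by (intro INF_superset_mono hausdorff_covers_mono) auto

lemma hausdorff_outer_mono: "A \<subseteq> B \<Longrightarrow> hausdorff_outer k A \<le> hausdorff_outer k B"
  unfolding hausdorff_outer_def by (intro SUP_mono) (auto intro: hausdorff_pre_mono)

lemma hausdorff_outer_empty [simp]: "hausdorff_outer k {} = 0"
proof -
  have "hausdorff_pre k \<delta> ({}::'a set) = 0" if "\<delta> > 0" for \<delta>
  proof -
    have "hausdorff_pre k \<delta> ({}::'a set) \<le> (\<Sum>i. hausdorff_gauge k ((\<lambda>_::nat. {}::'a set) i))"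
      unfolding hausdorff_pre_def
      using that by (intro INF_lower) (auto simp: hausdorff_covers_def)
    then show ?thesis by (simp add: hausdorff_gauge_def)
  qed
  then show ?thesis by (simp add: hausdorff_outer_def)
qed

lemma hausdorff_pre_UN:
  "hausdorff_pre k \<delta> (\<Union>i::nat. A i) \<le> (\<Sum>i. hausdorff_pre k \<delta> (A i))"
proof (cases "(\<Sum>i. hausdorff_pre k \<delta> (A i)) = top")
  case False
  show ?thesis
  proof (rule ennreal_le_epsilon)
    fix e :: real assume e: "0 < e"
    have fin: "hausdorff_pre k \<delta> (A i) \<noteq> top" for i
      using False ennreal_suminf_lessD[of "\<lambda>i. hausdorff_pre k \<delta> (A i)" top i]
      by (auto simp: less_top)
    have "\<exists>C\<in>hausdorff_covers \<delta> (A i).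
        (\<Sum>j. hausdorff_gauge k (C j)) < hausdorff_pre k \<delta> (A i) + ennreal (e * (1/2)^Suc i)" for i
    proof -
      have "hausdorff_pre k \<delta> (A i) < hausdorff_pre k \<delta> (A i) + ennreal (e * (1/2)^Suc i)"
        using fin[of i] e by (simp add: ennreal_zero_less_mult_iff ennreal_less_zero_iff less_top)
      then show ?thesis
        unfolding hausdorff_pre_def[of k \<delta> "A i"] INF_less_iff .
    qed
    then obtain C where C: "\<And>i. C i \<in> hausdorff_covers \<delta> (A i)"
      "\<And>i. (\<Sum>j. hausdorff_gauge k (C i j)) < hausdorff_pre k \<delta> (A i) + ennreal (e * (1/2)^Suc i)"
      by metis
    define D where "D n = (case prod_decode n of (i, j) \<Rightarrow> C i j)" for n
    have "D \<in> hausdorff_covers \<delta> (\<Union>i. A i)"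
    proof -
      have "x \<in> (\<Union>n. D n)" if x: "x \<in> A i" for x i
      proof -
        obtain j where "x \<in> C i j" using C(1)[of i] x by (fastforce simp: hausdorff_covers_def)
        then have "x \<in> D (prod_encode (i, j))" by (simp add: D_def)
        then show ?thesis by blast
      qed
      moreover have "bounded (D n) \<and> diameter (D n) \<le> \<delta>" for n
        using C(1) by (auto simp: hausdorff_covers_def D_def split: prod.split)
      ultimately show ?thesis by (auto simp: hausdorff_covers_def)
    qed
    then have "hausdorff_pre k \<delta> (\<Union>i. A i) \<le> (\<Sum>n. hausdorff_gauge k (D n))"
      unfolding hausdorff_pre_def by (rule INF_lower)
    also have "\<dots> = (\<Sum>n. (case prod_decode n of (i, j) \<Rightarrow> hausdorff_gauge k (C i j)))"
      by (intro suminf_cong) (simp add: D_def split: prod.split)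
    also have "\<dots> = (\<Sum>i. \<Sum>j. hausdorff_gauge k (C i j))"
      using suminf_ennreal_2dimen[of "\<lambda>i. \<Sum>j. hausdorff_gauge k (C i j)"
          "\<lambda>(i,j). hausdorff_gauge k (C i j)"] by simp
    also have "\<dots> \<le> (\<Sum>i. hausdorff_pre k \<delta> (A i) + ennreal (e * (1/2)^Suc i))"
      using C(2) by (intro suminf_le) (auto intro: less_imp_le)
    also have "\<dots> = (\<Sum>i. hausdorff_pre k \<delta> (A i)) + (\<Sum>i. ennreal (e * (1/2)^Suc i))"
      by (intro suminf_add[symmetric]) auto
    also have "(\<Sum>i. ennreal (e * (1/2)^Suc i)) = ennreal e"
    proof -
      have "(\<lambda>i. e * (1/2)^Suc i) sums (e * 1)"
        by (intro sums_mult power_half_series)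
      then show ?thesis using e by (intro suminf_ennreal_eq) auto
    qed
    finally show "hausdorff_pre k \<delta> (\<Union>i. A i) \<le> (\<Sum>i. hausdorff_pre k \<delta> (A i)) + ennreal e" .
  qed
qed simp

lemma hausdorff_outer_UN:
  "hausdorff_outer k (\<Union>i::nat. A i) \<le> (\<Sum>i. hausdorff_outer k (A i))"
  unfolding hausdorff_outer_def[of k "\<Union>i. A i"]
proof (rule SUP_least)
  fix \<delta> :: real assume "\<delta> \<in> {0<..}"
  then have "hausdorff_pre k \<delta> (A i) \<le> hausdorff_outer k (A i)" for i
    unfolding hausdorff_outer_def by (rule SUP_upper)
  then have "(\<Sum>i. hausdorff_pre k \<delta> (A i)) \<le> (\<Sum>i. hausdorff_outer k (A i))"
    by (intro suminf_le) auto
  with hausdorff_pre_UN show "hausdorff_pre k \<delta> (\<Union>i. A i) \<le> (\<Sum>i. hausdorff_outer k (A i))"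
    by (rule order_trans)
qed

lemma outer_measure_space_hausdorff: "outer_measure_space UNIV (hausdorff_outer k)"
  unfolding outer_measure_space_def positive_def increasing_def countably_subadditive_def
  by (auto intro: hausdorff_outer_mono hausdorff_outer_UN)

lemma hausdorff_outer_Un: "hausdorff_outer k (A \<union> B) \<le> hausdorff_outer k A + hausdorff_outer k B"
proof -
  have "hausdorff_outer k (A \<union> B) \<le> (\<Sum>i. hausdorff_outer k ((\<lambda>i::nat. if i = 0 then A else if i = 1 then B else {}) i))"
    by (rule order_trans[OF hausdorff_outer_mono hausdorff_outer_UN]) (force split: if_splits)
  also have "\<dots> = (\<Sum>i<2. hausdorff_outer k ((\<lambda>i::nat. if i = 0 then A else if i = 1 then B else {}) i))"
    by (intro suminf_finite) auto
  also have "\<dots> = hausdorff_outer k A + hausdorff_outer k B"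
    by (simp add: numeral_2_eq_2)
  finally show ?thesis .
qed

lemma hausdorff_outer_separated:
  assumes d: "d > 0" and sep: "\<And>x y. x \<in> A \<Longrightarrow> y \<in> B \<Longrightarrow> dist x y \<ge> d"
  shows "hausdorff_outer k A + hausdorff_outer k B \<le> hausdorff_outer k (A \<union> B)"
proof -
  have pre: "hausdorff_pre k \<delta> A + hausdorff_pre k \<delta> B \<le> hausdorff_pre k \<delta> (A \<union> B)"
    if "0 < \<delta>" "\<delta> < d" for \<delta>
    unfolding hausdorff_pre_def[of k \<delta> "A \<union> B"]
  proof (rule INF_greatest)
    fix C assume C: "C \<in> hausdorff_covers \<delta> (A \<union> B)"
    define CA where "CA i = (if C i \<inter> A = {} then {} else C i)" for i
    define CB where "CB i = (if C i \<inter> B = {} then {} else C i)" for i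
    have "CA \<in> hausdorff_covers \<delta> A" "CB \<in> hausdorff_covers \<delta> B"
      using C that by (fastforce simp: hausdorff_covers_def CA_def CB_def)+
    then have "hausdorff_pre k \<delta> A + hausdorff_pre k \<delta> B
        \<le> (\<Sum>i. hausdorff_gauge k (CA i)) + (\<Sum>i. hausdorff_gauge k (CB i))"
      unfolding hausdorff_pre_def by (intro add_mono INF_lower)
    also have "\<dots> = (\<Sum>i. hausdorff_gauge k (CA i) + hausdorff_gauge k (CB i))"
      by (intro suminf_add) auto
    also have "\<dots> \<le> (\<Sum>i. hausdorff_gauge k (C i))"
    proof (intro suminf_le)
      fix i
      have "C i \<inter> A = {} \<or> C i \<inter> B = {}"
      proof (rule ccontr)
        assume "\<not> ?thesis"
        then obtain x y where xy: "x \<in> C i" "x \<in> A" "y \<in> C i" "y \<in> B" by blast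
        then have "dist x y \<le> diameter (C i)"
          using C by (intro diameter_bounded_bound) (auto simp: hausdorff_covers_def)
        also have "\<dots> \<le> \<delta>" using C by (auto simp: hausdorff_covers_def)
        finally show False using sep[of x y] xy that by auto
      qed
      then show "hausdorff_gauge k (CA i) + hausdorff_gauge k (CB i) \<le> hausdorff_gauge k (C i)"
        by (auto simp: CA_def CB_def hausdorff_gauge_def)
    qed auto
    finally show "hausdorff_pre k \<delta> A + hausdorff_pre k \<delta> B \<le> (\<Sum>i. hausdorff_gauge k (C i))" .
  qed
  have "hausdorff_outer k A + hausdorff_outer k B
      = (SUP \<delta>\<in>{0<..}. hausdorff_pre k \<delta> A + hausdorff_pre k \<delta> B)"
    unfolding hausdorff_outer_def
  proof (rule SUP_add_directed_ennreal[symmetric])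
    fix i j :: real assume "i \<in> {0<..}" "j \<in> {0<..}"
    then show "\<exists>l\<in>{0<..}. hausdorff_pre k i A + hausdorff_pre k j B
        \<le> hausdorff_pre k l A + hausdorff_pre k l B"
      by (intro bexI[of _ "min i j"] add_mono hausdorff_pre_mono) auto
  qed
  also have "\<dots> \<le> hausdorff_outer k (A \<union> B)"
  proof (rule SUP_least)
    fix \<delta> :: real assume "\<delta> \<in> {0<..}"
    define \<epsilon> where "\<epsilon> = min \<delta> (d/2)"
    have \<epsilon>: "0 < \<epsilon>" "\<epsilon> < d" "\<epsilon> \<le> \<delta>" using \<open>\<delta> \<in> _\<close> d by (auto simp: \<epsilon>_def)
    have "hausdorff_pre k \<delta> A + hausdorff_pre k \<delta> B \<le> hausdorff_pre k \<epsilon> A + hausdorff_pre k \<epsilon> B"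
      using \<epsilon> by (intro add_mono hausdorff_pre_mono) auto
    also have "\<dots> \<le> hausdorff_pre k \<epsilon> (A \<union> B)" using \<epsilon> by (intro pre)
    also have "\<dots> \<le> hausdorff_outer k (A \<union> B)"
      unfolding hausdorff_outer_def using \<epsilon> by (intro SUP_upper) auto
    finally show "hausdorff_pre k \<delta> A + hausdorff_pre k \<delta> B \<le> hausdorff_outer k (A \<union> B)" .
  qed
  finally show ?thesis .
qed

lemma hausdorff_outer_separated_UN:
  fixes R :: "nat \<Rightarrow> 'a::metric_space set"
  assumes d: "\<And>j. d j > 0" and sep: "\<And>i j x y. i < j \<Longrightarrow> x \<in> R i \<Longrightarrow> y \<in> R j \<Longrightarrow> dist x y \<ge> d j"
  shows "(\<Sum>i. hausdorff_outer k (R i)) \<le> hausdorff_outer k (\<Union>i. R i)"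
proof (rule suminf_le_const)
  fix n
  have "(\<Sum>i<n. hausdorff_outer k (R i)) \<le> hausdorff_outer k (\<Union>i<n. R i)"
  proof (induction n)
    case (Suc n)
    have "(\<Sum>i<Suc n. hausdorff_outer k (R i)) \<le> hausdorff_outer k (\<Union>i<n. R i) + hausdorff_outer k (R n)"
      using Suc by (simp add: add_right_mono)
    also have "\<dots> \<le> hausdorff_outer k ((\<Union>i<n. R i) \<union> R n)"
      by (rule hausdorff_outer_separated[OF d[of n]]) (use sep in auto)
    also have "(\<Union>i<n. R i) \<union> R n = (\<Union>i<Suc n. R i)" by (auto simp: less_Suc_eq)
    finally show ?case .
  qed simp
  also have "\<dots> \<le> hausdorff_outer k (\<Union>i. R i)" by (intro hausdorff_outer_mono) auto
  finally show "(\<Sum>i<n. hausdorff_outer k (R i)) \<le> hausdorff_outer k (\<Union>i. R i)" .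
qed simp

lemma ennreal_suminf_tail:
  fixes f :: "nat \<Rightarrow> ennreal"
  assumes "(\<Sum>i. f i) \<noteq> top"
  shows "(\<lambda>n. \<Sum>i. f (i + n)) \<longlonglongrightarrow> 0"
proof -
  have fin: "(\<Sum>i<n. f i) \<noteq> top" for n
    using assms sum_le_suminf[of f "{..<n}"] by (metis finite_lessThan summableI top_unique zero_le)
  have "(\<Sum>i. f (i + n)) = (\<Sum>i. f i) - (\<Sum>i<n. f i)" for n
    using suminf_offset[of f n] fin[of n] by (simp add: add.commute)
  moreover have "(\<lambda>n. (\<Sum>i. f i) - (\<Sum>i<n. f i)) \<longlonglongrightarrow> (\<Sum>i. f i) - (\<Sum>i. f i)"
    using assms by (intro tendsto_diff_ennreal tendsto_const summable_LIMSEQ) auto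
  ultimately show ?thesis
    using assms by simp
qed

lemma closed_in_lambda_system_hausdorff:
  fixes F :: "'a::metric_space set"
  assumes "closed F"
  shows "F \<in> lambda_system UNIV UNIV (hausdorff_outer k)"
proof -
  let ?H = "hausdorff_outer k"
  have le: "?H (T \<inter> F) + ?H (T - F) \<le> ?H T" for T
  proof (cases "F = {} \<or> ?H T = top")
    case False
    define D where "D n = {x \<in> T. infdist x F \<ge> 1 / (real n + 1)}" for n
    define R where "R n = D (Suc n) - D n" for n
    have D_sep: "?H (T \<inter> F) + ?H (D n) \<le> ?H T" for n
    proof -
      have "?H (T \<inter> F) + ?H (D n) \<le> ?H ((T \<inter> F) \<union> D n)"
      proof (rule hausdorff_outer_separated[of "1 / (real n + 1)"])
        fix x y assume "x \<in> T \<inter> F" "y \<in> D n"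
        then have "infdist y F \<le> dist y x" "infdist y F \<ge> 1 / (real n + 1)"
          by (auto simp: D_def intro: infdist_le)
        then show "dist x y \<ge> 1 / (real n + 1)" by (simp add: dist_commute)
      qed simp
      also have "\<dots> \<le> ?H T" by (intro hausdorff_outer_mono) (auto simp: D_def)
      finally show ?thesis .
    qed
    have R_sep: "dist x y \<ge> 1 / (real i + 2) - 1 / (real j + 1)"
      if "x \<in> R i" "y \<in> R j" for x y i j
    proof -
      have "infdist x F \<ge> 1 / (real i + 2)" "infdist y F < 1 / (real j + 1)"
        using that by (auto simp: R_def D_def algebra_simps)
      moreover have "infdist x F \<le> infdist y F + dist x y" by (rule infdist_triangle)
      ultimately show ?thesis by linarith
    qed
    have R_le: "(\<Sum>i. ?H (R (2 * i + c))) \<le> ?H T" for c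
    proof -
      have "(\<Sum>i. ?H (R (2 * i + c))) \<le> ?H (\<Union>i. R (2 * i + c))"
      proof (rule hausdorff_outer_separated_UN[where d = "\<lambda>j. if j = 0 then 1
            else 1 / (2 * real j + real c) - 1 / (2 * real j + real c + 1)"])
        fix i j x y assume *: "i < j" "x \<in> R (2 * i + c)" "y \<in> R (2 * j + c)"
        have "1 / (2 * real j + real c) \<le> 1 / (real (2 * i + c) + 2)"
          using *(1) by (intro divide_left_mono) auto
        then show "dist x y \<ge> (if j = 0 then 1
            else 1 / (2 * real j + real c) - 1 / (2 * real j + real c + 1))"
          using R_sep[OF *(2,3)] *(1) by simp
      qed (auto simp: frac_less2)
      also have "\<dots> \<le> ?H T" by (intro hausdorff_outer_mono) (auto simp: R_def D_def)
      finally show ?thesis .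
    qed
    define E where "E c = (\<Sum>i. ?H (R (2 * i + c)))" for c
    have E_tail: "(\<lambda>p. E (2 * p + c)) \<longlonglongrightarrow> 0" for c
    proof -
      have "(\<Sum>i. ?H (R (2 * i + c))) \<noteq> top"
        using R_le[of c] False by (auto simp: top_unique)
      then have "(\<lambda>p. \<Sum>i. ?H (R (2 * (i + p) + c))) \<longlonglongrightarrow> 0"
        by (rule ennreal_suminf_tail)
      then show ?thesis by (simp add: E_def algebra_simps)
    qed
    have bound: "?H (T \<inter> F) + ?H (T - F) \<le> ?H T + (E (2 * p + 0) + E (2 * p + 1))" for p
    proof -
      have "T - F \<subseteq> D (2 * p) \<union> ((\<Union>i. R (2 * i + 2 * p)) \<union> (\<Union>i. R (2 * i + (2 * p + 1))))"
      proof
        fix x assume x: "x \<in> T - F"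
        then have pos: "infdist x F > 0"
          using False assms by (simp add: infdist_pos_not_in_closed)
        obtain n where "1 / (real n + 1) < infdist x F"
          using pos nat_approx_posE[of "infdist x F"] by (auto simp: add.commute)
        then have n: "x \<in> D n" using x by (auto simp: D_def)
        define l where "l = (LEAST n. x \<in> D n)"
        have l: "x \<in> D l" "\<And>n. n < l \<Longrightarrow> x \<notin> D n"
          using n by (auto simp: l_def intro: LeastI dest: not_less_Least)
        show "x \<in> D (2 * p) \<union> ((\<Union>i. R (2 * i + 2 * p)) \<union> (\<Union>i. R (2 * i + (2 * p + 1))))"
        proof (cases "l \<le> 2 * p")
          case True
          have "1 / (real (2 * p) + 1) \<le> 1 / (real l + 1)"
            using True by (intro divide_left_mono) auto
          then show ?thesis using l(1) unfolding D_def by force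
        next
          case False
          then obtain q where q: "l = Suc (q + 2 * p)"
            using less_imp_Suc_add[of "2 * p" l] by (auto simp: add.commute)
          then have "x \<in> R (q + 2 * p)" using l by (auto simp: R_def)
          moreover have "\<exists>i. q = 2 * i \<or> q = 2 * i + 1" by presburger
          ultimately show ?thesis by (force simp: algebra_simps)
        qed
      qed
      then have "?H (T - F) \<le> ?H (D (2 * p)) + (E (2 * p) + E (2 * p + 1))"
      proof -
        let ?U = "\<Union>i. R (2 * i + 2 * p)" and ?V = "\<Union>i. R (2 * i + (2 * p + 1))"
        assume "T - F \<subseteq> D (2 * p) \<union> (?U \<union> ?V)"
        then have "?H (T - F) \<le> ?H (D (2 * p) \<union> (?U \<union> ?V))"
          by (rule hausdorff_outer_mono)
        also have "\<dots> \<le> ?H (D (2 * p)) + ?H (?U \<union> ?V)"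
          by (rule hausdorff_outer_Un)
        also have "\<dots> \<le> ?H (D (2 * p)) + (?H ?U + ?H ?V)"
          by (intro add_left_mono hausdorff_outer_Un)
        also have "\<dots> \<le> ?H (D (2 * p)) + (E (2 * p) + E (2 * p + 1))"
          unfolding E_def by (intro add_left_mono add_mono hausdorff_outer_UN)
        finally show ?thesis .
      qed
      then have "?H (T \<inter> F) + ?H (T - F)
          \<le> (?H (T \<inter> F) + ?H (D (2 * p))) + (E (2 * p) + E (2 * p + 1))"
        by (simp add: add.assoc add_left_mono)
      also have "\<dots> \<le> ?H T + (E (2 * p) + E (2 * p + 1))"
        by (intro add_right_mono D_sep)
      finally show ?thesis by simp
    qed
    have "(\<lambda>p. ?H T + (E (2 * p + 0) + E (2 * p + 1))) \<longlonglongrightarrow> ?H T + (0 + 0)"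
      by (intro tendsto_add tendsto_const E_tail)
    then show ?thesis
      using bound by (intro LIMSEQ_le_const) auto
  qed (auto simp: top_unique)
  have ge: "?H T \<le> ?H (T \<inter> F) + ?H (T - F)" for T
    using hausdorff_outer_Un[of k "T \<inter> F" "T - F"] by (simp add: Int_Diff_Un)
  interpret algebra UNIV "UNIV :: 'a set set" using algebra_Pow[of "UNIV :: 'a set"] by simp
  show ?thesis
    using le ge by (auto simp: lambda_system_eq intro: antisym)
qed

lemma emeasure_hausdorff_measure:
  assumes "A \<in> sets borel"
  shows "emeasure (hausdorff_measure k) A = hausdorff_outer k A"
proof -
  let ?L = "lambda_system UNIV UNIV (hausdorff_outer k) :: 'a set set"
  interpret S: sigma_algebra UNIV "UNIV :: 'a set set"
    using sigma_algebra_Pow[of "UNIV :: 'a set"] by simp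
  have L: "measure_space UNIV ?L (hausdorff_outer k)"
    by (rule S.caratheodory_lemma[OF outer_measure_space_hausdorff])
  then interpret L: sigma_algebra UNIV ?L by (simp add: measure_space_def)
  have "sets borel \<subseteq> ?L"
  proof -
    have "S \<in> ?L" if "open S" for S
      using L.compl_sets[OF closed_in_lambda_system_hausdorff[of "- S"]] that
      by (simp add: closed_Compl flip: Compl_eq_Diff_UNIV)
    then have "sigma_sets UNIV (Collect open) \<subseteq> ?L"
      by (intro L.sigma_sets_subset) auto
    then show ?thesis
      by (simp add: borel_def)
  qed
  moreover have "countably_additive ?L (hausdorff_outer k)"
    using L by (simp add: measure_space_def)
  ultimately have ca: "countably_additive (sets borel) (hausdorff_outer k :: 'a set \<Rightarrow> _)"
    unfolding countably_additive_def by (meson order_trans subsetD)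
  show ?thesis
  proof (rule emeasure_measure_of[OF hausdorff_measure_def])
    have "sets (hausdorff_measure k :: 'a measure) = sets borel"
      unfolding hausdorff_measure_def using sets.sigma_sets_eq[of "borel :: 'a measure"] by simp
    then show "A \<in> sets (hausdorff_measure k)" "countably_additive (sets (hausdorff_measure k)) (hausdorff_outer k :: 'a set \<Rightarrow> _)"
      "positive (sets (hausdorff_measure k)) (hausdorff_outer k :: 'a set \<Rightarrow> _)"
      using assms ca by (simp_all add: positive_def)
  qed simp
qed

section \<open>Domains and classical function classes\<close>

text \<open>
  Near each boundary point, and in suitable orthogonal coordinates, the domain is the set of
  points strictly above the graph of a Lipschitz function of the coordinates orthogonal to \<open>e\<close>.
\<close>

definition lipschitz_boundary :: "'a::euclidean_space set \<Rightarrow> bool" where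
  "lipschitz_boundary \<Omega> \<longleftrightarrow>
     (\<forall>x\<^sub>0\<in>frontier \<Omega>. \<exists>e h L r. norm e = 1 \<and> r > 0 \<and> L-lipschitz_on {z. z \<bullet> e = 0} h \<and>
        \<Omega> \<inter> ball x\<^sub>0 r = {x \<in> ball x\<^sub>0 r. h (x - (x \<bullet> e) *\<^sub>R e) < x \<bullet> e})"

definition grad :: "('a::euclidean_space \<Rightarrow> real) \<Rightarrow> 'a \<Rightarrow> 'a" where
  "grad f x = (THE D. GDERIV f x :> D)"

definition C1_up_to_boundary :: "'a::euclidean_space set \<Rightarrow> ('a \<Rightarrow> real) \<Rightarrow> bool" where
  "C1_up_to_boundary \<Omega> u \<longleftrightarrow>
     (\<exists>U G. continuous_on (closure \<Omega>) U \<and> continuous_on (closure \<Omega>) G \<and>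
        (\<forall>x\<in>\<Omega>. u x = U x \<and> GDERIV u x :> G x))"

definition C1_compact_support :: "'a::euclidean_space set \<Rightarrow> ('a \<Rightarrow> real) set" where
  "C1_compact_support \<Omega> =
     {\<phi>. (\<exists>G. continuous_on UNIV G \<and> (\<forall>x. GDERIV \<phi> x :> G x)) \<and>
         compact (closure {x. \<phi> x \<noteq> 0}) \<and> closure {x. \<phi> x \<noteq> 0} \<subseteq> \<Omega>}"

section \<open>Lebesgue and Sobolev spaces\<close>

text \<open>
  Elements of function spaces are functions on the whole space; only their values on \<open>\<Omega>\<close>
  (up to Lebesgue null sets) matter.
\<close>

definition L_infinity :: "'a::euclidean_space set \<Rightarrow> ('a \<Rightarrow> real) set" where
  "L_infinity \<Omega> =
     {g \<in> borel_measurable (lebesgue_on \<Omega>). \<exists>C. AE x in lebesgue_on \<Omega>. \<bar>g x\<bar> \<le> C}"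

definition ess_sup_on :: "'a::euclidean_space set \<Rightarrow> ('a \<Rightarrow> real) \<Rightarrow> real" where
  "ess_sup_on \<Omega> g = real_of_ereal (esssup (lebesgue_on \<Omega>) (\<lambda>x. ereal (g x)))"

definition ess_inf_on :: "'a::euclidean_space set \<Rightarrow> ('a \<Rightarrow> real) \<Rightarrow> real" where
  "ess_inf_on \<Omega> g = - ess_sup_on \<Omega> (\<lambda>x. - g x)"

definition L2 :: "'a::euclidean_space set \<Rightarrow> ('a \<Rightarrow> 'b::euclidean_space) set" where
  "L2 \<Omega> = {f \<in> borel_measurable (lebesgue_on \<Omega>). integrable (lebesgue_on \<Omega>) (\<lambda>x. (norm (f x))\<^sup>2)}"

definition is_weak_grad ::
    "'a::euclidean_space set \<Rightarrow> ('a \<Rightarrow> real) \<Rightarrow> ('a \<Rightarrow> 'a) \<Rightarrow> bool" where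
  "is_weak_grad \<Omega> v G \<longleftrightarrow>
     (\<forall>\<phi>\<in>C1_compact_support \<Omega>. \<forall>i\<in>Basis.
        (LINT x|lebesgue_on \<Omega>. v x * (grad \<phi> x \<bullet> i)) = - (LINT x|lebesgue_on \<Omega>. \<phi> x * (G x \<bullet> i)))"

definition W12 :: "'a::euclidean_space set \<Rightarrow> ('a \<Rightarrow> real) set" where
  "W12 \<Omega> = {v \<in> L2 \<Omega>. \<exists>G\<in>L2 \<Omega>. is_weak_grad \<Omega> v G}"

definition weak_grad :: "'a::euclidean_space set \<Rightarrow> ('a \<Rightarrow> real) \<Rightarrow> 'a \<Rightarrow> 'a" where
  "weak_grad \<Omega> v = (SOME G. G \<in> L2 \<Omega> \<and> is_weak_grad \<Omega> v G)"

definition neumann_energy ::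
    "'a::euclidean_space set \<Rightarrow> real \<Rightarrow> ('a \<Rightarrow> real) \<Rightarrow> ('a \<Rightarrow> real) \<Rightarrow> real" where
  "neumann_energy \<Omega> \<beta> g v =
     (LINT x|lebesgue_on \<Omega>. (norm (weak_grad \<Omega> v x))\<^sup>2 + \<beta> * (v x - g x)\<^sup>2)"

text \<open>
  The solution of \<open>\<Delta>u = \<beta>(u - g)\<close> on \<open>\<Omega>\<close> with vanishing normal derivative on the boundary, in
  variational form.
\<close>

definition neumann_solution ::
    "'a::euclidean_space set \<Rightarrow> real \<Rightarrow> ('a \<Rightarrow> real) \<Rightarrow> ('a \<Rightarrow> real) \<Rightarrow> bool" where
  "neumann_solution \<Omega> \<beta> g u \<longleftrightarrow>
     u \<in> W12 \<Omega> \<and> (\<forall>v\<in>W12 \<Omega>. neumann_energy \<Omega> \<beta> g u \<le> neumann_energy \<Omega> \<beta> g v)"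

section \<open>Functions of bounded variation\<close>

text \<open>
  \<open>Dv\<close> is a finite vector-valued Borel measure on \<open>\<Omega>\<close>. It is given by its polar decomposition
  \<open>Dv = \<sigma> |Dv|\<close>, where \<open>|Dv|\<close> is the total variation measure and \<open>\<sigma>\<close> is a unit vector field;
  \<open>BV_deriv \<Omega> v A\<close> is the value \<open>Dv(A)\<close>.
\<close>

definition is_polar_deriv ::
    "'a::euclidean_space set \<Rightarrow> ('a \<Rightarrow> real) \<Rightarrow> 'a measure \<Rightarrow> ('a \<Rightarrow> 'a) \<Rightarrow> bool" where
  "is_polar_deriv \<Omega> v \<mu> \<sigma> \<longleftrightarrow>
     sets \<mu> = sets (restrict_space borel \<Omega>) \<and> finite_measure \<mu> \<and>
     \<sigma> \<in> borel_measurable \<mu> \<and> (\<forall>x\<in>\<Omega>. norm (\<sigma> x) = 1) \<and>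
     (\<forall>\<phi>\<in>C1_compact_support \<Omega>. \<forall>i\<in>Basis.
        (LINT x|lebesgue_on \<Omega>. v x * (grad \<phi> x \<bullet> i)) = - (LINT x|\<mu>. \<phi> x * (\<sigma> x \<bullet> i)))"

definition BV :: "'a::euclidean_space set \<Rightarrow> ('a \<Rightarrow> real) set" where
  "BV \<Omega> = {v. integrable (lebesgue_on \<Omega>) v \<and> (\<exists>\<mu> \<sigma>. is_polar_deriv \<Omega> v \<mu> \<sigma>)}"

definition BV_deriv :: "'a::euclidean_space set \<Rightarrow> ('a \<Rightarrow> real) \<Rightarrow> 'a set \<Rightarrow> 'a" where
  "BV_deriv \<Omega> v A =
     (case SOME (\<mu>, \<sigma>). is_polar_deriv \<Omega> v \<mu> \<sigma> of (\<mu>, \<sigma>) \<Rightarrow> LINT x:A|\<mu>. \<sigma> x)"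

text \<open>
  \<open>G\<close> is the density of \<open>Dv\<close> with respect to Lebesgue measure (of its absolutely continuous part,
  in the sense of the Lebesgue decomposition): off a Lebesgue null set, \<open>Dv\<close> is given by \<open>G\<close>.
  Such \<open>G\<close> is unique up to null sets.
\<close>

definition is_approx_grad ::
    "'a::euclidean_space set \<Rightarrow> ('a \<Rightarrow> real) \<Rightarrow> ('a \<Rightarrow> 'a) \<Rightarrow> bool" where
  "is_approx_grad \<Omega> v G \<longleftrightarrow>
     integrable (lebesgue_on \<Omega>) G \<and>
     (\<exists>N\<in>null_sets lborel. \<forall>A\<in>sets borel. A \<subseteq> \<Omega> - N \<longrightarrow> BV_deriv \<Omega> v A = (LINT x:A|lebesgue. G x))"

definition approx_grad :: "'a::euclidean_space set \<Rightarrow> ('a \<Rightarrow> real) \<Rightarrow> 'a \<Rightarrow> 'a" where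
  "approx_grad \<Omega> v = (SOME G. is_approx_grad \<Omega> v G)"

definition approx_limit :: "('a::euclidean_space \<Rightarrow> real) \<Rightarrow> 'a \<Rightarrow> real \<Rightarrow> bool" where
  "approx_limit v x a \<longleftrightarrow>
     ((\<lambda>r. (LINT y:ball x r|lebesgue. \<bar>v y - a\<bar>) / r ^ DIM('a)) \<longlongrightarrow> 0) (at_right 0)"

definition singular_set :: "'a::euclidean_space set \<Rightarrow> ('a \<Rightarrow> real) \<Rightarrow> 'a set" where
  "singular_set \<Omega> v = {x \<in> \<Omega>. \<not> (\<exists>a. approx_limit v x a)}"

definition approx_limit_side ::
    "('a::euclidean_space \<Rightarrow> real) \<Rightarrow> 'a \<Rightarrow> 'a \<Rightarrow> real \<Rightarrow> bool" where
  "approx_limit_side v x \<nu> a \<longleftrightarrow>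
     ((\<lambda>r. (LINT y:{y \<in> ball x r. (y - x) \<bullet> \<nu> > 0}|lebesgue. \<bar>v y - a\<bar>) / r ^ DIM('a)) \<longlongrightarrow> 0)
       (at_right 0)"

text \<open>
  The triple \<open>(v\<^sup>-, v\<^sup>+, \<nu>\<^sub>v)\<close> is determined up to the change to \<open>(v\<^sup>+, v\<^sup>-, -\<nu>\<^sub>v)\<close>, which does not
  affect \<open>(v\<^sup>+ - v\<^sup>-) \<nu>\<^sub>v\<close>; it is normalised by \<open>v\<^sup>- < v\<^sup>+\<close>. For \<open>v\<close> in \<open>BV\<close> it exists at almost every
  point of the singular set with respect to \<open>(n-1)\<close>-dimensional Hausdorff measure
  (Federer--Vol'pert), so that its value elsewhere is immaterial.
\<close>

definition is_jump_triple ::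
    "('a::euclidean_space \<Rightarrow> real) \<Rightarrow> 'a \<Rightarrow> real \<Rightarrow> real \<Rightarrow> 'a \<Rightarrow> bool" where
  "is_jump_triple v x a b \<nu> \<longleftrightarrow>
     norm \<nu> = 1 \<and> a < b \<and> approx_limit_side v x (- \<nu>) a \<and> approx_limit_side v x \<nu> b"

definition jump_vector :: "('a::euclidean_space \<Rightarrow> real) \<Rightarrow> 'a \<Rightarrow> 'a" where
  "jump_vector v x =
     (case SOME (a, b, \<nu>). is_jump_triple v x a b \<nu> of (v_minus, v_plus, \<nu>) \<Rightarrow> (v_plus - v_minus) *\<^sub>R \<nu>)"

text \<open>
  The integrability condition holds for every function in \<open>BV\<close>; it excludes that the Bochner
  integral takes its default value.
\<close>

definition SBV :: "'a::euclidean_space set \<Rightarrow> ('a \<Rightarrow> real) set" where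
  "SBV \<Omega> = {v \<in> BV \<Omega>.
     set_integrable (hausdorff_measure (DIM('a) - 1)) (singular_set \<Omega> v) (jump_vector v) \<and>
     (\<forall>A\<in>sets borel. A \<subseteq> \<Omega> \<longrightarrow>
        BV_deriv \<Omega> v A =
          (LINT x:A|lebesgue. approx_grad \<Omega> v x) +
          (LINT x:A \<inter> singular_set \<Omega> v|hausdorff_measure (DIM('a) - 1). jump_vector v x))}"

definition mumford_shah ::
    "'a::euclidean_space set \<Rightarrow> real \<Rightarrow> real \<Rightarrow> ('a \<Rightarrow> real) \<Rightarrow> ('a \<Rightarrow> real) \<Rightarrow> ennreal" where
  "mumford_shah \<Omega> \<alpha> \<beta> g v =
     (\<integral>\<^sup>+x. ennreal ((norm (approx_grad \<Omega> v x))\<^sup>2) \<partial>lebesgue_on \<Omega>) +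
     ennreal \<alpha> * hausdorff_outer (DIM('a) - 1) (singular_set \<Omega> v) +
     ennreal \<beta> * (\<integral>\<^sup>+x. ennreal ((v x - g x)\<^sup>2) \<partial>lebesgue_on \<Omega>)"

end

theory Submission
  imports Defs
begin

text \<open>
  Put \<open>X = \<nabla>u\<close> and \<open>f = \<beta>(u - g)\<close>; minimality of \<open>u\<close> gives \<open>\<integral> X \<bullet> \<nabla>\<phi> = - \<integral> f \<phi>\<close> for all \<open>C\<^sup>1\<close>
  functions \<open>\<phi>\<close>. For a competitor \<open>v\<close> let \<open>z = v - u/2\<close>, and let \<open>T\<close> be the truncation to \<open>[m/2, M/2]\<close>,
  centred so that \<open>\<bar>T\<bar> \<le> (M - m)/4\<close>. Since \<open>T(z)\<close> jumps by at most \<open>(M - m)/2\<close> across \<open>Sv\<close>, testing with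
  \<open>T(z)\<close> yields the flux inequality
  \<open>- \<integral> f T(z) \<le> \<integral> T'(z) X \<bullet> \<nabla>z + (M - m)/2 sup \<bar>X\<bar> H\<^sup>n\<^sup>-\<^sup>1(Sv)\<close>.
  Because \<open>2 X \<bullet> (\<nabla>v - X/2) \<le> \<bar>\<nabla>v\<bar>\<^sup>2\<close> and \<open>(M - m) sup \<bar>X\<bar> \<le> \<alpha>\<close>, twice the right-hand side is at most
  \<open>\<integral> \<bar>\<nabla>v\<bar>\<^sup>2 + \<alpha> H\<^sup>n\<^sup>-\<^sup>1(Sv)\<close>. The theorem follows from \<open>\<integral> f = 0\<close>, \<open>\<integral> \<bar>X\<bar>\<^sup>2 = - \<integral> f u\<close> and the pointwise
  inequality \<open>(v - g)\<^sup>2 - (u - g)\<^sup>2 + 2 (u - g)(u - w) \<ge> 0\<close>, where \<open>w - u/2\<close> is the truncation of \<open>z\<close>.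

  The flux inequality does not need the fine structure of \<open>BV\<close> functions. The function \<open>z\<close> is mollified;
  the singular part of \<open>Dz\<close> is cut into compact pieces \<open>K\<close> on which its direction is almost a constant
  unit vector \<open>e\<close>, and on each piece it is tested with a cutoff function satisfying
  \<open>\<integral> \<bar>\<partial>\<^sub>e \<phi>\<bar> \<le> 2 (H\<^sup>n\<^sup>-\<^sup>1(K) + \<delta>)\<close>. Such cutoff functions come from covers of \<open>K\<close> by convex sets, whose
  shadows orthogonal to \<open>e\<close> are bounded by the isodiametric inequality. The field \<open>X\<close> is replaced by fields
  with compact support by shifting it into \<open>\<Omega>\<close> along the Lipschitz charts of the boundary.
\<close>

section \<open>Continuously differentiable functions\<close>

text \<open>The truncation levels describe the strip (u + m)/2 \<le> t \<le> (u + M)/2, on which the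
  field 2X is used. Its slope u/2 comes from 2 X \<bullet> \<nabla>v - \<bar>X\<bar>^2 \<le>
  \<bar>\<nabla>v\<bar>^2, an equality exactly for \<nabla>v = X; its width (M - m)/2 lets 2X gain
  at most (M - m) sup \<bar>X\<bar> per unit area of jump, which is the quantity compared with
  \<alpha>. No constant may be lost on the way, and this shapes the proof. Covers are charged by the
  normalised gauge, so shadows must be bounded by the isodiametric inequality; enclosing balls would
  cost a power of 2. A line enters and leaves a convex set, so cutoffs have variation twice the
  gauge, and only centring the truncation at height c/2 turns this into c. Truncation comes after
  mollification, where the chain rule is classical. The singular measure then carries a weight in
  [0,1] whose integral is bounded in the limit; the weight itself is never passed to the limit. The
  boundary condition enters through test functions that do not vanish on the boundary: X extended by
  0 has a bounded weak divergence on the whole space, so smearing it across the boundary creates no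
  extra term.\<close>

definition C1_with_grad :: "('a::euclidean_space \<Rightarrow> real) \<Rightarrow> ('a \<Rightarrow> 'a) \<Rightarrow> bool" where
  "C1_with_grad \<phi> d \<longleftrightarrow> (\<forall>x. GDERIV \<phi> x :> d x) \<and> continuous_on UNIV d"

lemma GDERIV_unique:
  assumes "GDERIV f x :> a" "GDERIV f x :> b"
  shows "a = b"
proof -
  have "(\<lambda>h. h \<bullet> a) = (\<lambda>h. h \<bullet> b)"
    using assms unfolding gderiv_def by (rule has_derivative_unique)
  then show ?thesis
    by (metis vector_eq_ldot)
qed

lemma grad_eq: "GDERIV f x :> d \<Longrightarrow> grad f x = d"
  unfolding grad_def by (blast intro: GDERIV_unique)

lemma C1_with_grad_GDERIV: "C1_with_grad \<phi> d \<Longrightarrow> GDERIV \<phi> x :> d x"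
  by (simp add: C1_with_grad_def)

lemma C1_with_grad_grad: "C1_with_grad \<phi> d \<Longrightarrow> grad \<phi> x = d x"
  by (intro grad_eq C1_with_grad_GDERIV)

lemma C1_with_grad_continuous_grad: "C1_with_grad \<phi> d \<Longrightarrow> continuous_on S d"
  by (meson C1_with_grad_def continuous_on_subset subset_UNIV)

lemma C1_with_grad_continuous: "C1_with_grad \<phi> d \<Longrightarrow> continuous_on S \<phi>"
  by (rule has_derivative_continuous_on[where f'="\<lambda>x h. h \<bullet> d x"])
     (simp add: C1_with_grad_def gderiv_def has_derivative_at_withinI)

lemma C1_with_grad_measurable:
  assumes "C1_with_grad \<phi> d"
  shows "\<phi> \<in> borel_measurable borel" "d \<in> borel_measurable borel"
  by (rule borel_measurable_continuous_onI, rule C1_with_grad_continuous[OF assms])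
     (rule borel_measurable_continuous_onI, rule C1_with_grad_continuous_grad[OF assms])

lemma C1_with_grad_const: "C1_with_grad (\<lambda>x. c) (\<lambda>x. 0)"
  by (simp add: C1_with_grad_def GDERIV_const)

lemma C1_with_grad_add:
  "C1_with_grad \<phi> d \<Longrightarrow> C1_with_grad \<psi> e \<Longrightarrow> C1_with_grad (\<lambda>x. \<phi> x + \<psi> x) (\<lambda>x. d x + e x)"
  by (auto simp: C1_with_grad_def intro!: GDERIV_add continuous_intros)

lemma C1_with_grad_diff:
  "C1_with_grad \<phi> d \<Longrightarrow> C1_with_grad \<psi> e \<Longrightarrow> C1_with_grad (\<lambda>x. \<phi> x - \<psi> x) (\<lambda>x. d x - e x)"
  by (auto simp: C1_with_grad_def intro!: GDERIV_diff continuous_intros)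

lemma C1_with_grad_mult:
  assumes "C1_with_grad \<phi> d" "C1_with_grad \<psi> e"
  shows "C1_with_grad (\<lambda>x. \<phi> x * \<psi> x) (\<lambda>x. \<phi> x *\<^sub>R e x + \<psi> x *\<^sub>R d x)"
  using assms C1_with_grad_continuous[OF assms(1), of UNIV] C1_with_grad_continuous[OF assms(2), of UNIV]
  by (auto simp: C1_with_grad_def intro!: GDERIV_mult continuous_intros)

lemma C1_with_grad_sum:
  "(\<And>i. i \<in> I \<Longrightarrow> C1_with_grad (\<phi> i) (d i)) \<Longrightarrow>
   C1_with_grad (\<lambda>x. \<Sum>i\<in>I. \<phi> i x) (\<lambda>x. \<Sum>i\<in>I. d i x)"
  by (induction I rule: infinite_finite_induct)
     (auto intro: C1_with_grad_const C1_with_grad_add)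

lemma C1_with_grad_compose:
  assumes "C1_with_grad \<phi> d" and T: "\<And>t. (T has_real_derivative T' t) (at t)" and "continuous_on UNIV T'"
  shows "C1_with_grad (\<lambda>x. T (\<phi> x)) (\<lambda>x. T' (\<phi> x) *\<^sub>R d x)"
proof -
  have "continuous_on UNIV (\<lambda>x. T' (\<phi> x))"
    using continuous_on_compose2[OF assms(3) C1_with_grad_continuous[OF assms(1)]] by auto
  then show ?thesis
    using assms unfolding C1_with_grad_def
    by (auto intro!: continuous_on_scaleR intro: GDERIV_DERIV_compose[where g=T])
qed

text \<open>Closedness of \<open>K\<close> makes \<open>\<phi>\<close> vanish in a neighbourhood of
  \<open>x\<close>, so the gradient there is that of the zero function.\<close>

lemma C1_with_grad_zero_outside:
  assumes "C1_with_grad \<phi> d" "closed K" "\<And>x. x \<notin> K \<Longrightarrow> \<phi> x = 0" "x \<notin> K"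
  shows "d x = 0"
proof -
  have "(\<phi> has_derivative (\<lambda>h. 0)) (at x)"
    by (rule has_derivative_transform_within_open[where f="\<lambda>_. 0" and s="- K"])
       (use assms in \<open>auto simp: closed_def\<close>)
  then have "GDERIV \<phi> x :> 0"
    by (simp add: gderiv_def)
  then show ?thesis
    using GDERIV_unique C1_with_grad_GDERIV[OF assms(1)] by blast
qed

lemma C1_compact_supportI:
  assumes "C1_with_grad \<phi> d" "compact K" "K \<subseteq> \<Omega>" "\<And>x. x \<notin> K \<Longrightarrow> \<phi> x = 0"
  shows "\<phi> \<in> C1_compact_support \<Omega>"
proof -
  have "closure {x. \<phi> x \<noteq> 0} \<subseteq> K"
    using assms by (intro closure_minimal) (auto simp: compact_imp_closed)
  then have "compact (closure {x. \<phi> x \<noteq> 0})"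
    using assms(2) by (metis closed_closure compact_Int_closed inf.absorb_iff2)
  with \<open>closure {x. \<phi> x \<noteq> 0} \<subseteq> K\<close> show ?thesis
    using assms unfolding C1_compact_support_def C1_with_grad_def by blast
qed

lemma C1_compact_supportE:
  assumes "\<phi> \<in> C1_compact_support \<Omega>"
  obtains d K where "C1_with_grad \<phi> d" "compact K" "K \<subseteq> \<Omega>" "\<And>x. x \<notin> K \<Longrightarrow> \<phi> x = 0"
    "\<And>x. x \<notin> K \<Longrightarrow> d x = 0"
proof -
  obtain d where d: "C1_with_grad \<phi> d"
    using assms unfolding C1_compact_support_def C1_with_grad_def mem_Collect_eq by metis
  let ?K = "closure {x. \<phi> x \<noteq> 0}"
  have 1: "\<phi> x = 0" if "x \<notin> ?K" for x
    using that closure_subset[of "{x. \<phi> x \<noteq> 0}"] by blast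
  have 2: "d x = 0" if "x \<notin> ?K" for x
    using C1_with_grad_zero_outside[OF d _ 1 that] by simp
  show thesis
    using that[OF d _ _ 1 2] assms unfolding C1_compact_support_def mem_Collect_eq by metis
qed

section \<open>Integrals over the whole space and difference quotients\<close>

lemma integrable_continuous_compact_support:
  fixes f :: "'a::euclidean_space \<Rightarrow> 'b::{banach, second_countable_topology}"
  assumes "continuous_on UNIV f" "compact K" "\<And>x. x \<notin> K \<Longrightarrow> f x = 0"
  shows "integrable lborel f"
proof -
  have "integrable lborel (\<lambda>x. indicator K x *\<^sub>R f x)"
    using assms by (intro borel_integrable_compact) (auto intro: continuous_on_subset)
  also have "(\<lambda>x. indicator K x *\<^sub>R f x) = f"
    using assms(3) by (auto simp: indicator_def fun_eq_iff)
  finally show ?thesis .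
qed

lemma bounded_continuous_compact_support:
  fixes f :: "'a::metric_space \<Rightarrow> 'b::real_normed_vector"
  assumes "continuous_on UNIV f" "compact K" "\<And>x. x \<notin> K \<Longrightarrow> f x = 0"
  obtains B where "B > 0" "\<And>x. norm (f x) \<le> B"
proof -
  have "bounded (f ` K)"
    using assms by (intro compact_imp_bounded compact_continuous_image) (auto intro: continuous_on_subset)
  then obtain B where B: "B > 0" "\<forall>x\<in>K. norm (f x) \<le> B"
    unfolding bounded_pos by auto
  have "norm (f x) \<le> B" for x
    using B assms(3)[of x] by (cases "x \<in> K") auto
  then show ?thesis
    using that B by blast
qed

lemma lborel_distr_uminus_euclidean: "distr lborel borel uminus = (lborel :: 'a::euclidean_space measure)"
  by (subst lborel_affine[of "-1" 0]) (auto simp: density_1 one_ennreal_def[symmetric])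

lemma
  fixes f :: "'a::euclidean_space \<Rightarrow> 'b::{banach, second_countable_topology}"
  assumes [measurable]: "f \<in> borel_measurable borel"
  shows integral_lborel_translate: "(LINT x|lborel. f (x + a)) = (LINT x|lborel. f x)"
    and integral_lborel_reflect: "(LINT x|lborel. f (a - x)) = (LINT x|lborel. f x)"
proof -
  have "(LINT x|lborel. f x) = (LINT x|distr lborel borel ((+) a). f x)"
    by (simp add: lborel_distr_plus)
  also have "\<dots> = (LINT x|lborel. f (x + a))"
    by (subst integral_distr) (auto simp: add.commute)
  finally show T: "(LINT x|lborel. f (x + a)) = (LINT x|lborel. f x)" ..
  have "(LINT x|lborel. f (x + a)) = (LINT x|distr lborel borel uminus. f (x + a))"
    by (simp add: lborel_distr_uminus_euclidean)
  also have "\<dots> = (LINT x|lborel. f (a - x))"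
    by (subst integral_distr) auto
  finally show "(LINT x|lborel. f (a - x)) = (LINT x|lborel. f x)"
    using T by simp
qed

lemma
  fixes f :: "'a::euclidean_space \<Rightarrow> 'b::{banach, second_countable_topology}"
  assumes f: "integrable lborel f"
  shows integrable_lborel_translate: "integrable lborel (\<lambda>x. f (x + a))"
    and integrable_lborel_reflect: "integrable lborel (\<lambda>x. f (a - x))"
proof -
  have [measurable]: "f \<in> borel_measurable borel"
    using f by (auto dest: borel_measurable_integrable)
  have "integrable (distr lborel borel ((+) a)) f"
    using f by (simp add: lborel_distr_plus)
  then show T: "integrable lborel (\<lambda>x. f (x + a))"
    by (subst (asm) integrable_distr_eq) (auto simp: add.commute)
  then have "integrable (distr lborel borel uminus) (\<lambda>x. f (x + a))"
    by (simp add: lborel_distr_uminus_euclidean)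
  then show "integrable lborel (\<lambda>x. f (a - x))"
    by (subst (asm) integrable_distr_eq) auto
qed

lemma C1_with_grad_lipschitz:
  assumes "C1_with_grad \<phi> d" "\<And>x. norm (d x) \<le> B"
  shows "\<bar>\<phi> x - \<phi> y\<bar> \<le> B * norm (x - y)"
proof -
  have "norm (\<phi> x - \<phi> y) \<le> B * norm (x - y)"
  proof (rule differentiable_bound)
    fix x
    show "(\<phi> has_derivative (\<lambda>h. h \<bullet> d x)) (at x within UNIV)"
      using C1_with_grad_GDERIV[OF assms(1)] by (simp add: gderiv_def)
    show "onorm (\<lambda>h. h \<bullet> d x) \<le> B"
    proof (rule onorm_le)
      fix h
      have "norm (h \<bullet> d x) \<le> norm h * norm (d x)"
        using Cauchy_Schwarz_ineq2 by simp
      also have "\<dots> \<le> norm h * B"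
        using assms(2) by (intro mult_left_mono) auto
      finally show "norm (h \<bullet> d x) \<le> B * norm h"
        by (simp add: mult.commute)
    qed
  qed auto
  then show ?thesis by simp
qed

lemma C1_with_grad_quotient:
  assumes "C1_with_grad \<phi> d" "h \<longlonglongrightarrow> 0" "\<And>n::nat. h n \<noteq> 0"
  shows "(\<lambda>n. (\<phi> (x + h n *\<^sub>R e) - \<phi> x) / h n) \<longlonglongrightarrow> d x \<bullet> e"
proof -
  have "((\<lambda>t. x + t *\<^sub>R e) has_derivative (\<lambda>t. t *\<^sub>R e)) (at (0::real))"
    by (auto intro!: derivative_eq_intros)
  moreover have "(\<phi> has_derivative (\<lambda>h. h \<bullet> d x)) (at (x + 0 *\<^sub>R e))"
    using C1_with_grad_GDERIV[OF assms(1)] by (simp add: gderiv_def)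
  ultimately have "((\<lambda>t. \<phi> (x + t *\<^sub>R e)) has_derivative (\<lambda>t. (t *\<^sub>R e) \<bullet> d x)) (at 0)"
    by (rule has_derivative_compose)
  then have "((\<lambda>t. \<phi> (x + t *\<^sub>R e)) has_real_derivative (d x \<bullet> e)) (at 0)"
    by (rule has_derivative_imp_has_field_derivative) (simp add: inner_commute)
  then have "((\<lambda>t. (\<phi> (x + t *\<^sub>R e) - \<phi> x) / t) \<longlongrightarrow> d x \<bullet> e) (at 0)"
    by (simp add: has_field_derivative_iff)
  moreover have "filterlim h (at 0) sequentially"
    using assms by (auto simp: filterlim_at)
  ultimately show ?thesis
    by (rule filterlim_compose)
qed

text \<open>Dominated convergence: the quotients are bounded by \<open>B * norm e\<close>, and since
  the steps are at most 1 they all vanish outside one ball, of radius \<open>R + norm e\<close>.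
  \<open>F\<close> will be the identity, to integrate a gradient to zero, and the absolute value, to
  estimate a directional variation.\<close>

lemma C1_with_grad_quotient_integral:
  fixes \<phi> :: "'a::euclidean_space \<Rightarrow> real"
  assumes C: "C1_with_grad \<phi> d" and K: "compact K" "\<And>x. x \<notin> K \<Longrightarrow> \<phi> x = 0" and F: "continuous_on UNIV F" "F 0 = (0::real)"
    "\<And>s t. \<bar>F s\<bar> \<le> \<bar>s\<bar>"
  shows "(\<lambda>n. LINT x|lborel. F ((\<phi> (x + inverse (real (Suc n)) *\<^sub>R e) - \<phi> x) / inverse (real (Suc n))))
          \<longlonglongrightarrow> (LINT x|lborel. F (d x \<bullet> e))"
proof -
  have d0: "d x = 0" if "x \<notin> K" for x
    using C1_with_grad_zero_outside[OF C _ K(2) that] K(1) compact_imp_closed by blast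
  obtain B where B: "B > 0" "\<And>x. norm (d x) \<le> B"
    using bounded_continuous_compact_support[OF C1_with_grad_continuous_grad[OF C] K(1) d0] by blast
  obtain R where R: "K \<subseteq> cball 0 R"
    using compact_imp_bounded[OF K(1)] unfolding bounded_iff by (metis mem_cball_0 subsetI)
  have [measurable]: "\<phi> \<in> borel_measurable borel" "d \<in> borel_measurable borel" "F \<in> borel_measurable borel"
    using C1_with_grad_measurable[OF C] borel_measurable_continuous_onI[OF F(1)] by auto
  let ?h = "\<lambda>n. inverse (real (Suc n))"
  show ?thesis
  proof (rule integral_dominated_convergence[where w="\<lambda>x. indicator (cball 0 (R + norm e)) x *\<^sub>R (B * norm e)"])
    show "integrable lborel (\<lambda>x::'a. indicator (cball 0 (R + norm e)) x *\<^sub>R (B * norm e))"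
      by (intro borel_integrable_compact) auto
    show "AE x in lborel. (\<lambda>n. F ((\<phi> (x + ?h n *\<^sub>R e) - \<phi> x) / ?h n)) \<longlonglongrightarrow> F (d x \<bullet> e)"
    proof (intro AE_I2)
      fix x
      have "(\<lambda>n. (\<phi> (x + ?h n *\<^sub>R e) - \<phi> x) / ?h n) \<longlonglongrightarrow> d x \<bullet> e"
        by (rule C1_with_grad_quotient[OF C LIMSEQ_inverse_real_of_nat]) simp
      then show "(\<lambda>n. F ((\<phi> (x + ?h n *\<^sub>R e) - \<phi> x) / ?h n)) \<longlonglongrightarrow> F (d x \<bullet> e)"
        by (rule continuous_on_tendsto_compose[OF F(1)]) auto
    qed
    fix n
    show "AE x in lborel. norm (F ((\<phi> (x + ?h n *\<^sub>R e) - \<phi> x) / ?h n))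
        \<le> indicator (cball 0 (R + norm e)) x *\<^sub>R (B * norm e)"
    proof (intro AE_I2)
      fix x :: 'a
      have h: "0 < ?h n" "?h n \<le> 1" by (auto simp: field_simps)
      have le: "norm (?h n *\<^sub>R e) \<le> norm e"
        using mult_right_mono[OF h(2), of "norm e"] h by simp
      show "norm (F ((\<phi> (x + ?h n *\<^sub>R e) - \<phi> x) / ?h n)) \<le> indicator (cball 0 (R + norm e)) x *\<^sub>R (B * norm e)"
      proof (cases "x \<in> cball 0 (R + norm e)")
        case True
        have "\<bar>\<phi> (x + ?h n *\<^sub>R e) - \<phi> x\<bar> \<le> B * norm (?h n *\<^sub>R e)"
          using C1_with_grad_lipschitz[OF C B(2), of "x + ?h n *\<^sub>R e" x] by simp
        then have "\<bar>\<phi> (x + ?h n *\<^sub>R e) - \<phi> x\<bar> / ?h n \<le> B * norm e"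
          using h by (simp add: field_simps)
        then have "\<bar>(\<phi> (x + ?h n *\<^sub>R e) - \<phi> x) / ?h n\<bar> \<le> B * norm e"
          using h by (simp add: abs_divide del: of_nat_Suc)
        with F(3) have "\<bar>F ((\<phi> (x + ?h n *\<^sub>R e) - \<phi> x) / ?h n)\<bar> \<le> B * norm e"
          by (meson order_trans)
        then show ?thesis
          using True by simp
      next
        case False
        then have "norm x > R + norm e" by simp
        moreover have "norm x \<le> norm (x + ?h n *\<^sub>R e) + norm (?h n *\<^sub>R e)"
          by (metis add_diff_cancel_right' norm_triangle_ineq4)
        ultimately have "norm x > R" "norm (x + ?h n *\<^sub>R e) > R"
          using le by (smt (verit) norm_ge_zero)+
        then have "x \<notin> K" "x + ?h n *\<^sub>R e \<notin> K"
          using R by (meson leD mem_cball_0 subsetD)+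
        then show ?thesis
          using K F(2) B(1) by simp
      qed
    qed
  qed auto
qed

text \<open>By translation invariance every difference quotient of \<open>\<phi>\<close> has
  integral zero, and the integral of the derivative is the limit.\<close>

lemma integral_grad_compact_support:
  fixes \<phi> :: "'a::euclidean_space \<Rightarrow> real"
  assumes C: "C1_with_grad \<phi> d" and K: "compact K" "\<And>x. x \<notin> K \<Longrightarrow> \<phi> x = 0"
  shows "(LINT x|lborel. d x \<bullet> e) = 0"
proof -
  have [measurable]: "\<phi> \<in> borel_measurable borel"
    using C1_with_grad_measurable[OF C] by auto
  have int: "integrable lborel \<phi>"
    by (rule integrable_continuous_compact_support[OF C1_with_grad_continuous[OF C] K])
  have "(\<lambda>n. LINT x|lborel. (\<phi> (x + inverse (real (Suc n)) *\<^sub>R e) - \<phi> x) / inverse (real (Suc n)))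
          \<longlonglongrightarrow> (LINT x|lborel. d x \<bullet> e)"
    using C1_with_grad_quotient_integral[OF C K, of "\<lambda>x. x" e] by simp
  moreover have "(LINT x|lborel. (\<phi> (x + inverse (real (Suc n)) *\<^sub>R e) - \<phi> x) / inverse (real (Suc n))) = 0" for n
  proof -
    let ?a = "inverse (real (Suc n)) *\<^sub>R e"
    have "(LINT x|lborel. \<phi> (x + ?a) - \<phi> x) = (LINT x|lborel. \<phi> (x + ?a)) - (LINT x|lborel. \<phi> x)"
      by (intro Bochner_Integration.integral_diff integrable_lborel_translate int)
    also have "\<dots> = 0"
      using integral_lborel_translate[of \<phi> ?a] by simp
    finally show ?thesis
      by (simp only: integral_divide_zero div_0)
  qed
  ultimately show ?thesis
    by (simp add: LIMSEQ_const_iff)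
qed

section \<open>Mollification\<close>

text \<open>The square of a positive part is of class C^1, the regularity asked of test functions,
  and its second-order remainder has an explicit global bound.\<close>

definition bump :: "real \<Rightarrow> 'a::euclidean_space \<Rightarrow> real" where
  "bump \<epsilon> x = (max 0 (\<epsilon>\<^sup>2 - x \<bullet> x))\<^sup>2"

definition mollifier :: "real \<Rightarrow> 'a::euclidean_space \<Rightarrow> real" where
  "mollifier \<epsilon> x = bump \<epsilon> x / (LINT y|lborel. bump \<epsilon> (y::'a))"

definition mollifier_grad :: "real \<Rightarrow> 'a::euclidean_space \<Rightarrow> 'a" where
  "mollifier_grad \<epsilon> x = (- 4 * max 0 (\<epsilon>\<^sup>2 - x \<bullet> x) / (LINT y|lborel. bump \<epsilon> (y::'a))) *\<^sub>R x"

lemma bump_nonneg: "0 \<le> bump \<epsilon> x"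
  by (simp add: bump_def)

lemma inner_self_ge_iff: "\<epsilon> > 0 \<Longrightarrow> \<epsilon>\<^sup>2 \<le> x \<bullet> x \<longleftrightarrow> \<epsilon> \<le> norm x"
  by (metis less_imp_le norm_ge_zero power2_norm_eq_inner power_mono_iff zero_less_numeral)

lemma max_0_diff_inner_self: "\<epsilon> > 0 \<Longrightarrow> norm x \<ge> \<epsilon> \<Longrightarrow> max 0 (\<epsilon>\<^sup>2 - x \<bullet> x) = 0"
  using inner_self_ge_iff[of \<epsilon> x] by simp

lemma emeasure_lborel_bounded: "bounded A \<Longrightarrow> emeasure lborel A < top"
  using emeasure_bounded_finite[of A] by simp

lemma bump_eq_0: "\<epsilon> > 0 \<Longrightarrow> norm x \<ge> \<epsilon> \<Longrightarrow> bump \<epsilon> x = 0"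
  by (simp add: bump_def max_0_diff_inner_self)

lemma bump_le: "bump \<epsilon> x \<le> \<epsilon> ^ 4"
proof -
  have "(max 0 (\<epsilon>\<^sup>2 - x \<bullet> x))\<^sup>2 \<le> (\<epsilon>\<^sup>2)\<^sup>2"
    by (intro power_mono) auto
  then show ?thesis by (simp add: bump_def)
qed

lemma continuous_on_bump: "continuous_on S (bump \<epsilon>)"
  unfolding bump_def by (intro continuous_intros)

lemma integrable_bump: "\<epsilon> > 0 \<Longrightarrow> integrable lborel (bump \<epsilon> :: 'a::euclidean_space \<Rightarrow> real)"
  by (rule integrable_continuous_compact_support[OF continuous_on_bump, of "cball 0 \<epsilon>"])
     (auto simp: bump_eq_0)

text \<open>On the ball of radius \<open>\<epsilon> / 2\<close> the bump is at least 9/16 times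
  \<open>\<epsilon> ^ 4\<close>; the volume of that ball contributes \<open>2 ^ DIM('a)\<close>.
  Hence the normalised kernel is at most this constant over
  \<open>\<epsilon> ^ DIM('a)\<close>.\<close>

definition mollifier_const :: "'a::euclidean_space itself \<Rightarrow> real" where
  "mollifier_const _ = 16 * 2 ^ DIM('a) / (9 * unit_ball_vol (real DIM('a)))"

lemma integral_bump_ge:
  assumes "\<epsilon> > 0"
  shows "(LINT y|lborel. bump \<epsilon> (y::'a::euclidean_space)) \<ge> \<epsilon> ^ 4 * \<epsilon> ^ DIM('a) / mollifier_const TYPE('a)"
proof -
  have "(LINT y|lborel. indicator (cball 0 (\<epsilon>/2)) (y::'a) * (9/16 * \<epsilon>^4)) \<le> (LINT y|lborel. bump \<epsilon> (y::'a))"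
  proof (rule Bochner_Integration.integral_mono)
    show "integrable lborel (\<lambda>y::'a. indicator (cball 0 (\<epsilon>/2)) y * (9/16 * \<epsilon>^4))"
      by (intro integrable_mult_left integrable_real_indicator) (auto intro: emeasure_lborel_bounded)
    fix y :: 'a
    show "indicator (cball 0 (\<epsilon>/2)) y * (9/16 * \<epsilon>^4) \<le> bump \<epsilon> y"
    proof (cases "norm y \<le> \<epsilon>/2")
      case True
      have "y \<bullet> y = (norm y)\<^sup>2" by (simp add: power2_norm_eq_inner)
      also have "\<dots> \<le> (\<epsilon>/2)\<^sup>2" using True by (intro power_mono) auto
      finally have "3/4 * \<epsilon>\<^sup>2 \<le> \<epsilon>\<^sup>2 - y \<bullet> y" by (simp add: power_divide)
      then have "3/4 * \<epsilon>\<^sup>2 \<le> max 0 (\<epsilon>\<^sup>2 - y \<bullet> y)" by linarith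
      then have "(3/4 * \<epsilon>\<^sup>2)\<^sup>2 \<le> bump \<epsilon> y"
        unfolding bump_def by (intro power_mono) auto
      moreover have "(3/4 * \<epsilon>\<^sup>2)\<^sup>2 = 9/16 * \<epsilon>^4"
        by (simp add: power_mult_distrib power_divide)
      ultimately show ?thesis using True by simp
    qed (simp add: bump_nonneg)
  qed (use integrable_bump[OF assms] in auto)
  also have "(LINT y|lborel. indicator (cball 0 (\<epsilon>/2)) (y::'a) * (9/16 * \<epsilon>^4))
      = unit_ball_vol (real DIM('a)) * (\<epsilon>/2) ^ DIM('a) * (9/16 * \<epsilon>^4)"
    using assms by (simp add: content_cball)
  also have "\<dots> = \<epsilon> ^ 4 * \<epsilon> ^ DIM('a) / mollifier_const TYPE('a)"
    by (simp add: mollifier_const_def power_divide field_simps)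
  finally show ?thesis .
qed

lemma mollifier_const_pos: "mollifier_const TYPE('a::euclidean_space) > 0"
  by (simp add: mollifier_const_def)

lemma integral_bump_pos: "\<epsilon> > 0 \<Longrightarrow> (LINT y|lborel. bump \<epsilon> (y::'a::euclidean_space)) > 0"
  using integral_bump_ge[of \<epsilon>, where 'a='a] mollifier_const_pos[where 'a='a]
  by (smt (verit, del_insts) divide_pos_pos mult_pos_pos zero_less_power)

lemma mollifier_nonneg: "0 \<le> mollifier \<epsilon> x"
  unfolding mollifier_def by (intro divide_nonneg_nonneg integral_nonneg_AE) (auto simp: bump_nonneg)

lemma mollifier_eq_0: "\<epsilon> > 0 \<Longrightarrow> norm x \<ge> \<epsilon> \<Longrightarrow> mollifier \<epsilon> x = 0"
  by (simp add: mollifier_def bump_eq_0)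

lemma mollifier_grad_eq_0: "\<epsilon> > 0 \<Longrightarrow> norm x \<ge> \<epsilon> \<Longrightarrow> mollifier_grad \<epsilon> x = 0"
  by (simp add: mollifier_grad_def max_0_diff_inner_self)

lemma mollifier_minus [simp]: "mollifier \<epsilon> (- x) = mollifier \<epsilon> x"
  by (simp add: mollifier_def bump_def)

lemma mollifier_commute: "mollifier \<epsilon> (x - y) = mollifier \<epsilon> (y - x)"
  using mollifier_minus[of \<epsilon> "x - y"] by simp

lemma mollifier_le:
  assumes "\<epsilon> > 0"
  shows "mollifier \<epsilon> (x::'a::euclidean_space) \<le> mollifier_const TYPE('a) / \<epsilon> ^ DIM('a)"
proof -
  have "mollifier \<epsilon> x \<le> \<epsilon> ^ 4 / (\<epsilon> ^ 4 * \<epsilon> ^ DIM('a) / mollifier_const TYPE('a))"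
    unfolding mollifier_def
    using assms mollifier_const_pos[where 'a='a]
    by (intro frac_le bump_le integral_bump_ge) auto
  then show ?thesis using assms by simp
qed

lemma continuous_on_mollifier: "continuous_on S (mollifier \<epsilon>)"
  unfolding mollifier_def divide_inverse by (intro continuous_intros continuous_on_bump)

lemma continuous_on_mollifier_grad: "continuous_on S (mollifier_grad \<epsilon>)"
  unfolding mollifier_grad_def divide_inverse by (intro continuous_intros)

lemma measurable_mollifier [measurable]:
  "mollifier \<epsilon> \<in> borel_measurable borel" "mollifier_grad \<epsilon> \<in> borel_measurable borel"
  by (intro borel_measurable_continuous_onI continuous_on_mollifier continuous_on_mollifier_grad)+

lemma integrable_mollifier: "\<epsilon> > 0 \<Longrightarrow> integrable lborel (mollifier \<epsilon>)"
  unfolding mollifier_def by (intro integrable_divide integrable_bump)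

lemma integral_mollifier: "\<epsilon> > 0 \<Longrightarrow> (LINT y|lborel. mollifier \<epsilon> (y::'a::euclidean_space)) = 1"
  unfolding mollifier_def using integral_bump_pos[of \<epsilon>, where 'a='a] by simp

lemma integrable_mollifier_reflect: "\<epsilon> > 0 \<Longrightarrow> integrable lborel (\<lambda>y. mollifier \<epsilon> (x - y))"
  by (intro integrable_lborel_reflect integrable_mollifier)

lemma integral_mollifier_reflect: "\<epsilon> > 0 \<Longrightarrow> (LINT y|lborel. mollifier \<epsilon> (x - y)) = 1"
  by (subst integral_lborel_reflect) (auto simp: integral_mollifier)

text \<open>The derivative \<open>2 * max 0 t\<close> is 2-Lipschitz, which accounts for the
  remainder \<open>s\<^sup>2\<close>. Serves the mollifier and later the smooth clamp.\<close>

lemma max_square_taylor: "\<bar>(max 0 (t + s))\<^sup>2 - (max 0 t)\<^sup>2 - 2 * max 0 t * s\<bar> \<le> (s::real)\<^sup>2"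
proof -
  consider "t \<ge> 0" "t + s \<ge> 0" | "t \<ge> 0" "t + s < 0" | "t < 0" "t + s \<ge> 0" | "t < 0" "t + s < 0"
    by linarith
  then show ?thesis
  proof cases
    case 1
    then show ?thesis by (simp add: power2_eq_square algebra_simps)
  next
    case 2
    have "0 \<le> t * (- s)" using 2 by (intro mult_nonneg_nonneg) auto
    moreover have "t * t \<le> t * (- s)" using 2 by (intro mult_left_mono) auto
    moreover have "t * (- s) \<le> (- s) * (- s)" using 2 by (intro mult_right_mono) auto
    moreover have "0 \<le> (t + s)\<^sup>2" by simp
    ultimately show ?thesis using 2 by (simp add: power2_eq_square algebra_simps)
  next
    case 3
    have "(t + s)\<^sup>2 \<le> s\<^sup>2" using 3 by (intro power_mono) auto
    then show ?thesis using 3 by (simp add: max_def)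
  qed (simp add: max_def)
qed

text \<open>The constant does not depend on \<open>x\<close>, so the bound can be integrated against
  any integrable function. For \<open>norm x > \<epsilon> + 1\<close> everything vanishes; otherwise
  \<open>x \<bullet> x\<close> changes by at most \<open>(2 * \<epsilon> + 3) * norm h\<close>,
  which enters squared, and the term \<open>h \<bullet> h\<close> omitted from the linear part adds
  \<open>2 * \<epsilon>\<^sup>2\<close>.\<close>

lemma mollifier_taylor:
  fixes x h :: "'a::euclidean_space"
  assumes "\<epsilon> > 0" "norm h \<le> 1"
  defines "C \<equiv> ((2 * \<epsilon> + 3)\<^sup>2 + 2 * \<epsilon>\<^sup>2) / (LINT y|lborel. bump \<epsilon> (y::'a))"
  shows "\<bar>mollifier \<epsilon> (x + h) - mollifier \<epsilon> x - h \<bullet> mollifier_grad \<epsilon> x\<bar> \<le> C * (norm h)\<^sup>2"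
proof -
  define I where "I = (LINT y|lborel. bump \<epsilon> (y::'a))"
  have I: "I > 0" unfolding I_def by (rule integral_bump_pos[OF assms(1)])
  have "\<bar>bump \<epsilon> (x + h) - bump \<epsilon> x - h \<bullet> (- 4 * max 0 (\<epsilon>\<^sup>2 - x \<bullet> x)) *\<^sub>R x\<bar> \<le> ((2 * \<epsilon> + 3)\<^sup>2 + 2 * \<epsilon>\<^sup>2) * (norm h)\<^sup>2"
  proof (cases "norm x > \<epsilon> + 1")
    case True
    have "norm x \<le> norm (x + h) + norm h"
      by (metis add_diff_cancel_right' norm_triangle_ineq4)
    then have "norm (x + h) \<ge> \<epsilon>" "norm x \<ge> \<epsilon>" using assms True by auto
    moreover from this have "max 0 (\<epsilon>\<^sup>2 - x \<bullet> x) = 0"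
      using inner_self_ge_iff[OF assms(1), of x] by simp
    ultimately show ?thesis
      using assms(1) by (simp add: bump_eq_0)
  next
    case False
    define t where "t = \<epsilon>\<^sup>2 - x \<bullet> x"
    define s where "s = - 2 * (x \<bullet> h) - h \<bullet> h"
    have ts: "\<epsilon>\<^sup>2 - (x + h) \<bullet> (x + h) = t + s"
      by (simp add: t_def s_def algebra_simps inner_commute)
    have hh: "h \<bullet> h = (norm h)\<^sup>2" by (simp add: power2_norm_eq_inner)
    have "\<bar>s\<bar> \<le> 2 * (norm x * norm h) + norm h * norm h"
      using Cauchy_Schwarz_ineq2[of x h] unfolding s_def hh power2_eq_square[of "norm h"] by (smt (verit) zero_le_mult_iff norm_ge_zero)
    also have "\<dots> \<le> 2 * ((\<epsilon> + 1) * norm h) + 1 * norm h"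
      using False assms by (intro add_mono mult_left_mono mult_right_mono) auto
    finally have "\<bar>s\<bar> \<le> (2 * \<epsilon> + 3) * norm h" by (simp add: algebra_simps)
    then have "\<bar>s\<bar>\<^sup>2 \<le> ((2 * \<epsilon> + 3) * norm h)\<^sup>2" by (intro power_mono) auto
    then have s2: "s\<^sup>2 \<le> (2 * \<epsilon> + 3)\<^sup>2 * (norm h)\<^sup>2" by (simp add: power_mult_distrib)
    have "bump \<epsilon> (x + h) - bump \<epsilon> x - h \<bullet> (- 4 * max 0 (\<epsilon>\<^sup>2 - x \<bullet> x)) *\<^sub>R x
        = ((max 0 (t + s))\<^sup>2 - (max 0 t)\<^sup>2 - 2 * max 0 t * s) - 2 * max 0 t * (h \<bullet> h)"
      unfolding bump_def ts by (simp add: t_def[symmetric] s_def algebra_simps inner_commute)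
    also have "\<bar>\<dots>\<bar> \<le> s\<^sup>2 + 2 * max 0 t * (h \<bullet> h)"
      using max_square_taylor[of t s] by (smt (verit) inner_ge_zero mult_nonneg_nonneg)
    also have "2 * max 0 t * (h \<bullet> h) \<le> 2 * \<epsilon>\<^sup>2 * (norm h)\<^sup>2"
      unfolding hh by (intro mult_right_mono) (auto simp: t_def)
    finally show ?thesis using s2 by (simp add: algebra_simps)
  qed
  then have "\<bar>bump \<epsilon> (x + h) - bump \<epsilon> x - h \<bullet> (- 4 * max 0 (\<epsilon>\<^sup>2 - x \<bullet> x)) *\<^sub>R x\<bar> / I
      \<le> ((2 * \<epsilon> + 3)\<^sup>2 + 2 * \<epsilon>\<^sup>2) * (norm h)\<^sup>2 / I"
    using I by (intro divide_right_mono) auto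
  moreover have "mollifier \<epsilon> (x + h) - mollifier \<epsilon> x - h \<bullet> mollifier_grad \<epsilon> x
      = (bump \<epsilon> (x + h) - bump \<epsilon> x - h \<bullet> (- 4 * max 0 (\<epsilon>\<^sup>2 - x \<bullet> x)) *\<^sub>R x) / I"
    by (simp add: mollifier_def mollifier_grad_def I_def diff_divide_distrib add_divide_distrib)
  ultimately show ?thesis
    using I by (simp add: C_def I_def[symmetric] abs_divide)
qed

lemma GDERIV_of_quadratic_bound:
  fixes f :: "'a::euclidean_space \<Rightarrow> real"
  assumes "\<And>h. norm h \<le> 1 \<Longrightarrow> \<bar>f (x + h) - f x - h \<bullet> D\<bar> \<le> C * (norm h)\<^sup>2"
  shows "GDERIV f x :> D"
  unfolding gderiv_def has_derivative_at
proof (intro conjI bounded_linear_inner_left)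
  have "((\<lambda>h. \<bar>C\<bar> * norm h) \<longlongrightarrow> 0) (at (0::'a))"
    by (auto intro!: tendsto_eq_intros)
  then show "(\<lambda>h. norm (f (x + h) - f x - h \<bullet> D) / norm h) \<midarrow>0\<rightarrow> 0"
  proof (rule Lim_null_comparison[rotated])
    have "eventually (\<lambda>h. norm h < 1) (at (0::'a))"
      by (auto simp: eventually_at intro!: exI[of _ 1])
    then show "\<forall>\<^sub>F h in at 0. norm (norm (f (x + h) - f x - h \<bullet> D) / norm h) \<le> \<bar>C\<bar> * norm h"
    proof eventually_elim
      case (elim h)
      have "norm (f (x + h) - f x - h \<bullet> D) \<le> C * (norm h)\<^sup>2"
        using assms[of h] elim by simp
      also have "\<dots> \<le> \<bar>C\<bar> * (norm h)\<^sup>2" by (intro mult_right_mono) auto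
      finally show ?case
        by (cases "h = 0") (auto simp: field_simps power2_eq_square)
    qed
  qed
qed

lemma C1_with_grad_mollifier: 
  assumes "\<epsilon> > 0"
  shows "C1_with_grad (mollifier \<epsilon>) (mollifier_grad \<epsilon>)"
  unfolding C1_with_grad_def
  using GDERIV_of_quadratic_bound[OF mollifier_taylor[OF assms]] continuous_on_mollifier_grad by blast

lemma C1_with_grad_mollifier_reflect:
  assumes "\<epsilon> > 0"
  shows "C1_with_grad (\<lambda>y. mollifier \<epsilon> (x - y)) (\<lambda>y. - mollifier_grad \<epsilon> (x - y))"
  unfolding C1_with_grad_def
proof (intro conjI allI)
  fix y
  have "((\<lambda>y. x - y) has_derivative uminus) (at y)"
    by (auto intro!: derivative_eq_intros)
  from has_derivative_compose[OF this, of "mollifier \<epsilon>" "\<lambda>h. h \<bullet> mollifier_grad \<epsilon> (x - y)"]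
  show "GDERIV (\<lambda>y. mollifier \<epsilon> (x - y)) y :> - mollifier_grad \<epsilon> (x - y)"
    using C1_with_grad_GDERIV[OF C1_with_grad_mollifier[OF assms], of "x - y"] by (simp add: gderiv_def)
next
  show "continuous_on UNIV (\<lambda>y. - mollifier_grad \<epsilon> (x - y))"
    by (intro continuous_intros continuous_on_compose2[OF continuous_on_mollifier_grad[of UNIV]]) auto
qed

section \<open>Convolution with the mollifier\<close>

definition mollify :: "real \<Rightarrow> ('a::euclidean_space \<Rightarrow> real) \<Rightarrow> 'a \<Rightarrow> real" where
  "mollify \<epsilon> f x = (LINT y|lborel. f y * mollifier \<epsilon> (x - y))"

definition mollify_grad :: "real \<Rightarrow> ('a::euclidean_space \<Rightarrow> real) \<Rightarrow> 'a \<Rightarrow> 'a" where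
  "mollify_grad \<epsilon> f x = (LINT y|lborel. f y *\<^sub>R mollifier_grad \<epsilon> (x - y))"

lemma integrable_mult_bounded:
  fixes f :: "'a \<Rightarrow> real" and k :: "'a \<Rightarrow> 'b::{banach, second_countable_topology}"
  assumes "integrable M f" "k \<in> borel_measurable M" "\<And>x. norm (k x) \<le> B"
  shows "integrable M (\<lambda>x. f x *\<^sub>R k x)"
proof (rule Bochner_Integration.integrable_bound[where f="\<lambda>x. B * f x"])
  show "AE x in M. norm (f x *\<^sub>R k x) \<le> norm (B * f x)"
  proof (intro AE_I2)
    fix x
    have "\<bar>f x\<bar> * norm (k x) \<le> \<bar>f x\<bar> * B" using assms(3) by (intro mult_left_mono) auto
    also have "\<dots> \<le> \<bar>f x\<bar> * \<bar>B\<bar>" by (intro mult_left_mono) auto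
    finally show "norm (f x *\<^sub>R k x) \<le> norm (B * f x)" by (simp add: abs_mult mult.commute)
  qed
qed (use assms in auto)

lemma integrable_mollify:
  assumes "\<epsilon> > 0" "integrable lborel f"
  shows "integrable lborel (\<lambda>y. f y * mollifier \<epsilon> (x - y))"
proof -
  have "norm (mollifier \<epsilon> (x - y)) \<le> mollifier_const TYPE('a) / \<epsilon> ^ DIM('a)" for y
    using mollifier_le[OF assms(1), of "x - y"] mollifier_nonneg[of \<epsilon> "x - y"] by simp
  from integrable_mult_bounded[OF assms(2) _ this] show ?thesis by simp
qed

lemma mollifier_grad_bounded:
  assumes "\<epsilon> > 0"
  obtains B where "B > 0" "\<And>x::'a::euclidean_space. norm (mollifier_grad \<epsilon> x) \<le> B"
proof -
  have "mollifier_grad \<epsilon> x = 0" if "x \<notin> cball 0 \<epsilon>" for x :: 'a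
    using that assms by (intro mollifier_grad_eq_0) auto
  from bounded_continuous_compact_support[OF continuous_on_mollifier_grad compact_cball this]
  show ?thesis using that by blast
qed

lemma integrable_mollify_grad:
  fixes f :: "'a::euclidean_space \<Rightarrow> real"
  assumes "\<epsilon> > 0" "integrable lborel f"
  shows "integrable lborel (\<lambda>y. f y *\<^sub>R mollifier_grad \<epsilon> (x - y))"
proof -
  obtain B where "B > 0" "\<And>x::'a. norm (mollifier_grad \<epsilon> x) \<le> B"
    using mollifier_grad_bounded[OF assms(1)] by blast
  then show ?thesis
    using integrable_mult_bounded[OF assms(2), of "\<lambda>y. mollifier_grad \<epsilon> (x - y)" B] by simp
qed

text \<open>The uniform Taylor bound of the kernel, integrated against \<bar>f\<bar>, is a Taylor
  bound for the convolution; continuity of the gradient is dominated convergence.\<close>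

lemma C1_with_grad_mollify:
  fixes f :: "'a::euclidean_space \<Rightarrow> real"
  assumes \<epsilon>: "\<epsilon> > 0" and f: "integrable lborel f"
  shows "C1_with_grad (mollify \<epsilon> f) (mollify_grad \<epsilon> f)"
  unfolding C1_with_grad_def
proof (intro conjI allI)
  fix x
  let ?C = "((2 * \<epsilon> + 3)\<^sup>2 + 2 * \<epsilon>\<^sup>2) / (LINT y|lborel. bump \<epsilon> (y::'a))"
  show "GDERIV (mollify \<epsilon> f) x :> mollify_grad \<epsilon> f x"
  proof (rule GDERIV_of_quadratic_bound)
    fix h :: 'a assume h: "norm h \<le> 1"
    let ?E = "\<lambda>y. f y * mollifier \<epsilon> (x + h - y) - f y * mollifier \<epsilon> (x - y) - h \<bullet> (f y *\<^sub>R mollifier_grad \<epsilon> (x - y))"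
    note int = integrable_mollify[OF \<epsilon> f] integrable_mollify_grad[OF \<epsilon> f]
    have "mollify \<epsilon> f (x + h) - mollify \<epsilon> f x - h \<bullet> mollify_grad \<epsilon> f x = (LINT y|lborel. ?E y)"
    proof -
      have "h \<bullet> mollify_grad \<epsilon> f x = (LINT y|lborel. h \<bullet> (f y *\<^sub>R mollifier_grad \<epsilon> (x - y)))"
        unfolding mollify_grad_def by (rule integral_inner_right[symmetric]) (rule int)
      moreover have "(LINT y|lborel. ?E y) = (LINT y|lborel. f y * mollifier \<epsilon> (x + h - y) - f y * mollifier \<epsilon> (x - y))
          - (LINT y|lborel. h \<bullet> (f y *\<^sub>R mollifier_grad \<epsilon> (x - y)))"
        by (intro Bochner_Integration.integral_diff Bochner_Integration.integrable_diff integrable_inner_right int)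
      moreover have "(LINT y|lborel. f y * mollifier \<epsilon> (x + h - y) - f y * mollifier \<epsilon> (x - y)) = mollify \<epsilon> f (x + h) - mollify \<epsilon> f x"
        unfolding mollify_def by (intro Bochner_Integration.integral_diff int)
      ultimately show ?thesis by simp
    qed
    also have "norm \<dots> \<le> (LINT y|lborel. ?C * (norm h)\<^sup>2 * \<bar>f y\<bar>)"
    proof (rule Bochner_Integration.integral_norm_bound_integral)
      show "integrable lborel ?E"
        by (intro Bochner_Integration.integrable_diff integrable_inner_right int)
      show "integrable lborel (\<lambda>y. ?C * (norm h)\<^sup>2 * \<bar>f y\<bar>)" using f by auto
      fix y
      have "?E y = f y * (mollifier \<epsilon> ((x - y) + h) - mollifier \<epsilon> (x - y) - h \<bullet> mollifier_grad \<epsilon> (x - y))"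
        by (simp add: algebra_simps)
      then have "norm (?E y) = \<bar>f y\<bar> * \<bar>mollifier \<epsilon> ((x - y) + h) - mollifier \<epsilon> (x - y) - h \<bullet> mollifier_grad \<epsilon> (x - y)\<bar>"
        by (simp only: abs_mult real_norm_def)
      also have "\<dots> \<le> \<bar>f y\<bar> * (?C * (norm h)\<^sup>2)"
        by (intro mult_left_mono mollifier_taylor \<epsilon> h) auto
      finally show "norm (?E y) \<le> ?C * (norm h)\<^sup>2 * \<bar>f y\<bar>" by (simp add: mult.commute)
    qed
    finally show "\<bar>mollify \<epsilon> f (x + h) - mollify \<epsilon> f x - h \<bullet> mollify_grad \<epsilon> f x\<bar>
        \<le> (?C * (LINT y|lborel. \<bar>f y\<bar>)) * (norm h)\<^sup>2"
      by (simp add: mult_ac)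
  qed
next
  obtain B where B: "B > 0" "\<And>x::'a. norm (mollifier_grad \<epsilon> x) \<le> B"
    using mollifier_grad_bounded[OF \<epsilon>] by blast
  have [measurable]: "f \<in> borel_measurable borel" using f by (auto dest: borel_measurable_integrable)
  show "continuous_on UNIV (mollify_grad \<epsilon> f)"
    unfolding continuous_on_sequentially
  proof (intro allI ballI impI, elim conjE)
    fix X and a :: 'a assume X: "X \<longlonglongrightarrow> a"
    have "(\<lambda>n. LINT y|lborel. f y *\<^sub>R mollifier_grad \<epsilon> (X n - y)) \<longlonglongrightarrow> (LINT y|lborel. f y *\<^sub>R mollifier_grad \<epsilon> (a - y))"
    proof (rule integral_dominated_convergence[where w="\<lambda>y. B * \<bar>f y\<bar>"])
      show "AE y in lborel. (\<lambda>n. f y *\<^sub>R mollifier_grad \<epsilon> (X n - y)) \<longlonglongrightarrow> f y *\<^sub>R mollifier_grad \<epsilon> (a - y)"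
        by (intro AE_I2 tendsto_intros continuous_on_tendsto_compose[OF continuous_on_mollifier_grad[of UNIV]] X) auto
      fix n show "AE y in lborel. norm (f y *\<^sub>R mollifier_grad \<epsilon> (X n - y)) \<le> B * \<bar>f y\<bar>"
        using mult_left_mono[OF B(2) abs_ge_zero] by (intro AE_I2) (simp add: mult.commute)
    qed (use f in auto)
    then show "(mollify_grad \<epsilon> f \<circ> X) \<longlonglongrightarrow> mollify_grad \<epsilon> f a"
      by (simp add: o_def mollify_grad_def)
  qed
qed

lemma mollify_indicator:
  fixes D :: "'a::euclidean_space set"
  assumes \<epsilon>: "\<epsilon> > 0" and D: "D \<in> sets borel" "bounded D"
  shows "0 \<le> mollify \<epsilon> (indicator D) x" "mollify \<epsilon> (indicator D) x \<le> 1"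
    "ball x \<epsilon> \<subseteq> D \<Longrightarrow> mollify \<epsilon> (indicator D) x = 1"
    "ball x \<epsilon> \<inter> D = {} \<Longrightarrow> mollify \<epsilon> (indicator D) x = 0"
proof -
  have int: "integrable lborel (indicator D :: 'a \<Rightarrow> real)"
    using D by (intro integrable_real_indicator) (auto intro: emeasure_lborel_bounded)
  show "0 \<le> mollify \<epsilon> (indicator D) x"
    unfolding mollify_def by (intro integral_nonneg_AE) (auto simp: mollifier_nonneg)
  have "mollify \<epsilon> (indicator D) x \<le> (LINT y|lborel. mollifier \<epsilon> (x - y))"
    unfolding mollify_def
  proof (rule Bochner_Integration.integral_mono[OF integrable_mollify[OF \<epsilon> int] integrable_mollifier_reflect[OF \<epsilon>]])
    show "indicator D y * mollifier \<epsilon> (x - y) \<le> mollifier \<epsilon> (x - y)" for y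
      by (auto simp: indicator_def mollifier_nonneg)
  qed
  then show "mollify \<epsilon> (indicator D) x \<le> 1"
    using integral_mollifier_reflect[OF \<epsilon>, of x] by simp
  have out: "mollifier \<epsilon> (x - y) = 0" if "y \<notin> ball x \<epsilon>" for y
    using that by (intro mollifier_eq_0 \<epsilon>) (auto simp: dist_norm)
  show "mollify \<epsilon> (indicator D) x = 1" if "ball x \<epsilon> \<subseteq> D"
  proof -
    have "(\<lambda>y. indicator D y * mollifier \<epsilon> (x - y)) = (\<lambda>y. mollifier \<epsilon> (x - y))"
    proof
      show "indicator D y * mollifier \<epsilon> (x - y) = mollifier \<epsilon> (x - y)" for y
        using that out[of y] by (cases "y \<in> D") (auto simp del: mem_ball)
    qed
    then show ?thesis
      unfolding mollify_def using integral_mollifier_reflect[OF \<epsilon>, of x] by simp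
  qed
  show "mollify \<epsilon> (indicator D) x = 0" if "ball x \<epsilon> \<inter> D = {}"
  proof -
    have "(\<lambda>y. indicator D y * mollifier \<epsilon> (x - y)) = (\<lambda>y. 0)"
    proof
      show "indicator D y * mollifier \<epsilon> (x - y) = 0" for y
        using that out[of y] by (cases "y \<in> D") (auto simp del: mem_ball)
    qed
    then show ?thesis
      unfolding mollify_def by simp
  qed
qed

text \<open>The indicator of the \<open>e/3\<close>-neighbourhood of \<open>K\<close> is mollified
  at scale \<open>e/3\<close>: the result is 1 on \<open>K\<close> and is supported within distance
  \<open>e\<close> of \<open>K\<close>.\<close>

lemma cutoff_exists:
  fixes K :: "'a::euclidean_space set"
  assumes K: "compact K" and U: "open U" "K \<subseteq> U"
  obtains \<phi> d L where "C1_with_grad \<phi> d" "compact L" "L \<subseteq> U" "\<And>x. x \<notin> L \<Longrightarrow> \<phi> x = 0"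
    "\<And>x. 0 \<le> \<phi> x" "\<And>x. \<phi> x \<le> 1" "\<And>x. x \<in> K \<Longrightarrow> \<phi> x = 1"
proof -
  obtain e where e: "e > 0" "(\<Union>x\<in>K. cball x e) \<subseteq> U"
    using compact_subset_open_imp_cball_epsilon_subset[OF K U] by blast
  define D where "D = (\<Union>x\<in>K. ball x (e/3))"
  define L where "L = (\<Union>x\<in>K. cball x e)"
  have L: "compact L"
    using compact_minkowski_sum_cball[OF K, of e] by (simp add: L_def)
  have D: "open D" "bounded D"
  proof -
    have "D \<subseteq> L" using e by (force simp: D_def L_def)
    then show "bounded D" using bounded_subset[OF compact_imp_bounded[OF L]] by blast
  qed (auto simp: D_def)
  have DB: "D \<in> sets borel" using D by simp
  have int: "integrable lborel (indicator D :: 'a \<Rightarrow> real)"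
    using DB D by (intro integrable_real_indicator) (auto intro: emeasure_lborel_bounded)
  have e3: "e/3 > 0" using e by simp
  note m = mollify_indicator[OF e3 DB D(2)]
  show thesis
  proof (rule that[OF C1_with_grad_mollify[OF e3 int] L])
    show "L \<subseteq> U" using e by (simp add: L_def)
    show "mollify (e/3) (indicator D) x = 0" if "x \<notin> L" for x
    proof (rule m(4))
      { fix y k assume "dist x y < e/3" "k \<in> K" "dist k y < e/3"
        then have "dist k x \<le> e" using dist_triangle[of k x y] e by (simp add: dist_commute)
        with that \<open>k \<in> K\<close> have False by (auto simp: L_def) }
      then show "ball x (e/3) \<inter> D = {}" by (auto simp: D_def)
    qed
    show "mollify (e/3) (indicator D) x = 1" if "x \<in> K" for x
      by (rule m(3)) (use that in \<open>auto simp: D_def\<close>)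
  qed (use m in auto)
qed

section \<open>The isodiametric inequality\<close>

text \<open>Both \<open>Sup A - Inf C\<close> and \<open>Sup C - Inf A\<close> are at most
  \<open>r\<close>, and their sum is the total length of two intervals containing \<open>A\<close>
  and \<open>C\<close>. For Steiner symmetrization, with \<open>A\<close> and \<open>C\<close> two
  slices.\<close>

lemma emeasure_add_le_of_dist_le:
  assumes ne: "A \<noteq> {}" "C \<noteq> {}" and r: "\<And>a c. a \<in> A \<Longrightarrow> c \<in> C \<Longrightarrow> \<bar>a - c\<bar> \<le> (r::real)"
  shows "emeasure lborel A + emeasure lborel C \<le> ennreal (2 * r)"
proof -
  obtain a c where ac: "a \<in> A" "c \<in> C" using ne by blast
  have bA: "bdd_above A" "bdd_below A"
    using r[OF _ ac(2)] by (fastforce intro!: bdd_aboveI[of _ "c + r"] bdd_belowI[of _ "c - r"] simp: abs_le_iff)+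
  have bC: "bdd_above C" "bdd_below C"
    using r[OF ac(1)] by (fastforce intro!: bdd_aboveI[of _ "a + r"] bdd_belowI[of _ "a - r"] simp: abs_le_iff)+
  have AC: "Sup A \<le> r + Inf C"
  proof (rule cSup_least[OF ne(1)])
    fix x assume x: "x \<in> A"
    have "x - r \<le> Inf C"
    proof (rule cInf_greatest[OF ne(2)])
      show "x - r \<le> y" if "y \<in> C" for y
        using r[OF x that] by linarith
    qed
    then show "x \<le> r + Inf C" by simp
  qed
  have CA: "Sup C \<le> r + Inf A"
  proof (rule cSup_least[OF ne(2)])
    fix x assume x: "x \<in> C"
    have "x - r \<le> Inf A"
    proof (rule cInf_greatest[OF ne(1)])
      show "x - r \<le> y" if "y \<in> A" for y
        using r[OF that x] by linarith
    qed
    then show "x \<le> r + Inf A" by simp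
  qed
  have le: "Inf A \<le> Sup A" "Inf C \<le> Sup C"
    using bA bC ac cInf_lower cSup_upper by (meson order_trans)+
  have "A \<subseteq> {Inf A..Sup A}" "C \<subseteq> {Inf C..Sup C}"
    using bA bC by (auto intro: cInf_lower cSup_upper)
  then have "emeasure lborel A \<le> ennreal (Sup A - Inf A)" "emeasure lborel C \<le> ennreal (Sup C - Inf C)"
    using emeasure_mono[of A "{Inf A..Sup A}" lborel] emeasure_mono[of C "{Inf C..Sup C}" lborel] le by auto
  then have "emeasure lborel A + emeasure lborel C \<le> ennreal (Sup A - Inf A) + ennreal (Sup C - Inf C)"
    by (rule add_mono)
  also have "\<dots> = ennreal ((Sup A - Inf A) + (Sup C - Inf C))"
    using le by (intro ennreal_plus[symmetric]) auto
  also have "\<dots> \<le> ennreal (2 * r)"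
    using AC CA by (intro ennreal_leI) auto
  finally show ?thesis .
qed

text \<open>The centred open interval of length \<open>l\<close>, in a form that also covers
  infinite \<open>l\<close> and makes it empty for \<open>l = 0\<close>.\<close>

lemma emeasure_symmetric_interval: "emeasure lborel {t::real. ennreal (2 * \<bar>t\<bar>) < l} = l"
proof (cases l)
  case (real r)
  have "{t::real. ennreal (2 * \<bar>t\<bar>) < l} = {- r / 2 <..< r / 2}"
    unfolding real using real(1) by (auto simp: ennreal_less_iff)
  then show ?thesis using real by simp
next
  case top
  then show ?thesis by simp
qed

text \<open>Each slice of \<open>B\<close> in direction \<open>j\<close> is replaced by the centred
  interval of the same length. Fubini keeps the volume. The diameter bound survives because two
  slices of total length at most \<open>2 * r\<close> become centred intervals whose points differ
  by at most \<open>r\<close>. The last clause preserves symmetries gained earlier, so that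
  coordinates can be treated one after the other.\<close>

lemma steiner_symmetrization:
  fixes J :: "'i set" and d :: real
  defines "P \<equiv> Pi\<^sub>M J (\<lambda>_. lborel :: real measure)"
  assumes J: "finite J" "j \<in> J" and B: "B \<in> sets P"
    and diam: "\<And>f g. f \<in> B \<Longrightarrow> g \<in> B \<Longrightarrow> (\<Sum>i\<in>J. (f i - g i)\<^sup>2) \<le> d\<^sup>2"
  shows "\<exists>B'\<in>sets P. emeasure P B' = emeasure P B \<and>
    (\<forall>f\<in>B'. \<forall>g\<in>B'. (\<Sum>i\<in>J. (f i - g i)\<^sup>2) \<le> d\<^sup>2) \<and> (\<forall>f\<in>B'. f(j := - f j) \<in> B') \<and>
    (\<forall>i\<in>J. i \<noteq> j \<longrightarrow> (\<forall>f\<in>B. f(i := - f i) \<in> B) \<longrightarrow> (\<forall>f\<in>B'. f(i := - f i) \<in> B'))"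
proof -
  interpret product_sigma_finite "\<lambda>_. lborel :: real measure" by standard
  define J0 where "J0 = J - {j}"
  have J0: "finite J0" "j \<notin> J0" "J = insert j J0" using J by (auto simp: J0_def)
  define L where "L f = emeasure lborel {t. f(j := t) \<in> B}" for f
  have spP: "f \<in> space P \<longleftrightarrow> f \<in> extensional J" for f
    by (auto simp: P_def space_PiM PiE_def)
  have upd: "f(i := t) \<in> space P" if "f \<in> space P" "i \<in> J" for f i t
    using that by (auto simp: spP extensional_def)
  have [measurable]: "B \<in> sets P" by fact
  have m: "(\<lambda>(f, t). f(j := t)) \<in> measurable (P \<Otimes>\<^sub>M lborel) P"
    using measurable_add_dim[of j J "\<lambda>_. lborel"] J by (simp add: P_def insert_absorb)
  have "(\<lambda>f. emeasure lborel (Pair f -` ((\<lambda>(f, t). f(j := t)) -` B \<inter> space (P \<Otimes>\<^sub>M lborel)))) \<in> borel_measurable P"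
    by (intro lborel.measurable_emeasure_Pair measurable_sets[OF m B])
  then have [measurable]: "L \<in> borel_measurable P"
    by (subst measurable_cong[where g="\<lambda>f. emeasure lborel (Pair f -` ((\<lambda>(f, t). f(j := t)) -` B \<inter> space (P \<Otimes>\<^sub>M lborel)))"])
       (auto simp: L_def space_pair_measure vimage_def)
  have [measurable]: "(\<lambda>f. f j) \<in> borel_measurable P"
    using J unfolding P_def by measurable
  define B' where "B' = {f \<in> space P. ennreal (2 * \<bar>f j\<bar>) < L f}"
  have B': "B' \<in> sets P" unfolding B'_def by measurable
  have Lupd: "L (f(j := t)) = L f" for f t by (simp add: L_def)
  have slice: "emeasure P S = (\<integral>\<^sup>+ f. emeasure lborel {t. f(j := t) \<in> S} \<partial>Pi\<^sub>M J0 (\<lambda>_. lborel))"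
    if S: "S \<in> sets P" for S
  proof -
    have "emeasure P S = (\<integral>\<^sup>+ f. indicator S f \<partial>P)" using S by simp
    also have "\<dots> = (\<integral>\<^sup>+ f. \<integral>\<^sup>+ t. indicator S (f(j := t)) \<partial>lborel \<partial>Pi\<^sub>M J0 (\<lambda>_. lborel))"
      unfolding P_def J0(3) using S
      by (intro product_nn_integral_insert J0) (auto simp: P_def J0(3))
    also have "\<dots> = (\<integral>\<^sup>+ f. emeasure lborel {t. f(j := t) \<in> S} \<partial>Pi\<^sub>M J0 (\<lambda>_. lborel))"
    proof (rule nn_integral_cong)
      fix f assume f: "f \<in> space (Pi\<^sub>M J0 (\<lambda>_. lborel :: real measure))"
      have "(\<lambda>t. f(j := t)) \<in> measurable lborel P"
        using measurable_compose[OF measurable_Pair1'[OF f] measurable_add_dim[of j J0 "\<lambda>_. lborel"]]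
        by (simp add: P_def J0(3)[symmetric])
      then have "(\<lambda>t. f(j := t)) -` S \<inter> space lborel \<in> sets lborel"
        using S by (rule measurable_sets)
      then have "{t. f(j := t) \<in> S} \<in> sets lborel" by (simp add: vimage_def)
      then have "emeasure lborel {t. f(j := t) \<in> S} = (\<integral>\<^sup>+ t. indicator {t. f(j := t) \<in> S} t \<partial>lborel)"
        by simp
      then show "(\<integral>\<^sup>+ t. indicator S (f(j := t)) \<partial>lborel) = emeasure lborel {t. f(j := t) \<in> S}"
        by (simp add: indicator_def of_bool_def)
    qed
    finally show ?thesis .
  qed
  show ?thesis
  proof (rule bexI[OF _ B'], intro conjI ballI impI)
    show "emeasure P B' = emeasure P B"
      unfolding slice[OF B] slice[OF B']
    proof (rule nn_integral_cong)
      fix f assume f: "f \<in> space (Pi\<^sub>M J0 (\<lambda>_. lborel :: real measure))"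
      have "f(j := t) \<in> space P" for t
        using f unfolding spP J0(3) by (auto simp: space_PiM extensional_def)
      then have "{t. f(j := t) \<in> B'} = {t. ennreal (2 * \<bar>t\<bar>) < L f}"
        by (auto simp: B'_def Lupd)
      then show "emeasure lborel {t. f(j := t) \<in> B'} = emeasure lborel {t. f(j := t) \<in> B}"
        by (simp add: emeasure_symmetric_interval) (simp add: L_def)
    qed
    show "(\<Sum>i\<in>J. (f i - g i)\<^sup>2) \<le> d\<^sup>2" if f: "f \<in> B'" and g: "g \<in> B'" for f g
    proof -
      define s where "s = (\<Sum>i\<in>J0. (f i - g i)\<^sup>2)"
      let ?A = "{t. f(j := t) \<in> B}" and ?C = "{t. g(j := t) \<in> B}"
      have fL: "ennreal (2 * \<bar>f j\<bar>) < emeasure lborel ?A" and gL: "ennreal (2 * \<bar>g j\<bar>) < emeasure lborel ?C"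
        using f g by (auto simp: B'_def L_def)
      \<comment> \<open>The strict inequality in \<open>B'\<close> forces the original slices to
        have positive length.\<close>
      have ne: "?A \<noteq> {}" "?C \<noteq> {}"
        using fL gL by (metis emeasure_empty not_less_zero)+
      have sac: "s + (a - c)\<^sup>2 \<le> d\<^sup>2" if "a \<in> ?A" "c \<in> ?C" for a c
      proof -
        have "(\<Sum>i\<in>J. ((f(j := a)) i - (g(j := c)) i)\<^sup>2) = s + (a - c)\<^sup>2"
          using J0 by (simp add: s_def) (intro sum.cong, auto)
        then show ?thesis using diam[of "f(j := a)" "g(j := c)"] that by simp
      qed
      \<comment> \<open>The separation in coordinate \<open>j\<close> that is still compatible with
        diameter \<open>d\<close> once the other coordinates have used up \<open>s\<close>.\<close>
      define r where "r = sqrt (d\<^sup>2 - s)"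
      have "0 \<le> d\<^sup>2 - s"
        using ne sac by (smt (verit) all_not_in_conv zero_le_power2)
      then have r2: "r\<^sup>2 = d\<^sup>2 - s" "r \<ge> 0" by (auto simp: r_def)
      have "\<bar>a - c\<bar> \<le> r" if "a \<in> ?A" "c \<in> ?C" for a c
        using sac[OF that] unfolding r_def by (metis add.commute le_diff_eq real_sqrt_abs real_sqrt_le_iff)
      from emeasure_add_le_of_dist_le[OF ne this]
      have "emeasure lborel ?A + emeasure lborel ?C \<le> ennreal (2 * r)" .
      moreover have "ennreal (2 * \<bar>f j\<bar>) + ennreal (2 * \<bar>g j\<bar>) \<le> emeasure lborel ?A + emeasure lborel ?C"
        using fL gL by (intro add_mono) auto
      ultimately have "ennreal (2 * \<bar>f j\<bar> + 2 * \<bar>g j\<bar>) \<le> ennreal (2 * r)"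
        by (simp add: ennreal_plus)
      then have "\<bar>f j\<bar> + \<bar>g j\<bar> \<le> r" using r2(2) by (subst (asm) ennreal_le_iff) auto
      then have "\<bar>f j - g j\<bar> \<le> r" by linarith
      then have "(f j - g j)\<^sup>2 \<le> d\<^sup>2 - s" unfolding r2(1)[symmetric] by (metis abs_ge_zero power2_abs power_mono)
      then show ?thesis using J0 by (simp add: s_def)
    qed
    show "f(j := - f j) \<in> B'" if "f \<in> B'" for f
      using that upd[of f j] J by (simp add: B'_def Lupd)
    show "f(i := - f i) \<in> B'"
      if i: "i \<in> J" "i \<noteq> j" and sym: "\<forall>f\<in>B. f(i := - f i) \<in> B" and f: "f \<in> B'" for i f
    proof -
      have iff: "h(i := - h i) \<in> B \<longleftrightarrow> h \<in> B" for h
        using sym[rule_format, of h] sym[rule_format, of "h(i := - h i)"] by auto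
      have "(f(i := - f i))(j := t) \<in> B \<longleftrightarrow> f(j := t) \<in> B" for t
        using iff[of "f(j := t)"] i by (simp add: fun_upd_twist)
      then have "L (f(i := - f i)) = L f" by (simp add: L_def)
      then show ?thesis using f i upd[of f i] by (simp add: B'_def)
    qed
  qed
qed

text \<open>After symmetrization in every coordinate the set contains -f along with f, so twice the
  norm of f is at most \<open>d\<close> and the set lies in the ball of radius \<open>d / 2\<close>.
  Stated for coordinate products because it will be applied to the coordinates other than one chosen
  direction.\<close>

lemma isodiametric_PiM:
  fixes J :: "'i set" and d :: real
  defines "P \<equiv> Pi\<^sub>M J (\<lambda>_. lborel :: real measure)"
  assumes J: "finite J" and B: "B \<in> sets P" and d: "d > 0"
    and diam: "\<And>f g. f \<in> B \<Longrightarrow> g \<in> B \<Longrightarrow> (\<Sum>i\<in>J. (f i - g i)\<^sup>2) \<le> d\<^sup>2"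
  shows "emeasure P B \<le> ennreal (unit_ball_vol (real (card J)) * (d / 2) ^ card J)"
proof -
  have "\<exists>B'\<in>sets P. emeasure P B' = emeasure P B \<and> (\<forall>f\<in>B'. \<forall>g\<in>B'. (\<Sum>i\<in>J. (f i - g i)\<^sup>2) \<le> d\<^sup>2) \<and>
      (\<forall>i\<in>I. \<forall>f\<in>B'. f(i := - f i) \<in> B')" if "finite I" "I \<subseteq> J" for I
    using that
  proof (induction I rule: finite_induct)
    case empty
    then show ?case using B diam by blast
  next
    case (insert j I)
    have "I \<subseteq> J" using insert.prems by blast
    from insert.IH[OF this] obtain B1 where B1: "B1 \<in> sets P" "emeasure P B1 = emeasure P B"
      "\<forall>f\<in>B1. \<forall>g\<in>B1. (\<Sum>i\<in>J. (f i - g i)\<^sup>2) \<le> d\<^sup>2" "\<forall>i\<in>I. \<forall>f\<in>B1. f(i := - f i) \<in> B1"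
      by blast
    have "\<exists>B2\<in>sets P. emeasure P B2 = emeasure P B1 \<and>
      (\<forall>f\<in>B2. \<forall>g\<in>B2. (\<Sum>i\<in>J. (f i - g i)\<^sup>2) \<le> d\<^sup>2) \<and> (\<forall>f\<in>B2. f(j := - f j) \<in> B2) \<and>
      (\<forall>i\<in>J. i \<noteq> j \<longrightarrow> (\<forall>f\<in>B1. f(i := - f i) \<in> B1) \<longrightarrow> (\<forall>f\<in>B2. f(i := - f i) \<in> B2))"
      unfolding P_def
    proof (rule steiner_symmetrization[OF J])
      show "j \<in> J" using insert.prems by blast
      show "B1 \<in> sets (Pi\<^sub>M J (\<lambda>_. lborel))" using B1(1) by (simp add: P_def)
      show "(\<Sum>i\<in>J. (f i - g i)\<^sup>2) \<le> d\<^sup>2" if "f \<in> B1" "g \<in> B1" for f g using B1(3) that by blast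
    qed
    then obtain B2 where B2: "B2 \<in> sets P" "emeasure P B2 = emeasure P B1"
      "\<forall>f\<in>B2. \<forall>g\<in>B2. (\<Sum>i\<in>J. (f i - g i)\<^sup>2) \<le> d\<^sup>2" "\<forall>f\<in>B2. f(j := - f j) \<in> B2"
      "\<forall>i\<in>J. i \<noteq> j \<longrightarrow> (\<forall>f\<in>B1. f(i := - f i) \<in> B1) \<longrightarrow> (\<forall>f\<in>B2. f(i := - f i) \<in> B2)"
      by (elim bexE conjE)
    have flips: "f(i := - f i) \<in> B2" if "i \<in> insert j I" "f \<in> B2" for i f
    proof (cases "i = j")
      case True
      then show ?thesis using B2(4) that by simp
    next
      case False
      then have i: "i \<in> I" "i \<in> J" using that insert.prems by auto
      have "\<forall>f\<in>B1. f(i := - f i) \<in> B1" using B1(4) i(1) by (rule bspec)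
      then have "\<forall>f\<in>B2. f(i := - f i) \<in> B2" using B2(5) i(2) False by simp
      then show ?thesis using that(2) by (rule bspec)
    qed
    show ?case
    proof (rule bexI[OF _ B2(1)], intro conjI)
      show "emeasure P B2 = emeasure P B" using B1(2) B2(2) by simp
      show "\<forall>i\<in>insert j I. \<forall>f\<in>B2. f(i := - f i) \<in> B2" by (intro ballI) (rule flips)
    qed (rule B2(3))
  qed
  from this[OF J order_refl] obtain B' where B'_props: "B' \<in> sets P" "emeasure P B' = emeasure P B"
    "\<forall>f\<in>B'. \<forall>g\<in>B'. (\<Sum>i\<in>J. (f i - g i)\<^sup>2) \<le> d\<^sup>2"
    "\<forall>i\<in>J. \<forall>f\<in>B'. f(i := - f i) \<in> B'" by (elim bexE conjE)
  note B' = B'_props(1,2) B'_props(3)[rule_format] B'_props(4)[rule_format]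
  have flip: "(\<lambda>i. if i \<in> I then - f i else f i) \<in> B'" if "finite I" "I \<subseteq> J" "f \<in> B'" for I f
    using that(1,2)
  proof (induction I rule: finite_induct)
    case empty
    then show ?case using that by simp
  next
    case (insert i I)
    let ?h = "\<lambda>k. if k \<in> I then - f k else f k"
    have "?h(i := - ?h i) \<in> B'" using insert B'(4)[of i ?h] by auto
    moreover have "?h(i := - ?h i) = (\<lambda>k. if k \<in> insert i I then - f k else f k)"
      using insert.hyps by auto
    ultimately show ?case by simp
  qed
  have "B' \<subseteq> {f. sqrt (\<Sum>i\<in>J. (f i)\<^sup>2) \<le> d / 2} \<inter> space P"
  proof
    fix f assume f: "f \<in> B'"
    have "4 * (\<Sum>i\<in>J. (f i)\<^sup>2) = (\<Sum>i\<in>J. (f i - (if i \<in> J then - f i else f i))\<^sup>2)"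
      unfolding sum_distrib_left by (intro sum.cong refl) (simp add: power2_eq_square)
    also have "\<dots> \<le> d\<^sup>2"
      by (rule B'(3)[OF f flip[OF J order_refl f]])
    finally have "(\<Sum>i\<in>J. (f i)\<^sup>2) \<le> (d / 2)\<^sup>2"
      by (simp add: power_divide)
    then have "sqrt (\<Sum>i\<in>J. (f i)\<^sup>2) \<le> d / 2" using d by (intro real_le_lsqrt) (auto intro: sum_nonneg)
    then show "f \<in> {f. sqrt (\<Sum>i\<in>J. (f i)\<^sup>2) \<le> d / 2} \<inter> space P"
      using f B'(1) sets.sets_into_space by blast
  qed
  then have "emeasure P B' \<le> emeasure P ({f. sqrt (\<Sum>i\<in>J. (f i)\<^sup>2) \<le> d / 2} \<inter> space P)"
  proof (rule emeasure_mono)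
    show "{f. sqrt (\<Sum>i\<in>J. (f i)\<^sup>2) \<le> d / 2} \<inter> space P \<in> sets P"
      unfolding P_def by measurable
  qed
  also have "\<dots> = ennreal (unit_ball_vol (real (card J)) * (d / 2) ^ card J)"
    unfolding P_def using d by (intro emeasure_cball_aux J) auto
  finally show ?thesis using B'(2) by simp
qed

section \<open>Directional variation of convex sets\<close>

text \<open>By Vitali, disjoint closed balls fill \<open>S\<close> up to a null set; the involution
  \<open>R\<close> takes each of them to a ball of the same radius, hence of the same volume, and
  keeps them disjoint.\<close>

lemma emeasure_open_le_isometry:
  fixes R :: "'a::euclidean_space \<Rightarrow> 'a"
  assumes iso: "\<And>x y. dist (R x) (R y) = dist x y" and inv: "\<And>x. R (R x) = x" and S: "open S"
  shows "emeasure lborel S \<le> emeasure lborel (R -` S)"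
proof -
  define K where "K = {(a, r). (0::real) < r \<and> cball a r \<subseteq> S}"
  have K_pos: "0 < snd i" if "i \<in> K" for i using that by (auto simp: K_def)
  have "\<exists>i. i \<in> K \<and> x \<in> cball (fst i) (snd i) \<and> snd i < \<delta>" if "x \<in> S" "0 < \<delta>" for x \<delta>
  proof -
    obtain r where "r > 0" "cball x r \<subseteq> S" using S \<open>x \<in> S\<close> open_contains_cball by blast
    then have "cball x (min r (\<delta>/2)) \<subseteq> S" by auto
    then show ?thesis using \<open>r > 0\<close> \<open>0 < \<delta>\<close> by (intro exI[of _ "(x, min r (\<delta>/2))"]) (auto simp: K_def)
  qed
  from Vitali_covering_theorem_cballs[where K=K and r=snd and a=fst and S=S, OF K_pos this]
  obtain C where C: "countable C" "C \<subseteq> K"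
    "pairwise (\<lambda>i j. disjnt (cball (fst i) (snd i)) (cball (fst j) (snd j))) C"
    "negligible (S - (\<Union>i\<in>C. cball (fst i) (snd i)))"
    by blast
  let ?b = "\<lambda>i. cball (fst i) (snd i) :: 'a set"
  have Rb: "R -` cball a r = cball (R a) r" for a r
    using iso[of "R a"] inv by auto
  have disj: "disjoint_family_on ?b C"
    using C(3) by (auto simp: disjoint_family_on_def pairwise_def disjnt_def)
  have disjR: "disjoint_family_on (\<lambda>i. R -` ?b i) C"
    using disj unfolding disjoint_family_on_def by blast
  have U: "(\<Union>i\<in>C. ?b i) \<in> sets borel" "(\<Union>i\<in>C. R -` ?b i) \<in> sets borel"
    using C(1) unfolding Rb by (auto intro!: sets.countable_UN')
  have "continuous_on UNIV R"
    unfolding continuous_on_iff using iso by metis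
  then have RS: "open (R -` S)" using S by (simp add: continuous_on_open_vimage)
  have "emeasure lborel S \<le> emeasure lborel ((\<Union>i\<in>C. ?b i) \<union> (S - (\<Union>i\<in>C. ?b i)))"
    using U S by (intro emeasure_mono) auto
  also have "\<dots> = emeasure lborel (\<Union>i\<in>C. ?b i)"
  proof (rule emeasure_Un_null_set)
    have "S - (\<Union>i\<in>C. ?b i) \<in> null_sets lebesgue" using C(4) by (simp add: negligible_iff_null_sets)
    then show "S - (\<Union>i\<in>C. ?b i) \<in> null_sets lborel"
      using U S by (auto simp: null_sets_completion_iff)
  qed (use U in auto)
  also have "\<dots> = (\<integral>\<^sup>+ i. emeasure lborel (?b i) \<partial>count_space C)"
    using C(1) disj by (intro emeasure_UN_countable) auto
  also have "\<dots> = (\<integral>\<^sup>+ i. emeasure lborel (R -` ?b i) \<partial>count_space C)"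
  proof (rule nn_integral_cong)
    fix i assume "i \<in> space (count_space C)"
    then have "snd i \<ge> 0" using C(2) by (auto simp: K_def)
    then show "emeasure lborel (?b i) = emeasure lborel (R -` ?b i)"
      unfolding Rb by (simp add: emeasure_cball)
  qed
  also have "\<dots> = emeasure lborel (\<Union>i\<in>C. R -` ?b i)"
    using C(1) disjR unfolding Rb by (intro emeasure_UN_countable[symmetric]) auto
  also have "\<dots> \<le> emeasure lborel (R -` S)"
  proof (rule emeasure_mono)
    have "?b i \<subseteq> S" if "i \<in> C" for i using C(2) that by (cases i) (auto simp: K_def)
    then show "(\<Union>i\<in>C. R -` ?b i) \<subseteq> R -` S" by blast
  qed (use RS in simp)
  finally show ?thesis .
qed

text \<open>The preceding inequality, applied to a box and to its preimage, gives equality because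
  \<open>R\<close> is its own inverse.\<close>

lemma lborel_distr_isometry:
  fixes R :: "'a::euclidean_space \<Rightarrow> 'a"
  assumes iso: "\<And>x y. dist (R x) (R y) = dist x y" and inv: "\<And>x. R (R x) = x"
  shows "distr lborel borel R = lborel"
proof (rule lborel_eqI[symmetric])
  have cont: "continuous_on UNIV R"
    unfolding continuous_on_iff using iso by metis
  then have [measurable]: "R \<in> borel_measurable borel" by (rule borel_measurable_continuous_onI)
  fix l u :: 'a assume "\<And>b. b \<in> Basis \<Longrightarrow> l \<bullet> b \<le> u \<bullet> b"
  then have box: "emeasure lborel (box l u) = (\<Prod>b\<in>Basis. (u - l) \<bullet> b)"
    by (rule emeasure_lborel_box)
  have "open (R -` box l u)" by (rule open_vimage[OF open_box cont])
  from emeasure_open_le_isometry[OF iso inv this]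
  have "emeasure lborel (R -` box l u) \<le> emeasure lborel (box l u)"
    using inv by (simp add: vimage_def)
  then have "emeasure lborel (R -` box l u) = emeasure lborel (box l u)"
    using emeasure_open_le_isometry[OF iso inv open_box] by (intro antisym)
  then show "emeasure (distr lborel borel R) (box l u) = (\<Prod>b\<in>Basis. (u - l) \<bullet> b)"
    using box by (simp add: emeasure_distr)
qed simp

text \<open>Reflecting in the hyperplane orthogonal to \<open>e - b\<close>, rather than rotating,
  yields an involution, as the invariance of Lebesgue measure above requires.\<close>

lemma householder_reflection:
  fixes e b :: "'a::euclidean_space"
  assumes "norm e = 1" "norm b = 1"
  obtains R where "linear R" "\<And>x y. dist (R x) (R y) = dist x y" "\<And>x. R (R x) = x" "R e = b"
proof (cases "e = b")
  case True
  then show ?thesis using that[of "\<lambda>x. x"] by (simp add: linear_id[unfolded id_def])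
next
  case False
  define n where "n = e - b"
  define R where "R x = x - (2 * (x \<bullet> n) / (n \<bullet> n)) *\<^sub>R n" for x
  have nn: "n \<bullet> n \<noteq> 0" using False by (simp add: n_def)
  have lin: "linear R"
    by (rule linearI) (simp_all add: R_def algebra_simps add_divide_distrib inner_add_left)
  have "R x \<bullet> R x = x \<bullet> x" for x
    using nn by (simp add: R_def inner_diff_left inner_diff_right inner_commute field_simps)
  then have nR: "norm (R x) = norm x" for x by (simp add: norm_eq_sqrt_inner)
  have "dist (R x) (R y) = dist x y" for x y
    using nR[of "x - y"] linear_diff[OF lin, of x y] by (simp add: dist_norm)
  moreover have "R (R x) = x" for x
    using nn by (simp add: R_def inner_diff_left field_simps flip: scaleR_add_left)
  moreover have "R e = b"
  proof -
    have "e \<bullet> e = 1" "b \<bullet> b = 1" using assms by (simp_all add: norm_eq_sqrt_inner)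
    then have eq: "n \<bullet> n = 2 * (e \<bullet> n)" by (simp add: n_def inner_diff_left inner_diff_right inner_commute)
    have q: "2 * (e \<bullet> n) / (n \<bullet> n) = 1" using nn eq by (metis divide_self)
    have "R e = e - n" unfolding R_def q by simp
    then show ?thesis by (simp add: n_def)
  qed
  ultimately show ?thesis using that lin by blast
qed

text \<open>A shift by \<open>h\<close> changes the indicator of an interval only within distance
  \<open>h\<close> before each of its two end points. Slices of length zero contribute nothing, and
  the indicator on the right records this.\<close>

lemma nn_integral_shift_interval:
  fixes A :: "real set"
  assumes A: "A \<in> sets borel" "bounded A" "convex A" and h: "h > 0"
  shows "(\<integral>\<^sup>+ t. ennreal \<bar>indicator A (t + h) - indicator A t\<bar> \<partial>lborel)
      \<le> ennreal (2 * h) * indicator {A. emeasure lborel A > 0} A"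
proof (cases "emeasure lborel A > 0")
  case False
  then have A0: "emeasure lborel A = 0" by simp
  have "(\<integral>\<^sup>+ t. ennreal \<bar>indicator A (t + h) - indicator A t\<bar> \<partial>lborel)
      \<le> (\<integral>\<^sup>+ t. indicator A (h + 1 * t) + indicator A t \<partial>lborel)"
    by (intro nn_integral_mono) (auto simp: indicator_def add.commute)
  also have "\<dots> = (\<integral>\<^sup>+ t. indicator A (h + 1 * t) \<partial>lborel) + (\<integral>\<^sup>+ t. indicator A t \<partial>lborel)"
    using A by (intro nn_integral_add) auto
  also have "(\<integral>\<^sup>+ t. indicator A (h + 1 * t) \<partial>lborel) = (\<integral>\<^sup>+ t. indicator A t \<partial>lborel)"
    using nn_integral_real_affine[of "indicator A" 1 h] A by simp
  also have "(\<integral>\<^sup>+ t. indicator A t \<partial>lborel) = 0" using A A0 by simp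
  finally show ?thesis by simp
next
  case True
  then have ne: "A \<noteq> {}" by auto
  define a where "a = Inf A" define c where "c = Sup A"
  have bdd: "bdd_above A" "bdd_below A" using A bounded_imp_bdd_above bounded_imp_bdd_below by auto
  have int: "t \<in> A" if "x \<in> A" "y \<in> A" "x \<le> t" "t \<le> y" for x y t
    using A(3) that unfolding is_interval_convex_1[symmetric] is_interval_1 by blast
  have "ennreal \<bar>indicator A (t + h) - indicator A t\<bar> \<le> indicator {a - h..a} t + indicator {c - h..c} t" for t
  proof (cases "t + h \<in> A \<longleftrightarrow> t \<in> A")
    case False
    then consider "t + h \<in> A" "t \<notin> A" | "t \<in> A" "t + h \<notin> A" by blast
    then have "t \<in> {a - h..a} \<or> t \<in> {c - h..c}"
    proof cases
      case 1
      have "t \<le> x" if "x \<in> A" for x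
        using int[OF that 1(1), of t] 1(2) h by linarith
      then have "t \<le> a" unfolding a_def using ne by (intro cInf_greatest) auto
      moreover have "a \<le> t + h" unfolding a_def using 1 bdd by (intro cInf_lower)
      ultimately show ?thesis by simp
    next
      case 2
      have "x \<le> t + h" if "x \<in> A" for x
        using int[OF 2(1) that, of "t + h"] 2(2) h by linarith
      then have "c \<le> t + h" unfolding c_def using ne by (intro cSup_least) auto
      moreover have "t \<le> c" unfolding c_def using 2 bdd by (intro cSup_upper)
      ultimately show ?thesis by simp
    qed
    then have "(1::ennreal) \<le> indicator {a - h..a} t + indicator {c - h..c} t"
      by (auto simp: indicator_def)
    moreover have "ennreal \<bar>indicator A (t + h) - indicator A t\<bar> = 1" using False by (auto simp: indicator_def)
    ultimately show ?thesis by simp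
  qed (auto simp: indicator_def)
  then have "(\<integral>\<^sup>+ t. ennreal \<bar>indicator A (t + h) - indicator A t\<bar> \<partial>lborel)
      \<le> (\<integral>\<^sup>+ t. indicator {a - h..a} t + indicator {c - h..c} t \<partial>lborel)"
    by (intro nn_integral_mono) auto
  also have "\<dots> = ennreal h + ennreal h"
    using h by (subst nn_integral_add) auto
  also have "\<dots> = ennreal (2 * h)" using h by (simp flip: ennreal_plus)
  finally show ?thesis using True by simp
qed

text \<open>By Fubini along \<open>b\<close>, each line contributes at most \<open>2 * h\<close>,
  and only if it meets \<open>D\<close> in positive length. The set of these lines, seen in the
  remaining coordinates, has diameter at most \<open>d\<close>, so the isodiametric inequality in
  one dimension less bounds its measure.\<close>

lemma nn_integral_shift_convex_Basis:
  fixes D :: "'a::euclidean_space set"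
  assumes D: "compact D" "convex D" and diam: "\<And>x y. x \<in> D \<Longrightarrow> y \<in> D \<Longrightarrow> dist x y \<le> d" and d: "d > 0"
    and b: "b \<in> Basis" and h: "h > 0"
  shows "(\<integral>\<^sup>+ x. ennreal \<bar>indicator D (x + h *\<^sub>R b) - indicator D x\<bar> \<partial>lborel)
      \<le> ennreal (2 * h * (unit_ball_vol (real (DIM('a) - 1)) * (d / 2) ^ (DIM('a) - 1)))"
proof -
  interpret product_sigma_finite "\<lambda>_. lborel :: real measure" by standard
  define J where "J = Basis - {b}"
  define PJ where "PJ = Pi\<^sub>M J (\<lambda>_. lborel :: real measure)"
  have J: "finite J" "b \<notin> J" "insert b J = Basis" "card J = DIM('a) - 1" using b by (auto simp: J_def)
  define E where "E f = (\<Sum>i\<in>Basis. f i *\<^sub>R i)" for f :: "'a \<Rightarrow> real"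
  have DB: "D \<in> sets borel" using D by (intro borel_compact)
  have Em: "E \<in> measurable (Pi\<^sub>M Basis (\<lambda>_. lborel)) borel"
    unfolding E_def by measurable
  have Eupd: "E (f(b := t)) = E (f(b := 0)) + t *\<^sub>R b" for f t
  proof -
    have "E (f(b := t)) = t *\<^sub>R b + (\<Sum>i\<in>J. f i *\<^sub>R i)" for t
      unfolding E_def J(3)[symmetric] using J(1,2) by (simp add: sum.insert) (intro sum.cong, auto)
    from this[of t] this[of 0] show ?thesis by simp
  qed
  define A where "A f = {t. E (f(b := t)) \<in> D}" for f
  have "(\<lambda>(f, t). E (f(b := t))) \<in> measurable (PJ \<Otimes>\<^sub>M lborel) borel"
    using measurable_compose[OF measurable_add_dim[of b J "\<lambda>_. lborel"], of E] Em
    unfolding J(3) PJ_def by (simp add: split_def)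
  from measurable_sets[OF this, of D] DB
  have QB: "(\<lambda>(f, t). E (f(b := t))) -` D \<inter> space (PJ \<Otimes>\<^sub>M lborel) \<in> sets (PJ \<Otimes>\<^sub>M lborel)" by simp
  have secA: "Pair f -` ((\<lambda>(f, t). E (f(b := t))) -` D \<inter> space (PJ \<Otimes>\<^sub>M lborel)) = A f" if "f \<in> space PJ" for f
    using that by (auto simp: A_def space_pair_measure)
  have [measurable]: "(\<lambda>f. emeasure lborel (A f)) \<in> borel_measurable PJ"
    using lborel.measurable_emeasure_Pair[OF QB] by (rule measurable_cong[THEN iffD1, rotated]) (rule arg_cong[OF secA])
  \<comment> \<open>The shadow is taken with positive length in place of nonempty slices: this makes
    it measurable, and its points still come from points of \<open>D\<close>.\<close>
  define B where "B = {f \<in> space PJ. emeasure lborel (A f) > 0}"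
  have B: "B \<in> sets PJ" unfolding B_def by measurable
  have A_borel: "A f \<in> sets borel" for f
  proof -
    have "continuous_on UNIV (\<lambda>t. E (f(b := 0)) + t *\<^sub>R b)" by (intro continuous_intros)
    then have "(\<lambda>t. E (f(b := 0)) + t *\<^sub>R b) -` D \<inter> space borel \<in> sets borel"
      using DB by (intro measurable_sets[OF borel_measurable_continuous_onI]) auto
    then show ?thesis by (simp add: A_def vimage_def Eupd[symmetric])
  qed
  have A_convex: "convex (A f)" for f
  proof (rule convexI)
    fix x y u v :: real assume xy: "x \<in> A f" "y \<in> A f" "0 \<le> u" "0 \<le> v" "u + v = 1"
    have "u *\<^sub>R (E (f(b := 0)) + x *\<^sub>R b) + v *\<^sub>R (E (f(b := 0)) + y *\<^sub>R b) \<in> D"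
      using xy D(2) unfolding A_def mem_Collect_eq Eupd[of f x] Eupd[of f y] by (intro convexD) auto
    also have "u *\<^sub>R (E (f(b := 0)) + x *\<^sub>R b) + v *\<^sub>R (E (f(b := 0)) + y *\<^sub>R b)
        = (u + v) *\<^sub>R E (f(b := 0)) + (u *\<^sub>R x + v *\<^sub>R y) *\<^sub>R b" by (simp add: algebra_simps)
    finally show "u *\<^sub>R x + v *\<^sub>R y \<in> A f" using xy by (simp add: A_def Eupd[of f "u * x + v * y"])
  qed
  have nb: "norm b = 1" using b by simp
  have A_bounded: "bounded (A f)" for f
  proof -
    obtain M where M: "\<And>x. x \<in> D \<Longrightarrow> norm x \<le> M" using compact_imp_bounded[OF D(1)] by (auto simp: bounded_iff)
    have "norm t \<le> M + norm (E (f(b := 0)))" if "t \<in> A f" for t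
    proof -
      have "norm (E (f(b := 0)) + t *\<^sub>R b) \<le> M" using that M by (simp add: A_def Eupd[of f t])
      moreover have "norm (t *\<^sub>R b) \<le> norm (E (f(b := 0)) + t *\<^sub>R b) + norm (E (f(b := 0)))"
        by (metis add.commute add_diff_cancel_right' norm_triangle_ineq4)
      ultimately show ?thesis using nb by simp
    qed
    then show ?thesis by (auto simp: bounded_iff)
  qed
  have isod: "emeasure PJ B \<le> ennreal (unit_ball_vol (real (card J)) * (d / 2) ^ card J)"
    unfolding PJ_def
  proof (rule isodiametric_PiM[OF J(1) _ d])
    show "B \<in> sets (Pi\<^sub>M J (\<lambda>_. lborel))" using B by (simp add: PJ_def)
    fix f g assume fg: "f \<in> B" "g \<in> B"
    have "A f \<noteq> {}" "A g \<noteq> {}" using fg by (auto simp: B_def)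
    then obtain s t where "s \<in> A f" "t \<in> A g" by blast
    then have le: "dist (E (f(b := s))) (E (g(b := t))) \<le> d" by (intro diam) (auto simp: A_def)
    have comp: "E f' \<bullet> i = f' i" if "i \<in> Basis" for f' i
      unfolding E_def using that by (simp add: inner_sum_left inner_Basis if_distrib cong: if_cong)
    have dE: "(dist (E F) (E G))\<^sup>2 = (\<Sum>i\<in>Basis. (F i - G i)\<^sup>2)" for F G
    proof -
      have "(dist (E F) (E G))\<^sup>2 = (\<Sum>i\<in>Basis. (dist (E F \<bullet> i) (E G \<bullet> i))\<^sup>2)"
        by (subst euclidean_dist_l2) (unfold L2_set_def, intro real_sqrt_pow2 sum_nonneg, auto)
      also have "\<dots> = (\<Sum>i\<in>Basis. (F i - G i)\<^sup>2)"
        by (intro sum.cong refl) (simp add: comp dist_real_def)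
      finally show ?thesis .
    qed
    have "(\<Sum>i\<in>J. (f i - g i)\<^sup>2) = (\<Sum>i\<in>J. ((f(b := s)) i - (g(b := t)) i)\<^sup>2)"
      using J(2) by (intro sum.cong) auto
    also have "\<dots> \<le> (\<Sum>i\<in>Basis. ((f(b := s)) i - (g(b := t)) i)\<^sup>2)"
      by (intro sum_mono2) (auto simp: J_def)
    also have "\<dots> = (dist (E (f(b := s))) (E (g(b := t))))\<^sup>2"
      by (rule dE[symmetric])
    also have "\<dots> \<le> d\<^sup>2" using le by (intro power_mono) auto
    finally show "(\<Sum>i\<in>J. (f i - g i)\<^sup>2) \<le> d\<^sup>2" .
  qed
  have "(\<integral>\<^sup>+ x. ennreal \<bar>indicator D (x + h *\<^sub>R b) - indicator D x\<bar> \<partial>lborel)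
      = (\<integral>\<^sup>+ x. ennreal \<bar>indicator D (x + h *\<^sub>R b) - indicator D x\<bar> \<partial>distr (Pi\<^sub>M Basis (\<lambda>_. lborel)) borel E)"
    unfolding E_def using lborel_eq[where 'a='a] by simp
  also have "\<dots> = (\<integral>\<^sup>+ f. ennreal \<bar>indicator D (E f + h *\<^sub>R b) - indicator D (E f)\<bar> \<partial>Pi\<^sub>M (insert b J) (\<lambda>_. lborel))"
    unfolding J(3) using DB Em by (intro nn_integral_distr) auto
  also have "\<dots> = (\<integral>\<^sup>+ f. \<integral>\<^sup>+ t. ennreal \<bar>indicator D (E (f(b := t)) + h *\<^sub>R b) - indicator D (E (f(b := t)))\<bar> \<partial>lborel \<partial>PJ)"
    unfolding PJ_def using DB Em by (intro product_nn_integral_insert J) (auto simp: J(3))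
  also have "\<dots> \<le> (\<integral>\<^sup>+ f. ennreal (2 * h) * indicator B f \<partial>PJ)"
  proof (rule nn_integral_mono)
    fix f assume f: "f \<in> space PJ"
    have "indicator D (E (f(b := t))) = (indicator (A f) t :: real)" for t by (simp add: A_def indicator_def)
    moreover have "E (f(b := t)) + h *\<^sub>R b = E (f(b := t + h))" for t
      by (simp only: Eupd[of f t] Eupd[of f "t + h"] scaleR_add_left add.assoc)
    then have "indicator D (E (f(b := t)) + h *\<^sub>R b) = (indicator (A f) (t + h) :: real)" for t
      by (simp add: A_def indicator_def)
    ultimately have "(\<integral>\<^sup>+ t. ennreal \<bar>indicator D (E (f(b := t)) + h *\<^sub>R b) - indicator D (E (f(b := t)))\<bar> \<partial>lborel)
        = (\<integral>\<^sup>+ t. ennreal \<bar>indicator (A f) (t + h) - indicator (A f) t\<bar> \<partial>lborel)" by simp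
    also have "\<dots> \<le> ennreal (2 * h) * indicator {A. emeasure lborel A > 0} (A f)"
      by (rule nn_integral_shift_interval[OF A_borel A_bounded A_convex h])
    also have "\<dots> = ennreal (2 * h) * indicator B f" using f by (simp add: B_def indicator_def)
    finally show "(\<integral>\<^sup>+ t. ennreal \<bar>indicator D (E (f(b := t)) + h *\<^sub>R b) - indicator D (E (f(b := t)))\<bar> \<partial>lborel)
        \<le> ennreal (2 * h) * indicator B f" .
  qed
  also have "\<dots> = ennreal (2 * h) * emeasure PJ B"
    using B by (simp add: nn_integral_cmult)
  also have "\<dots> \<le> ennreal (2 * h) * ennreal (unit_ball_vol (real (card J)) * (d / 2) ^ card J)"
    by (intro mult_left_mono isod) auto
  also have "\<dots> = ennreal (2 * h * (unit_ball_vol (real (DIM('a) - 1)) * (d / 2) ^ (DIM('a) - 1)))"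
    using h by (simp add: ennreal_mult' J(4))
  finally show ?thesis .
qed

lemma nn_integral_shift_convex:
  fixes D :: "'a::euclidean_space set"
  assumes D: "compact D" "convex D" and diam: "\<And>x y. x \<in> D \<Longrightarrow> y \<in> D \<Longrightarrow> dist x y \<le> d" and d: "d > 0"
    and e: "norm e = 1" and h: "h > 0"
  shows "(\<integral>\<^sup>+ x. ennreal \<bar>indicator D (x + h *\<^sub>R e) - indicator D x\<bar> \<partial>lborel)
      \<le> ennreal (2 * h * (unit_ball_vol (real (DIM('a) - 1)) * (d / 2) ^ (DIM('a) - 1)))"
proof -
  obtain b :: 'a where b: "b \<in> Basis" using nonempty_Basis by blast
  obtain R where R: "linear R" "\<And>x y. dist (R x) (R y) = dist x y" "\<And>x. R (R x) = x" "R e = b"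
    using householder_reflection[OF e, of b] b by auto
  have cont: "continuous_on UNIV R"
    unfolding continuous_on_iff using R(2) by metis
  then have [measurable]: "R \<in> borel_measurable borel" by (rule borel_measurable_continuous_onI)
  let ?D = "R ` D"
  have RD: "compact ?D" "convex ?D"
    using D cont R(1) by (auto intro!: compact_continuous_image convex_linear_image intro: continuous_on_subset)
  then have [measurable]: "?D \<in> sets borel" by (auto intro: borel_compact)
  have mem: "R x \<in> ?D \<longleftrightarrow> x \<in> D" for x
    using R(3) by (metis imageE imageI)
  have "R (x + h *\<^sub>R e) = R x + h *\<^sub>R b" for x
    using R(1,4) by (simp add: linear_add linear_cmul)
  then have "indicator D x = (indicator ?D (R x) :: real)"
    "indicator D (x + h *\<^sub>R e) = (indicator ?D (R x + h *\<^sub>R b) :: real)" for x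
    using mem[of x] mem[of "x + h *\<^sub>R e"] by (auto simp: indicator_def)
  then have "(\<integral>\<^sup>+ x. ennreal \<bar>indicator D (x + h *\<^sub>R e) - indicator D x\<bar> \<partial>lborel)
      = (\<integral>\<^sup>+ x. ennreal \<bar>indicator ?D (R x + h *\<^sub>R b) - indicator ?D (R x)\<bar> \<partial>lborel)" by simp
  also have "\<dots> = (\<integral>\<^sup>+ x. ennreal \<bar>indicator ?D (x + h *\<^sub>R b) - indicator ?D x\<bar> \<partial>distr lborel borel R)"
    by (intro nn_integral_distr[symmetric]) auto
  also have "\<dots> = (\<integral>\<^sup>+ x. ennreal \<bar>indicator ?D (x + h *\<^sub>R b) - indicator ?D x\<bar> \<partial>lborel)"
    using lborel_distr_isometry[OF R(2,3)] by simp
  also have "\<dots> \<le> ennreal (2 * h * (unit_ball_vol (real (DIM('a) - 1)) * (d / 2) ^ (DIM('a) - 1)))"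
    by (rule nn_integral_shift_convex_Basis[OF RD _ d b h]) (use diam R(2) in auto)
  finally show ?thesis .
qed

section \<open>Cutoff functions with small directional variation\<close>

lemma integrable_mollifier_shift: "\<epsilon> > 0 \<Longrightarrow> integrable lborel (\<lambda>x. mollifier \<epsilon> (x - y))"
  using integrable_mollifier_reflect[of \<epsilon> y] by (simp only: mollifier_commute[of \<epsilon> y])

lemma integral_mollifier_shift: "\<epsilon> > 0 \<Longrightarrow> (LINT x|lborel. mollifier \<epsilon> (x - y)) = 1"
  using integral_mollifier_reflect[of \<epsilon> y] by (simp only: mollifier_commute[of \<epsilon> y])

lemma integral_abs_mollify_le:
  fixes f :: "'a::euclidean_space \<Rightarrow> real"
  assumes \<epsilon>: "\<epsilon> > 0" and f: "integrable lborel f"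
  shows "(\<integral>\<^sup>+ x. ennreal \<bar>mollify \<epsilon> f x\<bar> \<partial>lborel) \<le> (\<integral>\<^sup>+ x. ennreal \<bar>f x\<bar> \<partial>lborel)"
proof -
  have [measurable]: "f \<in> borel_measurable borel" using f by (auto dest: borel_measurable_integrable)
  have "(\<integral>\<^sup>+ x. ennreal \<bar>mollify \<epsilon> f x\<bar> \<partial>lborel) \<le> (\<integral>\<^sup>+ x. \<integral>\<^sup>+ y. ennreal (\<bar>f y\<bar> * mollifier \<epsilon> (x - y)) \<partial>lborel \<partial>lborel)"
  proof (rule nn_integral_mono)
    fix x
    have "ennreal (norm (mollify \<epsilon> f x)) \<le> (\<integral>\<^sup>+ y. ennreal (norm (f y * mollifier \<epsilon> (x - y))) \<partial>lborel)"
      unfolding mollify_def by (intro integral_norm_bound_ennreal integrable_mollify \<epsilon> f)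
    then show "ennreal \<bar>mollify \<epsilon> f x\<bar> \<le> (\<integral>\<^sup>+ y. ennreal (\<bar>f y\<bar> * mollifier \<epsilon> (x - y)) \<partial>lborel)"
      by (simp add: abs_mult mollifier_nonneg)
  qed
  also have "\<dots> = (\<integral>\<^sup>+ y. \<integral>\<^sup>+ x. ennreal (\<bar>f y\<bar> * mollifier \<epsilon> (x - y)) \<partial>lborel \<partial>lborel)"
    by (rule lborel_pair.Fubini') measurable
  also have "\<dots> = (\<integral>\<^sup>+ y. ennreal \<bar>f y\<bar> \<partial>lborel)"
  proof (rule nn_integral_cong)
    fix y :: 'a
    have "(\<integral>\<^sup>+ x. ennreal (mollifier \<epsilon> (x - y)) \<partial>lborel) = ennreal (LINT x|lborel. mollifier \<epsilon> (x - y))"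
      by (intro nn_integral_eq_integral integrable_mollifier_shift \<epsilon>) (auto simp: mollifier_nonneg)
    also have "(LINT x|lborel. mollifier \<epsilon> (x - y)) = 1"
      by (rule integral_mollifier_shift[OF \<epsilon>])
    finally have "(\<integral>\<^sup>+ x. ennreal (mollifier \<epsilon> (x - y)) \<partial>lborel) = 1" by simp
    then show "(\<integral>\<^sup>+ x. ennreal (\<bar>f y\<bar> * mollifier \<epsilon> (x - y)) \<partial>lborel) = ennreal \<bar>f y\<bar>"
      by (simp add: ennreal_mult' mollifier_nonneg nn_integral_cmult)
  qed
  finally show ?thesis .
qed

lemma mollify_translate:
  fixes f :: "'a::euclidean_space \<Rightarrow> real"
  assumes [measurable]: "f \<in> borel_measurable borel"
  shows "mollify \<epsilon> f (x + a) = mollify \<epsilon> (\<lambda>y. f (y + a)) x"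
  unfolding mollify_def
  using integral_lborel_translate[of "\<lambda>y. f y * mollifier \<epsilon> (x + a - y)" a] by (simp add: algebra_simps)

lemma mollify_diff:
  assumes "\<epsilon> > 0" "integrable lborel f" "integrable lborel g"
  shows "mollify \<epsilon> (\<lambda>y. f y - g y) x = mollify \<epsilon> f x - mollify \<epsilon> g x"
  unfolding mollify_def
  using Bochner_Integration.integral_diff[OF integrable_mollify[OF assms(1,2)] integrable_mollify[OF assms(1,3)]]
  by (simp add: left_diff_distrib)

text \<open>The closed convex hull of \<open>C\<close> has the diameter of \<open>C\<close>, and its
  closed \<open>2 * \<tau>\<close>-neighbourhood \<open>D\<close> is convex of diameter at most
  \<open>diameter C + 4 * \<tau>\<close>. Mollifying the indicator of \<open>D\<close> at scale
  \<open>\<tau>\<close> keeps the value 1 at distance less than \<open>\<tau>\<close> from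
  \<open>C\<close> and does not increase the L^1 norm of difference quotients, which the shift
  estimate for convex sets bounds.\<close>

lemma cutoff_convex_neighbourhood:
  fixes C :: "'a::euclidean_space set"
  assumes C: "bounded C" "C \<noteq> {}" and \<tau>: "\<tau> > 0" and e: "norm e = 1"
  obtains \<phi> d L where "C1_with_grad \<phi> d" "compact L" "\<And>x c. x \<in> L \<Longrightarrow> c \<in> C \<Longrightarrow> dist x c \<le> diameter C + 3 * \<tau>"
    "\<And>x. x \<notin> L \<Longrightarrow> \<phi> x = 0" "\<And>x. 0 \<le> \<phi> x" "\<And>x. \<phi> x \<le> 1"
    "\<And>x c. c \<in> C \<Longrightarrow> dist x c < \<tau> \<Longrightarrow> \<phi> x = 1"
    "(LINT x|lborel. \<bar>d x \<bullet> e\<bar>) \<le> 2 * (unit_ball_vol (real (DIM('a) - 1)) * ((diameter C + 4 * \<tau>) / 2) ^ (DIM('a) - 1))"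
proof -
  define H where "H = closure (convex hull C)"
  have bH: "bounded (convex hull C)" using C by (intro bounded_convex_hull)
  have H: "compact H" "convex H" "C \<subseteq> H"
    using bH closure_subset hull_subset[of C convex] by (auto simp: H_def compact_closure intro: convex_closure)
  \<comment> \<open>A closed ball containing \<open>C\<close> contains its closed convex hull. This
    is used twice: with centres in \<open>C\<close>, to move one point to the hull, and then with
    centre \<open>x\<close>.\<close>
  have dH: "dist x y \<le> diameter C" if "x \<in> H" "y \<in> H" for x y
  proof -
    have step: "H \<subseteq> cball w (diameter C)" if "C \<subseteq> cball w (diameter C)" for w
      unfolding H_def using that by (intro closure_minimal hull_minimal) auto
    have "C \<subseteq> cball c (diameter C)" if "c \<in> C" for c
      using diameter_bounded_bound[OF C(1) that] by auto
    then have "x \<in> cball c (diameter C)" if "c \<in> C" for c using step[of c] that \<open>x \<in> H\<close> by blast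
    then have "C \<subseteq> cball x (diameter C)" by (auto simp: dist_commute)
    from step[OF this] show ?thesis using \<open>y \<in> H\<close> by auto
  qed
  have d0: "diameter C \<ge> 0" using C by (intro diameter_ge_0)
  define D where "D = (\<Union>x\<in>H. cball x (2 * \<tau>))"
  have Dc: "compact D" unfolding D_def by (rule compact_minkowski_sum_cball[OF H(1)])
  have D_alt: "D = (\<Union>x\<in>H. \<Union>y\<in>cball 0 (2 * \<tau>). {x + y})"
  proof -
    have cb: "cball x (2 * \<tau>) = (\<Union>y\<in>cball 0 (2 * \<tau>). {x + y})" for x :: 'a
    proof (intro equalityI subsetI)
      fix z assume "z \<in> cball x (2 * \<tau>)"
      then have "z - x \<in> cball 0 (2 * \<tau>)" by (simp add: dist_norm norm_minus_commute)
      then show "z \<in> (\<Union>y\<in>cball 0 (2 * \<tau>). {x + y})" by force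
    qed (auto simp: dist_norm)
    show ?thesis unfolding D_def by (rule SUP_cong[OF refl cb])
  qed
  have Dconv: "convex D" unfolding D_alt by (intro convex_sums H convex_cball)
  have dD: "dist x y \<le> diameter C + 4 * \<tau>" if xy: "x \<in> D" "y \<in> D" for x y
  proof -
    obtain x' y' where "x' \<in> H" "dist x' x \<le> 2 * \<tau>" "y' \<in> H" "dist y' y \<le> 2 * \<tau>" using xy by (auto simp: D_def)
    then show ?thesis using dH[of x' y'] dist_triangle[of x y x'] dist_triangle[of x' y y'] by (simp add: dist_commute)
  qed
  have DB: "D \<in> sets borel" using Dc by (rule borel_compact)
  have bD: "bounded D" using Dc by (rule compact_imp_bounded)
  have int: "integrable lborel (indicator D :: 'a \<Rightarrow> real)"
    using DB bD by (intro integrable_real_indicator) (auto intro: emeasure_lborel_bounded)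
  define \<phi> where "\<phi> = mollify \<tau> (indicator D)"
  define d where "d = mollify_grad \<tau> (indicator D)"
  have C1: "C1_with_grad \<phi> d" unfolding \<phi>_def d_def by (rule C1_with_grad_mollify[OF \<tau> int])
  note m = mollify_indicator[OF \<tau> DB bD, folded \<phi>_def]
  define L where "L = (\<Union>x\<in>D. cball x \<tau>)"
  have L: "compact L" unfolding L_def by (rule compact_minkowski_sum_cball[OF Dc])
  have \<phi>0: "\<phi> x = 0" if "x \<notin> L" for x
    by (rule m(4)) (use that in \<open>force simp: L_def dist_commute\<close>)
  have LC: "dist x c \<le> diameter C + 3 * \<tau>" if x: "x \<in> L" and c: "c \<in> C" for x c
  proof -
    obtain x' x'' where "x' \<in> H" "dist x' x'' \<le> 2 * \<tau>" "dist x'' x \<le> \<tau>" using x by (auto simp: D_def L_def)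
    then show ?thesis using dH[of x' c] c H(3) dist_triangle[of x c x'] dist_triangle[of x x' x''] by (auto simp: dist_commute)
  qed
  have \<phi>1: "\<phi> x = 1" if c: "c \<in> C" "dist x c < \<tau>" for x c
  proof (rule m(3))
    show "ball x \<tau> \<subseteq> D"
    proof
      fix y assume "y \<in> ball x \<tau>"
      then have "dist c y \<le> 2 * \<tau>" using c dist_triangle[of c y x] by (simp add: dist_commute)
      then show "y \<in> D" using c H(3) by (auto simp: D_def)
    qed
  qed
  have var: "(LINT x|lborel. \<bar>d x \<bullet> e\<bar>) \<le> 2 * (unit_ball_vol (real (DIM('a) - 1)) * ((diameter C + 4 * \<tau>) / 2) ^ (DIM('a) - 1))"
    (is "_ \<le> ?V")
  proof (rule LIMSEQ_le_const2)
    let ?h = "\<lambda>n. inverse (real (Suc n))"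
    show "(\<lambda>n. LINT x|lborel. \<bar>(\<phi> (x + ?h n *\<^sub>R e) - \<phi> x) / ?h n\<bar>) \<longlonglongrightarrow> (LINT x|lborel. \<bar>d x \<bullet> e\<bar>)"
      by (rule C1_with_grad_quotient_integral[OF C1 L \<phi>0, where F=abs]) (auto intro!: continuous_intros)
    have "(LINT x|lborel. \<bar>(\<phi> (x + ?h n *\<^sub>R e) - \<phi> x) / ?h n\<bar>) \<le> ?V" for n
    proof -
      define h where "h = ?h n"
      have h: "h > 0" by (simp add: h_def)
      have m\<phi>[measurable]: "\<phi> \<in> borel_measurable borel" using C1_with_grad_measurable[OF C1] by simp
      define D' where "D' y = (indicator D (y + h *\<^sub>R e) :: real)" for y
      have int': "integrable lborel D'" unfolding D'_def by (rule integrable_lborel_translate[OF int])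
      have "\<phi> (x + h *\<^sub>R e) - \<phi> x = mollify \<tau> (\<lambda>y. D' y - indicator D y) x" for x
        unfolding \<phi>_def D'_def using DB int int'
        by (subst mollify_translate) (auto simp: mollify_diff[OF \<tau>] D'_def[abs_def])
      then have "(\<integral>\<^sup>+ x. ennreal \<bar>\<phi> (x + h *\<^sub>R e) - \<phi> x\<bar> \<partial>lborel)
          = (\<integral>\<^sup>+ x. ennreal \<bar>mollify \<tau> (\<lambda>y. D' y - indicator D y) x\<bar> \<partial>lborel)" by simp
      also have "\<dots> \<le> (\<integral>\<^sup>+ x. ennreal \<bar>D' x - indicator D x\<bar> \<partial>lborel)"
        by (rule integral_abs_mollify_le[OF \<tau>]) (use int int' in auto)
      also have "\<dots> \<le> ennreal (2 * h * (unit_ball_vol (real (DIM('a) - 1)) * ((diameter C + 4 * \<tau>) / 2) ^ (DIM('a) - 1)))"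
        unfolding D'_def by (rule nn_integral_shift_convex[OF Dc Dconv dD _ e h]) (use d0 \<tau> in auto)
      finally have le: "(\<integral>\<^sup>+ x. ennreal \<bar>\<phi> (x + h *\<^sub>R e) - \<phi> x\<bar> \<partial>lborel) \<le> ennreal (h * ?V)" by (simp add: mult_ac)
      have "(LINT x|lborel. \<bar>\<phi> (x + h *\<^sub>R e) - \<phi> x\<bar>) \<le> h * ?V"
        by (subst integral_eq_nn_integral) (use le h d0 \<tau> in \<open>auto intro!: enn2real_leI mult_nonneg_nonneg\<close>)
      then have "(LINT x|lborel. \<bar>\<phi> (x + h *\<^sub>R e) - \<phi> x\<bar>) / h \<le> ?V" using h by (simp add: field_simps)
      then show ?thesis using h unfolding h_def[symmetric] by (simp add: abs_divide)
    qed
    then show "\<exists>N. \<forall>n\<ge>N. (LINT x|lborel. \<bar>(\<phi> (x + ?h n *\<^sub>R e) - \<phi> x) / ?h n\<bar>) \<le> ?V" by blast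
  qed
  show thesis
    by (rule that[OF C1 L LC \<phi>0 m(1,2) \<phi>1 var])
qed

text \<open>A differentiable substitute for the maximum of the \<open>\<phi> i\<close>.\<close>

lemma C1_with_grad_probabilistic_sum:
  assumes "finite I" "\<And>i. i \<in> I \<Longrightarrow> C1_with_grad (\<phi> i) (d i)" "\<And>i x. i \<in> I \<Longrightarrow> 0 \<le> \<phi> i x" "\<And>i x. i \<in> I \<Longrightarrow> \<phi> i x \<le> 1"
  shows "\<exists>D. C1_with_grad (\<lambda>x. 1 - (\<Prod>i\<in>I. 1 - \<phi> i x)) D \<and> (\<forall>x. \<bar>D x \<bullet> e\<bar> \<le> (\<Sum>i\<in>I. \<bar>d i x \<bullet> e\<bar>))"
  using assms
proof (induction I rule: finite_induct)
  case empty
  then show ?case using C1_with_grad_const[of 0] by auto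
next
  case (insert j I)
  have "\<exists>D. C1_with_grad (\<lambda>x. 1 - (\<Prod>i\<in>I. 1 - \<phi> i x)) D \<and> (\<forall>x. \<bar>D x \<bullet> e\<bar> \<le> (\<Sum>i\<in>I. \<bar>d i x \<bullet> e\<bar>))"
    by (rule insert.IH) (use insert.prems in auto)
  then obtain D where D: "C1_with_grad (\<lambda>x. 1 - (\<Prod>i\<in>I. 1 - \<phi> i x)) D" "\<forall>x. \<bar>D x \<bullet> e\<bar> \<le> (\<Sum>i\<in>I. \<bar>d i x \<bullet> e\<bar>)"
    by (elim exE conjE)
  let ?p = "\<lambda>x. \<Prod>i\<in>I. 1 - \<phi> i x"
  have p: "0 \<le> ?p x" "?p x \<le> 1" for x
    using insert.prems by (auto intro!: prod_nonneg prod_le_1)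
  have j: "C1_with_grad (\<phi> j) (d j)" "0 \<le> \<phi> j x" "\<phi> j x \<le> 1" for x
    using insert.prems by auto
  let ?D = "\<lambda>x. 0 - ((1 - \<phi> j x) *\<^sub>R (0 - D x) + (1 - (1 - ?p x)) *\<^sub>R (0 - d j x))"
  have "C1_with_grad (\<lambda>x. 1 - (1 - \<phi> j x) * (1 - (1 - ?p x))) ?D"
    by (intro C1_with_grad_diff C1_with_grad_const C1_with_grad_mult D(1) j(1))
  moreover have "(\<lambda>x. 1 - (1 - \<phi> j x) * (1 - (1 - ?p x))) = (\<lambda>x. 1 - (\<Prod>i\<in>insert j I. 1 - \<phi> i x))"
    using insert.hyps by simp
  moreover have "\<bar>?D x \<bullet> e\<bar> \<le> (\<Sum>i\<in>insert j I. \<bar>d i x \<bullet> e\<bar>)" for x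
  proof -
    \<comment> \<open>Both coefficients in the product rule lie between 0 and 1, so the variations
      simply add up.\<close>
    have "\<bar>?D x \<bullet> e\<bar> = \<bar>(1 - \<phi> j x) * (D x \<bullet> e) + ?p x * (d j x \<bullet> e)\<bar>"
      by (simp add: inner_add_left inner_diff_left)
    also have "\<dots> \<le> (1 - \<phi> j x) * \<bar>D x \<bullet> e\<bar> + ?p x * \<bar>d j x \<bullet> e\<bar>"
      using j p by (intro order_trans[OF abs_triangle_ineq]) (simp add: abs_mult)
    also have "\<dots> \<le> 1 * \<bar>D x \<bullet> e\<bar> + 1 * \<bar>d j x \<bullet> e\<bar>"
      using j p by (intro add_mono mult_right_mono) auto
    also have "\<dots> \<le> (\<Sum>i\<in>insert j I. \<bar>d i x \<bullet> e\<bar>)" using D(2)[rule_format, of x] insert.hyps by simp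
    finally show ?thesis .
  qed
  ultimately show ?case by (intro exI[of _ ?D] conjI allI) simp_all
qed

lemma hausdorff_gauge_mono:
  assumes "A \<subseteq> B" "bounded B"
  shows "hausdorff_gauge k A \<le> hausdorff_gauge k B"
proof (cases "A = {}")
  case False
  then have "B \<noteq> {}" using assms by auto
  moreover have "diameter A \<le> diameter B" using assms by (rule diameter_subset)
  ultimately show ?thesis
    using False diameter_ge_0[of A] bounded_subset[OF assms(2,1)] unfolding hausdorff_gauge_def
    by (auto intro!: ennreal_leI mult_left_mono power_mono)
qed (simp add: hausdorff_gauge_def)

text \<open>Each member of an almost optimal cover of \<open>K\<close> gets a cutoff function of
  variation about twice its gauge, compactness leaves finitely many, and the smooth substitute for
  their maximum has at most the sum of the variations. The gauge and the isodiametric bound carry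
  the same constant, so nothing but the factor 2 appears.\<close>

lemma hausdorff_cutoff:
  fixes K U :: "'a::euclidean_space set"
  assumes K: "compact K" and U: "open U" "K \<subseteq> U" and e: "norm e = 1"
    and H: "hausdorff_outer (DIM('a) - 1) K \<le> ennreal h" "h \<ge> 0" and \<delta>: "\<delta> > 0"
  obtains \<phi> d L where "C1_with_grad \<phi> d" "compact L" "L \<subseteq> U" "\<And>x. x \<notin> L \<Longrightarrow> \<phi> x = 0"
    "\<And>x. 0 \<le> \<phi> x" "\<And>x. \<phi> x \<le> 1" "\<And>x. x \<in> K \<Longrightarrow> \<phi> x = 1" "(LINT x|lborel. \<bar>d x \<bullet> e\<bar>) \<le> 2 * (h + \<delta>)"
proof -
  define k where "k = DIM('a) - 1"
  define \<omega> where "\<omega> = unit_ball_vol (real k)"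
  have \<omega>: "\<omega> > 0" by (simp add: \<omega>_def)
  obtain \<eta> where \<eta>: "\<eta> > 0" "(\<Union>x\<in>K. cball x \<eta>) \<subseteq> U"
    using compact_subset_open_imp_cball_epsilon_subset[OF K U] by blast
  \<comment> \<open>The supports reach at most \<open>\<eta>/4 + 3 * \<eta>/8\<close> from points of
    \<open>K\<close>, which is within the margin \<open>\<eta>\<close>.\<close>
  have "hausdorff_pre k (\<eta>/4) K \<le> hausdorff_outer k K"
    unfolding hausdorff_outer_def using \<eta> by (intro SUP_upper) auto
  also have "\<dots> \<le> ennreal h" using H by (simp add: k_def)
  also have "\<dots> < ennreal (h + \<delta>/2)" using H \<delta> by (intro ennreal_lessI) auto
  finally obtain C where C: "C \<in> hausdorff_covers (\<eta>/4) K" "(\<Sum>i. hausdorff_gauge k (C i)) < ennreal (h + \<delta>/2)"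
    unfolding hausdorff_pre_def INF_less_iff by blast
  have Cb: "bounded (C i)" "diameter (C i) \<le> \<eta>/4" for i using C(1) by (auto simp: hausdorff_covers_def)
  \<comment> \<open>Intersecting with \<open>K\<close> ensures that every nonempty piece contains a
    point of \<open>K\<close>, from which the distance to its support is measured.\<close>
  define E where "E i = C i \<inter> K" for i
  have Eb: "bounded (E i)" "diameter (E i) \<le> \<eta>/4" for i
    using bounded_subset[OF Cb(1)] diameter_subset[of "E i" "C i"] Cb[of i] by (auto simp: E_def)
  have Ed: "diameter (E i) \<ge> 0" for i using Eb by (intro diameter_ge_0)
  \<comment> \<open>Besides having no point to measure from, an empty piece would be charged a
    positive amount by the formula for the gauge when \<open>k = 0\<close>.\<close>
  define N where "N = {i. E i \<noteq> {}}"
  have Kcov: "K \<subseteq> (\<Union>i\<in>N. E i)"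
  proof
    fix x assume "x \<in> K"
    then obtain i where "x \<in> C i" using C(1) by (auto simp: hausdorff_covers_def)
    with \<open>x \<in> K\<close> have "x \<in> E i" by (simp add: E_def)
    then show "x \<in> (\<Union>i\<in>N. E i)" unfolding N_def by blast
  qed
  \<comment> \<open>By continuity at \<tau> = 0 the enlargement of the i-th diameter costs less than
    a geometric share; the shares sum to at most \<open>\<delta>/2\<close>, and the near-optimality
    of the cover takes the other half of \<open>\<delta>\<close>.\<close>
  have "\<exists>\<tau>>0. \<tau> \<le> \<eta>/8 \<and> \<omega> * ((diameter (E i) + 4 * \<tau>) / 2) ^ k \<le> \<omega> * (diameter (E i) / 2) ^ k + \<delta>/2 * (1/2)^Suc i" for i
  proof -
    have "((\<lambda>\<tau>. \<omega> * ((diameter (E i) + 4 * \<tau>) / 2) ^ k) \<longlongrightarrow> \<omega> * ((diameter (E i) + 4 * 0) / 2) ^ k) (at_right 0)"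
      by (intro tendsto_intros) auto
    moreover have "\<omega> * ((diameter (E i) + 4 * 0) / 2) ^ k < \<omega> * (diameter (E i) / 2) ^ k + \<delta>/2 * (1/2)^Suc i" using \<delta> by simp
    ultimately have "eventually (\<lambda>\<tau>. \<omega> * ((diameter (E i) + 4 * \<tau>) / 2) ^ k < \<omega> * (diameter (E i) / 2) ^ k + \<delta>/2 * (1/2)^Suc i) (at_right 0)"
      by (rule order_tendstoD(2))
    moreover have "eventually (\<lambda>\<tau>. 0 < \<tau> \<and> \<tau> < \<eta>/8) (at_right (0::real))"
      using \<eta> by (intro eventually_at_rightI[of _ "\<eta>/8"]) auto
    ultimately have "eventually (\<lambda>\<tau>. 0 < \<tau> \<and> \<tau> \<le> \<eta>/8 \<and> \<omega> * ((diameter (E i) + 4 * \<tau>) / 2) ^ k \<le> \<omega> * (diameter (E i) / 2) ^ k + \<delta>/2 * (1/2)^Suc i) (at_right 0)"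
      by eventually_elim auto
    from eventually_happens'[OF _ this] show ?thesis by auto
  qed
  then obtain \<tau> where \<tau>: "\<And>i. \<tau> i > 0" "\<And>i. \<tau> i \<le> \<eta>/8"
    "\<And>i. \<omega> * ((diameter (E i) + 4 * \<tau> i) / 2) ^ k \<le> \<omega> * (diameter (E i) / 2) ^ k + \<delta>/2 * (1/2)^Suc i"
    by metis
  define Q where "Q i \<phi> d L \<longleftrightarrow> C1_with_grad \<phi> d \<and> compact L \<and> (\<forall>x c. x \<in> L \<longrightarrow> c \<in> E i \<longrightarrow> dist x c \<le> diameter (E i) + 3 * \<tau> i) \<and>
      (\<forall>x. x \<notin> L \<longrightarrow> \<phi> x = 0) \<and> (\<forall>x. 0 \<le> \<phi> x) \<and> (\<forall>x. \<phi> x \<le> 1) \<and> (\<forall>x c. c \<in> E i \<longrightarrow> dist x c < \<tau> i \<longrightarrow> \<phi> x = 1) \<and>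
      (LINT x|lborel. \<bar>d x \<bullet> e\<bar>) \<le> 2 * (\<omega> * ((diameter (E i) + 4 * \<tau> i) / 2) ^ k)" for i \<phi> d L
  have "\<exists>\<phi> d L. Q i \<phi> d L" if "i \<in> N" for i
  proof -
    have ne: "E i \<noteq> {}" using that by (simp add: N_def)
    show ?thesis
    proof (rule cutoff_convex_neighbourhood[OF Eb(1) ne \<tau>(1) e])
      fix \<phi> d L
      assume a: "C1_with_grad \<phi> d" "compact L" "\<And>x c. x \<in> L \<Longrightarrow> c \<in> E i \<Longrightarrow> dist x c \<le> diameter (E i) + 3 * \<tau> i"
        "\<And>x. x \<notin> L \<Longrightarrow> \<phi> x = 0" "\<And>x. 0 \<le> \<phi> x" "\<And>x. \<phi> x \<le> 1" "\<And>x c. c \<in> E i \<Longrightarrow> dist x c < \<tau> i \<Longrightarrow> \<phi> x = 1"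
        "(LINT x|lborel. \<bar>d x \<bullet> e\<bar>) \<le> 2 * (unit_ball_vol (real (DIM('a) - 1)) * ((diameter (E i) + 4 * \<tau> i) / 2) ^ (DIM('a) - 1))"
      have "Q i \<phi> d L"
        unfolding Q_def \<omega>_def k_def by (intro conjI allI impI) (fact a | rule a; assumption)+
      then show ?thesis by (intro exI)
    qed
  qed
  then obtain \<phi> d L where Q: "\<And>i. i \<in> N \<Longrightarrow> Q i (\<phi> i) (d i) (L i)"
    by metis
  note \<phi> = Q[unfolded Q_def]
  let ?O = "\<lambda>i. \<Union>c\<in>E i. ball c (\<tau> i)"
  have "K \<subseteq> (\<Union>i\<in>N. ?O i)"
  proof
    fix x assume "x \<in> K"
    then obtain i where "i \<in> N" "x \<in> E i" using Kcov by blast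
    then have "x \<in> ?O i" using \<tau>(1)[of i] by force
    then show "x \<in> (\<Union>i\<in>N. ?O i)" using \<open>i \<in> N\<close> by blast
  qed
  moreover have "open (?O i)" for i by auto
  ultimately obtain I where I: "I \<subseteq> N" "finite I" "K \<subseteq> (\<Union>i\<in>I. ?O i)"
    using compactE_image[OF K, of N ?O] by metis
  have \<phi>I: "i \<in> I \<Longrightarrow> i \<in> N" for i using I by blast
  obtain D where D: "C1_with_grad (\<lambda>x. 1 - (\<Prod>i\<in>I. 1 - \<phi> i x)) D" "\<And>x. \<bar>D x \<bullet> e\<bar> \<le> (\<Sum>i\<in>I. \<bar>d i x \<bullet> e\<bar>)"
    using C1_with_grad_probabilistic_sum[of I \<phi> d e] \<phi> \<phi>I I(2) by metis
  define \<psi> where "\<psi> x = 1 - (\<Prod>i\<in>I. 1 - \<phi> i x)" for x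
  define M where "M = (\<Union>i\<in>I. L i)"
  have intd: "integrable lborel (\<lambda>x. \<bar>d i x \<bullet> e\<bar>)" if "i \<in> I" for i
  proof (rule integrable_continuous_compact_support)
    have *: "C1_with_grad (\<phi> i) (d i)" "compact (L i)" "\<And>x. x \<notin> L i \<Longrightarrow> \<phi> i x = 0" using \<phi>[OF \<phi>I[OF that]] by auto
    show "continuous_on UNIV (\<lambda>x. \<bar>d i x \<bullet> e\<bar>)" by (intro continuous_intros C1_with_grad_continuous_grad[OF *(1)])
    show "compact (L i)" by fact
    show "\<bar>d i x \<bullet> e\<bar> = 0" if "x \<notin> L i" for x
      using C1_with_grad_zero_outside[OF *(1) compact_imp_closed[OF *(2)] *(3) that] by simp
  qed
  have out: "\<psi> x = 0" if "x \<notin> M" for x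
  proof -
    have "(\<Prod>i\<in>I. 1 - \<phi> i x) = (\<Prod>i\<in>I. 1)"
      using that \<phi>[OF \<phi>I] by (intro prod.cong) (auto simp: M_def)
    then show ?thesis by (simp add: \<psi>_def)
  qed
  have M: "compact M" unfolding M_def using I(2) \<phi>[OF \<phi>I] by (intro compact_UN) auto
  have C1: "C1_with_grad \<psi> D" using D(1) by (simp add: \<psi>_def[abs_def])
  have Mint: "integrable lborel (\<lambda>x. \<bar>D x \<bullet> e\<bar>)"
    by (rule integrable_continuous_compact_support[OF _ M])
       (auto intro!: continuous_intros C1_with_grad_continuous_grad[OF C1] simp: C1_with_grad_zero_outside[OF C1 compact_imp_closed[OF M] out])
  have "(\<Sum>i\<in>I. \<omega> * (diameter (E i) / 2) ^ k) \<le> h + \<delta>/2"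
  proof -
    have "ennreal (\<Sum>i\<in>I. \<omega> * (diameter (E i) / 2) ^ k) = (\<Sum>i\<in>I. hausdorff_gauge k (E i))"
      using \<phi>I \<omega> Ed by (subst sum_ennreal[symmetric]) (auto simp: hausdorff_gauge_def N_def \<omega>_def)
    also have "\<dots> \<le> (\<Sum>i\<in>I. hausdorff_gauge k (C i))"
      using Cb by (intro sum_mono hausdorff_gauge_mono) (auto simp: E_def)
    also have "\<dots> \<le> (\<Sum>i. hausdorff_gauge k (C i))" using I(2) by (intro sum_le_suminf) auto
    also have "\<dots> \<le> ennreal (h + \<delta>/2)" using C(2) by simp
    finally show ?thesis using H \<delta> by (subst (asm) ennreal_le_iff) auto
  qed
  moreover have "(\<Sum>i\<in>I. \<delta>/2 * (1/2)^Suc i) \<le> \<delta>/2"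
  proof -
    have s: "(\<lambda>i. (1/2::real)^Suc i) sums 1" by (rule power_half_series)
    have "(\<Sum>i\<in>I. (1/2::real)^Suc i) \<le> 1"
      using sum_le_suminf[OF sums_summable[OF s] I(2)] sums_unique[OF s] by simp
    then show ?thesis using \<delta> by (simp only: sum_distrib_left[symmetric]) (simp add: mult_left_le)
  qed
  moreover have "(LINT x|lborel. \<bar>D x \<bullet> e\<bar>) \<le> (\<Sum>i\<in>I. 2 * (\<omega> * (diameter (E i) / 2) ^ k + \<delta>/2 * (1/2)^Suc i))"
  proof -
    have "(LINT x|lborel. \<bar>D x \<bullet> e\<bar>) \<le> (LINT x|lborel. (\<Sum>i\<in>I. \<bar>d i x \<bullet> e\<bar>))"
      using Mint intd D(2) by (intro Bochner_Integration.integral_mono) auto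
    also have "\<dots> = (\<Sum>i\<in>I. LINT x|lborel. \<bar>d i x \<bullet> e\<bar>)" using intd by (intro Bochner_Integration.integral_sum)
    also have "\<dots> \<le> (\<Sum>i\<in>I. 2 * (\<omega> * (diameter (E i) / 2) ^ k + \<delta>/2 * (1/2)^Suc i))"
    proof (rule sum_mono)
      fix i assume "i \<in> I"
      then have "(LINT x|lborel. \<bar>d i x \<bullet> e\<bar>) \<le> 2 * (\<omega> * ((diameter (E i) + 4 * \<tau> i) / 2) ^ k)" using \<phi>[OF \<phi>I] by blast
      from order_trans[OF this mult_left_mono[OF \<tau>(3)[of i] zero_le_numeral]]
      show "(LINT x|lborel. \<bar>d i x \<bullet> e\<bar>) \<le> 2 * (\<omega> * (diameter (E i) / 2) ^ k + \<delta>/2 * (1/2)^Suc i)" .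
    qed
    finally show ?thesis .
  qed
  ultimately have var: "(LINT x|lborel. \<bar>D x \<bullet> e\<bar>) \<le> 2 * (h + \<delta>)"
    by (simp only: sum_distrib_left[symmetric] sum.distrib) (simp add: sum.distrib)
  show thesis
  proof (rule that[OF C1 M _ out _ _ _ var])
    show "M \<subseteq> U"
    proof
      fix x assume "x \<in> M"
      then obtain i where i: "i \<in> I" "x \<in> L i" by (auto simp: M_def)
      then obtain c where c: "c \<in> E i" using \<phi>I by (auto simp: N_def)
      have "dist x c \<le> diameter (E i) + 3 * \<tau> i" using \<phi>[OF \<phi>I[OF i(1)]] i(2) c by blast
      also have "\<dots> \<le> \<eta>" using Eb(2)[of i] \<tau>(2)[of i] \<eta>(1) by simp
      finally have "x \<in> cball c \<eta>" by (simp add: dist_commute)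
      moreover have "c \<in> K" using c by (simp add: E_def)
      ultimately show "x \<in> U" using \<eta>(2) by blast
    qed
    have b: "0 \<le> 1 - \<phi> i x" "1 - \<phi> i x \<le> 1" if "i \<in> I" for i x using \<phi>[OF \<phi>I[OF that]] by auto
    show "0 \<le> \<psi> x" for x using b by (auto simp: \<psi>_def intro!: prod_le_1)
    show "\<psi> x \<le> 1" for x using b by (auto simp: \<psi>_def intro!: prod_nonneg)
    show "\<psi> x = 1" if "x \<in> K" for x
    proof -
      obtain i c where i: "i \<in> I" "c \<in> E i" "dist c x < \<tau> i" using I(3) \<open>x \<in> K\<close> by auto
      then have "\<phi> i x = 1" using \<phi>[OF \<phi>I[OF i(1)]] by (metis dist_commute)
      then have "(\<Prod>i\<in>I. 1 - \<phi> i x) = 0" using I(2) i(1) by (intro prod_zero) auto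
      then show ?thesis by (simp add: \<psi>_def)
    qed
  qed
qed

section \<open>Determination by test functions\<close>

lemma set_integrable_of_integrable:
  fixes f :: "'a \<Rightarrow> 'b::{banach, second_countable_topology}"
  shows "integrable M f \<Longrightarrow> A \<in> sets M \<Longrightarrow> set_integrable M A f"
  unfolding set_integrable_def by (rule integrable_mult_indicator)

text \<open>Cutoff functions of \<open>K\<close> supported in shrinking neighbourhoods converge
  pointwise to its indicator. Two measures with densities are allowed, so that a polar decomposition
  can be compared with a Lebesgue density.\<close>

lemma set_integral_compact_eq_of_test_functions:
  fixes f1 f2 :: "'a::euclidean_space \<Rightarrow> real"
  assumes \<Omega>: "open \<Omega>" and M: "sets M1 = sets borel" "sets M2 = sets borel"
    and f: "integrable M1 f1" "integrable M2 f2"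
    and test: "\<And>\<phi>. \<phi> \<in> C1_compact_support \<Omega> \<Longrightarrow> (LINT x|M1. \<phi> x * f1 x) = (LINT x|M2. \<phi> x * f2 x)"
    and K: "compact K" "K \<subseteq> \<Omega>"
  shows "(LINT x:K|M1. f1 x) = (LINT x:K|M2. f2 x)"
proof -
  define U where "U n = (\<Union>x\<in>K. ball x (inverse (real (Suc n)))) \<inter> \<Omega>" for n
  have "\<exists>\<phi>. \<phi> \<in> C1_compact_support \<Omega> \<and> \<phi> \<in> borel_measurable borel \<and>
      (\<forall>x. 0 \<le> \<phi> x \<and> \<phi> x \<le> 1) \<and> (\<forall>x\<in>K. \<phi> x = 1) \<and> (\<forall>x. x \<notin> U n \<longrightarrow> \<phi> x = 0)" for n
  proof -
    have U: "open (U n)" "K \<subseteq> U n"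
    proof -
      show "open (U n)" unfolding U_def using \<Omega> by (intro open_Int open_UN) auto
      have "x \<in> ball x (inverse (real (Suc n)))" for x :: 'a by simp
      then show "K \<subseteq> U n" unfolding U_def using K(2) by blast
    qed
    show ?thesis
    proof (rule cutoff_exists[OF K(1) U])
      fix \<phi> d L assume a: "C1_with_grad \<phi> d" "compact L" "L \<subseteq> U n" "\<And>x. x \<notin> L \<Longrightarrow> \<phi> x = 0"
        "\<And>x. 0 \<le> \<phi> x" "\<And>x. \<phi> x \<le> 1" "\<And>x. x \<in> K \<Longrightarrow> \<phi> x = 1"
      have "\<phi> \<in> C1_compact_support \<Omega>"
        by (rule C1_compact_supportI[OF a(1,2) _ a(4)]) (use a(3) in \<open>auto simp: U_def\<close>)
      moreover have "\<phi> x = 0" if "x \<notin> U n" for x using a(3,4) that by blast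
      ultimately show ?thesis using a C1_with_grad_measurable(1)[OF a(1)] by (intro exI[of _ \<phi>]) auto
    qed
  qed
  then obtain \<phi> where \<phi>: "\<And>n. \<phi> n \<in> C1_compact_support \<Omega>" "\<And>n. \<phi> n \<in> borel_measurable borel"
      "\<And>n x. 0 \<le> \<phi> n x" "\<And>n x. \<phi> n x \<le> 1" "\<And>n x. x \<in> K \<Longrightarrow> \<phi> n x = 1" "\<And>n x. x \<notin> U n \<Longrightarrow> \<phi> n x = 0"
    by metis
  have lim: "(\<lambda>n. \<phi> n x) \<longlonglongrightarrow> indicator K x" for x
  proof (cases "x \<in> K")
    case False
    have "\<exists>N. \<forall>n\<ge>N. x \<notin> U n"
    proof -
      have "open (- K)" "x \<in> - K" using K(1) False by (auto simp: compact_imp_closed open_Compl)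
      then obtain r where r: "r > 0" "ball x r \<subseteq> - K" using open_contains_ball by blast
      obtain N where N: "inverse (real (Suc N)) < r" using reals_Archimedean[OF r(1)] by auto
      have "x \<notin> U n" if "n \<ge> N" for n
      proof
        assume "x \<in> U n"
        then obtain k where k: "k \<in> K" "dist k x < inverse (real (Suc n))" by (auto simp: U_def)
        have "inverse (real (Suc n)) \<le> inverse (real (Suc N))" using that by (intro le_imp_inverse_le) auto
        then have "dist k x < r" using k N by linarith
        then show False using r k by (auto simp: dist_commute subset_iff)
      qed
      then show ?thesis by blast
    qed
    then have "eventually (\<lambda>n. \<phi> n x = 0) sequentially"
      using \<phi>(6) by (auto simp: eventually_sequentially)
    then show ?thesis using False by (simp add: tendsto_eventually)
  qed (simp add: \<phi>(5))
  have conv: "(\<lambda>n. LINT x|M. \<phi> n x * f x) \<longlonglongrightarrow> (LINT x:K|M. f x)"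
    if MM: "sets M = sets borel" and ff: "integrable M f" for M and f :: "'a \<Rightarrow> real"
    unfolding set_lebesgue_integral_def real_scaleR_def
  proof (rule integral_dominated_convergence[where w="\<lambda>x. \<bar>f x\<bar>"])
    have [measurable]: "f \<in> borel_measurable M" using ff by auto
    have [measurable]: "\<phi> n \<in> borel_measurable M" for n using \<phi>(2) MM by (simp cong: measurable_cong_sets)
    have [measurable]: "K \<in> sets M" using K MM by (simp add: borel_compact)
    show "(\<lambda>x. indicator K x * f x) \<in> borel_measurable M" by measurable
    show "(\<lambda>x. \<phi> n x * f x) \<in> borel_measurable M" for n by measurable
    show "integrable M (\<lambda>x. \<bar>f x\<bar>)" using ff by auto
    show "AE x in M. (\<lambda>n. \<phi> n x * f x) \<longlonglongrightarrow> indicator K x * f x"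
      by (intro AE_I2 tendsto_mult lim tendsto_const)
    show "AE x in M. norm (\<phi> n x * f x) \<le> \<bar>f x\<bar>" for n
      using \<phi>(3,4) by (intro AE_I2) (simp add: abs_mult mult_left_le_one_le)
  qed
  show ?thesis
    using conv[OF M(1) f(1)] conv[OF M(2) f(2)] test[OF \<phi>(1)] by (simp add: LIMSEQ_unique)
qed

text \<open>An exhaustion of \<Omega> by compact sets extends the equality to relatively closed
  sets; closed sets are stable under intersection and generate the Borel sets, so Dynkin's theorem
  does the rest.\<close>

lemma set_integral_eq_of_test_functions:
  fixes f1 f2 :: "'a::euclidean_space \<Rightarrow> real"
  assumes \<Omega>: "open \<Omega>" and M: "sets M1 = sets borel" "sets M2 = sets borel"
    and f: "integrable M1 f1" "integrable M2 f2"
    and test: "\<And>\<phi>. \<phi> \<in> C1_compact_support \<Omega> \<Longrightarrow> (LINT x|M1. \<phi> x * f1 x) = (LINT x|M2. \<phi> x * f2 x)"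
    and A: "A \<in> sets borel" "A \<subseteq> \<Omega>"
  shows "(LINT x:A|M1. f1 x) = (LINT x:A|M2. f2 x)"
proof -
  obtain C where C: "\<And>n::nat. compact (C n)" "\<And>n. C n \<subseteq> \<Omega>" "\<And>K. compact K \<Longrightarrow> K \<subseteq> \<Omega> \<Longrightarrow> \<exists>N. \<forall>n\<ge>N. K \<subseteq> C n"
    using open_Union_compact_subsets[OF \<Omega>] by metis
  \<comment> \<open>The sets are intersected with \<Omega> inside the claim, which makes it stable
    under complements in the whole space.\<close>
  let ?P = "\<lambda>A. (LINT x:A \<inter> \<Omega>|M1. f1 x) = (LINT x:A \<inter> \<Omega>|M2. f2 x)"
  have closed: "?P A" if A: "closed A" for A
  proof -
    have conv: "(\<lambda>n. LINT x:A \<inter> C n|M. f x) \<longlonglongrightarrow> (LINT x:A \<inter> \<Omega>|M. f x)"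
      if MM: "sets M = sets borel" and ff: "integrable M f" for M and f :: "'a \<Rightarrow> real"
      unfolding set_lebesgue_integral_def real_scaleR_def
    proof (rule integral_dominated_convergence[where w="\<lambda>x. \<bar>f x\<bar>"])
      have [measurable]: "f \<in> borel_measurable M" using ff by auto
      have "A \<in> sets M" "C n \<in> sets M" "\<Omega> \<in> sets M" for n
        unfolding MM by (rule borel_closed[OF A], rule borel_compact[OF C(1)], rule borel_open[OF \<Omega>])
      then have [measurable]: "A \<inter> C n \<in> sets M" "A \<inter> \<Omega> \<in> sets M" for n
        by (auto simp del: MM)
      show "(\<lambda>x. indicator (A \<inter> \<Omega>) x * f x) \<in> borel_measurable M" by measurable
      show "(\<lambda>x. indicator (A \<inter> C n) x * f x) \<in> borel_measurable M" for n by measurable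
      show "integrable M (\<lambda>x. \<bar>f x\<bar>)" using ff by auto
      show "AE x in M. (\<lambda>n. indicator (A \<inter> C n) x * f x) \<longlonglongrightarrow> indicator (A \<inter> \<Omega>) x * f x"
      proof (intro AE_I2 tendsto_mult tendsto_const)
        fix x
        have "eventually (\<lambda>n. indicator (A \<inter> C n) x = (indicator (A \<inter> \<Omega>) x :: real)) sequentially"
        proof (cases "x \<in> \<Omega>")
          case True
          then obtain N where "\<forall>n\<ge>N. {x} \<subseteq> C n" using C(3)[of "{x}"] by auto
          then have "indicator (A \<inter> C n) x = (indicator (A \<inter> \<Omega>) x :: real)" if "n \<ge> N" for n
            using True that by (auto simp: indicator_def)
          then show ?thesis by (auto simp: eventually_sequentially)
        next
          case False
          then have "x \<notin> C n" for n using C(2) by blast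
          then show ?thesis using False by (simp add: indicator_def)
        qed
        then show "(\<lambda>n. indicator (A \<inter> C n) x :: real) \<longlonglongrightarrow> indicator (A \<inter> \<Omega>) x" by (rule tendsto_eventually)
      qed
      show "AE x in M. norm (indicator (A \<inter> C n) x * f x) \<le> \<bar>f x\<bar>" for n
        by (intro AE_I2) (simp add: indicator_def)
    qed
    have "(LINT x:A \<inter> C n|M1. f1 x) = (LINT x:A \<inter> C n|M2. f2 x)" for n
      using C(2)[of n] A by (intro set_integral_compact_eq_of_test_functions[OF \<Omega> M f test] closed_Int_compact C(1)) auto
    then show ?thesis using conv[OF M(1) f(1)] conv[OF M(2) f(2)] by (simp add: LIMSEQ_unique)
  qed
  have \<Omega>B: "\<Omega> \<in> sets borel" using \<Omega> by simp
  have "Int_stable (Collect closed :: 'a set set)" "(Collect closed :: 'a set set) \<subseteq> Pow UNIV" "A \<in> sigma_sets UNIV (Collect closed)"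
    using A(1) unfolding borel_eq_closed by (auto simp: Int_stable_def)
  then have "?P A"
  proof (induction rule: sigma_sets_induct_disjoint)
    case (basic A) then show ?case by (simp add: closed)
  next
    case empty show ?case by (simp add: set_lebesgue_integral_def)
  next
    case (compl A)
    have AB: "A \<in> sets borel" using compl(1) unfolding borel_eq_closed by simp
    have "(LINT x:(UNIV - A) \<inter> \<Omega>|M. f x) = (LINT x:UNIV \<inter> \<Omega>|M. f x) - (LINT x:A \<inter> \<Omega>|M. f x)"
      if "sets M = sets borel" "integrable M f" for M and f :: "'a \<Rightarrow> real"
    proof -
      have "(LINT x:UNIV \<inter> \<Omega>|M. f x) = (LINT x:((UNIV - A) \<inter> \<Omega>) \<union> (A \<inter> \<Omega>)|M. f x)"
        by (rule arg_cong[where f="\<lambda>S. LINT x:S|M. f x"]) auto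
      also have "\<dots> = (LINT x:(UNIV - A) \<inter> \<Omega>|M. f x) + (LINT x:A \<inter> \<Omega>|M. f x)"
        using that AB \<Omega>B by (intro set_integral_Un set_integrable_of_integrable) auto
      finally show ?thesis by simp
    qed
    from this[OF M(1) f(1)] this[OF M(2) f(2)] show ?case using compl(2) closed[of UNIV] by simp
  next
    case (union A)
    have AB: "A i \<in> sets borel" for i using union(2) unfolding borel_eq_closed by auto
    have "(LINT x:(\<Union>i. A i) \<inter> \<Omega>|M. f x) = (\<Sum>i. (LINT x:A i \<inter> \<Omega>|M. f x))"
      if "sets M = sets borel" "integrable M f" for M and f :: "'a \<Rightarrow> real"
    proof -
      have "(LINT x:(\<Union>i. A i \<inter> \<Omega>)|M. f x) = (\<Sum>i. (LINT x:A i \<inter> \<Omega>|M. f x))"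
      proof (rule lebesgue_integral_countable_add)
        show "A i \<inter> \<Omega> \<in> sets M" for i using that AB \<Omega>B by auto
        show "(A i \<inter> \<Omega>) \<inter> (A j \<inter> \<Omega>) = {}" if "i \<noteq> j" for i j using union(1) that by (auto simp: disjoint_family_on_def)
        show "set_integrable M (\<Union>i. A i \<inter> \<Omega>) f"
          using that AB \<Omega>B by (intro set_integrable_of_integrable) auto
      qed
      then show ?thesis by (simp only: Int_UN_distrib2[symmetric] UN_simps)
    qed
    from this[OF M(1) f(1)] this[OF M(2) f(2)] show ?case using union(3) by simp
  qed
  then show ?thesis using A(2) by (simp add: Int_absorb2)
qed

lemma AE_eq_0_of_set_integrals:
  fixes f :: "'a \<Rightarrow> real"
  assumes f: "integrable M f" and z: "\<And>A. A \<in> sets M \<Longrightarrow> A \<subseteq> S \<Longrightarrow> (LINT x:A|M. f x) = 0" and S: "S \<in> sets M"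
  shows "AE x in M. x \<in> S \<longrightarrow> f x = 0"
proof -
  have [measurable]: "f \<in> borel_measurable M" "S \<in> sets M" using f S by auto
  have *: "AE x in M. indicator {x\<in>space M. x \<in> S \<and> g x > 0} x * g x = 0" if g: "integrable M g" "\<And>A. A \<in> sets M \<Longrightarrow> A \<subseteq> S \<Longrightarrow> (LINT x:A|M. g x) = 0" for g :: "'a \<Rightarrow> real"
  proof -
    have [measurable]: "g \<in> borel_measurable M" using g by auto
    let ?A = "{x\<in>space M. x \<in> S \<and> g x > 0}"
    have A: "?A \<in> sets M" by measurable
    have "(LINT x|M. indicator ?A x * g x) = 0" using g(2)[OF A] by (auto simp: set_lebesgue_integral_def)
    moreover have "integrable M (\<lambda>x. indicator ?A x * g x)" using integrable_mult_indicator[OF A g(1)] by simp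
    ultimately show ?thesis
      by (subst (asm) integral_nonneg_eq_0_iff_AE) (auto simp: indicator_def)
  qed
  have "AE x in M. indicator {x\<in>space M. x \<in> S \<and> f x > 0} x * f x = 0" by (rule *[OF f z])
  moreover have "AE x in M. indicator {x\<in>space M. x \<in> S \<and> - f x > 0} x * (- f x) = 0"
    by (rule *) (use f z in \<open>auto simp: set_lebesgue_integral_def\<close>)
  moreover have "AE x in M. x \<in> space M" by simp
  ultimately show ?thesis
    by eventually_elim (auto simp: indicator_def split: if_splits)
qed

lemma AE_eq_of_test_functions:
  fixes f1 f2 :: "'a::euclidean_space \<Rightarrow> real"
  assumes \<Omega>: "open \<Omega>" and f: "integrable lborel f1" "integrable lborel f2"
    and test: "\<And>\<phi>. \<phi> \<in> C1_compact_support \<Omega> \<Longrightarrow> (LINT x|lborel. \<phi> x * f1 x) = (LINT x|lborel. \<phi> x * f2 x)"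
  shows "AE x in lborel. x \<in> \<Omega> \<longrightarrow> f1 x = f2 x"
proof -
  have "AE x in lborel. x \<in> \<Omega> \<longrightarrow> f1 x - f2 x = 0"
  proof (rule AE_eq_0_of_set_integrals)
    show "integrable lborel (\<lambda>x. f1 x - f2 x)" using f by auto
    fix A assume A: "A \<in> sets lborel" "A \<subseteq> \<Omega>"
    have "(LINT x:A|lborel. f1 x) = (LINT x:A|lborel. f2 x)"
      by (rule set_integral_eq_of_test_functions[OF \<Omega> _ _ f test]) (use A in auto)
    moreover have "set_integrable lborel A f1" "set_integrable lborel A f2"
      using A f by (auto intro!: set_integrable_of_integrable)
    ultimately show "(LINT x:A|lborel. f1 x - f2 x) = 0"
      by (simp add: set_integral_diff)
  qed (use \<Omega> in simp)
  then show ?thesis by simp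
qed

section \<open>Approximate limits\<close>

lemma approx_limit_lborel:
  fixes f :: "'a::euclidean_space \<Rightarrow> real"
  assumes [measurable]: "f \<in> borel_measurable borel"
  shows "approx_limit f x a \<longleftrightarrow> ((\<lambda>r. (LINT y:ball x r|lborel. \<bar>f y - a\<bar>) / r ^ DIM('a)) \<longlongrightarrow> 0) (at_right 0)"
proof -
  have "integral\<^sup>L lebesgue (\<lambda>y. indicator (ball x r) y *\<^sub>R \<bar>f y - a\<bar>) = integral\<^sup>L lborel (\<lambda>y. indicator (ball x r) y *\<^sub>R \<bar>f y - a\<bar>)" for r
    using assms by (intro integral_completion borel_measurable_scaleR borel_measurable_indicator borel_measurable_abs borel_measurable_diff) simp_all
  then show ?thesis unfolding approx_limit_def set_lebesgue_integral_def by simp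
qed

text \<open>The kernel is at most a constant over \<open>\<epsilon> ^ DIM('a)\<close> and lives on a
  ball of radius \<open>\<epsilon>\<close>; for all \<open>x\<close> within
  \<open>c * \<epsilon>\<close> of \<open>y\<close> that ball lies in the ball of radius
  \<open>(c + 1) * \<epsilon>\<close> about \<open>y\<close>. The uniformity in \<open>x\<close> is
  needed when the result is averaged again (c = 1) or evaluated at shifted points.\<close>

lemma mollify_approx_limit:
  fixes f :: "'a::euclidean_space \<Rightarrow> real"
  assumes f: "integrable lborel f" and lim: "approx_limit f y a" and c: "c \<ge> 0" and \<delta>: "\<delta> > 0"
  shows "eventually (\<lambda>\<epsilon>. \<forall>x. dist x y \<le> c * \<epsilon> \<longrightarrow> \<bar>mollify \<epsilon> f x - a\<bar> < \<delta>) (at_right 0)"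
proof -
  have [measurable]: "f \<in> borel_measurable borel" using f by (auto dest: borel_measurable_integrable)
  let ?Q = "\<lambda>r. (LINT t:ball y r|lborel. \<bar>f t - a\<bar>) / r ^ DIM('a)"
  let ?B = "mollifier_const TYPE('a)"
  have "(?Q \<longlongrightarrow> 0) (at_right 0)" using lim by (simp add: approx_limit_lborel)
  moreover have "filterlim (\<lambda>\<epsilon>. (c + 1) * \<epsilon>) (at_right 0) (at_right 0)"
    unfolding filterlim_at
  proof (intro conjI)
    have "((\<lambda>\<epsilon>. (c + 1) * \<epsilon>) \<longlongrightarrow> (c + 1) * 0) (at_right 0)" by (intro tendsto_intros)
    then show "((\<lambda>\<epsilon>. (c + 1) * \<epsilon>) \<longlongrightarrow> 0) (at_right 0)" by simp
    show "\<forall>\<^sub>F \<epsilon> in at_right 0. (c + 1) * \<epsilon> \<in> {0<..} \<and> (c + 1) * \<epsilon> \<noteq> 0"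
      using c by (intro eventually_at_rightI[of _ 1]) auto
  qed
  ultimately have "((\<lambda>\<epsilon>. ?Q ((c + 1) * \<epsilon>)) \<longlongrightarrow> 0) (at_right 0)" by (rule filterlim_compose)
  then have "((\<lambda>\<epsilon>. ?B * (c + 1) ^ DIM('a) * ?Q ((c + 1) * \<epsilon>)) \<longlongrightarrow> ?B * (c + 1) ^ DIM('a) * 0) (at_right 0)"
    by (intro tendsto_mult tendsto_const)
  then have "eventually (\<lambda>\<epsilon>. ?B * (c + 1) ^ DIM('a) * ?Q ((c + 1) * \<epsilon>) < \<delta>) (at_right 0)"
    using \<delta> by (intro order_tendstoD(2)) auto
  moreover have "eventually (\<lambda>\<epsilon>. 0 < \<epsilon>) (at_right (0::real))" by (simp add: eventually_at_right_less)
  ultimately show ?thesis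
  proof eventually_elim
    case (elim \<epsilon>)
    show ?case
    proof (intro allI impI)
      fix x assume x: "dist x y \<le> c * \<epsilon>"
      let ?r = "(c + 1) * \<epsilon>"
      have ind: "integrable lborel (\<lambda>t. indicator (ball y ?r) t * (f t - a))"
      proof -
        have "integrable lborel (\<lambda>t. indicator (ball y ?r) t *\<^sub>R f t)" using f by (intro integrable_mult_indicator) auto
        moreover have "integrable lborel (\<lambda>t. indicator (ball y ?r) t * a)"
          by (intro integrable_mult_left integrable_real_indicator) (auto intro: emeasure_lborel_bounded)
        ultimately show ?thesis by (simp add: right_diff_distrib)
      qed
      have "mollify \<epsilon> f x - a = (LINT t|lborel. f t * mollifier \<epsilon> (x - t)) - (LINT t|lborel. a * mollifier \<epsilon> (x - t))"
        using integral_mollifier_reflect[OF elim(2), of x] by (simp add: mollify_def)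
      also have "\<dots> = (LINT t|lborel. f t * mollifier \<epsilon> (x - t) - a * mollifier \<epsilon> (x - t))"
        using elim(2) f by (intro Bochner_Integration.integral_diff[symmetric] integrable_mollify integrable_mult_right integrable_mollifier_reflect) auto
      also have "norm \<dots> \<le> (LINT t|lborel. ?B / \<epsilon> ^ DIM('a) * \<bar>indicator (ball y ?r) t * (f t - a)\<bar>)"
      proof (rule Bochner_Integration.integral_norm_bound_integral)
        show "integrable lborel (\<lambda>t. f t * mollifier \<epsilon> (x - t) - a * mollifier \<epsilon> (x - t))"
          using elim(2) f by (intro Bochner_Integration.integrable_diff integrable_mollify integrable_mult_right integrable_mollifier_reflect) auto
        show "integrable lborel (\<lambda>t. ?B / \<epsilon> ^ DIM('a) * \<bar>indicator (ball y ?r) t * (f t - a)\<bar>)"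
          by (intro integrable_mult_right integrable_abs ind)
        fix t
        have eq: "f t * mollifier \<epsilon> (x - t) - a * mollifier \<epsilon> (x - t) = (f t - a) * mollifier \<epsilon> (x - t)" by (simp add: algebra_simps)
        show "norm (f t * mollifier \<epsilon> (x - t) - a * mollifier \<epsilon> (x - t)) \<le> ?B / \<epsilon> ^ DIM('a) * \<bar>indicator (ball y ?r) t * (f t - a)\<bar>"
        proof (cases "t \<in> ball y ?r")
          case True
          have "\<bar>f t - a\<bar> * mollifier \<epsilon> (x - t) \<le> \<bar>f t - a\<bar> * (?B / \<epsilon> ^ DIM('a))"
            by (intro mult_left_mono mollifier_le elim(2)) auto
          then show ?thesis unfolding eq using True mollifier_nonneg[of \<epsilon> "x - t"] by (simp add: abs_mult mult.commute)
        next
          case False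
          have far: "norm (x - t) \<ge> \<epsilon>"
            using False x dist_triangle[of y t x] by (simp add: dist_norm[symmetric] dist_commute algebra_simps)
          show ?thesis unfolding eq using mollifier_eq_0[OF elim(2) far] False by simp
        qed
      qed
      also have "\<dots> = ?B / \<epsilon> ^ DIM('a) * (LINT t:ball y ?r|lborel. \<bar>f t - a\<bar>)"
        by (simp add: set_lebesgue_integral_def abs_mult)
      also have "\<dots> = ?B * (c + 1) ^ DIM('a) * ?Q ?r"
        using elim(2) c by (simp add: power_mult_distrib)
      finally show "\<bar>mollify \<epsilon> f x - a\<bar> < \<delta>" using elim(1) by simp
    qed
  qed
qed

section \<open>Flux of a truncated function through its jump set\<close>

text \<open>Mollification for vector fields, with the kernel arranged as it comes out of Fubini when
  a mollified measure is tested with \<open>F\<close>. On real functions it coincides with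
  \<open>mollify\<close>.\<close>

definition smear :: "real \<Rightarrow> ('a::euclidean_space \<Rightarrow> 'b::euclidean_space) \<Rightarrow> 'a \<Rightarrow> 'b" where
  "smear \<epsilon> F y = (LINT x|lborel. mollifier \<epsilon> (x - y) *\<^sub>R F x)"

lemma integrable_scaleR_bounded:
  fixes \<tau> :: "'a \<Rightarrow> 'b::{banach, second_countable_topology}" and m :: "'a \<Rightarrow> real"
  assumes "integrable M \<tau>" "m \<in> borel_measurable M" "\<And>x. \<bar>m x\<bar> \<le> k"
  shows "integrable M (\<lambda>x. m x *\<^sub>R \<tau> x)"
proof (rule Bochner_Integration.integrable_bound[where f="\<lambda>x. k * norm (\<tau> x)"])
  show "AE x in M. norm (m x *\<^sub>R \<tau> x) \<le> norm (k * norm (\<tau> x))"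
  proof (intro AE_I2)
    fix x
    have "\<bar>m x\<bar> * norm (\<tau> x) \<le> k * norm (\<tau> x)" by (intro mult_right_mono assms(3)) auto
    also have "\<dots> \<le> norm (k * norm (\<tau> x))" by simp
    finally show "norm (m x *\<^sub>R \<tau> x) \<le> norm (k * norm (\<tau> x))" by simp
  qed
qed (use assms in auto)

lemma integrable_smear:
  fixes F :: "'a::euclidean_space \<Rightarrow> 'b::euclidean_space"
  assumes "\<epsilon> > 0" "F \<in> borel_measurable borel" "\<And>x. norm (F x) \<le> B"
  shows "integrable lborel (\<lambda>x. mollifier \<epsilon> (x - y) *\<^sub>R F x)"
  using integrable_mult_bounded[OF integrable_mollifier_shift[OF assms(1), of y], of F B] assms by simp

lemma measurable_smear [measurable]:
  fixes F :: "'a::euclidean_space \<Rightarrow> 'b::euclidean_space"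
  assumes [measurable]: "F \<in> borel_measurable borel"
  shows "smear \<epsilon> F \<in> borel_measurable borel"
  unfolding smear_def by measurable

text \<open>\<open>smear \<epsilon> F y\<close> is a mean of \<open>F\<close> over the ball of
  radius \<open>\<epsilon>\<close> about \<open>y\<close>, with total weight 1; the global bound
  \<open>B\<close> supplies integrability.\<close>

lemma norm_smear_diff_le:
  fixes F :: "'a::euclidean_space \<Rightarrow> 'b::euclidean_space"
  assumes \<epsilon>: "\<epsilon> > 0" and F: "F \<in> borel_measurable borel" "\<And>x. norm (F x) \<le> B"
    and near: "\<And>x. dist x y < \<epsilon> \<Longrightarrow> norm (F x - A) \<le> \<delta>"
  shows "norm (smear \<epsilon> F y - A) \<le> \<delta>"
proof -
  have A: "A = (LINT x|lborel. mollifier \<epsilon> (x - y) *\<^sub>R A)"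
    using integral_mollifier_shift[OF \<epsilon>, of y] integrable_mollifier_shift[OF \<epsilon>, of y] by simp
  have int: "integrable lborel (\<lambda>x. mollifier \<epsilon> (x - y) *\<^sub>R F x)" "integrable lborel (\<lambda>x. mollifier \<epsilon> (x - y) *\<^sub>R A)"
    using integrable_smear[OF \<epsilon> F] integrable_mollifier_shift[OF \<epsilon>, of y] by auto
  have "smear \<epsilon> F y - A = (LINT x|lborel. mollifier \<epsilon> (x - y) *\<^sub>R F x) - (LINT x|lborel. mollifier \<epsilon> (x - y) *\<^sub>R A)"
    by (subst A) (simp only: smear_def)
  also have "\<dots> = (LINT x|lborel. mollifier \<epsilon> (x - y) *\<^sub>R F x - mollifier \<epsilon> (x - y) *\<^sub>R A)"
    by (intro Bochner_Integration.integral_diff[symmetric] int)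
  also have "norm \<dots> \<le> (LINT x|lborel. mollifier \<epsilon> (x - y) * \<delta>)"
  proof (rule Bochner_Integration.integral_norm_bound_integral)
    show "integrable lborel (\<lambda>x. mollifier \<epsilon> (x - y) *\<^sub>R F x - mollifier \<epsilon> (x - y) *\<^sub>R A)"
      by (intro Bochner_Integration.integrable_diff int)
    show "integrable lborel (\<lambda>x. mollifier \<epsilon> (x - y) * \<delta>)"
      by (intro integrable_mult_left integrable_mollifier_shift \<epsilon>)
    fix x
    show "norm (mollifier \<epsilon> (x - y) *\<^sub>R F x - mollifier \<epsilon> (x - y) *\<^sub>R A) \<le> mollifier \<epsilon> (x - y) * \<delta>"
    proof (cases "dist x y < \<epsilon>")
      case True
      have "norm (mollifier \<epsilon> (x - y) *\<^sub>R F x - mollifier \<epsilon> (x - y) *\<^sub>R A) = mollifier \<epsilon> (x - y) * norm (F x - A)"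
        by (simp add: mollifier_nonneg flip: scaleR_diff_right)
      also have "\<dots> \<le> mollifier \<epsilon> (x - y) * \<delta>" using near[OF True] by (intro mult_left_mono mollifier_nonneg)
      finally show ?thesis .
    next
      case False
      then have "mollifier \<epsilon> (x - y) = 0" by (intro mollifier_eq_0 \<epsilon>) (simp add: dist_norm)
      then show ?thesis by simp
    qed
  qed
  also have "\<dots> = \<delta>" using integral_mollifier_shift[OF \<epsilon>, of y] by simp
  finally show ?thesis .
qed

lemma norm_smear_le:
  fixes F :: "'a::euclidean_space \<Rightarrow> 'b::euclidean_space"
  assumes "\<epsilon> > 0" "F \<in> borel_measurable borel" "\<And>x. norm (F x) \<le> B"
  shows "norm (smear \<epsilon> F y) \<le> B"
  using norm_smear_diff_le[OF assms, of y 0 B] assms(3) by simp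

lemma smear_eq_0:
  fixes F :: "'a::euclidean_space \<Rightarrow> 'b::euclidean_space"
  assumes \<epsilon>: "\<epsilon> > 0" and out: "\<And>x. dist x y < \<epsilon> \<Longrightarrow> F x = 0"
  shows "smear \<epsilon> F y = 0"
proof -
  have "mollifier \<epsilon> (x - y) *\<^sub>R F x = 0" for x
    using out[of x] mollifier_eq_0[OF \<epsilon>, of "x - y"] by (cases "dist x y < \<epsilon>") (auto simp: dist_norm)
  then show ?thesis unfolding smear_def by (simp only: integral_zero)
qed

text \<open>Fubini moves the mollifier from the vector measure with density \<open>\<tau>\<close> to
  the test field; the double integral is dominated by \<open>B * norm (\<tau> y)\<close> because the
  kernel has mass 1.\<close>

lemma integral_inner_smear:
  fixes \<Psi> \<tau> :: "'a::euclidean_space \<Rightarrow> 'a"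
  assumes N: "sigma_finite_measure N" "sets N = sets borel" and \<tau>: "integrable N \<tau>"
    and \<Psi>: "\<Psi> \<in> borel_measurable borel" "\<And>x. norm (\<Psi> x) \<le> B" and \<epsilon>: "\<epsilon> > 0"
  shows "(LINT x|lborel. \<Psi> x \<bullet> (LINT y|N. mollifier \<epsilon> (x - y) *\<^sub>R \<tau> y)) = (LINT y|N. \<tau> y \<bullet> smear \<epsilon> \<Psi> y)"
proof -
  interpret N: sigma_finite_measure N by fact
  interpret pair_sigma_finite N lborel ..
  have [measurable]: "\<tau> \<in> borel_measurable N" using \<tau> by auto
  have \<tau>b[measurable]: "\<tau> \<in> borel_measurable borel" using \<open>\<tau> \<in> borel_measurable N\<close> N(2) by (simp cong: measurable_cong_sets)
  note N(2)[measurable_cong] \<Psi>(1)[measurable]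
  define f where "f y x = \<Psi> x \<bullet> (mollifier \<epsilon> (x - y) *\<^sub>R \<tau> y)" for y x
  have B0: "B \<ge> 0" using \<Psi>(2)[of 0] norm_ge_zero order_trans by blast
  have fm[measurable]: "(\<lambda>(y, x). f y x) \<in> borel_measurable (N \<Otimes>\<^sub>M lborel)"
    unfolding f_def by measurable
  have "integrable (N \<Otimes>\<^sub>M lborel) (case_prod f)"
  proof (rule integrableI_bounded)
    show "case_prod f \<in> borel_measurable (N \<Otimes>\<^sub>M lborel)" by (rule fm)
    have "(\<integral>\<^sup>+ p. ennreal (norm (case_prod f p)) \<partial>(N \<Otimes>\<^sub>M lborel)) = (\<integral>\<^sup>+ y. \<integral>\<^sup>+ x. ennreal (norm (f y x)) \<partial>lborel \<partial>N)"
      by (subst lborel.nn_integral_fst[symmetric]) auto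
    also have "\<dots> \<le> (\<integral>\<^sup>+ y. ennreal (B * norm (\<tau> y)) \<partial>N)"
    proof (rule nn_integral_mono)
      fix y
      have "(\<integral>\<^sup>+ x. ennreal (norm (f y x)) \<partial>lborel) \<le> (\<integral>\<^sup>+ x. ennreal (B * norm (\<tau> y)) * ennreal (mollifier \<epsilon> (x - y)) \<partial>lborel)"
      proof (rule nn_integral_mono)
        fix x
        have "norm (f y x) \<le> norm (\<Psi> x) * norm (mollifier \<epsilon> (x - y) *\<^sub>R \<tau> y)"
          unfolding f_def real_norm_def by (rule Cauchy_Schwarz_ineq2)
        also have "\<dots> \<le> B * norm (mollifier \<epsilon> (x - y) *\<^sub>R \<tau> y)" using \<Psi>(2) by (intro mult_right_mono) auto
        also have "\<dots> = B * norm (\<tau> y) * mollifier \<epsilon> (x - y)" by (simp add: mollifier_nonneg)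
        finally show "ennreal (norm (f y x)) \<le> ennreal (B * norm (\<tau> y)) * ennreal (mollifier \<epsilon> (x - y))"
          using B0 by (simp add: ennreal_mult'[symmetric] mollifier_nonneg ennreal_leI)
      qed
      also have "\<dots> = ennreal (B * norm (\<tau> y)) * (\<integral>\<^sup>+ x. ennreal (mollifier \<epsilon> (x - y)) \<partial>lborel)"
        by (intro nn_integral_cmult) measurable
      also have "(\<integral>\<^sup>+ x. ennreal (mollifier \<epsilon> (x - y)) \<partial>lborel) = 1"
        using nn_integral_eq_integral[OF integrable_mollifier_shift[OF \<epsilon>, of y]] integral_mollifier_shift[OF \<epsilon>, of y]
        by (simp add: mollifier_nonneg)
      finally show "(\<integral>\<^sup>+ x. ennreal (norm (f y x)) \<partial>lborel) \<le> ennreal (B * norm (\<tau> y))" by simp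
    qed
    also have "\<dots> < \<infinity>"
      using integrableD(2)[OF integrable_mult_right[OF integrable_norm[OF \<tau>], of B]] B0 by (simp add: top.not_eq_extremum)
    finally show "(\<integral>\<^sup>+ p. ennreal (norm (case_prod f p)) \<partial>(N \<Otimes>\<^sub>M lborel)) < \<infinity>" .
  qed
  then have "(LINT x|lborel. LINT y|N. f y x) = (LINT y|N. LINT x|lborel. f y x)" by (rule Fubini_integral)
  moreover have "(LINT y|N. f y x) = \<Psi> x \<bullet> (LINT y|N. mollifier \<epsilon> (x - y) *\<^sub>R \<tau> y)" for x
  proof -
    have "norm (mollifier \<epsilon> (x - y)) \<le> mollifier_const TYPE('a) / \<epsilon> ^ DIM('a)" for y
      using mollifier_le[OF \<epsilon>, of "x - y"] mollifier_nonneg[of \<epsilon> "x - y"] by simp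
    then have "integrable N (\<lambda>y. mollifier \<epsilon> (x - y) *\<^sub>R \<tau> y)"
      by (intro integrable_scaleR_bounded[OF \<tau>]) auto
    then show ?thesis unfolding f_def by (rule integral_inner_right)
  qed
  moreover have "(LINT x|lborel. f y x) = \<tau> y \<bullet> smear \<epsilon> \<Psi> y" for y
  proof -
    have "f y x = \<tau> y \<bullet> (mollifier \<epsilon> (x - y) *\<^sub>R \<Psi> x)" for x by (simp add: f_def inner_commute)
    then show ?thesis unfolding smear_def using integral_inner_right[OF integrable_smear[OF \<epsilon> \<Psi>]] by simp
  qed
  ultimately show ?thesis by simp
qed

text \<open>The distributional derivative of \<open>z\<close> on \<open>\<Omega>\<close> is \<open>\<sigma> \<nu>\<close> plus the measure with Lebesgue density \<open>G\<close>. The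
  set \<open>P\<close> stands for the part of the singular set that is charged by the jumps; unlike the
  singular set itself it is known to be Borel.\<close>

locale jump_decomposition =
  fixes \<Omega> P :: "'a::euclidean_space set" and z :: "'a \<Rightarrow> real" and G \<sigma> :: "'a \<Rightarrow> 'a" and \<nu> :: "'a measure" and h :: real
  assumes open_domain: "open \<Omega>"
    and z_integrable: "integrable lborel z"
    and z_approx_limit: "AE x in lborel. x \<in> \<Omega> \<longrightarrow> approx_limit z x (z x)"
    and G_integrable: "integrable lborel G"
    and G_zero: "\<And>x. x \<notin> \<Omega> \<Longrightarrow> G x = 0"
    and \<nu>_finite: "finite_measure \<nu>"
    and \<nu>_sets: "sets \<nu> = sets borel"
    and \<sigma>_measurable: "\<sigma> \<in> borel_measurable borel"
    and \<sigma>_le: "\<And>x. norm (\<sigma> x) \<le> 1"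
    and \<sigma>_unit: "\<And>x. x \<in> P \<Longrightarrow> norm (\<sigma> x) = 1"
    and P_borel: "P \<in> sets borel"
    and P_subset: "P \<subseteq> \<Omega>"
    and P_null: "P \<in> null_sets lborel"
    and P_carrier: "emeasure \<nu> (- P) = 0"
    and P_hausdorff: "hausdorff_outer (DIM('a) - 1) P \<le> ennreal h"
    and h_nonneg: "h \<ge> 0"
    and deriv: "\<And>\<phi> d. \<phi> \<in> C1_compact_support \<Omega> \<Longrightarrow> C1_with_grad \<phi> d \<Longrightarrow>
      (LINT x|lborel. z x *\<^sub>R d x) = - (LINT x|\<nu>. \<phi> x *\<^sub>R \<sigma> x) - (LINT x|lborel. \<phi> x *\<^sub>R G x)"
begin

sublocale \<nu>: finite_measure \<nu> by (rule \<nu>_finite)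

lemma \<sigma>_integrable: "integrable \<nu> \<sigma>"
  using \<sigma>_measurable \<sigma>_le \<nu>_sets
  by (intro \<nu>.integrable_const_bound[where B=1]) (auto simp: cong: measurable_cong_sets)

text \<open>The formula \<open>deriv\<close> is tested with the reflected kernel centred at
  \<open>x\<close>, whose support stays inside \<Omega> by the assumption on the ball; reflection
  accounts for the sign.\<close>

lemma mollify_grad_z:
  assumes \<epsilon>: "\<epsilon> > 0" and x: "cball x \<epsilon> \<subseteq> \<Omega>"
  shows "mollify_grad \<epsilon> z x = (LINT y|\<nu>. mollifier \<epsilon> (x - y) *\<^sub>R \<sigma> y) + (LINT y|lborel. mollifier \<epsilon> (x - y) *\<^sub>R G y)"
proof -
  have "(\<lambda>y. mollifier \<epsilon> (x - y)) \<in> C1_compact_support \<Omega>"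
    using x by (intro C1_compact_supportI[OF C1_with_grad_mollifier_reflect[OF \<epsilon>] compact_cball])
      (auto intro!: mollifier_eq_0[OF \<epsilon>] simp: dist_norm)
  from deriv[OF this C1_with_grad_mollifier_reflect[OF \<epsilon>]]
  have "- mollify_grad \<epsilon> z x = - ((LINT y|\<nu>. mollifier \<epsilon> (x - y) *\<^sub>R \<sigma> y) + (LINT y|lborel. mollifier \<epsilon> (x - y) *\<^sub>R G y))"
    unfolding mollify_grad_def by simp
  then show ?thesis by (simp only: neg_equal_iff_equal)
qed

text \<open>Splits the pairing of a field with the gradient of mollified \<open>z\<close> into the
  contributions of the singular and the absolutely continuous part of the derivative, with the
  mollifier moved to the field.\<close>

lemma flux_mollify:
  assumes \<epsilon>: "\<epsilon> > 0" and \<Psi>: "\<Psi> \<in> borel_measurable borel" "\<And>x. norm (\<Psi> x) \<le> B"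
    and supp: "\<And>x. \<Psi> x \<noteq> 0 \<Longrightarrow> cball x \<epsilon> \<subseteq> \<Omega>" and bdd: "bounded {x. \<Psi> x \<noteq> 0}"
  shows "(LINT x|lborel. \<Psi> x \<bullet> mollify_grad \<epsilon> z x) = (LINT y|\<nu>. \<sigma> y \<bullet> smear \<epsilon> \<Psi> y) + (LINT y|lborel. G y \<bullet> smear \<epsilon> \<Psi> y)"
proof -
  let ?S = "\<lambda>x. LINT y|\<nu>. mollifier \<epsilon> (x - y) *\<^sub>R \<sigma> y"
  let ?R = "\<lambda>x. LINT y|lborel. mollifier \<epsilon> (x - y) *\<^sub>R G y"
  note \<Psi>(1)[measurable] \<sigma>_measurable[measurable] \<nu>_sets[measurable_cong]
  have Gm[measurable]: "G \<in> borel_measurable borel" using G_integrable by (auto dest: borel_measurable_integrable)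
  have sf: "sigma_finite_measure \<nu>" by unfold_locales
  define k where "k = mollifier_const TYPE('a) / \<epsilon> ^ DIM('a)"
  have k: "\<bar>mollifier \<epsilon> w\<bar> \<le> k" for w :: 'a
    using mollifier_le[OF \<epsilon>, of w] mollifier_nonneg[of \<epsilon> w] by (simp add: k_def)
  have bound: "norm (LINT y|N. mollifier \<epsilon> (x - y) *\<^sub>R \<tau> y) \<le> k * (LINT y|N. norm (\<tau> y))" if "integrable N \<tau>" for N and \<tau> :: "'a \<Rightarrow> 'a" and x
  proof -
    have "norm (LINT y|N. mollifier \<epsilon> (x - y) *\<^sub>R \<tau> y) \<le> (LINT y|N. norm (mollifier \<epsilon> (x - y) *\<^sub>R \<tau> y))"
      by (rule integral_norm_bound)
    also have "\<dots> \<le> (LINT y|N. k * norm (\<tau> y))"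
      using that k by (intro integral_mono') (auto intro!: mult_right_mono mult_nonneg_nonneg order_trans[OF abs_ge_zero k])
    finally show ?thesis by simp
  qed
  have "bounded {x. \<Psi> x \<noteq> 0}" by fact
  then obtain R where R: "\<And>x. \<Psi> x \<noteq> 0 \<Longrightarrow> norm x \<le> R" by (auto simp: bounded_iff)
  have B0: "B \<ge> 0" using \<Psi>(2)[of 0] norm_ge_zero order_trans by blast
  have int: "integrable lborel (\<lambda>x. \<Psi> x \<bullet> H x)" if H: "H \<in> borel_measurable borel" "\<And>x. norm (H x) \<le> C" for H C
  proof (rule Bochner_Integration.integrable_bound[where f="\<lambda>x. indicator (cball 0 R) x * (B * C)"])
    show "integrable lborel (\<lambda>x::'a. indicator (cball 0 R) x * (B * C))"
      by (intro integrable_mult_left integrable_real_indicator) (auto intro: emeasure_lborel_bounded)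
    show "AE x in lborel. norm (\<Psi> x \<bullet> H x) \<le> norm (indicator (cball 0 R) x * (B * C))"
    proof (intro AE_I2)
      fix x
      have "norm (\<Psi> x \<bullet> H x) \<le> norm (\<Psi> x) * norm (H x)" unfolding real_norm_def by (rule Cauchy_Schwarz_ineq2)
      also have "\<dots> \<le> B * C" using \<Psi>(2) H(2) B0 by (intro mult_mono) auto
      finally show "norm (\<Psi> x \<bullet> H x) \<le> norm (indicator (cball 0 R) x * (B * C))"
        using R[of x] by (cases "\<Psi> x = 0") auto
    qed
  qed (use H in simp)
  have "\<Psi> x \<bullet> mollify_grad \<epsilon> z x = \<Psi> x \<bullet> ?S x + \<Psi> x \<bullet> ?R x" for x
    using mollify_grad_z[OF \<epsilon> supp, of x] by (cases "\<Psi> x = 0") (simp_all add: inner_add_right)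
  then have "(LINT x|lborel. \<Psi> x \<bullet> mollify_grad \<epsilon> z x) = (LINT x|lborel. \<Psi> x \<bullet> ?S x + \<Psi> x \<bullet> ?R x)" by simp
  also have "\<dots> = (LINT x|lborel. \<Psi> x \<bullet> ?S x) + (LINT x|lborel. \<Psi> x \<bullet> ?R x)"
  proof (intro Bochner_Integration.integral_add int)
    show "?S \<in> borel_measurable borel" by measurable
    show "?R \<in> borel_measurable borel" by measurable
  qed (rule bound[OF \<sigma>_integrable] bound[OF G_integrable])+
  also have "\<dots> = (LINT y|\<nu>. \<sigma> y \<bullet> smear \<epsilon> \<Psi> y) + (LINT y|lborel. G y \<bullet> smear \<epsilon> \<Psi> y)"
    using integral_inner_smear[OF sf \<nu>_sets \<sigma>_integrable \<Psi> \<epsilon>]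
      integral_inner_smear[OF lborel.sigma_finite_measure_axioms _ G_integrable \<Psi> \<epsilon>] by simp
  finally show ?thesis .
qed

end

lemma smear_diff:
  fixes F F' :: "'a::euclidean_space \<Rightarrow> 'b::euclidean_space"
  assumes "\<epsilon> > 0" "F \<in> borel_measurable borel" "\<And>x. norm (F x) \<le> B" "F' \<in> borel_measurable borel" "\<And>x. norm (F' x) \<le> B'"
  shows "smear \<epsilon> (\<lambda>x. F x - F' x) y = smear \<epsilon> F y - smear \<epsilon> F' y"
  unfolding smear_def scaleR_diff_right
  by (intro Bochner_Integration.integral_diff integrable_smear[OF assms(1-3)] integrable_smear[OF assms(1,4,5)])

lemma smear_scaleR_right:
  fixes f :: "'a::euclidean_space \<Rightarrow> real" and e :: "'b::euclidean_space"
  assumes "\<epsilon> > 0" "f \<in> borel_measurable borel" "\<And>x. \<bar>f x\<bar> \<le> B"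
  shows "smear \<epsilon> (\<lambda>x. f x *\<^sub>R e) y = smear \<epsilon> f y *\<^sub>R e"
proof -
  have "integrable lborel (\<lambda>x. mollifier \<epsilon> (x - y) *\<^sub>R f x)"
    using integrable_smear[of \<epsilon> f B y] assms by simp
  then show ?thesis
    unfolding smear_def using integral_scaleR_left[of e lborel "\<lambda>x. mollifier \<epsilon> (x - y) *\<^sub>R f x"] by simp
qed

lemma smear_mult_left: "smear \<epsilon> (\<lambda>x. a * f x) y = a * (smear \<epsilon> f y :: real)"
proof -
  have "(\<lambda>x. mollifier \<epsilon> (x - y) *\<^sub>R (a * f x)) = (\<lambda>x. a * (mollifier \<epsilon> (x - y) *\<^sub>R f x))"
    by (simp add: fun_eq_iff)
  then show ?thesis unfolding smear_def by simp
qed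

lemma smear_nonneg: "(\<And>x. 0 \<le> f x) \<Longrightarrow> 0 \<le> (smear \<epsilon> f y :: real)"
  unfolding smear_def by (intro integral_nonneg_AE AE_I2) (simp add: mollifier_nonneg)

text \<open>\<open>T\<close> stands for a smooth truncation with oscillation at most
  \<open>c\<close>, centred so that half of it bounds \<bar>T\<bar>; \<open>c\<close> will be
  \<open>M / 2 - m / 2\<close>.\<close>

locale truncated_jump = jump_decomposition +
  fixes T T' :: "real \<Rightarrow> real" and c :: real
  assumes T_deriv: "\<And>t. (T has_real_derivative T' t) (at t)"
    and T'_cont: "continuous_on UNIV T'"
    and T'_nonneg: "\<And>t. 0 \<le> T' t" and T'_le: "\<And>t. T' t \<le> 1"
    and T_le: "\<And>t. \<bar>T t\<bar> \<le> c / 2"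
begin

lemma c_nonneg: "c \<ge> 0"
  using T_le[of 0] by linarith

text \<open>The weight with which \<open>\<nu>\<close> enters the derivative of \<open>T\<close> composed with the mollification of \<open>z\<close>.\<close>

definition \<kappa> :: "real \<Rightarrow> 'a \<Rightarrow> real" where
  "\<kappa> \<epsilon> = smear \<epsilon> (\<lambda>x. T' (mollify \<epsilon> z x))"

lemma T'_mollify_measurable:
  assumes "\<epsilon> > 0"
  shows "(\<lambda>x. T' (mollify \<epsilon> z x)) \<in> borel_measurable borel"
proof (rule borel_measurable_continuous_onI)
  show "continuous_on UNIV (\<lambda>x. T' (mollify \<epsilon> z x))"
    using continuous_on_compose2[OF T'_cont C1_with_grad_continuous[OF C1_with_grad_mollify[OF assms z_integrable]]] by auto
qed

lemma \<kappa>_measurable: "\<epsilon> > 0 \<Longrightarrow> \<kappa> \<epsilon> \<in> borel_measurable borel"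
  unfolding \<kappa>_def by (intro measurable_smear T'_mollify_measurable)

lemma \<kappa>_bounds:
  assumes "\<epsilon> > 0"
  shows "0 \<le> \<kappa> \<epsilon> y" "\<kappa> \<epsilon> y \<le> 1"
proof -
  show "0 \<le> \<kappa> \<epsilon> y" unfolding \<kappa>_def by (rule smear_nonneg) (rule T'_nonneg)
  have "norm (\<kappa> \<epsilon> y) \<le> 1" unfolding \<kappa>_def
    by (rule norm_smear_le[OF assms T'_mollify_measurable[OF assms]]) (simp add: T'_nonneg T'_le)
  then show "\<kappa> \<epsilon> y \<le> 1" by simp
qed

lemma \<kappa>_integrable: "\<epsilon> > 0 \<Longrightarrow> integrable \<nu> (\<kappa> \<epsilon>)"
  using \<kappa>_measurable[of \<epsilon>] \<kappa>_bounds[of \<epsilon>] \<nu>_sets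
  by (intro \<nu>.integrable_const_bound[where B=1]) (auto cong: measurable_cong_sets)

text \<open>The derivative of the product of \<phi> and T of the mollified z in direction
  \<open>e\<close> has integral zero, since \<phi> has compact support.\<close>

lemma integral_by_parts_mollify:
  assumes \<epsilon>: "\<epsilon> > 0" and C: "C1_with_grad \<phi> d" and L: "compact L" "\<And>x. x \<notin> L \<Longrightarrow> \<phi> x = 0"
  shows "(LINT x|lborel. \<phi> x * (T' (mollify \<epsilon> z x) * (mollify_grad \<epsilon> z x \<bullet> e))) = - (LINT x|lborel. T (mollify \<epsilon> z x) * (d x \<bullet> e))"
    "integrable lborel (\<lambda>x. T (mollify \<epsilon> z x) * (d x \<bullet> e))"
    "integrable lborel (\<lambda>x. \<phi> x * (T' (mollify \<epsilon> z x) * (mollify_grad \<epsilon> z x \<bullet> e)))"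
proof -
  let ?D = "\<lambda>x. T' (mollify \<epsilon> z x) *\<^sub>R mollify_grad \<epsilon> z x"
  have CT: "C1_with_grad (\<lambda>x. T (mollify \<epsilon> z x)) ?D"
    by (rule C1_with_grad_compose[OF C1_with_grad_mollify[OF \<epsilon> z_integrable] T_deriv T'_cont])
  have d0: "d x = 0" if "x \<notin> L" for x
    by (rule C1_with_grad_zero_outside[OF C compact_imp_closed[OF L(1)] L(2) that])
  have 1: "integrable lborel (\<lambda>x. T (mollify \<epsilon> z x) * (d x \<bullet> e))"
    by (rule integrable_continuous_compact_support[OF _ L(1)])
       (auto intro!: continuous_intros C1_with_grad_continuous[OF CT] C1_with_grad_continuous_grad[OF C] simp: d0)
  have "integrable lborel (\<lambda>x. \<phi> x * (?D x \<bullet> e))"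
    by (rule integrable_continuous_compact_support[OF _ L(1)])
       (auto intro!: continuous_intros C1_with_grad_continuous[OF C] C1_with_grad_continuous_grad[OF CT] simp: L(2) simp del: inner_scaleR_left)
  then have 2: "integrable lborel (\<lambda>x. \<phi> x * (T' (mollify \<epsilon> z x) * (mollify_grad \<epsilon> z x \<bullet> e)))" by simp
  have "(LINT x|lborel. (\<phi> x *\<^sub>R ?D x + T (mollify \<epsilon> z x) *\<^sub>R d x) \<bullet> e) = 0"
    by (rule integral_grad_compact_support[OF C1_with_grad_mult[OF C CT] L(1)]) (simp add: L(2))
  then have "(LINT x|lborel. \<phi> x * (T' (mollify \<epsilon> z x) * (mollify_grad \<epsilon> z x \<bullet> e)) + T (mollify \<epsilon> z x) * (d x \<bullet> e)) = 0"
    by (simp add: inner_add_left mult.assoc)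
  then show "(LINT x|lborel. \<phi> x * (T' (mollify \<epsilon> z x) * (mollify_grad \<epsilon> z x \<bullet> e))) = - (LINT x|lborel. T (mollify \<epsilon> z x) * (d x \<bullet> e))"
    using 1 2 by simp
  show "integrable lborel (\<lambda>x. T (mollify \<epsilon> z x) * (d x \<bullet> e))"
    "integrable lborel (\<lambda>x. \<phi> x * (T' (mollify \<epsilon> z x) * (mollify_grad \<epsilon> z x \<bullet> e)))" by fact+
qed

lemma finite_measure_outer_open:
  fixes N :: "'a measure"
  assumes "finite_measure N" "sets N = sets borel" "K \<in> sets borel" "\<eta> > 0"
  obtains U where "open U" "K \<subseteq> U" "measure N U < measure N K + \<eta>"
proof -
  interpret N: finite_measure N by fact
  have "emeasure N K = (INF U \<in> {U. K \<subseteq> U \<and> open U}. emeasure N U)"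
    using assms by (intro outer_regular) auto
  moreover have "emeasure N K < ennreal (measure N K + \<eta>)"
    using assms(4) by (simp add: N.emeasure_eq_measure ennreal_less_iff)
  ultimately obtain U where U: "K \<subseteq> U" "open U" "emeasure N U < ennreal (measure N K + \<eta>)"
    by (auto simp: INF_less_iff)
  then have "measure N U < measure N K + \<eta>" by (simp add: N.emeasure_eq_measure ennreal_less_iff)
  then show ?thesis using that U by blast
qed

text \<open>Outer regularity of the finite measure with density \<open>norm (G x)\<close>, for which
  \<open>K\<close> is a null set.\<close>

lemma small_G_neighbourhood:
  assumes "K \<in> null_sets lborel" "\<eta> > 0"
  obtains U where "open U" "K \<subseteq> U" "(LINT x|lborel. indicator U x * norm (G x)) < \<eta>"
proof -
  let ?N = "density lborel (\<lambda>x. ennreal (norm (G x)))"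
  have Gm[measurable]: "G \<in> borel_measurable borel" using G_integrable by (auto dest: borel_measurable_integrable)
  have KB: "K \<in> sets borel" using assms by auto
  have meas: "emeasure ?N A = ennreal (LINT x|lborel. indicator A x * norm (G x))" if A[measurable]: "A \<in> sets borel" for A
  proof -
    have "integrable lborel (\<lambda>x. indicator A x *\<^sub>R norm (G x))" using A G_integrable by (intro integrable_mult_indicator) auto
    then have "(\<integral>\<^sup>+ x. ennreal (indicator A x * norm (G x)) \<partial>lborel) = ennreal (LINT x|lborel. indicator A x * norm (G x))"
      by (intro nn_integral_eq_integral) auto
    moreover have "emeasure ?N A = (\<integral>\<^sup>+ x. ennreal (indicator A x * norm (G x)) \<partial>lborel)"
      using A by (subst emeasure_density) (auto intro!: nn_integral_cong simp: indicator_def)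
    ultimately show ?thesis by simp
  qed
  have fin: "finite_measure ?N"
    by (rule finite_measureI) (use meas[of UNIV] in simp)
  then interpret N: finite_measure ?N .
  obtain U where U: "open U" "K \<subseteq> U" "measure ?N U < measure ?N K + \<eta>"
    by (rule finite_measure_outer_open[OF fin _ KB assms(2)]) auto
  have "emeasure ?N K = 0"
    using assms(1) by (subst emeasure_density) (auto intro!: nn_integral_0_iff_AE[THEN iffD2] simp: AE_iff_null_sets intro: AE_mp[OF AE_not_in[OF assms(1)]])
  then have "measure ?N K = 0" by (simp add: measure_def)
  moreover have "measure ?N U = (LINT x|lborel. indicator U x * norm (G x))"
    using meas[of U] U(1) by (simp add: measure_def integral_nonneg_AE)
  ultimately show ?thesis using that U by simp
qed

text \<open>Integrating the derivative of \<open>T\<close> of the mollification in direction \<open>e\<close> against a cutoff function of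
  \<open>K\<close> with \<open>e\<close>-variation at most about \<open>2 hK\<close> gives at most \<open>c / 2 * 2 hK\<close>.\<close>

lemma piece_bound:
  assumes K: "compact K" "K \<subseteq> P" and e: "norm e = 1" and q: "\<And>x. x \<in> K \<Longrightarrow> 1 - q \<le> \<sigma> x \<bullet> e"
    and hK: "hausdorff_outer (DIM('a) - 1) K \<le> ennreal hK" "hK \<ge> 0" and \<eta>: "\<eta> > 0"
  shows "eventually (\<lambda>\<epsilon>. (1 - q) * (LINT y|\<nu>. indicator K y * \<kappa> \<epsilon> y) \<le> c * hK + \<eta>) (at_right 0)"
proof -
  \<comment> \<open>The error budget: \<open>c * \<eta>'\<close> from the variation of the cutoff,
    and one \<open>\<eta>'\<close> each from the mass of \<open>\<nu>\<close> on
    \<open>U1 - K\<close>, from \<open>G\<close> on \<open>U2\<close>, and from moving the cutoff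
    out of the average.\<close>
  define \<eta>' where "\<eta>' = \<eta> / (c + 4)"
  have \<eta>': "\<eta>' > 0" "c * \<eta>' + 3 * \<eta>' \<le> \<eta>"
  proof -
    show "\<eta>' > 0" using \<eta> c_nonneg by (simp add: \<eta>'_def)
    then have "c * \<eta>' + 3 * \<eta>' \<le> (c + 4) * \<eta>'" by (simp add: algebra_simps)
    also have "\<dots> = \<eta>" using c_nonneg by (simp add: \<eta>'_def)
    finally show "c * \<eta>' + 3 * \<eta>' \<le> \<eta>" .
  qed
  have KB: "K \<in> sets borel" using K by (simp add: borel_compact)
  have Gm[measurable]: "G \<in> borel_measurable borel" using G_integrable by (auto dest: borel_measurable_integrable)
  note \<sigma>_measurable[measurable] \<nu>_sets[measurable_cong] KB[measurable]
  obtain U1 where U1: "open U1" "K \<subseteq> U1" "measure \<nu> U1 < measure \<nu> K + \<eta>'"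
    by (rule finite_measure_outer_open[OF \<nu>_finite \<nu>_sets KB \<eta>'(1)])
  have "K \<in> null_sets lborel" using P_null K(2) KB by (intro null_sets_subset[OF P_null]) auto
  then obtain U2 where U2: "open U2" "K \<subseteq> U2" "(LINT x|lborel. indicator U2 x * norm (G x)) < \<eta>'"
    by (rule small_G_neighbourhood[OF _ \<eta>'(1)])
  define U where "U = U1 \<inter> U2 \<inter> \<Omega>"
  have U: "open U" "K \<subseteq> U" using U1 U2 open_domain K(2) P_subset by (auto simp: U_def)
  obtain \<phi> d L where \<phi>: "C1_with_grad \<phi> d" "compact L" "L \<subseteq> U" "\<And>x. x \<notin> L \<Longrightarrow> \<phi> x = 0"
    "\<And>x. 0 \<le> \<phi> x" "\<And>x. \<phi> x \<le> 1" "\<And>x. x \<in> K \<Longrightarrow> \<phi> x = 1" "(LINT x|lborel. \<bar>d x \<bullet> e\<bar>) \<le> 2 * (hK + \<eta>')"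
    by (rule hausdorff_cutoff[OF K(1) U e hK \<eta>'(1)]) (rule that)
  have d0: "d x = 0" if "x \<notin> L" for x
    by (rule C1_with_grad_zero_outside[OF \<phi>(1) compact_imp_closed[OF \<phi>(2)] \<phi>(4) that])
  obtain B where B: "B > 0" "\<And>x. norm (d x) \<le> B"
    using bounded_continuous_compact_support[OF C1_with_grad_continuous_grad[OF \<phi>(1)] \<phi>(2) d0] by blast
  obtain r where r: "r > 0" "(\<Union>x\<in>L. cball x r) \<subseteq> U"
    using compact_subset_open_imp_cball_epsilon_subset[OF \<phi>(2) U(1) \<phi>(3)] by blast
  define V where "V = measure \<nu> UNIV"
  have V: "V \<ge> 0" by (simp add: V_def)
  have sp: "space \<nu> = UNIV" using sets_eq_imp_space_eq[OF \<nu>_sets] by simp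
  \<comment> \<open>The first bound keeps \<epsilon>-balls about the support inside
    \<open>U\<close>. The second makes the Lipschitz error \<open>B * \<epsilon>\<close>, integrated
    over the total mass \<open>V\<close>, at most \<open>\<eta>'\<close>; adding 1 keeps the
    denominator positive.\<close>
  define \<epsilon>0 where "\<epsilon>0 = min r (\<eta>' / (B * V + 1))"
  have BV: "B * V + 1 > 0" using B V by (simp add: add_nonneg_pos)
  have "\<epsilon>0 > 0" using r \<eta>' BV by (simp add: \<epsilon>0_def)
  show ?thesis
  proof (rule eventually_at_rightI[OF _ \<open>\<epsilon>0 > 0\<close>])
    fix \<epsilon> assume "\<epsilon> \<in> {0<..<\<epsilon>0}"
    then have \<epsilon>: "\<epsilon> > 0" "\<epsilon> < r" "\<epsilon> \<le> \<eta>' / (B * V + 1)" by (auto simp: \<epsilon>0_def)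
    have \<epsilon>BV: "B * \<epsilon> * V \<le> \<eta>'"
    proof -
      have "\<epsilon> * (B * V + 1) \<le> \<eta>'" using \<epsilon>(3) BV by (simp add: pos_le_divide_eq)
      moreover have "B * \<epsilon> * V \<le> \<epsilon> * (B * V + 1)" using \<epsilon>(1) by (simp add: algebra_simps)
      ultimately show ?thesis by linarith
    qed
    define a where "a x = T' (mollify \<epsilon> z x)" for x
    have am[measurable]: "a \<in> borel_measurable borel" unfolding a_def by (rule T'_mollify_measurable[OF \<epsilon>(1)])
    have a: "0 \<le> a x" "a x \<le> 1" for x by (simp_all add: a_def T'_nonneg T'_le)
    have \<phi>m[measurable]: "\<phi> \<in> borel_measurable borel" using C1_with_grad_measurable[OF \<phi>(1)] by simp
    have \<phi>a: "\<bar>\<phi> x * a x\<bar> \<le> 1" for x using \<phi>(5,6)[of x] a[of x] by (simp add: abs_mult mult_le_one)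
    \<comment> \<open>The smeared weight including the cutoff. Since \<open>\<phi>\<close> varies by
      at most \<open>B * \<epsilon>\<close> under the average, \<open>b\<close> is that close to
      \<open>\<phi>\<close> times \<open>\<kappa>\<close>, hence to \<open>\<kappa>\<close> on
      \<open>K\<close>.\<close>
    define b where "b = smear \<epsilon> (\<lambda>x. \<phi> x * a x)"
    have bm[measurable]: "b \<in> borel_measurable borel" unfolding b_def by measurable
    have b1: "\<bar>b y\<bar> \<le> 1" for y
      unfolding b_def using norm_smear_le[OF \<epsilon>(1), of "\<lambda>x. \<phi> x * a x" 1 y] \<phi>a by simp
    have b_near: "\<bar>b y - \<phi> y * \<kappa> \<epsilon> y\<bar> \<le> B * \<epsilon>" for y
    proof -
      have "b y - \<phi> y * \<kappa> \<epsilon> y = smear \<epsilon> (\<lambda>x. \<phi> x * a x) y - smear \<epsilon> (\<lambda>x. \<phi> y * a x) y"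
        by (simp add: b_def \<kappa>_def smear_mult_left a_def)
      also have "\<dots> = smear \<epsilon> (\<lambda>x. \<phi> x * a x - \<phi> y * a x) y"
      proof (rule smear_diff[symmetric, OF \<epsilon>(1)])
        show "norm (\<phi> x * a x) \<le> 1" for x using \<phi>a by simp
        show "norm (\<phi> y * a x) \<le> 1" for x using \<phi>(5,6)[of y] a[of x] by (simp add: abs_mult mult_le_one)
      qed auto
      also have "norm (\<dots> - 0) \<le> B * \<epsilon>"
      proof (rule norm_smear_diff_le[OF \<epsilon>(1)])
        show "(\<lambda>x. \<phi> x * a x - \<phi> y * a x) \<in> borel_measurable borel" by measurable
        have eq: "\<phi> x * a x - \<phi> y * a x = (\<phi> x - \<phi> y) * a x" for x by (simp add: algebra_simps)
        show "norm (\<phi> x * a x - \<phi> y * a x) \<le> 1" for x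
          unfolding eq using \<phi>(5,6)[of x] \<phi>(5,6)[of y] a[of x] by (simp add: abs_mult mult_le_one abs_le_iff)
        show "norm (\<phi> x * a x - \<phi> y * a x - 0) \<le> B * \<epsilon>" if "dist x y < \<epsilon>" for x
        proof -
          have "\<bar>\<phi> x - \<phi> y\<bar> * a x \<le> \<bar>\<phi> x - \<phi> y\<bar> * 1" by (intro mult_left_mono a) auto
          also have "\<dots> \<le> B * norm (x - y)" using C1_with_grad_lipschitz[OF \<phi>(1) B(2)] by simp
          also have "\<dots> \<le> B * \<epsilon>" using that B(1) by (intro mult_left_mono) (auto simp: dist_norm)
          finally show ?thesis unfolding eq using a[of x] by (simp add: abs_mult)
        qed
      qed
      finally show ?thesis by simp
    qed
    have b0: "b y = 0" if "y \<notin> U" for y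
      unfolding b_def
    proof (rule smear_eq_0[OF \<epsilon>(1)])
      fix x assume "dist x y < \<epsilon>"
      then have "y \<in> cball x r" using \<epsilon>(2) by simp
      then have "x \<notin> L" using that r(2) by blast
      then show "\<phi> x * a x = 0" using \<phi>(4) by simp
    qed
    define \<Psi> where "\<Psi> x = (\<phi> x * a x) *\<^sub>R e" for x
    have sm: "smear \<epsilon> \<Psi> y = b y *\<^sub>R e" for y
      unfolding \<Psi>_def b_def by (rule smear_scaleR_right[OF \<epsilon>(1) _ \<phi>a]) measurable
    have flux: "(LINT x|lborel. \<Psi> x \<bullet> mollify_grad \<epsilon> z x) = (LINT y|\<nu>. \<sigma> y \<bullet> smear \<epsilon> \<Psi> y) + (LINT y|lborel. G y \<bullet> smear \<epsilon> \<Psi> y)"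
    proof (rule flux_mollify[OF \<epsilon>(1)])
      show "\<Psi> \<in> borel_measurable borel" unfolding \<Psi>_def by measurable
      show "norm (\<Psi> x) \<le> 1" for x using \<phi>a[of x] e by (simp add: \<Psi>_def)
      have L: "x \<in> L" if "\<Psi> x \<noteq> 0" for x using that \<phi>(4)[of x] by (auto simp: \<Psi>_def)
      show "cball x \<epsilon> \<subseteq> \<Omega>" if "\<Psi> x \<noteq> 0" for x
      proof -
        have "cball x \<epsilon> \<subseteq> cball x r" using \<epsilon>(2) by auto
        also have "\<dots> \<subseteq> U" using r(2) L[OF that] by blast
        finally show ?thesis by (auto simp: U_def)
      qed
      show "bounded {x. \<Psi> x \<noteq> 0}" by (rule bounded_subset[OF compact_imp_bounded[OF \<phi>(2)]]) (rule subsetI, simp add: L)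
    qed
    have "(LINT x|lborel. \<Psi> x \<bullet> mollify_grad \<epsilon> z x) = (LINT x|lborel. \<phi> x * (T' (mollify \<epsilon> z x) * (mollify_grad \<epsilon> z x \<bullet> e)))"
      by (rule Bochner_Integration.integral_cong) (simp_all add: \<Psi>_def a_def inner_commute mult.assoc)
    also have "\<dots> = (LINT x|lborel. - (T (mollify \<epsilon> z x) * (d x \<bullet> e)))"
      using integral_by_parts_mollify(1)[OF \<epsilon>(1) \<phi>(1,2,4), of e] by simp
    also have "\<dots> \<le> (LINT x|lborel. c / 2 * \<bar>d x \<bullet> e\<bar>)"
    proof (rule Bochner_Integration.integral_mono)
      show "integrable lborel (\<lambda>x. - (T (mollify \<epsilon> z x) * (d x \<bullet> e)))"
        using integral_by_parts_mollify(2)[OF \<epsilon>(1) \<phi>(1,2,4), of e] by simp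
      show "integrable lborel (\<lambda>x. c / 2 * \<bar>d x \<bullet> e\<bar>)"
        by (rule integrable_continuous_compact_support[OF _ \<phi>(2)])
           (auto intro!: continuous_intros C1_with_grad_continuous_grad[OF \<phi>(1)] simp: d0)
      fix x
      have "- (T (mollify \<epsilon> z x) * (d x \<bullet> e)) \<le> \<bar>T (mollify \<epsilon> z x)\<bar> * \<bar>d x \<bullet> e\<bar>"
        by (metis abs_ge_minus_self abs_mult)
      also have "\<dots> \<le> c / 2 * \<bar>d x \<bullet> e\<bar>" by (intro mult_right_mono T_le) auto
      finally show "- (T (mollify \<epsilon> z x) * (d x \<bullet> e)) \<le> c / 2 * \<bar>d x \<bullet> e\<bar>" .
    qed
    also have "\<dots> = c / 2 * (LINT x|lborel. \<bar>d x \<bullet> e\<bar>)" by simp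
    also have "\<dots> \<le> c / 2 * (2 * (hK + \<eta>'))" using c_nonneg by (intro mult_left_mono \<phi>(8)) auto
    finally have A: "(LINT y|\<nu>. \<sigma> y \<bullet> smear \<epsilon> \<Psi> y) + (LINT y|lborel. G y \<bullet> smear \<epsilon> \<Psi> y) \<le> c * hK + c * \<eta>'"
      unfolding flux by (simp add: algebra_simps)
    have GB: "- \<eta>' \<le> (LINT y|lborel. G y \<bullet> smear \<epsilon> \<Psi> y)"
    proof -
      have int2: "integrable lborel (\<lambda>x. indicator U2 x * norm (G x))"
        using integrable_mult_indicator[of U2 lborel "\<lambda>x. norm (G x)"] U2(1) G_integrable by simp
      have "norm (LINT y|lborel. G y \<bullet> smear \<epsilon> \<Psi> y) \<le> (LINT x|lborel. indicator U2 x * norm (G x))"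
      proof (rule Bochner_Integration.integral_norm_bound_integral[OF _ int2])
        fix y
        have "\<bar>G y \<bullet> e\<bar> \<le> norm (G y)" using Cauchy_Schwarz_ineq2[of "G y" e] e by simp
        then have "\<bar>b y\<bar> * \<bar>G y \<bullet> e\<bar> \<le> 1 * norm (G y)" by (intro mult_mono b1) auto
        then have "norm (G y \<bullet> smear \<epsilon> \<Psi> y) \<le> norm (G y)" by (simp add: sm abs_mult)
        moreover have "G y \<bullet> smear \<epsilon> \<Psi> y = 0" if "y \<notin> U2" using that b0[of y] by (simp add: sm U_def)
        ultimately show bnd: "norm (G y \<bullet> smear \<epsilon> \<Psi> y) \<le> indicator U2 y * norm (G y)" by (auto simp: indicator_def)
      next
        show "integrable lborel (\<lambda>y. G y \<bullet> smear \<epsilon> \<Psi> y)"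
        proof (rule Bochner_Integration.integrable_bound[OF integrable_norm[OF G_integrable]])
          show "(\<lambda>y. G y \<bullet> smear \<epsilon> \<Psi> y) \<in> borel_measurable lborel" unfolding sm by measurable
          have "norm (G y \<bullet> smear \<epsilon> \<Psi> y) \<le> norm (G y)" for y
          proof -
            have "\<bar>G y \<bullet> e\<bar> \<le> norm (G y)" using Cauchy_Schwarz_ineq2[of "G y" e] e by simp
            then have "\<bar>b y\<bar> * \<bar>G y \<bullet> e\<bar> \<le> 1 * norm (G y)" by (intro mult_mono b1) auto
            then show ?thesis by (simp add: sm abs_mult)
          qed
          then show "AE y in lborel. norm (G y \<bullet> smear \<epsilon> \<Psi> y) \<le> norm (norm (G y))" by simp
        qed
      qed
      then show ?thesis using U2(3) by (simp add: abs_le_iff)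
    qed
    have \<sigma>b: "integrable \<nu> (\<lambda>y. \<sigma> y \<bullet> smear \<epsilon> \<Psi> y)"
    proof (rule \<nu>.integrable_const_bound[where B=1])
      show "(\<lambda>y. \<sigma> y \<bullet> smear \<epsilon> \<Psi> y) \<in> borel_measurable \<nu>" unfolding sm by measurable
      have "norm (\<sigma> y \<bullet> smear \<epsilon> \<Psi> y) \<le> 1" for y
      proof -
        have "\<bar>\<sigma> y \<bullet> e\<bar> \<le> 1" using Cauchy_Schwarz_ineq2[of "\<sigma> y" e] e \<sigma>_le[of y] by simp
        then have "\<bar>b y\<bar> * \<bar>\<sigma> y \<bullet> e\<bar> \<le> 1 * 1" by (intro mult_mono b1) auto
        then show ?thesis by (simp add: sm abs_mult)
      qed
      then show "AE y in \<nu>. norm (\<sigma> y \<bullet> smear \<epsilon> \<Psi> y) \<le> 1" by simp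
    qed
    have \<kappa>m[measurable]: "\<kappa> \<epsilon> \<in> borel_measurable borel" by (rule \<kappa>_measurable[OF \<epsilon>(1)])
    have intK: "integrable \<nu> (\<lambda>y. indicator K y * \<kappa> \<epsilon> y)"
      using integrable_mult_indicator[OF _ \<kappa>_integrable[OF \<epsilon>(1)], of K] KB \<nu>_sets by simp
    have U1K: "U1 - K \<in> sets \<nu>" using U1(1) KB \<nu>_sets by auto
    have intU: "integrable \<nu> (indicator (U1 - K) :: 'a \<Rightarrow> real)"
      using U1K by (intro integrable_real_indicator) (auto simp: \<nu>.emeasure_eq_measure)
    \<comment> \<open>Lower bound for the singular term in three regions: on \<open>K\<close> the
      direction is almost \<open>e\<close>; on \<open>U1 - K\<close> the integrand is at least -1
      but the mass is small; off \<open>U1\<close> the cutoff vanishes, so \<open>b\<close> is at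
      most the Lipschitz error.\<close>
    have "(1 - q) * (LINT y|\<nu>. indicator K y * \<kappa> \<epsilon> y) - measure \<nu> (U1 - K) - B * \<epsilon> * V
        = (LINT y|\<nu>. (1 - q) * (indicator K y * \<kappa> \<epsilon> y) - indicator (U1 - K) y - B * \<epsilon>)"
      using intK intU U1K sp by (simp add: V_def)
    also have "\<dots> \<le> (LINT y|\<nu>. \<sigma> y \<bullet> smear \<epsilon> \<Psi> y)"
    proof (rule Bochner_Integration.integral_mono[OF _ \<sigma>b])
      show "integrable \<nu> (\<lambda>y. (1 - q) * (indicator K y * \<kappa> \<epsilon> y) - indicator (U1 - K) y - B * \<epsilon>)"
        using intK intU by simp
      fix y
      have s1: "\<bar>\<sigma> y \<bullet> e\<bar> \<le> 1" using Cauchy_Schwarz_ineq2[of "\<sigma> y" e] e \<sigma>_le[of y] by simp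
      have eq: "\<sigma> y \<bullet> smear \<epsilon> \<Psi> y = (\<sigma> y \<bullet> e) * b y" by (simp add: sm)
      consider "y \<in> K" | "y \<in> U1 - K" | "y \<notin> U1" by blast
      then show "(1 - q) * (indicator K y * \<kappa> \<epsilon> y) - indicator (U1 - K) y - B * \<epsilon> \<le> \<sigma> y \<bullet> smear \<epsilon> \<Psi> y"
      proof cases
        case 1
        have "(1 - q) * \<kappa> \<epsilon> y \<le> (\<sigma> y \<bullet> e) * \<kappa> \<epsilon> y" using q[OF 1] \<kappa>_bounds[OF \<epsilon>(1)] by (intro mult_right_mono) auto
        also have "\<dots> = (\<sigma> y \<bullet> e) * b y + (\<sigma> y \<bullet> e) * (\<kappa> \<epsilon> y - b y)" by (simp add: algebra_simps)
        also have "(\<sigma> y \<bullet> e) * (\<kappa> \<epsilon> y - b y) \<le> \<bar>\<sigma> y \<bullet> e\<bar> * \<bar>\<kappa> \<epsilon> y - b y\<bar>" by (metis abs_ge_self abs_mult)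
        also have "\<dots> \<le> 1 * (B * \<epsilon>)" using b_near[of y] \<phi>(7)[OF 1] s1 by (intro mult_mono) (auto simp: abs_minus_commute)
        finally show ?thesis using 1 eq by simp
      next
        case 2
        have "\<bar>\<sigma> y \<bullet> e\<bar> * \<bar>b y\<bar> \<le> 1 * 1" by (intro mult_mono s1 b1) auto
        then have "- 1 \<le> (\<sigma> y \<bullet> e) * b y" by (simp add: abs_mult[symmetric] abs_le_iff)
        moreover have "0 \<le> B * \<epsilon>" using B(1) \<epsilon>(1) by simp
        ultimately show ?thesis using 2 eq by simp
      next
        case 3
        have "y \<notin> L" using 3 \<phi>(3) by (auto simp: U_def)
        then have "\<bar>b y\<bar> \<le> B * \<epsilon>" using b_near[of y] \<phi>(4)[of y] by simp
        then have "\<bar>\<sigma> y \<bullet> e\<bar> * \<bar>b y\<bar> \<le> 1 * (B * \<epsilon>)" by (intro mult_mono s1) auto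
        then have "- (B * \<epsilon>) \<le> (\<sigma> y \<bullet> e) * b y" by (simp add: abs_mult[symmetric] abs_le_iff)
        then show ?thesis using 3 U1(2) eq by (auto simp: indicator_def)
      qed
    qed
    finally have "(1 - q) * (LINT y|\<nu>. indicator K y * \<kappa> \<epsilon> y) - measure \<nu> (U1 - K) - B * \<epsilon> * V \<le> (LINT y|\<nu>. \<sigma> y \<bullet> smear \<epsilon> \<Psi> y)" .
    moreover have "measure \<nu> (U1 - K) < \<eta>'"
      using U1 KB \<nu>_sets by (subst \<nu>.finite_measure_Diff) auto
    ultimately show "(1 - q) * (LINT y|\<nu>. indicator K y * \<kappa> \<epsilon> y) \<le> c * hK + \<eta>"
      using A GB \<epsilon>BV \<eta>'(2) by linarith
  qed
qed

end

section \<open>The total weight of the singular part\<close>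

lemma sets_hausdorff_measure: "sets (hausdorff_measure k :: 'a::metric_space measure) = sets borel"
  unfolding hausdorff_measure_def using sets.sigma_sets_eq[of "borel :: 'a measure"] by simp

text \<open>Additivity on disjoint Borel sets is essential here: subadditivity of the outer measure
  gives the opposite inequality.\<close>

lemma sum_hausdorff_outer_le:
  fixes K :: "nat \<Rightarrow> 'a::metric_space set"
  assumes "disjoint_family_on K {..<N}" "\<And>n. n < N \<Longrightarrow> K n \<in> sets borel" "\<And>n. n < N \<Longrightarrow> K n \<subseteq> P" 
  shows "(\<Sum>n<N. hausdorff_outer k (K n)) \<le> hausdorff_outer k P"
proof -
  have "(\<Sum>n<N. hausdorff_outer k (K n)) = (\<Sum>n<N. emeasure (hausdorff_measure k) (K n))"
    using assms(2) by (intro sum.cong) (auto simp: emeasure_hausdorff_measure)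
  also have "\<dots> = emeasure (hausdorff_measure k) (\<Union>n<N. K n)"
    using assms by (intro sum_emeasure) (auto simp: sets_hausdorff_measure)
  also have "\<dots> = hausdorff_outer k (\<Union>n<N. K n)"
    using assms(2) by (intro emeasure_hausdorff_measure) auto
  also have "\<dots> \<le> hausdorff_outer k P"
    using assms(3) by (intro hausdorff_outer_mono) auto
  finally show ?thesis .
qed

text \<open>For unit vectors the inner product is 1 minus half the squared distance, so a
  \<open>q\<close>-net of the compact sphere suffices.\<close>

lemma finite_sphere_net:
  assumes "0 < q" "q < 1"
  obtains xs :: "'a::euclidean_space list" where "\<And>e. e \<in> set xs \<Longrightarrow> norm e = 1"
    "\<And>s. norm s = 1 \<Longrightarrow> \<exists>e\<in>set xs. 1 - q \<le> s \<bullet> e"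
proof -
  have "sphere (0::'a) 1 \<subseteq> (\<Union>e\<in>sphere 0 1. ball e q)" using assms by force
  then obtain E where E: "E \<subseteq> sphere (0::'a) 1" "finite E" "sphere 0 1 \<subseteq> (\<Union>e\<in>E. ball e q)"
    using compactE_image[OF compact_sphere[of "0::'a" 1], of "sphere 0 1" "\<lambda>e. ball e q"] by (metis open_ball)
  obtain xs where xs: "set xs = E" using finite_list[OF E(2)] by blast
  show thesis
  proof (rule that[of xs])
    show "norm e = 1" if "e \<in> set xs" for e using that E(1) xs by auto
    fix s :: 'a assume s: "norm s = 1"
    then have "s \<in> sphere 0 1" by simp
    then obtain e where e: "e \<in> E" "dist e s < q" using E(3) by (meson UN_E mem_ball subsetD)
    then have "norm e = 1" using E(1) by auto
    have "(norm (s - e))\<^sup>2 = (norm s)\<^sup>2 + (norm e)\<^sup>2 - 2 * (s \<bullet> e)"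
      unfolding power2_norm_eq_inner by (simp add: inner_diff_left inner_diff_right inner_commute)
    also have "\<dots> = 2 - 2 * (s \<bullet> e)" using s \<open>norm e = 1\<close> by simp
    finally have "s \<bullet> e = 1 - (norm (s - e))\<^sup>2 / 2" by linarith
    moreover have "(norm (s - e))\<^sup>2 \<le> q * 1"
      unfolding power2_eq_square using e(2) assms by (intro mult_mono) (auto simp: dist_norm norm_minus_commute)
    ultimately show "\<exists>e\<in>set xs. 1 - q \<le> s \<bullet> e" using e(1) xs assms by (intro bexI[of _ e]) auto
  qed
qed

context truncated_jump
begin

text \<open>\<open>P\<close> is cut into finitely many disjoint Borel pieces according to a net
  direction close to \<open>\<sigma>\<close>, each is approximated in \<open>\<nu>\<close>-measure
  by a compact subset, and the bounds for the compact pieces add up because their Hausdorff measures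
  sum to at most \<open>h\<close>.\<close>

lemma \<kappa>_bound_with_slack:
  assumes q: "0 < q" "q < 1" and \<eta>: "\<eta> > 0"
  shows "eventually (\<lambda>\<epsilon>. (1 - q) * (LINT y|\<nu>. \<kappa> \<epsilon> y) \<le> c * h + \<eta>) (at_right 0)"
proof -
  obtain xs :: "'a list" where xs: "\<And>e. e \<in> set xs \<Longrightarrow> norm e = 1"
    "\<And>s. norm s = 1 \<Longrightarrow> \<exists>e\<in>set xs. 1 - q \<le> s \<bullet> e"
    by (rule finite_sphere_net[OF q]) (rule that)
  define N where "N = length xs"
  \<comment> \<open>The condition \<open>n < N\<close> sits inside the set so that \<open>B\<close>
    is a sequence, empty from \<open>N\<close> on, to which \<open>disjointed\<close>
    applies.\<close>
  define B where "B n = {x \<in> P. n < N \<and> 1 - q \<le> \<sigma> x \<bullet> (xs ! n)}" for n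
  note \<sigma>_measurable[measurable] P_borel[measurable] \<nu>_sets[measurable_cong]
  have BB: "B n \<in> sets borel" for n unfolding B_def by measurable
  define A where "A = disjointed B"
  have AB: "A n \<in> sets borel" for n
    unfolding A_def using sets.range_disjointed_sets[of B borel] BB by auto
  have Adisj: "disjoint_family A" unfolding A_def by (rule disjoint_family_disjointed)
  have Asub: "A n \<subseteq> B n" for n unfolding A_def by (rule disjointed_subset)
  have UA: "P \<subseteq> (\<Union>n<N. A n)"
  proof
    fix x assume x: "x \<in> P"
    obtain e where "e \<in> set xs" "1 - q \<le> \<sigma> x \<bullet> e" using xs(2)[OF \<sigma>_unit[OF x]] by blast
    then obtain m where "m < N" "1 - q \<le> \<sigma> x \<bullet> (xs ! m)" by (auto simp: in_set_conv_nth N_def)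
    then have "x \<in> (\<Union>n. B n)" using x by (auto simp: B_def)
    then have "x \<in> (\<Union>n. A n)" by (simp add: A_def UN_disjointed_eq)
    then obtain n where "x \<in> A n" by blast
    moreover then have "n < N" using Asub[of n] by (auto simp: B_def)
    ultimately show "x \<in> (\<Union>n<N. A n)" by blast
  qed
  \<comment> \<open>Each of the \<open>N\<close> pieces spends \<open>\<eta>'\<close> twice: in its
    own bound and for the part of \<open>A n\<close> not covered by \<open>K n\<close>.\<close>
  define \<eta>' where "\<eta>' = \<eta> / (2 * (real N + 1))"
  have \<eta>': "\<eta>' > 0" "2 * (real N * \<eta>') \<le> \<eta>"
    using \<eta> by (auto simp: \<eta>'_def field_simps)
  have "\<exists>K. compact K \<and> K \<subseteq> A n \<and> measure \<nu> (A n) \<le> measure \<nu> K + \<eta>'" for n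
  proof -
    have sup: "emeasure \<nu> (A n) = (SUP K \<in> {K. K \<subseteq> A n \<and> compact K}. emeasure \<nu> K)"
      using AB \<nu>_sets by (intro inner_regular) (auto simp: \<nu>.emeasure_eq_measure)
    show ?thesis
    \<comment> \<open>Inner regularity is stated in \<open>ennreal\<close>, so the difference with
      \<open>\<eta>'\<close> must be nonnegative; otherwise the empty set is good enough.\<close>
    proof (cases "measure \<nu> (A n) \<le> \<eta>'")
      case True
      then show ?thesis by (intro exI[of _ "{}"]) auto
    next
      case False
      have "ennreal (measure \<nu> (A n) - \<eta>') < emeasure \<nu> (A n)"
        using False \<eta>'(1) by (simp add: \<nu>.emeasure_eq_measure ennreal_less_iff)
      then obtain K where K: "K \<subseteq> A n" "compact K" "ennreal (measure \<nu> (A n) - \<eta>') < emeasure \<nu> K"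
        unfolding sup less_SUP_iff by auto
      then have "measure \<nu> (A n) - \<eta>' < measure \<nu> K"
        using False by (simp add: \<nu>.emeasure_eq_measure ennreal_less_iff)
      then show ?thesis using K by (intro exI[of _ K]) auto
    qed
  qed
  then obtain K where K: "\<And>n. compact (K n)" "\<And>n. K n \<subseteq> A n" "\<And>n. measure \<nu> (A n) \<le> measure \<nu> (K n) + \<eta>'"
    by metis
  have KB[measurable]: "K n \<in> sets borel" for n using K(1) by (rule borel_compact)
  have KP: "K n \<subseteq> P" for n using K(2)[of n] Asub[of n] by (auto simp: B_def)
  have fin: "hausdorff_outer (DIM('a) - 1) (K n) \<le> ennreal h" for n
    using hausdorff_outer_mono[OF KP, of "DIM('a) - 1" n] P_hausdorff by (rule order_trans)
  define hk where "hk n = enn2real (hausdorff_outer (DIM('a) - 1) (K n))" for n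
  have hk: "hausdorff_outer (DIM('a) - 1) (K n) = ennreal (hk n)" "hk n \<ge> 0" for n
    using fin[of n] by (auto simp: hk_def less_top[symmetric] intro!: ennreal_enn2real[symmetric] dest: le_less_trans[OF _ ennreal_less_top])
  have sumh: "(\<Sum>n<N. hk n) \<le> h"
  proof -
    have "ennreal (\<Sum>n<N. hk n) = (\<Sum>n<N. hausdorff_outer (DIM('a) - 1) (K n))"
      using hk by (subst sum_ennreal[symmetric]) auto
    also have "\<dots> \<le> hausdorff_outer (DIM('a) - 1) P"
    proof (rule sum_hausdorff_outer_le)
      show "disjoint_family_on K {..<N}"
        using Adisj K(2) unfolding disjoint_family_on_def by blast
    qed (use KP KB in auto)
    also have "\<dots> \<le> ennreal h" by (rule P_hausdorff)
    finally show ?thesis using h_nonneg by (simp add: ennreal_le_iff)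
  qed
  have "eventually (\<lambda>\<epsilon>. \<forall>n\<in>{..<N}. (1 - q) * (LINT y|\<nu>. indicator (K n) y * \<kappa> \<epsilon> y) \<le> c * hk n + \<eta>') (at_right 0)"
  proof (rule eventually_ball_finite)
    show "\<forall>n\<in>{..<N}. \<forall>\<^sub>F \<epsilon> in at_right 0. (1 - q) * (LINT y|\<nu>. indicator (K n) y * \<kappa> \<epsilon> y) \<le> c * hk n + \<eta>'"
    proof
      fix n assume n: "n \<in> {..<N}"
      show "\<forall>\<^sub>F \<epsilon> in at_right 0. (1 - q) * (LINT y|\<nu>. indicator (K n) y * \<kappa> \<epsilon> y) \<le> c * hk n + \<eta>'"
      proof (rule piece_bound[OF K(1) KP])
        show "norm (xs ! n) = 1" using n xs(1) by (simp add: N_def)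
        show "1 - q \<le> \<sigma> x \<bullet> (xs ! n)" if "x \<in> K n" for x using that K(2)[of n] Asub[of n] by (auto simp: B_def)
      qed (use hk \<eta>' in auto)
    qed
  qed simp
  moreover have "eventually (\<lambda>\<epsilon>. 0 < \<epsilon>) (at_right (0::real))" by (simp add: eventually_at_right_less)
  ultimately show ?thesis
  proof eventually_elim
    case (elim \<epsilon>)
    note \<epsilon> = elim(2)
    have \<kappa>m[measurable]: "\<kappa> \<epsilon> \<in> borel_measurable borel" by (rule \<kappa>_measurable[OF \<epsilon>])
    have intK: "integrable \<nu> (\<lambda>y. indicator (K n) y * \<kappa> \<epsilon> y)" for n
      using integrable_mult_indicator[OF _ \<kappa>_integrable[OF \<epsilon>], of "K n"] KB \<nu>_sets by simp
    have AK: "A n - K n \<in> sets \<nu>" for n using AB KB \<nu>_sets by auto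
    have intA: "integrable \<nu> (indicator (A n - K n) :: 'a \<Rightarrow> real)" for n
      using AK by (intro integrable_real_indicator) (auto simp: \<nu>.emeasure_eq_measure)
    have "(LINT y|\<nu>. \<kappa> \<epsilon> y) \<le> (LINT y|\<nu>. (\<Sum>n<N. indicator (K n) y * \<kappa> \<epsilon> y + indicator (A n - K n) y))"
    proof (rule integral_mono_AE)
      show "integrable \<nu> (\<kappa> \<epsilon>)" by (rule \<kappa>_integrable[OF \<epsilon>])
      show "integrable \<nu> (\<lambda>y. \<Sum>n<N. indicator (K n) y * \<kappa> \<epsilon> y + indicator (A n - K n) y)"
        using intK intA by auto
      have "- P \<in> null_sets \<nu>" using P_carrier P_borel \<nu>_sets by (auto simp: null_sets_def)
      then have "AE y in \<nu>. y \<notin> - P" by (rule AE_not_in)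
      then show "AE y in \<nu>. \<kappa> \<epsilon> y \<le> (\<Sum>n<N. indicator (K n) y * \<kappa> \<epsilon> y + indicator (A n - K n) y)"
      proof eventually_elim
        case (elim y)
        then obtain n where n: "n < N" "y \<in> A n" using UA by auto
        have "\<kappa> \<epsilon> y \<le> indicator (K n) y * \<kappa> \<epsilon> y + indicator (A n - K n) y"
          using n(2) \<kappa>_bounds[OF \<epsilon>, of y] by (auto simp: indicator_def)
        also have "\<dots> \<le> (\<Sum>n<N. indicator (K n) y * \<kappa> \<epsilon> y + indicator (A n - K n) y)"
          by (rule member_le_sum[of n "{..<N}" "\<lambda>n. indicator (K n) y * \<kappa> \<epsilon> y + indicator (A n - K n) y"])
             (use n \<kappa>_bounds[OF \<epsilon>, of y] in auto)
        finally show ?case .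
      qed
    qed
    also have "\<dots> = (\<Sum>n<N. (LINT y|\<nu>. indicator (K n) y * \<kappa> \<epsilon> y) + measure \<nu> (A n - K n))"
    proof -
      have "(LINT y|\<nu>. (\<Sum>n<N. indicator (K n) y * \<kappa> \<epsilon> y + indicator (A n - K n) y))
          = (\<Sum>n<N. LINT y|\<nu>. indicator (K n) y * \<kappa> \<epsilon> y + indicator (A n - K n) y)"
        using intK intA by (intro Bochner_Integration.integral_sum Bochner_Integration.integrable_add)
      also have "\<dots> = (\<Sum>n<N. (LINT y|\<nu>. indicator (K n) y * \<kappa> \<epsilon> y) + measure \<nu> (A n - K n))"
      proof (rule sum.cong[OF refl])
        fix n
        have "space \<nu> = UNIV" using sets_eq_imp_space_eq[OF \<nu>_sets] by simp
        then show "(LINT y|\<nu>. indicator (K n) y * \<kappa> \<epsilon> y + indicator (A n - K n) y) = (LINT y|\<nu>. indicator (K n) y * \<kappa> \<epsilon> y) + measure \<nu> (A n - K n)"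
          using intK[of n] intA[of n] AK[of n] by simp
      qed
      finally show ?thesis .
    qed
    also have "\<dots> \<le> (\<Sum>n<N. (LINT y|\<nu>. indicator (K n) y * \<kappa> \<epsilon> y) + \<eta>')"
    proof (intro sum_mono add_left_mono)
      fix n
      show "measure \<nu> (A n - K n) \<le> \<eta>'"
        using K(2,3)[of n] AB KB \<nu>_sets by (subst \<nu>.finite_measure_Diff) auto
    qed
    finally have "(1 - q) * (LINT y|\<nu>. \<kappa> \<epsilon> y) \<le> (1 - q) * (\<Sum>n<N. (LINT y|\<nu>. indicator (K n) y * \<kappa> \<epsilon> y) + \<eta>')"
      using q by (intro mult_left_mono) auto
    also have "\<dots> = (\<Sum>n<N. (1 - q) * (LINT y|\<nu>. indicator (K n) y * \<kappa> \<epsilon> y) + (1 - q) * \<eta>')"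
      by (simp add: sum_distrib_left distrib_left)
    also have "\<dots> \<le> (\<Sum>n<N. (c * hk n + \<eta>') + 1 * \<eta>')"
      using elim(1) q \<eta>'(1) by (intro sum_mono add_mono mult_right_mono) auto
    also have "\<dots> = c * (\<Sum>n<N. hk n) + 2 * (real N * \<eta>')"
      by (simp add: sum.distrib sum_distrib_left)
    also have "\<dots> \<le> c * h + \<eta>" using sumh c_nonneg \<eta>'(2) by (intro add_mono mult_left_mono)
    finally show ?case .
  qed
qed

text \<open>As \<open>\<kappa>\<close> is at most 1, the part lost to the factor
  \<open>1 - q\<close> is at most \<open>q\<close> times the total mass, and \<open>q\<close> is
  chosen to make this at most \<open>\<delta> / 2\<close>.\<close>

lemma \<kappa>_bound:
  assumes \<delta>: "\<delta> > 0"
  shows "eventually (\<lambda>\<epsilon>. (LINT y|\<nu>. \<kappa> \<epsilon> y) \<le> c * h + \<delta>) (at_right 0)"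
proof -
  define V where "V = measure \<nu> (space \<nu>)"
  have V: "V \<ge> 0" by (simp add: V_def)
  define q where "q = min (1/2) (\<delta> / (2 * (V + 1)))"
  have q: "0 < q" "q < 1" using \<delta> V by (auto simp: q_def)
  have qV: "q * V \<le> \<delta> / 2"
  proof -
    have "q * V \<le> \<delta> / (2 * (V + 1)) * (V + 1)" using V \<delta> by (intro mult_mono) (auto simp: q_def)
    also have "\<dots> = \<delta> / 2"
    proof -
      have "V + 1 \<noteq> 0" using V by simp
      then show ?thesis by (simp add: field_simps)
    qed
    finally show ?thesis .
  qed
  have "eventually (\<lambda>\<epsilon>. (1 - q) * (LINT y|\<nu>. \<kappa> \<epsilon> y) \<le> c * h + \<delta> / 2) (at_right 0)"
    using \<kappa>_bound_with_slack[OF q, of "\<delta>/2"] \<delta> by simp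
  moreover have "eventually (\<lambda>\<epsilon>. 0 < \<epsilon>) (at_right (0::real))" by (simp add: eventually_at_right_less)
  ultimately show ?thesis
  proof eventually_elim
    case (elim \<epsilon>)
    have "(LINT y|\<nu>. \<kappa> \<epsilon> y) \<le> (LINT y|\<nu>. 1)"
      using \<kappa>_integrable[OF elim(2)] \<kappa>_bounds[OF elim(2)] by (intro Bochner_Integration.integral_mono) auto
    then have "q * (LINT y|\<nu>. \<kappa> \<epsilon> y) \<le> q * V" using q by (intro mult_left_mono) (auto simp: V_def)
    then show ?case using elim(1) qV by (simp add: algebra_simps)
  qed
qed

text \<open>Classical integration by parts for T of the mollified z against \<open>Y\<close>,
  followed by \<epsilon> tending to 0. The Lebesgue terms converge because z has approximate limit z
  x at almost every x in \<Omega>. On the singular part only an upper bound is taken: its integrand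
  is at most \<open>s\<close> times \<open>\<kappa>\<close>, whose integral is controlled by
  \<open>\<kappa>_bound\<close>.\<close>

lemma flux_inequality:
  fixes Y :: "'a \<Rightarrow> 'a" and DY :: "'a \<Rightarrow> 'a \<Rightarrow> 'a"
  assumes Y: "\<And>i. i \<in> Basis \<Longrightarrow> C1_with_grad (\<lambda>x. Y x \<bullet> i) (DY i)"
    and K: "compact K" "K \<subseteq> \<Omega>" "\<And>x. x \<notin> K \<Longrightarrow> Y x = 0" and s: "\<And>x. norm (Y x) \<le> s"
  shows "- (LINT x|lborel. T (z x) * (\<Sum>i\<in>Basis. DY i x \<bullet> i)) \<le> (LINT x|lborel. T' (z x) * (Y x \<bullet> G x)) + s * (c * h)"
proof -
  define dv where "dv x = (\<Sum>i\<in>Basis. DY i x \<bullet> i)" for x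
  have s0: "s \<ge> 0" using s[of 0] norm_ge_zero order_trans by blast
  note \<sigma>_measurable[measurable] \<nu>_sets[measurable_cong]
  have Gm[measurable]: "G \<in> borel_measurable borel" and zm[measurable]: "z \<in> borel_measurable borel"
    using G_integrable z_integrable by (auto dest: borel_measurable_integrable)
  have Ycont: "continuous_on UNIV Y"
  proof -
    have "continuous_on UNIV (\<lambda>x. \<Sum>i\<in>Basis. (Y x \<bullet> i) *\<^sub>R i)"
      by (intro continuous_intros C1_with_grad_continuous[OF Y])
    then show ?thesis by (simp add: euclidean_representation)
  qed
  then have Ym[measurable]: "Y \<in> borel_measurable borel" by (rule borel_measurable_continuous_onI)
  have DY0: "DY i x = 0" if "i \<in> Basis" "x \<notin> K" for i x
    by (rule C1_with_grad_zero_outside[OF Y[OF that(1)] compact_imp_closed[OF K(1)] _ that(2)]) (simp add: K(3))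
  have dv0: "dv x = 0" if "x \<notin> K" for x using DY0[OF _ that] by (simp add: dv_def)
  have dvc: "continuous_on UNIV dv"
    unfolding dv_def by (intro continuous_intros C1_with_grad_continuous_grad[OF Y])
  then have dvm[measurable]: "dv \<in> borel_measurable borel" by (rule borel_measurable_continuous_onI)
  have dvi: "integrable lborel dv" by (rule integrable_continuous_compact_support[OF dvc K(1) dv0])
  obtain r where r: "r > 0" "(\<Union>x\<in>K. cball x r) \<subseteq> \<Omega>"
    using compact_subset_open_imp_cball_epsilon_subset[OF K(1) open_domain K(2)] by blast
  have Tc: "continuous_on UNIV T"
    using T_deriv by (meson DERIV_isCont continuous_at_imp_continuous_on)
  have [measurable]: "T \<in> borel_measurable borel" "T' \<in> borel_measurable borel"
    using borel_measurable_continuous_onI[OF Tc] borel_measurable_continuous_onI[OF T'_cont] by auto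
  define \<epsilon> where "\<epsilon> n = inverse (real (Suc n))" for n
  have \<epsilon>: "\<epsilon> n > 0" for n by (simp add: \<epsilon>_def)
  have \<epsilon>_lim: "filterlim \<epsilon> (at_right 0) sequentially"
    unfolding \<epsilon>_def filterlim_at using LIMSEQ_inverse_real_of_nat by (simp del: of_nat_Suc)
  have \<epsilon>_lim0: "\<epsilon> \<longlonglongrightarrow> 0" unfolding \<epsilon>_def by (rule LIMSEQ_inverse_real_of_nat)
  define \<Psi> where "\<Psi> n x = T' (mollify (\<epsilon> n) z x) *\<^sub>R Y x" for n x
  have am[measurable]: "(\<lambda>x. T' (mollify (\<epsilon> n) z x)) \<in> borel_measurable borel" for n by (rule T'_mollify_measurable[OF \<epsilon>])
  have \<Psi>m[measurable]: "\<Psi> n \<in> borel_measurable borel" for n unfolding \<Psi>_def by measurable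
  have \<Psi>s: "norm (\<Psi> n x) \<le> s" for n x
  proof -
    have "T' (mollify (\<epsilon> n) z x) * norm (Y x) \<le> 1 * s" by (intro mult_mono T'_le s) auto
    then show ?thesis by (simp add: \<Psi>_def T'_nonneg)
  qed
  have main: "- (LINT x|lborel. T (mollify (\<epsilon> n) z x) * dv x) = (LINT y|\<nu>. \<sigma> y \<bullet> smear (\<epsilon> n) (\<Psi> n) y) + (LINT y|lborel. G y \<bullet> smear (\<epsilon> n) (\<Psi> n) y)"
    if "\<epsilon> n < r" for n
  proof -
    note parts = integral_by_parts_mollify[OF \<epsilon>[of n] Y K(1)]
    have "(LINT x|lborel. T (mollify (\<epsilon> n) z x) * dv x) = (LINT x|lborel. (\<Sum>i\<in>Basis. T (mollify (\<epsilon> n) z x) * (DY i x \<bullet> i)))"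
      by (simp add: dv_def sum_distrib_left)
    also have "\<dots> = (\<Sum>i\<in>Basis. LINT x|lborel. T (mollify (\<epsilon> n) z x) * (DY i x \<bullet> i))"
      by (intro Bochner_Integration.integral_sum parts(2)) (auto simp: K(3))
    also have "\<dots> = (\<Sum>i\<in>Basis. - (LINT x|lborel. (Y x \<bullet> i) * (T' (mollify (\<epsilon> n) z x) * (mollify_grad (\<epsilon> n) z x \<bullet> i))))"
      by (intro sum.cong refl) (subst parts(1), auto simp: K(3))
    also have "\<dots> = - (\<Sum>i\<in>Basis. LINT x|lborel. (Y x \<bullet> i) * (T' (mollify (\<epsilon> n) z x) * (mollify_grad (\<epsilon> n) z x \<bullet> i)))"
      by (rule sum_negf)
    also have "(\<Sum>i\<in>Basis. LINT x|lborel. (Y x \<bullet> i) * (T' (mollify (\<epsilon> n) z x) * (mollify_grad (\<epsilon> n) z x \<bullet> i)))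
        = (LINT x|lborel. (\<Sum>i\<in>Basis. (Y x \<bullet> i) * (T' (mollify (\<epsilon> n) z x) * (mollify_grad (\<epsilon> n) z x \<bullet> i))))"
      by (intro Bochner_Integration.integral_sum[symmetric] parts(3)) (auto simp: K(3))
    also have "\<dots> = (LINT x|lborel. \<Psi> n x \<bullet> mollify_grad (\<epsilon> n) z x)"
      by (intro Bochner_Integration.integral_cong refl)
         (subst euclidean_inner[of "\<Psi> n _"], simp add: \<Psi>_def mult_ac)
    finally have "- (LINT x|lborel. T (mollify (\<epsilon> n) z x) * dv x) = (LINT x|lborel. \<Psi> n x \<bullet> mollify_grad (\<epsilon> n) z x)" by simp
    also have "\<dots> = (LINT y|\<nu>. \<sigma> y \<bullet> smear (\<epsilon> n) (\<Psi> n) y) + (LINT y|lborel. G y \<bullet> smear (\<epsilon> n) (\<Psi> n) y)"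
    proof (rule flux_mollify[OF \<epsilon> \<Psi>m \<Psi>s])
      have L: "x \<in> K" if "\<Psi> n x \<noteq> 0" for x using that K(3)[of x] by (auto simp: \<Psi>_def)
      show "cball x (\<epsilon> n) \<subseteq> \<Omega>" if "\<Psi> n x \<noteq> 0" for x
      proof -
        have "cball x (\<epsilon> n) \<subseteq> cball x r" using \<open>\<epsilon> n < r\<close> by auto
        also have "\<dots> \<subseteq> \<Omega>" using r(2) L[OF that] by blast
        finally show ?thesis .
      qed
      show "bounded {x. \<Psi> n x \<noteq> 0}" by (rule bounded_subset[OF compact_imp_bounded[OF K(1)]]) (rule subsetI, simp add: L)
    qed
    finally show ?thesis .
  qed
  have lim1: "(\<lambda>n. LINT x|lborel. T (mollify (\<epsilon> n) z x) * dv x) \<longlonglongrightarrow> (LINT x|lborel. T (z x) * dv x)"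
  proof (rule integral_dominated_convergence[where w="\<lambda>x. c / 2 * \<bar>dv x\<bar>"])
    have mm[measurable]: "mollify (\<epsilon> n) z \<in> borel_measurable borel" for n
      using C1_with_grad_measurable(1)[OF C1_with_grad_mollify[OF \<epsilon> z_integrable]] .
    show "(\<lambda>x. T (mollify (\<epsilon> n) z x) * dv x) \<in> borel_measurable lborel" for n by measurable
    show "(\<lambda>x. T (z x) * dv x) \<in> borel_measurable lborel" by measurable
    show "integrable lborel (\<lambda>x. c / 2 * \<bar>dv x\<bar>)" using dvi by auto
    show "AE x in lborel. norm (T (mollify (\<epsilon> n) z x) * dv x) \<le> c / 2 * \<bar>dv x\<bar>" for n
      using mult_right_mono[OF T_le abs_ge_zero] by (intro AE_I2) (simp add: abs_mult)
    show "AE x in lborel. (\<lambda>n. T (mollify (\<epsilon> n) z x) * dv x) \<longlonglongrightarrow> T (z x) * dv x"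
      using z_approx_limit
    proof eventually_elim
      case (elim x)
      show ?case
      proof (cases "x \<in> \<Omega>")
        case True
        have "(\<lambda>n. mollify (\<epsilon> n) z x) \<longlonglongrightarrow> z x"
          unfolding tendsto_iff
        proof (intro allI impI)
          fix \<delta> :: real assume "\<delta> > 0"
          from mollify_approx_limit[OF z_integrable _ order_refl this, of x "z x"] elim True
          have "eventually (\<lambda>\<epsilon>. \<forall>w. dist w x \<le> 0 * \<epsilon> \<longrightarrow> \<bar>mollify \<epsilon> z w - z x\<bar> < \<delta>) (at_right 0)" by simp
          from eventually_compose_filterlim[OF this \<epsilon>_lim]
          show "eventually (\<lambda>n. dist (mollify (\<epsilon> n) z x) (z x) < \<delta>) sequentially"
            by eventually_elim (simp add: dist_real_def)
        qed
        then have "(\<lambda>n. T (mollify (\<epsilon> n) z x)) \<longlonglongrightarrow> T (z x)"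
          by (rule continuous_on_tendsto_compose[OF Tc]) auto
        then show ?thesis by (intro tendsto_mult tendsto_const)
      next
        case False
        then have "dv x = 0" using dv0 K(2) by blast
        then show ?thesis by simp
      qed
    qed
  qed
  have lim2: "(\<lambda>n. LINT y|lborel. G y \<bullet> smear (\<epsilon> n) (\<Psi> n) y) \<longlonglongrightarrow> (LINT y|lborel. G y \<bullet> (T' (z y) *\<^sub>R Y y))"
  proof (rule integral_dominated_convergence[where w="\<lambda>x. s * norm (G x)"])
    show "(\<lambda>y. G y \<bullet> smear (\<epsilon> n) (\<Psi> n) y) \<in> borel_measurable lborel" for n by measurable
    show "(\<lambda>y. G y \<bullet> (T' (z y) *\<^sub>R Y y)) \<in> borel_measurable lborel" by measurable
    show "integrable lborel (\<lambda>x. s * norm (G x))" using G_integrable by auto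
    show "AE y in lborel. norm (G y \<bullet> smear (\<epsilon> n) (\<Psi> n) y) \<le> s * norm (G y)" for n
    proof (intro AE_I2)
      fix y
      have "\<bar>G y \<bullet> smear (\<epsilon> n) (\<Psi> n) y\<bar> \<le> norm (G y) * norm (smear (\<epsilon> n) (\<Psi> n) y)" by (rule Cauchy_Schwarz_ineq2)
      also have "\<dots> \<le> norm (G y) * s" by (intro mult_left_mono norm_smear_le[OF \<epsilon> \<Psi>m \<Psi>s]) auto
      finally show "norm (G y \<bullet> smear (\<epsilon> n) (\<Psi> n) y) \<le> s * norm (G y)" by (simp add: mult.commute)
    qed
    show "AE y in lborel. (\<lambda>n. G y \<bullet> smear (\<epsilon> n) (\<Psi> n) y) \<longlonglongrightarrow> G y \<bullet> (T' (z y) *\<^sub>R Y y)"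
      using z_approx_limit
    proof eventually_elim
      case (elim y)
      show ?case
      proof (cases "y \<in> \<Omega>")
        case False
        then show ?thesis using G_zero by simp
      next
        case True
        have "(\<lambda>n. smear (\<epsilon> n) (\<Psi> n) y) \<longlonglongrightarrow> T' (z y) *\<^sub>R Y y"
          unfolding tendsto_iff
        proof (intro allI impI)
          fix \<delta> :: real assume \<delta>: "\<delta> > 0"
          have "continuous_on UNIV (\<lambda>p. T' (fst p) *\<^sub>R Y (snd p))"
            by (intro continuous_intros continuous_on_compose2[OF T'_cont] continuous_on_compose2[OF Ycont]) auto
          then obtain \<rho> where \<rho>: "\<rho> > 0" "\<And>p. dist p (z y, y) < \<rho> \<Longrightarrow> dist (T' (fst p) *\<^sub>R Y (snd p)) (T' (z y) *\<^sub>R Y y) < \<delta> / 2"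
            unfolding continuous_on_iff using \<delta> by (metis UNIV_I fst_conv snd_conv half_gt_zero)
          have "\<rho> / 2 > 0" using \<rho> by simp
          \<comment> \<open>The smeared field averages over a ball of radius
            \<open>\<epsilon> n\<close> about \<open>y\<close>, so the mollifications of
            \<open>z\<close> must be close to \<open>z y\<close> on that whole ball: the case c =
            1.\<close>
          from mollify_approx_limit[OF z_integrable _ zero_le_one this, of y "z y"] elim True
          have "eventually (\<lambda>\<epsilon>. \<forall>w. dist w y \<le> 1 * \<epsilon> \<longrightarrow> \<bar>mollify \<epsilon> z w - z y\<bar> < \<rho> / 2) (at_right 0)" by simp
          from eventually_compose_filterlim[OF this \<epsilon>_lim]
          have "eventually (\<lambda>n. \<forall>w. dist w y \<le> 1 * \<epsilon> n \<longrightarrow> \<bar>mollify (\<epsilon> n) z w - z y\<bar> < \<rho> / 2) sequentially" .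
          moreover have "eventually (\<lambda>n. \<epsilon> n < \<rho> / 2) sequentially"
            using \<open>\<rho> / 2 > 0\<close> by (rule order_tendstoD(2)[OF \<epsilon>_lim0])
          ultimately show "eventually (\<lambda>n. dist (smear (\<epsilon> n) (\<Psi> n) y) (T' (z y) *\<^sub>R Y y) < \<delta>) sequentially"
          proof eventually_elim
            case (elim n)
            have "norm (smear (\<epsilon> n) (\<Psi> n) y - T' (z y) *\<^sub>R Y y) \<le> \<delta> / 2"
            proof (rule norm_smear_diff_le[OF \<epsilon> \<Psi>m \<Psi>s])
              fix x assume x: "dist x y < \<epsilon> n"
              then have "\<bar>mollify (\<epsilon> n) z x - z y\<bar> < \<rho> / 2" using elim(1) by simp
              then have "dist (mollify (\<epsilon> n) z x, x) (z y, y) < \<rho>"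
                using x elim(2) dist_Pair_Pair[of "mollify (\<epsilon> n) z x" x "z y" y]
                  sqrt_sum_squares_le_sum[of "dist (mollify (\<epsilon> n) z x) (z y)" "dist x y"] by (simp add: dist_real_def)
              from \<rho>(2)[OF this] show "norm (\<Psi> n x - T' (z y) *\<^sub>R Y y) \<le> \<delta> / 2" by (simp add: \<Psi>_def dist_norm)
            qed
            then show ?case using \<delta> by (simp add: dist_norm)
          qed
        qed
        then show ?thesis by (intro tendsto_inner tendsto_const)
      qed
    qed
  qed
  have "- (LINT x|lborel. T (z x) * dv x) \<le> (LINT y|lborel. G y \<bullet> (T' (z y) *\<^sub>R Y y)) + s * (c * h) + \<delta>'" if \<delta>': "\<delta>' > 0" for \<delta>'
  proof -
    \<comment> \<open>The slack in the bound on the weight is multiplied by \<open>s\<close>, which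
      may be 0.\<close>
    define \<delta> where "\<delta> = \<delta>' / (s + 1)"
    have \<delta>: "\<delta> > 0" "s * \<delta> \<le> \<delta>'" using \<delta>' s0 by (auto simp: \<delta>_def field_simps)
    have ev: "eventually (\<lambda>n. - (LINT x|lborel. T (mollify (\<epsilon> n) z x) * dv x) \<le> (LINT y|lborel. G y \<bullet> smear (\<epsilon> n) (\<Psi> n) y) + s * (c * h) + \<delta>') sequentially"
    proof -
      have "eventually (\<lambda>n. \<epsilon> n < r) sequentially"
        using r(1) by (rule order_tendstoD(2)[OF \<epsilon>_lim0])
      moreover have "eventually (\<lambda>n. (LINT y|\<nu>. \<kappa> (\<epsilon> n) y) \<le> c * h + \<delta>) sequentially"
        by (rule eventually_compose_filterlim[OF \<kappa>_bound[OF \<delta>(1)] \<epsilon>_lim])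
      ultimately show ?thesis
      proof eventually_elim
        case (elim n)
        have "(LINT y|\<nu>. \<sigma> y \<bullet> smear (\<epsilon> n) (\<Psi> n) y) \<le> (LINT y|\<nu>. s * \<kappa> (\<epsilon> n) y)"
        proof (rule Bochner_Integration.integral_mono)
          have bnd: "\<sigma> y \<bullet> smear (\<epsilon> n) (\<Psi> n) y \<le> s * \<kappa> (\<epsilon> n) y \<and> \<bar>\<sigma> y \<bullet> smear (\<epsilon> n) (\<Psi> n) y\<bar> \<le> s" for y
          proof -
            \<comment> \<open>Since \<open>T'\<close> is nonnegative and
              \<open>norm (Y x) \<le> s\<close>, the average of the norms is at most
              \<open>s\<close> times the average of the values of \<open>T'\<close>, that is
              \<open>s\<close> times \<open>\<kappa>\<close>.\<close>
            have "norm (smear (\<epsilon> n) (\<Psi> n) y) \<le> (LINT x|lborel. norm (mollifier (\<epsilon> n) (x - y) *\<^sub>R \<Psi> n x))"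
              unfolding smear_def by (rule integral_norm_bound)
            also have "\<dots> \<le> (LINT x|lborel. s * (mollifier (\<epsilon> n) (x - y) *\<^sub>R T' (mollify (\<epsilon> n) z x)))"
            proof (rule Bochner_Integration.integral_mono)
              show "integrable lborel (\<lambda>x. norm (mollifier (\<epsilon> n) (x - y) *\<^sub>R \<Psi> n x))"
                by (intro integrable_norm integrable_smear[OF \<epsilon> \<Psi>m \<Psi>s])
              show "integrable lborel (\<lambda>x. s * (mollifier (\<epsilon> n) (x - y) *\<^sub>R T' (mollify (\<epsilon> n) z x)))"
                by (intro integrable_mult_right integrable_smear[OF \<epsilon> am, of _ 1]) (simp add: T'_nonneg T'_le)
              fix x
              have "mollifier (\<epsilon> n) (x - y) * T' (mollify (\<epsilon> n) z x) * norm (Y x) \<le> mollifier (\<epsilon> n) (x - y) * T' (mollify (\<epsilon> n) z x) * s"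
                by (intro mult_left_mono s mult_nonneg_nonneg mollifier_nonneg T'_nonneg)
              then show "norm (mollifier (\<epsilon> n) (x - y) *\<^sub>R \<Psi> n x) \<le> s * (mollifier (\<epsilon> n) (x - y) *\<^sub>R T' (mollify (\<epsilon> n) z x))"
                by (simp add: \<Psi>_def mollifier_nonneg T'_nonneg mult_ac)
            qed
            also have "\<dots> = s * \<kappa> (\<epsilon> n) y" by (simp add: \<kappa>_def smear_def)
            finally have nk: "norm (smear (\<epsilon> n) (\<Psi> n) y) \<le> s * \<kappa> (\<epsilon> n) y" .
            have "\<bar>\<sigma> y \<bullet> smear (\<epsilon> n) (\<Psi> n) y\<bar> \<le> norm (\<sigma> y) * norm (smear (\<epsilon> n) (\<Psi> n) y)" by (rule Cauchy_Schwarz_ineq2)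
            also have "\<dots> \<le> 1 * norm (smear (\<epsilon> n) (\<Psi> n) y)" by (intro mult_right_mono \<sigma>_le) auto
            finally show ?thesis using nk norm_smear_le[OF \<epsilon> \<Psi>m \<Psi>s, of n n y] by linarith
          qed
          show "\<sigma> y \<bullet> smear (\<epsilon> n) (\<Psi> n) y \<le> s * \<kappa> (\<epsilon> n) y" for y using bnd[of y] by simp
          show "integrable \<nu> (\<lambda>y. \<sigma> y \<bullet> smear (\<epsilon> n) (\<Psi> n) y)"
          proof (rule \<nu>.integrable_const_bound[where B=s])
            show "(\<lambda>y. \<sigma> y \<bullet> smear (\<epsilon> n) (\<Psi> n) y) \<in> borel_measurable \<nu>" by measurable
          qed (use bnd in simp)
          show "integrable \<nu> (\<lambda>y. s * \<kappa> (\<epsilon> n) y)" using \<kappa>_integrable[OF \<epsilon>] by auto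
        qed
        also have "\<dots> = s * (LINT y|\<nu>. \<kappa> (\<epsilon> n) y)" by simp
        also have "\<dots> \<le> s * (c * h + \<delta>)" using elim(2) s0 by (intro mult_left_mono)
        finally have "(LINT y|\<nu>. \<sigma> y \<bullet> smear (\<epsilon> n) (\<Psi> n) y) \<le> s * (c * h) + \<delta>'" using \<delta>(2) by (simp add: distrib_left)
        then show ?case using main[OF elim(1)] by linarith
      qed
    qed
    show ?thesis
    proof (rule tendsto_le[OF _ _ _ ev])
      show "(\<lambda>n. - (LINT x|lborel. T (mollify (\<epsilon> n) z x) * dv x)) \<longlonglongrightarrow> - (LINT x|lborel. T (z x) * dv x)"
        by (intro tendsto_minus lim1)
      show "(\<lambda>n. (LINT y|lborel. G y \<bullet> smear (\<epsilon> n) (\<Psi> n) y) + s * (c * h) + \<delta>') \<longlonglongrightarrow> (LINT y|lborel. G y \<bullet> (T' (z y) *\<^sub>R Y y)) + s * (c * h) + \<delta>'"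
        by (intro tendsto_add lim2 tendsto_const)
    qed simp
  qed
  then have "- (LINT x|lborel. T (z x) * dv x) \<le> (LINT y|lborel. G y \<bullet> (T' (z y) *\<^sub>R Y y)) + s * (c * h)"
    by (rule field_le_epsilon)
  then show ?thesis by (simp add: dv_def inner_commute)
qed

end

section \<open>Fields with vanishing normal component\<close>

text \<open>At a boundary point take \<open>w = (L + 2) *\<^sub>R e\<close>. A step \<epsilon>
  raises the height by at least \<epsilon> (L + 1), while the sideways move of length at most
  \<epsilon> lets the graph rise by at most \<epsilon> L. The free vector \<open>k\<close> leaves
  room for an average over an \<epsilon>-ball after the shift.\<close>

lemma lipschitz_boundary_inward_shift:
  fixes \<Omega> :: "'a::euclidean_space set"
  assumes \<Omega>: "open \<Omega>" "lipschitz_boundary \<Omega>" and x0: "x0 \<in> closure \<Omega>"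
  shows "\<exists>r>0. \<exists>w. \<exists>\<epsilon>0>0. \<forall>y\<in>closure \<Omega> \<inter> cball x0 r. \<forall>k. norm k \<le> 1 \<longrightarrow> (\<forall>\<epsilon>. 0 < \<epsilon> \<and> \<epsilon> \<le> \<epsilon>0 \<longrightarrow> y + \<epsilon> *\<^sub>R (w + k) \<in> \<Omega>)"
proof (cases "x0 \<in> \<Omega>")
  case True
  then obtain R where R: "R > 0" "ball x0 R \<subseteq> \<Omega>" using \<Omega>(1) open_contains_ball by blast
  have "y + \<epsilon> *\<^sub>R (0 + k) \<in> \<Omega>" if "y \<in> cball x0 (R/3)" "norm k \<le> 1" "0 < \<epsilon>" "\<epsilon> \<le> R/3" for y k \<epsilon>
  proof -
    have "dist x0 (y + \<epsilon> *\<^sub>R k) \<le> dist x0 y + norm (\<epsilon> *\<^sub>R k)"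
      using dist_triangle[of x0 "y + \<epsilon> *\<^sub>R k" y] by (simp add: dist_norm)
    also have "norm (\<epsilon> *\<^sub>R k) \<le> \<epsilon> * 1" using that by (simp add: mult_left_le)
    finally have "dist x0 (y + \<epsilon> *\<^sub>R k) < R" using that R by simp
    then show ?thesis using R(2) by auto
  qed
  then show ?thesis using R(1) by (intro exI[of _ "R/3"] conjI exI[of _ "0::'a"]) auto
next
  case False
  then have "x0 \<in> frontier \<Omega>" using x0 \<Omega>(1) by (simp add: frontier_def interior_open)
  then obtain e h L R where e: "norm e = 1" and R: "R > 0" and h: "L-lipschitz_on {z. z \<bullet> e = 0} h"
    and graph: "\<Omega> \<inter> ball x0 R = {x \<in> ball x0 R. h (x - (x \<bullet> e) *\<^sub>R e) < x \<bullet> e}"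
    using \<Omega>(2) unfolding lipschitz_boundary_def by blast
  have L: "L \<ge> 0" using h by (rule lipschitz_on_nonneg)
  define p where "p x = x - (x \<bullet> e) *\<^sub>R e" for x
  have ee: "e \<bullet> e = 1" using e by (simp add: norm_eq_sqrt_inner)
  have pe: "p x \<in> {z. z \<bullet> e = 0}" for x by (simp add: p_def inner_diff_left ee)
  have pnorm: "norm (p x) \<le> norm x" for x
  proof -
    have "(norm (p x))\<^sup>2 = (norm x)\<^sup>2 - (x \<bullet> e)\<^sup>2"
      unfolding power2_norm_eq_inner p_def
      by (simp add: inner_diff_left inner_diff_right inner_commute ee power2_eq_square)
    then have "(norm (p x))\<^sup>2 \<le> (norm x)\<^sup>2" by simp
    then show ?thesis by (rule power2_le_imp_le) simp
  qed
  have hc: "continuous_on UNIV (\<lambda>x. h (p x))"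
    by (rule continuous_on_compose2[OF lipschitz_on_continuous_on[OF h]])
       (use pe in \<open>auto simp: p_def intro!: continuous_intros\<close>)
  \<comment> \<open>Strictly below the graph there is an open neighbourhood free of points of
    \<Omega>, so points of the closure lie on or above the graph.\<close>
  have above: "h (p y) \<le> y \<bullet> e" if y: "y \<in> closure \<Omega>" "y \<in> ball x0 R" for y
  proof (rule ccontr)
    assume below: "\<not> h (p y) \<le> y \<bullet> e"
    define S where "S = ball x0 R \<inter> {x. x \<bullet> e < h (p x)}"
    have "open {x. x \<bullet> e < h (p x)}" by (intro open_Collect_less hc continuous_intros)
    then have "open S" by (auto simp: S_def)
    moreover have "y \<in> S" using y below by (simp add: S_def)
    ultimately obtain x where "x \<in> \<Omega>" "x \<in> S"
      using y(1) closure_iff_nhds_not_empty[of y \<Omega>] by blast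
    then have "x \<in> \<Omega> \<inter> ball x0 R" by (simp add: S_def)
    then have "h (p x) < x \<bullet> e" using graph by (auto simp: p_def)
    then show False using \<open>x \<in> S\<close> by (simp add: S_def)
  qed
  define w where "w = (L + 2) *\<^sub>R e"
  \<comment> \<open>The displacement is at most \<epsilon> (L + 3), hence less than
    \<open>R / 2\<close>: from the half-size ball one stays inside the chart.\<close>
  define \<epsilon>0 where "\<epsilon>0 = R / (2 * (L + 4))"
  have \<epsilon>0: "\<epsilon>0 > 0" using R L by (simp add: \<epsilon>0_def)
  have "y + \<epsilon> *\<^sub>R (w + k) \<in> \<Omega>" if y: "y \<in> closure \<Omega>" "y \<in> cball x0 (R/2)" and k: "norm k \<le> 1" and \<epsilon>: "0 < \<epsilon>" "\<epsilon> \<le> \<epsilon>0" for y k \<epsilon>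
  proof -
    let ?x = "y + \<epsilon> *\<^sub>R (w + k)"
    have "norm (\<epsilon> *\<^sub>R (w + k)) \<le> \<epsilon> * (L + 3)"
    proof -
      have "norm (w + k) \<le> norm w + norm k" by (rule norm_triangle_ineq)
      also have "\<dots> \<le> (L + 2) + 1" using k e L by (simp add: w_def)
      finally show ?thesis using \<epsilon> by simp
    qed
    also have "\<dots> < \<epsilon> * (L + 4)" using \<epsilon> by simp
    also have "\<dots> \<le> \<epsilon>0 * (L + 4)" using \<epsilon> L by (intro mult_right_mono) auto
    also have "\<dots> = R / 2"
    proof -
      have "L + 4 \<noteq> 0" using L by simp
      then show ?thesis by (simp add: \<epsilon>0_def field_simps)
    qed
    finally have "dist x0 ?x < R"
      using y(2) dist_triangle[of x0 ?x y] by (simp add: dist_norm)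
    then have xb: "?x \<in> ball x0 R" by simp
    have yb: "y \<in> ball x0 R" using y(2) R by simp
    have "p ?x = p y + \<epsilon> *\<^sub>R p k"
      by (simp add: p_def w_def algebra_simps inner_add_left ee)
    then have "dist (p ?x) (p y) \<le> \<epsilon> * 1"
      using \<epsilon> pnorm[of k] k by (simp add: dist_norm mult_left_le)
    then have "dist (h (p ?x)) (h (p y)) \<le> L * \<epsilon>"
      using lipschitz_onD[OF h pe pe, of ?x y] mult_left_mono[OF _ L, of "dist (p ?x) (p y)" \<epsilon>] by linarith
    then have "h (p ?x) \<le> y \<bullet> e + L * \<epsilon>" using above[OF y(1) yb] by (simp add: dist_real_def abs_le_iff)
    also have "\<dots> < ?x \<bullet> e"
    proof -
      have "\<bar>k \<bullet> e\<bar> \<le> 1" using Cauchy_Schwarz_ineq2[of k e] k e by simp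
      then have "L < L + 2 + k \<bullet> e" by linarith
      then have "\<epsilon> * L < \<epsilon> * (L + 2 + k \<bullet> e)" using \<epsilon> by simp
      also have "\<epsilon> * (L + 2 + k \<bullet> e) = ?x \<bullet> e - y \<bullet> e" by (simp add: w_def inner_add_left ee)
      finally show ?thesis by (simp add: mult.commute)
    qed
    finally have "h (p ?x) < ?x \<bullet> e" .
    then have "?x \<in> \<Omega> \<inter> ball x0 R" unfolding graph using xb by (simp add: p_def)
    then show ?thesis by simp
  qed
  then show ?thesis using R \<epsilon>0 by (intro exI[of _ "R/2"] conjI exI[of _ w] exI[of _ \<epsilon>0]) auto
qed

text \<open>Read off from the smooth substitute for the maximum; the direction 0 makes its
  derivative bound trivial.\<close>

lemma C1_with_grad_prod_complement:
  assumes "finite I" "\<And>i. i \<in> I \<Longrightarrow> C1_with_grad (\<phi> i) (d i)" "\<And>i x. i \<in> I \<Longrightarrow> 0 \<le> \<phi> i x" "\<And>i x. i \<in> I \<Longrightarrow> \<phi> i x \<le> 1"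
  shows "\<exists>D. C1_with_grad (\<lambda>x. \<Prod>i\<in>I. 1 - \<phi> i x) D"
proof -
  have "\<exists>D. C1_with_grad (\<lambda>x. 1 - (\<Prod>i\<in>I. 1 - \<phi> i x)) D \<and> (\<forall>x. \<bar>D x \<bullet> 0\<bar> \<le> (\<Sum>i\<in>I. \<bar>d i x \<bullet> 0\<bar>))"
    by (rule C1_with_grad_probabilistic_sum) (fact assms(1), (rule assms; assumption)+)
  then obtain D where "C1_with_grad (\<lambda>x. 1 - (\<Prod>i\<in>I. 1 - \<phi> i x)) D" by blast
  from C1_with_grad_diff[OF C1_with_grad_const[of 1] this] show ?thesis by auto
qed

lemma sum_telescope_prod:
  fixes \<phi> :: "nat \<Rightarrow> real"
  shows "(\<Sum>j<N. \<phi> j * (\<Prod>i<j. 1 - \<phi> i)) = 1 - (\<Prod>i<N. 1 - \<phi> i)"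
  by (induction N) (auto simp: algebra_simps)

text \<open>Multiplying the j-th bump by the complements of the earlier ones gives a telescoping
  sum: it equals 1 where some bump is 1 and stays at most 1 everywhere, with no division by a sum
  that might vanish. Both facts about the sum are used for the norm bound on the approximating
  field.\<close>

lemma partition_of_unity_C1:
  fixes K :: "'a::euclidean_space set" and r :: "'a \<Rightarrow> real"
  assumes K: "compact K" and r: "\<And>x. x \<in> K \<Longrightarrow> r x > 0"
  obtains N :: nat and c :: "nat \<Rightarrow> 'a" and \<zeta> :: "nat \<Rightarrow> 'a \<Rightarrow> real" and d
  where "\<And>j. j < N \<Longrightarrow> c j \<in> K" "\<And>j. j < N \<Longrightarrow> C1_with_grad (\<zeta> j) (d j)" "\<And>j x. j < N \<Longrightarrow> 0 \<le> \<zeta> j x"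
    "\<And>j x. j < N \<Longrightarrow> x \<notin> cball (c j) (r (c j)) \<Longrightarrow> \<zeta> j x = 0"
    "\<And>x. (\<Sum>j<N. \<zeta> j x) \<le> 1" "\<And>x. x \<in> K \<Longrightarrow> (\<Sum>j<N. \<zeta> j x) = 1"
proof -
  have "K \<subseteq> (\<Union>x\<in>K. ball x (r x / 2))"
  proof
    fix x assume "x \<in> K"
    then have "x \<in> ball x (r x / 2)" using r by simp
    then show "x \<in> (\<Union>x\<in>K. ball x (r x / 2))" using \<open>x \<in> K\<close> by blast
  qed
  then obtain C where C: "C \<subseteq> K" "finite C" "K \<subseteq> (\<Union>x\<in>C. ball x (r x / 2))"
    using compactE_image[OF K, of K "\<lambda>x. ball x (r x / 2)"] by (metis open_ball)
  obtain xs where xs: "set xs = C" using finite_list[OF C(2)] by blast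
  define N where "N = length xs"
  define c where "c j = xs ! j" for j
  have cK: "c j \<in> K" if "j < N" for j using that C(1) xs by (auto simp: c_def N_def)
  define Q where "Q j \<phi> d \<longleftrightarrow> C1_with_grad \<phi> d \<and> (\<forall>x. 0 \<le> \<phi> x) \<and> (\<forall>x. \<phi> x \<le> 1) \<and>
    (\<forall>x. x \<notin> cball (c j) (r (c j)) \<longrightarrow> \<phi> x = 0) \<and> (\<forall>x\<in>cball (c j) (r (c j) / 2). \<phi> x = 1)" for j \<phi> d
  have "\<exists>\<phi> d. Q j \<phi> d" if "j < N" for j
  proof -
    have rj: "r (c j) > 0" using r cK[OF that] by simp
    have sub: "cball (c j) (r (c j) / 2) \<subseteq> ball (c j) (r (c j))" using rj by auto
    show ?thesis
    proof (rule cutoff_exists[OF compact_cball open_ball sub])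
      fix \<phi> d L assume a: "C1_with_grad \<phi> d" "compact L" "L \<subseteq> ball (c j) (r (c j))" "\<And>x. x \<notin> L \<Longrightarrow> \<phi> x = 0"
        "\<And>x. 0 \<le> \<phi> x" "\<And>x. \<phi> x \<le> 1" "\<And>x. x \<in> cball (c j) (r (c j) / 2) \<Longrightarrow> \<phi> x = 1"
      have "\<phi> x = 0" if "x \<notin> cball (c j) (r (c j))" for x
        using a(3,4) that ball_subset_cball by blast
      then have "Q j \<phi> d" unfolding Q_def using a(1,5,6,7) by simp
      then show ?thesis by blast
    qed
  qed
  then obtain \<phi> d where Q: "\<And>j. j < N \<Longrightarrow> Q j (\<phi> j) (d j)" by metis
  note \<phi> = Q[unfolded Q_def]
  define \<zeta> where "\<zeta> j x = \<phi> j x * (\<Prod>i<j. 1 - \<phi> i x)" for j x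
  have "\<exists>D. C1_with_grad (\<zeta> j) D" if "j < N" for j
  proof -
    have "\<exists>D. C1_with_grad (\<lambda>x. \<Prod>i\<in>{..<j}. 1 - \<phi> i x) D"
    proof (rule C1_with_grad_prod_complement[where d=d])
      fix i assume "i \<in> {..<j}"
      then have "i < N" using that by simp
      from \<phi>[OF this] show "C1_with_grad (\<phi> i) (d i)" "0 \<le> \<phi> i x" "\<phi> i x \<le> 1" for x by simp_all
    qed simp
    then obtain D where "C1_with_grad (\<lambda>x. \<Prod>i<j. 1 - \<phi> i x) D" by blast
    moreover have "C1_with_grad (\<phi> j) (d j)" using \<phi>[OF that] by simp
    ultimately have "C1_with_grad (\<lambda>x. \<phi> j x * (\<Prod>i<j. 1 - \<phi> i x)) (\<lambda>x. \<phi> j x *\<^sub>R D x + (\<Prod>i<j. 1 - \<phi> i x) *\<^sub>R d j x)"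
      by (intro C1_with_grad_mult)
    then show ?thesis unfolding \<zeta>_def by blast
  qed
  then obtain D where D: "\<And>j. j < N \<Longrightarrow> C1_with_grad (\<zeta> j) (D j)" by metis
  have b: "0 \<le> 1 - \<phi> i x" "1 - \<phi> i x \<le> 1" if "i < N" for i x using \<phi>[OF that] by auto
  show thesis
  proof (rule that[OF cK D])
    show "0 \<le> \<zeta> j x" if "j < N" for j x
      unfolding \<zeta>_def using \<phi>[OF that] b that by (intro mult_nonneg_nonneg prod_nonneg) auto
    show "\<zeta> j x = 0" if "j < N" "x \<notin> cball (c j) (r (c j))" for j x
      using \<phi>[OF that(1)] that(2) by (simp add: \<zeta>_def)
    show "(\<Sum>j<N. \<zeta> j x) \<le> 1" for x
      unfolding \<zeta>_def sum_telescope_prod using b by (auto intro!: prod_nonneg)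
    show "(\<Sum>j<N. \<zeta> j x) = 1" if xK: "x \<in> K" for x
    proof -
      obtain y where "y \<in> C" "x \<in> ball y (r y / 2)" using C(3) xK by blast
      then obtain j where j: "j < N" "x \<in> cball (c j) (r (c j) / 2)"
        using xs by (auto simp: in_set_conv_nth N_def c_def)
      then have "\<phi> j x = 1" using \<phi>[OF j(1)] by blast
      then have "(\<Prod>i<N. 1 - \<phi> i x) = 0" using j(1) by (intro prod_zero) auto
      then show ?thesis unfolding \<zeta>_def sum_telescope_prod by simp
    qed
  qed
qed

lemma C1_with_grad_translate:
  assumes "C1_with_grad \<phi> d"
  shows "C1_with_grad (\<lambda>x. \<phi> (x - a)) (\<lambda>x. d (x - a))"
  unfolding C1_with_grad_def
proof (intro conjI allI)
  fix x
  have "((\<lambda>x. x - a) has_derivative (\<lambda>h. h)) (at x)" by (auto intro!: derivative_eq_intros)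
  from has_derivative_compose[OF this, of \<phi> "\<lambda>h. h \<bullet> d (x - a)"]
  show "GDERIV (\<lambda>x. \<phi> (x - a)) x :> d (x - a)"
    using C1_with_grad_GDERIV[OF assms, of "x - a"] by (simp add: gderiv_def)
  show "continuous_on UNIV (\<lambda>x. d (x - a))"
    by (intro continuous_on_compose2[OF C1_with_grad_continuous_grad[OF assms, of UNIV]] continuous_intros) auto
qed

lemma smear_eq_mollify: "smear \<epsilon> f x = mollify \<epsilon> f x"
proof -
  have "(\<lambda>y. mollifier \<epsilon> (y - x) *\<^sub>R f y) = (\<lambda>y. f y * mollifier \<epsilon> (x - y))"
    by (rule ext) (simp add: mollifier_commute[of \<epsilon> _ x] mult.commute)
  then show ?thesis unfolding smear_def mollify_def by simp
qed

text \<open>The kernel is even, so mollification is self-adjoint; the shift changes side with the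
  opposite sign. Obtained from the vector version by multiplying both functions by one basis
  vector.\<close>

lemma integral_mult_mollify:
  fixes g W :: "'a::euclidean_space \<Rightarrow> real"
  assumes \<epsilon>: "\<epsilon> > 0" and g: "integrable lborel g" and W: "W \<in> borel_measurable borel" "\<And>x. \<bar>W x\<bar> \<le> B"
  shows "(LINT x|lborel. W x * mollify \<epsilon> g (x - a)) = (LINT y|lborel. g y * mollify \<epsilon> W (y + a))"
proof -
  obtain b :: 'a where b: "b \<in> Basis" using nonempty_Basis by blast
  then have bb: "b \<bullet> b = 1" "norm b = 1" by (auto simp: inner_Basis)
  have [measurable]: "g \<in> borel_measurable borel" "W \<in> borel_measurable borel" using g W by (auto dest: borel_measurable_integrable)
  have gi: "integrable lborel (\<lambda>y. g (y - a))" using integrable_lborel_translate[OF g, of "- a"] by simp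
  have W1: "norm (W x *\<^sub>R b) \<le> B" for x using W(2) bb by simp
  have eq1: "(W x *\<^sub>R b) \<bullet> (LINT y|lborel. mollifier \<epsilon> (x - y) *\<^sub>R (g (y - a) *\<^sub>R b)) = W x * mollify \<epsilon> g (x - a)" for x
  proof -
    have "(LINT y|lborel. mollifier \<epsilon> (x - y) *\<^sub>R (g (y - a) *\<^sub>R b)) = (LINT y|lborel. (g (y - a) * mollifier \<epsilon> (x - y)) *\<^sub>R b)"
      by (simp add: mult.commute)
    also have "\<dots> = mollify \<epsilon> (\<lambda>y. g (y - a)) x *\<^sub>R b"
      unfolding mollify_def by (rule integral_scaleR_left) (rule integrable_mollify[OF \<epsilon> gi])
    also have "mollify \<epsilon> (\<lambda>y. g (y - a)) x = mollify \<epsilon> g (x - a)"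
      using mollify_translate[of g \<epsilon> x "- a"] by simp
    finally show ?thesis using bb by simp
  qed
  have eq2: "(g (y - a) *\<^sub>R b) \<bullet> smear \<epsilon> (\<lambda>x. W x *\<^sub>R b) y = g (y - a) * mollify \<epsilon> W y" for y
    using smear_scaleR_right[OF \<epsilon> W(1) W(2), of b y] bb by (simp add: smear_eq_mollify)
  have mW: "mollify \<epsilon> W \<in> borel_measurable borel"
    unfolding smear_eq_mollify[symmetric, abs_def] by (rule measurable_smear) fact
  have "(LINT x|lborel. (W x *\<^sub>R b) \<bullet> (LINT y|lborel. mollifier \<epsilon> (x - y) *\<^sub>R (g (y - a) *\<^sub>R b)))
      = (LINT y|lborel. (g (y - a) *\<^sub>R b) \<bullet> smear \<epsilon> (\<lambda>x. W x *\<^sub>R b) y)"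
    by (rule integral_inner_smear[OF lborel.sigma_finite_measure_axioms sets_lborel _ _ W1 \<epsilon>]) (use gi in auto)
  then have "(LINT x|lborel. W x * mollify \<epsilon> g (x - a)) = (LINT y|lborel. g (y - a) * mollify \<epsilon> W y)"
    unfolding eq1 eq2 .
  also have "\<dots> = (LINT y|lborel. g y * mollify \<epsilon> W (y + a))"
    using integral_lborel_translate[of "\<lambda>y. g (y - a) * mollify \<epsilon> W y" a] mW by simp
  finally show ?thesis .
qed

text \<open>Near \<open>y\<close> the indicator of \<Omega> is 1, so there the oscillation is at
  most that of \<open>z\<close>.\<close>

lemma approx_limit_lipschitz_compose:
  fixes z :: "'a::euclidean_space \<Rightarrow> real"
  assumes z: "integrable lborel z" and lim: "approx_limit z y a" and \<Omega>: "open \<Omega>" "y \<in> \<Omega>"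
    and T: "T \<in> borel_measurable borel" "\<And>s t. \<bar>T s - T t\<bar> \<le> \<bar>s - t\<bar>"
  shows "approx_limit (\<lambda>x. indicator \<Omega> x * T (z x)) y (T a)"
proof -
  have [measurable]: "z \<in> borel_measurable borel" "T \<in> borel_measurable borel" "\<Omega> \<in> sets borel"
    using z T \<Omega> by (auto dest: borel_measurable_integrable)
  obtain R where R: "R > 0" "ball y R \<subseteq> \<Omega>" using \<Omega> open_contains_ball by blast
  have lim': "((\<lambda>r. (LINT x:ball y r|lborel. \<bar>z x - a\<bar>) / r ^ DIM('a)) \<longlongrightarrow> 0) (at_right 0)"
    using lim by (simp add: approx_limit_lborel)
  have "((\<lambda>r. (LINT x:ball y r|lborel. \<bar>indicator \<Omega> x * T (z x) - T a\<bar>) / r ^ DIM('a)) \<longlongrightarrow> 0) (at_right 0)"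
  proof (rule tendsto_sandwich[OF _ _ tendsto_const lim'])
    have ev: "eventually (\<lambda>r. 0 < r \<and> r < R) (at_right (0::real))"
      using R(1) by (intro eventually_at_rightI[of _ R]) auto
    then show "\<forall>\<^sub>F r in at_right 0. 0 \<le> (LINT x:ball y r|lborel. \<bar>indicator \<Omega> x * T (z x) - T a\<bar>) / r ^ DIM('a)"
      by eventually_elim (auto simp: set_lebesgue_integral_def intro!: divide_nonneg_nonneg integral_nonneg_AE)
    show "\<forall>\<^sub>F r in at_right 0. (LINT x:ball y r|lborel. \<bar>indicator \<Omega> x * T (z x) - T a\<bar>) / r ^ DIM('a)
        \<le> (LINT x:ball y r|lborel. \<bar>z x - a\<bar>) / r ^ DIM('a)"
      using ev
    proof eventually_elim
      case (elim r)
      have "integrable lborel (\<lambda>x. indicator (ball y r) x *\<^sub>R \<bar>z x - a\<bar>)"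
      proof -
        have "integrable lborel (\<lambda>x. indicator (ball y r) x *\<^sub>R z x)" using z by (intro integrable_mult_indicator) auto
        moreover have "integrable lborel (\<lambda>x. indicator (ball y r) x * a)"
          by (intro integrable_mult_left integrable_real_indicator) (auto intro: emeasure_lborel_bounded)
        ultimately have "integrable lborel (\<lambda>x. \<bar>indicator (ball y r) x *\<^sub>R z x - indicator (ball y r) x * a\<bar>)" by auto
        also have "(\<lambda>x. \<bar>indicator (ball y r) x *\<^sub>R z x - indicator (ball y r) x * a\<bar>) = (\<lambda>x. indicator (ball y r) x *\<^sub>R \<bar>z x - a\<bar>)"
          by (auto simp: indicator_def fun_eq_iff)
        finally show ?thesis .
      qed
      then have "(LINT x:ball y r|lborel. \<bar>indicator \<Omega> x * T (z x) - T a\<bar>) \<le> (LINT x:ball y r|lborel. \<bar>z x - a\<bar>)"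
        unfolding set_lebesgue_integral_def
      proof (rule integral_mono')
        fix x
        show "indicator (ball y r) x *\<^sub>R \<bar>indicator \<Omega> x * T (z x) - T a\<bar> \<le> indicator (ball y r) x *\<^sub>R \<bar>z x - a\<bar>"
        proof (cases "x \<in> ball y r")
          case True
          then have "x \<in> \<Omega>" using elim R(2) by auto
          then show ?thesis using T(2)[of "z x" a] True by simp
        qed simp
      qed (auto simp: indicator_def)
      then show ?case using elim by (intro divide_right_mono) auto
    qed
  qed
  then show ?thesis by (subst approx_limit_lborel) auto
qed

context truncated_jump
begin

lemma T_lipschitz: "\<bar>T s - T t\<bar> \<le> \<bar>s - t\<bar>"
proof -
  have "norm (T s - T t) \<le> 1 * norm (s - t)"
  proof (rule field_differentiable_bound[where S=UNIV])
    show "(T has_field_derivative T' x) (at x within UNIV)" for x using T_deriv by simp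
    show "norm (T' x) \<le> 1" for x using T'_nonneg[of x] T'_le[of x] by simp
  qed auto
  then show ?thesis by simp
qed

text \<open>A partition of unity splits \<open>X\<close> into pieces supported near a boundary point; each is shifted into
  \<open>\<Omega>\<close> and mollified, to which the flux inequality for fields with compact support applies. The
  divergence of the approximating field is computed from \<open>weak\<close> with shifted mollifiers as test functions.\<close>

theorem neumann_flux_inequality:
  fixes X :: "'a \<Rightarrow> 'a" and f :: "'a \<Rightarrow> real"
  assumes bdd: "bounded \<Omega>" and lip: "lipschitz_boundary \<Omega>"
    and X: "X \<in> borel_measurable borel" "continuous_on \<Omega> X" "\<And>x. x \<notin> \<Omega> \<Longrightarrow> X x = 0" "\<And>x. norm (X x) \<le> s"
    and f: "f \<in> borel_measurable borel" "\<And>x. x \<notin> \<Omega> \<Longrightarrow> f x = 0" "\<And>x. \<bar>f x\<bar> \<le> F"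
    and weak: "\<And>\<phi> d. C1_with_grad \<phi> d \<Longrightarrow> (LINT x|lborel. X x \<bullet> d x) = - (LINT x|lborel. f x * \<phi> x)"
  shows "- (LINT x|lborel. f x * T (z x)) \<le> (LINT x|lborel. T' (z x) * (X x \<bullet> G x)) + s * (c * h)"
proof -
  note X(1)[measurable] f(1)[measurable]
  have Gm[measurable]: "G \<in> borel_measurable borel" and zm[measurable]: "z \<in> borel_measurable borel"
    using G_integrable z_integrable by (auto dest: borel_measurable_integrable)
  have \<Omega>B[measurable]: "\<Omega> \<in> sets borel" using open_domain by simp
  have Tc: "continuous_on UNIV T"
    using T_deriv by (meson DERIV_isCont continuous_at_imp_continuous_on)
  have Tm[measurable]: "T \<in> borel_measurable borel" "T' \<in> borel_measurable borel"
    using borel_measurable_continuous_onI[OF Tc] borel_measurable_continuous_onI[OF T'_cont] by auto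
  have s0: "s \<ge> 0" using X(4)[of 0] norm_ge_zero order_trans by blast
  have F0: "F \<ge> 0" using f(3)[of 0] abs_ge_zero order_trans by blast
  have bint: "integrable lborel q" if "q \<in> borel_measurable borel" "\<And>x. x \<notin> \<Omega> \<Longrightarrow> q x = 0" "\<And>x. norm (q x) \<le> B" for q :: "'a \<Rightarrow> 'b::euclidean_space" and B
  proof (rule Bochner_Integration.integrable_bound[where f="\<lambda>x. indicator \<Omega> x * B"])
    show "integrable lborel (\<lambda>x. indicator \<Omega> x * B)"
      using \<Omega>B bdd by (intro integrable_mult_left integrable_real_indicator) (auto intro: emeasure_lborel_bounded)
    show "AE x in lborel. norm (q x) \<le> norm (indicator \<Omega> x * B)"
    proof (intro AE_I2)
      fix x show "norm (q x) \<le> norm (indicator \<Omega> x * B)"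
        using that(2)[of x] that(3)[of x] by (cases "x \<in> \<Omega>") (auto intro: order_trans)
    qed
  qed (use that in simp)
  define C where "C = closure \<Omega>"
  have C: "compact C" unfolding C_def using bdd by (simp add: compact_closure)
  obtain r w \<epsilon>0 where shift: "\<And>x. x \<in> C \<Longrightarrow> r x > 0" "\<And>x. x \<in> C \<Longrightarrow> \<epsilon>0 x > 0"
    "\<And>x y k \<epsilon>. x \<in> C \<Longrightarrow> y \<in> C \<inter> cball x (r x) \<Longrightarrow> norm k \<le> 1 \<Longrightarrow> 0 < \<epsilon> \<Longrightarrow> \<epsilon> \<le> \<epsilon>0 x \<Longrightarrow> y + \<epsilon> *\<^sub>R (w x + k) \<in> \<Omega>"
    using lipschitz_boundary_inward_shift[OF open_domain lip] unfolding C_def by metis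
  show ?thesis
  proof (rule partition_of_unity_C1[OF C shift(1)])
    fix N :: nat and cc \<zeta> d
    assume pu: "\<And>j. j < N \<Longrightarrow> cc j \<in> C" "\<And>j. j < N \<Longrightarrow> C1_with_grad (\<zeta> j) (d j)" "\<And>j x. j < N \<Longrightarrow> 0 \<le> \<zeta> j x"
      "\<And>j x. j < N \<Longrightarrow> x \<notin> cball (cc j) (r (cc j)) \<Longrightarrow> \<zeta> j x = 0"
      "\<And>x. (\<Sum>j<N. \<zeta> j x) \<le> 1" "\<And>x. x \<in> C \<Longrightarrow> (\<Sum>j<N. \<zeta> j x) = 1"
    have \<Omega>C: "\<Omega> \<subseteq> C" unfolding C_def by (rule closure_subset)
    have d0: "d j x = 0" if "j < N" "x \<notin> cball (cc j) (r (cc j))" for j x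
      by (rule C1_with_grad_zero_outside[OF pu(2)[OF that(1)] closed_cball pu(4)[OF that(1)] that(2)])
    have \<zeta>m: "\<zeta> j \<in> borel_measurable borel" "d j \<in> borel_measurable borel" if "j < N" for j
      using C1_with_grad_measurable[OF pu(2)[OF that]] by auto
    have \<zeta>1: "\<zeta> j x \<le> 1" if "j < N" for j x
    proof -
      have "\<zeta> j x \<le> (\<Sum>j<N. \<zeta> j x)" using that pu(3) by (intro member_le_sum) auto
      then show ?thesis using pu(5)[of x] by simp
    qed
    have "\<exists>B>0. \<forall>x. norm (d j x) \<le> B" if "j < N" for j
      by (rule bounded_continuous_compact_support[OF C1_with_grad_continuous_grad[OF pu(2)[OF that]] compact_cball d0[OF that]]) auto
    then obtain B where B: "\<And>j. j < N \<Longrightarrow> B j > 0" "\<And>j x. j < N \<Longrightarrow> norm (d j x) \<le> B j" by metis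
    \<comment> \<open>\<open>T\<close> of \<open>z\<close> need not be integrable over the whole
      space; it will only be paired with functions supported in \<Omega>, so it may be cut off
      there.\<close>
    define W where "W x = indicator \<Omega> x * T (z x)" for x
    have Wm[measurable]: "W \<in> borel_measurable borel" unfolding W_def by measurable
    have Wb: "\<bar>W x\<bar> \<le> c / 2" for x using T_le[of "z x"] c_nonneg by (auto simp: W_def indicator_def)
    have W0: "W x = 0" if "x \<notin> \<Omega>" for x using that by (simp add: W_def)
    have Wi: "integrable lborel W" by (rule bint[OF Wm W0, of "c/2"]) (assumption, simp only: real_norm_def Wb)
    define wj where "wj j = w (cc j)" for j
    \<comment> \<open>\<open>weak\<close> says that \<open>X\<close>, extended by zero, has weak
      divergence \<open>f\<close> on the whole space; \<open>g j\<close> is accordingly the weak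
      divergence of \<open>\<zeta> j\<close> times \<open>X\<close>.\<close>
    define g where "g j y = f y * \<zeta> j y + X y \<bullet> d j y" for j y
    have gm: "g j \<in> borel_measurable borel" if "j < N" for j
      unfolding g_def using \<zeta>m[OF that] by measurable
    have gb: "\<bar>g j y\<bar> \<le> F + s * B j" if "j < N" for j y
    proof -
      have "\<bar>f y\<bar> * \<bar>\<zeta> j y\<bar> \<le> F * 1" using f(3) \<zeta>1[OF that, of y] pu(3)[OF that, of y] F0 by (intro mult_mono) auto
      moreover have "\<bar>X y \<bullet> d j y\<bar> \<le> norm (X y) * norm (d j y)" by (rule Cauchy_Schwarz_ineq2)
      moreover have "norm (X y) * norm (d j y) \<le> s * B j" using X(4) B(2)[OF that] s0 by (intro mult_mono) auto
      ultimately show ?thesis unfolding g_def using abs_triangle_ineq[of "f y * \<zeta> j y" "X y \<bullet> d j y"] by (simp add: abs_mult)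
    qed
    have g0: "g j y = 0" if "y \<notin> \<Omega>" for j y using f(2) X(3) that by (simp add: g_def)
    have gi: "integrable lborel (g j)" if "j < N" for j
      by (rule bint[OF gm[OF that] g0, of "F + s * B j"]) (use gb[OF that] in auto)
    \<comment> \<open>The partition of unity sums to 1 on the open set \<Omega>, so its gradients
      cancel there.\<close>
    have gsum: "(\<Sum>j<N. g j y) = f y" for y
    proof (cases "y \<in> \<Omega>")
      case True
      have "GDERIV (\<lambda>x. \<Sum>j<N. \<zeta> j x) y :> (\<Sum>j<N. d j y)"
        by (rule C1_with_grad_GDERIV[OF C1_with_grad_sum]) (use pu(2) in auto)
      moreover have "((\<lambda>x. \<Sum>j<N. \<zeta> j x) has_derivative (\<lambda>h. 0)) (at y)"
        by (rule has_derivative_transform_within_open[where f="\<lambda>_. 1" and s=\<Omega>])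
           (use open_domain True pu(6) \<Omega>C in auto)
      then have "GDERIV (\<lambda>x. \<Sum>j<N. \<zeta> j x) y :> 0" by (simp add: gderiv_def)
      ultimately have ds: "(\<Sum>j<N. d j y) = 0" by (rule GDERIV_unique)
      have "(\<Sum>j<N. g j y) = f y * (\<Sum>j<N. \<zeta> j y) + X y \<bullet> (\<Sum>j<N. d j y)"
        by (simp add: g_def sum.distrib sum_distrib_left inner_sum_right)
      then show ?thesis using ds pu(6)[of y] True \<Omega>C by auto
    qed (simp add: g0 f(2))
    define XZ where "XZ j y = \<zeta> j y *\<^sub>R X y" for j y
    have XZm: "XZ j \<in> borel_measurable borel" if "j < N" for j
      unfolding XZ_def using \<zeta>m[OF that] by measurable
    have XZb: "norm (XZ j y) \<le> s" if "j < N" for j y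
    proof -
      have "\<bar>\<zeta> j y\<bar> * norm (X y) \<le> 1 * s" using \<zeta>1[OF that, of y] pu(3)[OF that, of y] X(4) by (intro mult_mono) auto
      then show ?thesis by (simp add: XZ_def)
    qed
    have XZ0: "XZ j y = 0" if "y \<notin> \<Omega>" for j y using X(3) that by (simp add: XZ_def)
    have XZi: "integrable lborel (\<lambda>y. XZ j y \<bullet> i)" if "j < N" "i \<in> Basis" for j i
    proof (rule bint[of _ s])
      show "(\<lambda>y. XZ j y \<bullet> i) \<in> borel_measurable borel" using XZm[OF that(1)] by measurable
      show "norm (XZ j y \<bullet> i) \<le> s" for y using XZb[OF that(1), of y] Basis_le_norm[OF that(2), of "XZ j y"] by simp
    qed (simp add: XZ0)
    \<comment> \<open>Each piece is averaged at scale \<epsilon> and moved by \<epsilon> times its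
      own inward vector; shift and averaging radius are of the same order, as in the shift
      lemma.\<close>
    define Y where "Y \<epsilon> x = (\<Sum>j<N. smear \<epsilon> (XZ j) (x - \<epsilon> *\<^sub>R wj j))" for \<epsilon> x
    define DY where "DY \<epsilon> i x = (\<Sum>j<N. mollify_grad \<epsilon> (\<lambda>y. XZ j y \<bullet> i) (x - \<epsilon> *\<^sub>R wj j))" for \<epsilon> i x
    have comp: "smear \<epsilon> (XZ j) p \<bullet> i = mollify \<epsilon> (\<lambda>y. XZ j y \<bullet> i) p" if "j < N" "\<epsilon> > 0" for j p i \<epsilon>
    proof -
      have "smear \<epsilon> (XZ j) p \<bullet> i = (LINT x|lborel. (mollifier \<epsilon> (x - p) *\<^sub>R XZ j x) \<bullet> i)"
        unfolding smear_def by (rule integral_inner_left[symmetric]) (rule integrable_smear[OF that(2) XZm[OF that(1)] XZb[OF that(1)]])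
      also have "\<dots> = smear \<epsilon> (\<lambda>y. XZ j y \<bullet> i) p" by (simp add: smear_def)
      finally show ?thesis by (simp add: smear_eq_mollify)
    qed
    have YC1: "C1_with_grad (\<lambda>x. Y \<epsilon> x \<bullet> i) (DY \<epsilon> i)" if "i \<in> Basis" "\<epsilon> > 0" for \<epsilon> i
    proof -
      have "C1_with_grad (\<lambda>x. \<Sum>j<N. mollify \<epsilon> (\<lambda>y. XZ j y \<bullet> i) (x - \<epsilon> *\<^sub>R wj j)) (DY \<epsilon> i)"
        unfolding DY_def
        by (intro C1_with_grad_sum C1_with_grad_translate C1_with_grad_mollify) (use that XZi in auto)
      moreover have "(\<lambda>x. Y \<epsilon> x \<bullet> i) = (\<lambda>x. \<Sum>j<N. mollify \<epsilon> (\<lambda>y. XZ j y \<bullet> i) (x - \<epsilon> *\<^sub>R wj j))"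
        unfolding Y_def inner_sum_left using comp that(2) by (intro ext sum.cong) auto
      ultimately show ?thesis by simp
    qed
    \<comment> \<open>This is where the Neumann condition acts: \<open>weak\<close> is tested with
      \<open>\<zeta> j\<close> times the reflected kernel, whose support may cross the boundary, so
      no boundary term arises.\<close>
    have div: "(\<Sum>i\<in>Basis. mollify_grad \<epsilon> (\<lambda>y. XZ j y \<bullet> i) p \<bullet> i) = mollify \<epsilon> (g j) p" if jN: "j < N" and \<epsilon>: "\<epsilon> > 0" for j p \<epsilon>
    proof -
      obtain B\<rho> where B\<rho>: "B\<rho> > 0" "\<And>x::'a. norm (mollifier_grad \<epsilon> x) \<le> B\<rho>" using mollifier_grad_bounded[OF \<epsilon>] by blast
      note \<zeta>m[OF jN, measurable] XZm[OF jN, measurable]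
      have "(\<Sum>i\<in>Basis. mollify_grad \<epsilon> (\<lambda>y. XZ j y \<bullet> i) p \<bullet> i) = (\<Sum>i\<in>Basis. LINT y|lborel. ((XZ j y \<bullet> i) *\<^sub>R mollifier_grad \<epsilon> (p - y)) \<bullet> i)"
        unfolding mollify_grad_def
        by (intro sum.cong refl integral_inner_left[symmetric]) (rule integrable_mollify_grad[OF \<epsilon> XZi[OF jN]])
      also have "\<dots> = (LINT y|lborel. (\<Sum>i\<in>Basis. ((XZ j y \<bullet> i) *\<^sub>R mollifier_grad \<epsilon> (p - y)) \<bullet> i))"
        by (intro Bochner_Integration.integral_sum[symmetric] integrable_inner_left) (rule integrable_mollify_grad[OF \<epsilon> XZi[OF jN]])
      also have "\<dots> = (LINT y|lborel. \<zeta> j y * (X y \<bullet> mollifier_grad \<epsilon> (p - y)))"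
      proof (rule Bochner_Integration.integral_cong[OF refl])
        fix y
        have "(\<Sum>i\<in>Basis. ((XZ j y \<bullet> i) *\<^sub>R mollifier_grad \<epsilon> (p - y)) \<bullet> i) = XZ j y \<bullet> mollifier_grad \<epsilon> (p - y)"
          by (subst euclidean_inner[of "XZ j y"]) simp
        then show "(\<Sum>i\<in>Basis. ((XZ j y \<bullet> i) *\<^sub>R mollifier_grad \<epsilon> (p - y)) \<bullet> i) = \<zeta> j y * (X y \<bullet> mollifier_grad \<epsilon> (p - y))"
          by (simp add: XZ_def)
      qed
      also have "\<dots> = mollify \<epsilon> (g j) p"
      proof -
        define a1 where "a1 y = \<zeta> j y * (X y \<bullet> mollifier_grad \<epsilon> (p - y))" for y
        define a2 where "a2 y = mollifier \<epsilon> (p - y) * (X y \<bullet> d j y)" for y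
        define a3 where "a3 y = f y * (\<zeta> j y * mollifier \<epsilon> (p - y))" for y
        define k where "k = mollifier_const TYPE('a) / \<epsilon> ^ DIM('a)"
        have k: "\<bar>mollifier \<epsilon> v\<bar> \<le> k" for v :: 'a
          using mollifier_le[OF \<epsilon>, of v] mollifier_nonneg[of \<epsilon> v] by (simp add: k_def)
        have k0: "k \<ge> 0" using k[of 0] by linarith
        have i1: "integrable lborel a1"
        proof (rule bint[of _ "1 * (s * B\<rho>)"])
          show "a1 \<in> borel_measurable borel" unfolding a1_def by measurable
          show "norm (a1 y) \<le> 1 * (s * B\<rho>)" for y
          proof -
            have "\<bar>X y \<bullet> mollifier_grad \<epsilon> (p - y)\<bar> \<le> norm (X y) * norm (mollifier_grad \<epsilon> (p - y))" by (rule Cauchy_Schwarz_ineq2)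
            also have "\<dots> \<le> s * B\<rho>" using X(4) B\<rho> s0 by (intro mult_mono) auto
            finally show ?thesis unfolding a1_def real_norm_def abs_mult
              using \<zeta>1[OF jN, of y] pu(3)[OF jN, of y] by (intro mult_mono) auto
          qed
        qed (simp add: a1_def X(3))
        have i2: "integrable lborel a2"
        proof (rule bint[of _ "k * (s * B j)"])
          show "a2 \<in> borel_measurable borel" unfolding a2_def by measurable
          show "norm (a2 y) \<le> k * (s * B j)" for y
          proof -
            have "\<bar>X y \<bullet> d j y\<bar> \<le> norm (X y) * norm (d j y)" by (rule Cauchy_Schwarz_ineq2)
            also have "\<dots> \<le> s * B j" using X(4) B(2)[OF jN] s0 by (intro mult_mono) auto
            finally show ?thesis unfolding a2_def real_norm_def abs_mult
              using k k0 by (intro mult_mono) auto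
          qed
        qed (simp add: a2_def X(3))
        have i3: "integrable lborel a3"
        proof (rule bint[of _ "F * (1 * k)"])
          show "a3 \<in> borel_measurable borel" unfolding a3_def by measurable
          show "norm (a3 y) \<le> F * (1 * k)" for y
            unfolding a3_def real_norm_def abs_mult
            using f(3) k \<zeta>1[OF jN, of y] pu(3)[OF jN, of y] F0 by (intro mult_mono) auto
        qed (simp add: a3_def f(2))
        have "(LINT y|lborel. X y \<bullet> (\<zeta> j y *\<^sub>R (- mollifier_grad \<epsilon> (p - y)) + mollifier \<epsilon> (p - y) *\<^sub>R d j y)) = - (LINT y|lborel. a3 y)"
          unfolding a3_def by (rule weak[OF C1_with_grad_mult[OF pu(2)[OF jN] C1_with_grad_mollifier_reflect[OF \<epsilon>]]])
        also have "(\<lambda>y. X y \<bullet> (\<zeta> j y *\<^sub>R (- mollifier_grad \<epsilon> (p - y)) + mollifier \<epsilon> (p - y) *\<^sub>R d j y)) = (\<lambda>y. a2 y - a1 y)"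
          by (rule ext) (simp add: a1_def a2_def inner_add_right inner_diff_right)
        finally have "(LINT y|lborel. a1 y) = (LINT y|lborel. a2 y + a3 y)" using i1 i2 i3 by simp
        also have "\<dots> = mollify \<epsilon> (g j) p"
          unfolding mollify_def by (intro Bochner_Integration.integral_cong refl) (simp add: a2_def a3_def g_def algebra_simps)
        finally show ?thesis by (simp add: a1_def)
      qed
      finally show ?thesis .
    qed
    \<comment> \<open>The average at \<open>x\<close> sees points at distance at most
      \<open>\<epsilon> * (1 + norm (wj j))\<close>, over which \<open>\<zeta> j\<close> changes by
      at most \<open>B j\<close> times this distance. As the \<open>\<zeta> j\<close> sum to at most
      1, the norm bound \<open>s\<close> is recovered up to a factor tending to 1.\<close>
    define Cst where "Cst = (\<Sum>j<N. B j * (1 + norm (wj j)))"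
    have Ynorm: "norm (Y \<epsilon> x) \<le> s * (1 + \<epsilon> * Cst)" if \<epsilon>: "\<epsilon> > 0" for \<epsilon> x
    proof -
      have part: "norm (smear \<epsilon> (XZ j) (x - \<epsilon> *\<^sub>R wj j)) \<le> s * (\<zeta> j x + \<epsilon> * (B j * (1 + norm (wj j))))" if jN: "j < N" for j
      proof -
        let ?p = "x - \<epsilon> *\<^sub>R wj j"
        have \<zeta>b: "norm (\<zeta> j y) \<le> 1" for y using \<zeta>1[OF jN, of y] pu(3)[OF jN, of y] by simp
        have "norm (smear \<epsilon> (XZ j) ?p) \<le> (LINT y|lborel. norm (mollifier \<epsilon> (y - ?p) *\<^sub>R XZ j y))"
          unfolding smear_def by (rule integral_norm_bound)
        also have "\<dots> \<le> (LINT y|lborel. s * (mollifier \<epsilon> (y - ?p) *\<^sub>R \<zeta> j y))"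
        proof (rule Bochner_Integration.integral_mono)
          show "integrable lborel (\<lambda>y. norm (mollifier \<epsilon> (y - ?p) *\<^sub>R XZ j y))"
            by (intro integrable_norm integrable_smear[OF \<epsilon> XZm[OF jN] XZb[OF jN]])
          show "integrable lborel (\<lambda>y. s * (mollifier \<epsilon> (y - ?p) *\<^sub>R \<zeta> j y))"
            by (intro integrable_mult_right integrable_smear[OF \<epsilon> \<zeta>m(1)[OF jN] \<zeta>b])
          fix y
          have "mollifier \<epsilon> (y - ?p) * \<zeta> j y * norm (X y) \<le> mollifier \<epsilon> (y - ?p) * \<zeta> j y * s"
            by (intro mult_left_mono X(4) mult_nonneg_nonneg mollifier_nonneg pu(3)[OF jN])
          then show "norm (mollifier \<epsilon> (y - ?p) *\<^sub>R XZ j y) \<le> s * (mollifier \<epsilon> (y - ?p) *\<^sub>R \<zeta> j y)"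
            using pu(3)[OF jN, of y] by (simp add: XZ_def mollifier_nonneg mult_ac)
        qed
        also have "\<dots> = s * smear \<epsilon> (\<zeta> j) ?p" by (simp add: smear_def)
        also have "smear \<epsilon> (\<zeta> j) ?p \<le> \<zeta> j x + \<epsilon> * (B j * (1 + norm (wj j)))"
        proof -
          have "norm (smear \<epsilon> (\<zeta> j) ?p - \<zeta> j x) \<le> \<epsilon> * (B j * (1 + norm (wj j)))"
          proof (rule norm_smear_diff_le[OF \<epsilon> \<zeta>m(1)[OF jN] \<zeta>b])
            fix y assume "dist y ?p < \<epsilon>"
            then have "norm (y - x) \<le> \<epsilon> + norm (\<epsilon> *\<^sub>R wj j)"
              using norm_triangle_ineq4[of "y - ?p" "\<epsilon> *\<^sub>R wj j"] by (simp add: dist_norm)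
            then have "norm (y - x) \<le> \<epsilon> * (1 + norm (wj j))" using \<epsilon> by (simp add: algebra_simps)
            then have "B j * norm (y - x) \<le> B j * (\<epsilon> * (1 + norm (wj j)))" using B(1)[OF jN] by (intro mult_left_mono) auto
            then show "norm (\<zeta> j y - \<zeta> j x) \<le> \<epsilon> * (B j * (1 + norm (wj j)))"
              using C1_with_grad_lipschitz[OF pu(2)[OF jN] B(2)[OF jN], of y x] by (simp add: mult_ac)
          qed
          then show ?thesis by (simp add: abs_le_iff)
        qed
        finally show ?thesis using s0 by (simp add: mult_left_mono)
      qed
      have "norm (Y \<epsilon> x) \<le> (\<Sum>j<N. norm (smear \<epsilon> (XZ j) (x - \<epsilon> *\<^sub>R wj j)))" unfolding Y_def by (rule norm_sum)
      also have "\<dots> \<le> (\<Sum>j<N. s * (\<zeta> j x + \<epsilon> * (B j * (1 + norm (wj j)))))" by (intro sum_mono part) simp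
      also have "\<dots> = s * ((\<Sum>j<N. \<zeta> j x) + \<epsilon> * Cst)"
        unfolding Cst_def by (simp add: sum_distrib_left sum.distrib distrib_left)
      also have "\<dots> \<le> s * (1 + \<epsilon> * Cst)" using pu(5)[of x] s0 by (intro mult_left_mono add_right_mono)
      finally show ?thesis .
    qed
    \<comment> \<open>A compact set outside which \<open>Y \<epsilon>\<close> vanishes: all points
      reached from the supports of the pieces by shift and averaging.\<close>
    define KK where "KK \<epsilon> = (\<Union>j\<in>{..<N}. (\<lambda>q. fst q + \<epsilon> *\<^sub>R (wj j + snd q)) ` ((C \<inter> cball (cc j) (r (cc j))) \<times> cball 0 1))" for \<epsilon>
    have KKc: "compact (KK \<epsilon>)" for \<epsilon>
      unfolding KK_def using C
      by (intro compact_UN compact_continuous_image compact_Times compact_Int_closed continuous_intros) auto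
    have KK\<Omega>: "KK \<epsilon> \<subseteq> \<Omega>" if "\<epsilon> > 0" "\<And>j. j < N \<Longrightarrow> \<epsilon> \<le> \<epsilon>0 (cc j)" for \<epsilon>
    proof
      fix x assume "x \<in> KK \<epsilon>"
      then obtain j y k where "j < N" "y \<in> C \<inter> cball (cc j) (r (cc j))" "norm k \<le> 1" "x = y + \<epsilon> *\<^sub>R (wj j + k)"
        by (auto simp: KK_def)
      then show "x \<in> \<Omega>" unfolding wj_def using shift(3)[OF pu(1), of j y k \<epsilon>] that by simp
    qed
    have Y0: "Y \<epsilon> x = 0" if \<epsilon>: "\<epsilon> > 0" and x: "x \<notin> KK \<epsilon>" for \<epsilon> x
      unfolding Y_def
    proof (rule sum.neutral, rule ballI)
      fix j assume "j \<in> {..<N}"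
      then have jN: "j < N" by simp
      show "smear \<epsilon> (XZ j) (x - \<epsilon> *\<^sub>R wj j) = 0"
      proof (rule smear_eq_0[OF \<epsilon>])
        fix y assume y: "dist y (x - \<epsilon> *\<^sub>R wj j) < \<epsilon>"
        show "XZ j y = 0"
        proof (rule ccontr)
          assume "XZ j y \<noteq> 0"
          then have "y \<in> \<Omega>" "\<zeta> j y \<noteq> 0" using XZ0[of y j] by (auto simp: XZ_def)
          then have yC: "y \<in> C \<inter> cball (cc j) (r (cc j))" using pu(4)[OF jN, of y] \<Omega>C by blast
          define k where "k = (1 / \<epsilon>) *\<^sub>R (x - \<epsilon> *\<^sub>R wj j - y)"
          have "norm k = dist y (x - \<epsilon> *\<^sub>R wj j) / \<epsilon>" unfolding k_def using \<epsilon> by (simp add: dist_norm norm_minus_commute)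
          then have "norm k \<le> 1" using y \<epsilon> by simp
          moreover have "y + \<epsilon> *\<^sub>R (wj j + k) = x" unfolding k_def using \<epsilon> by (simp add: scaleR_add_right)
          ultimately have "x \<in> (\<lambda>q. fst q + \<epsilon> *\<^sub>R (wj j + snd q)) ` ((C \<inter> cball (cc j) (r (cc j))) \<times> cball 0 1)"
            using yC by (intro image_eqI[of _ _ "(y, k)"]) auto
          then have "x \<in> KK \<epsilon>" unfolding KK_def using jN by blast
          then show False using x by simp
        qed
      qed
    qed
    define \<epsilon> where "\<epsilon> n = inverse (real (Suc n))" for n
    have \<epsilon>: "\<epsilon> n > 0" for n by (simp add: \<epsilon>_def)
    have \<epsilon>_lim: "filterlim \<epsilon> (at_right 0) sequentially"
      unfolding \<epsilon>_def filterlim_at using LIMSEQ_inverse_real_of_nat by (simp del: of_nat_Suc)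
    have \<epsilon>_lim0: "\<epsilon> \<longlonglongrightarrow> 0" unfolding \<epsilon>_def by (rule LIMSEQ_inverse_real_of_nat)
    have small: "eventually (\<lambda>n. \<forall>j\<in>{..<N}. \<epsilon> n < \<epsilon>0 (cc j)) sequentially"
      by (rule eventually_ball_finite) (use order_tendstoD(2)[OF \<epsilon>_lim0] shift(2) pu(1) in auto)
    \<comment> \<open>Off \<Omega> the divergence of the approximating field is zero, so
      \<open>T\<close> of \<open>z\<close> may be replaced by \<open>W\<close>; then
      self-adjointness moves mollifier and shift from \<open>g j\<close> to \<open>W\<close>, which
      converges almost everywhere on \<Omega>.\<close>
    have dvint: "(LINT x|lborel. T (z x) * (\<Sum>i\<in>Basis. DY (\<epsilon> n) i x \<bullet> i)) = (\<Sum>j<N. LINT y|lborel. g j y * mollify (\<epsilon> n) W (y + \<epsilon> n *\<^sub>R wj j))"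
      if "KK (\<epsilon> n) \<subseteq> \<Omega>" for n
    proof -
      have "T (z x) * (\<Sum>i\<in>Basis. DY (\<epsilon> n) i x \<bullet> i) = (\<Sum>j<N. W x * mollify (\<epsilon> n) (g j) (x - \<epsilon> n *\<^sub>R wj j))" for x
      proof -
        have "(\<Sum>i\<in>Basis. DY (\<epsilon> n) i x \<bullet> i) = (\<Sum>j<N. \<Sum>i\<in>Basis. mollify_grad (\<epsilon> n) (\<lambda>y. XZ j y \<bullet> i) (x - \<epsilon> n *\<^sub>R wj j) \<bullet> i)"
          unfolding DY_def inner_sum_left by (rule sum.swap)
        also have "\<dots> = (\<Sum>j<N. mollify (\<epsilon> n) (g j) (x - \<epsilon> n *\<^sub>R wj j))" by (intro sum.cong refl div \<epsilon>) simp
        finally have eq: "(\<Sum>i\<in>Basis. DY (\<epsilon> n) i x \<bullet> i) = (\<Sum>j<N. mollify (\<epsilon> n) (g j) (x - \<epsilon> n *\<^sub>R wj j))" .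
        show ?thesis
        proof (cases "x \<in> \<Omega>")
          case True
          then show ?thesis unfolding eq by (simp add: W_def sum_distrib_left)
        next
          case False
          then have "x \<notin> KK (\<epsilon> n)" using that by blast
          then have "DY (\<epsilon> n) i x = 0" if "i \<in> Basis" for i
            by (intro C1_with_grad_zero_outside[OF YC1[OF that \<epsilon>] compact_imp_closed[OF KKc[of "\<epsilon> n"]]]) (simp add: Y0[OF \<epsilon>])
          then show ?thesis using False by (simp add: W_def)
        qed
      qed
      then have "(LINT x|lborel. T (z x) * (\<Sum>i\<in>Basis. DY (\<epsilon> n) i x \<bullet> i)) = (LINT x|lborel. (\<Sum>j<N. W x * mollify (\<epsilon> n) (g j) (x - \<epsilon> n *\<^sub>R wj j)))" by simp
      also have "\<dots> = (\<Sum>j<N. LINT x|lborel. W x * mollify (\<epsilon> n) (g j) (x - \<epsilon> n *\<^sub>R wj j))"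
      proof (rule Bochner_Integration.integral_sum)
        fix j assume "j \<in> {..<N}"
        then have jN: "j < N" by simp
        show "integrable lborel (\<lambda>x. W x * mollify (\<epsilon> n) (g j) (x - \<epsilon> n *\<^sub>R wj j))"
        proof (rule bint[of _ "c / 2 * (F + s * B j)"])
          have [measurable]: "mollify (\<epsilon> n) (g j) \<in> borel_measurable borel"
            using C1_with_grad_measurable(1)[OF C1_with_grad_mollify[OF \<epsilon> gi[OF jN]]] .
          show "(\<lambda>x. W x * mollify (\<epsilon> n) (g j) (x - \<epsilon> n *\<^sub>R wj j)) \<in> borel_measurable borel" by measurable
          have "norm (smear (\<epsilon> n) (g j) v) \<le> F + s * B j" for v
            by (rule norm_smear_le[OF \<epsilon> gm[OF jN]]) (use gb[OF jN] in simp)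
          then show "norm (W x * mollify (\<epsilon> n) (g j) (x - \<epsilon> n *\<^sub>R wj j)) \<le> c / 2 * (F + s * B j)" for x
            unfolding real_norm_def abs_mult smear_eq_mollify[symmetric] using Wb[of x] c_nonneg by (intro mult_mono) auto
        qed (simp add: W0)
      qed
      also have "\<dots> = (\<Sum>j<N. LINT y|lborel. g j y * mollify (\<epsilon> n) W (y + \<epsilon> n *\<^sub>R wj j))"
        by (intro sum.cong refl integral_mult_mollify[OF \<epsilon> gi Wm Wb]) simp
      finally show ?thesis .
    qed
    have lim1: "(\<lambda>n. \<Sum>j<N. LINT y|lborel. g j y * mollify (\<epsilon> n) W (y + \<epsilon> n *\<^sub>R wj j)) \<longlonglongrightarrow> (\<Sum>j<N. LINT y|lborel. g j y * T (z y))"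
    proof (rule tendsto_sum)
      fix j assume "j \<in> {..<N}"
      then have jN: "j < N" by simp
      note gm[OF jN, measurable]
      show "(\<lambda>n. LINT y|lborel. g j y * mollify (\<epsilon> n) W (y + \<epsilon> n *\<^sub>R wj j)) \<longlonglongrightarrow> (LINT y|lborel. g j y * T (z y))"
      proof (rule integral_dominated_convergence[where w="\<lambda>y. \<bar>g j y\<bar> * (c / 2)"])
        have mW[measurable]: "mollify (\<epsilon> n) W \<in> borel_measurable borel" for n
          using C1_with_grad_measurable(1)[OF C1_with_grad_mollify[OF \<epsilon> Wi]] .
        show "(\<lambda>y. g j y * mollify (\<epsilon> n) W (y + \<epsilon> n *\<^sub>R wj j)) \<in> borel_measurable lborel" for n by measurable
        show "(\<lambda>y. g j y * T (z y)) \<in> borel_measurable lborel" by measurable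
        show "integrable lborel (\<lambda>y. \<bar>g j y\<bar> * (c / 2))" using gi[OF jN] by auto
        have "norm (smear (\<epsilon> n) W v) \<le> c / 2" for n v
          by (rule norm_smear_le[OF \<epsilon> Wm]) (simp only: real_norm_def Wb)
        then show "AE y in lborel. norm (g j y * mollify (\<epsilon> n) W (y + \<epsilon> n *\<^sub>R wj j)) \<le> \<bar>g j y\<bar> * (c / 2)" for n
          unfolding real_norm_def abs_mult smear_eq_mollify[symmetric] by (intro AE_I2 mult_left_mono) auto
        show "AE y in lborel. (\<lambda>n. g j y * mollify (\<epsilon> n) W (y + \<epsilon> n *\<^sub>R wj j)) \<longlonglongrightarrow> g j y * T (z y)"
          using z_approx_limit
        proof eventually_elim
          case (elim y)
          show ?case
          proof (cases "y \<in> \<Omega>")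
            case True
            have Wlim: "approx_limit W y (T (z y))"
              unfolding W_def using elim True
              by (intro approx_limit_lipschitz_compose[OF z_integrable _ open_domain True Tm(1) T_lipschitz]) simp
            have "(\<lambda>n. mollify (\<epsilon> n) W (y + \<epsilon> n *\<^sub>R wj j)) \<longlonglongrightarrow> T (z y)"
              unfolding tendsto_iff
            proof (intro allI impI)
              fix \<delta> :: real assume "\<delta> > 0"
              \<comment> \<open>The evaluation point is shifted by \<open>norm (wj j)\<close> times
                \<epsilon>, which is the constant c here.\<close>
              from eventually_compose_filterlim[OF mollify_approx_limit[OF Wi Wlim norm_ge_zero[of "wj j"] this] \<epsilon>_lim]
              show "eventually (\<lambda>n. dist (mollify (\<epsilon> n) W (y + \<epsilon> n *\<^sub>R wj j)) (T (z y)) < \<delta>) sequentially"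
              proof eventually_elim
                case (elim n)
                have "dist (y + \<epsilon> n *\<^sub>R wj j) y \<le> norm (wj j) * \<epsilon> n" using \<epsilon>[of n] by (simp add: dist_norm mult.commute)
                then show ?case using elim by (simp add: dist_real_def)
              qed
            qed
            then show ?thesis by (intro tendsto_mult tendsto_const)
          qed (simp add: g0)
        qed
      qed
    qed
    have lim1': "(\<Sum>j<N. LINT y|lborel. g j y * T (z y)) = (LINT y|lborel. f y * T (z y))"
    proof -
      have gT: "integrable lborel (\<lambda>y. g j y * T (z y))" if "j < N" for j
        using integrable_mult_bounded[OF gi[OF that], of "\<lambda>y. T (z y)" "c/2"] T_le by simp
      then have "(\<Sum>j<N. LINT y|lborel. g j y * T (z y)) = (LINT y|lborel. (\<Sum>j<N. g j y * T (z y)))"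
        by (intro Bochner_Integration.integral_sum[symmetric]) auto
      also have "\<dots> = (LINT y|lborel. f y * T (z y))" by (simp add: sum_distrib_right[symmetric] gsum)
      finally show ?thesis .
    qed
    have Ym[measurable]: "Y (\<epsilon> n) \<in> borel_measurable borel" for n
    proof -
      have "continuous_on UNIV (\<lambda>x. \<Sum>i\<in>Basis. (Y (\<epsilon> n) x \<bullet> i) *\<^sub>R i)"
        by (intro continuous_intros C1_with_grad_continuous[OF YC1] \<epsilon>)
      then show ?thesis by (intro borel_measurable_continuous_onI) (simp add: euclidean_representation)
    qed
    have Cst0: "Cst \<ge> 0" unfolding Cst_def using B(1) by (intro sum_nonneg mult_nonneg_nonneg) (auto intro: less_imp_le)
    have lim2: "(\<lambda>n. LINT x|lborel. T' (z x) * (Y (\<epsilon> n) x \<bullet> G x)) \<longlonglongrightarrow> (LINT x|lborel. T' (z x) * (X x \<bullet> G x))"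
    proof (rule integral_dominated_convergence[where w="\<lambda>x. s * (1 + Cst) * norm (G x)"])
      show "(\<lambda>x. T' (z x) * (Y (\<epsilon> n) x \<bullet> G x)) \<in> borel_measurable lborel" for n by measurable
      show "(\<lambda>x. T' (z x) * (X x \<bullet> G x)) \<in> borel_measurable lborel" by measurable
      show "integrable lborel (\<lambda>x. s * (1 + Cst) * norm (G x))" using G_integrable by auto
      show "AE x in lborel. norm (T' (z x) * (Y (\<epsilon> n) x \<bullet> G x)) \<le> s * (1 + Cst) * norm (G x)" for n
      proof (intro AE_I2)
        fix x
        have "\<epsilon> n \<le> 1" by (simp add: \<epsilon>_def field_simps)
        then have "\<epsilon> n * Cst \<le> 1 * Cst" using Cst0 by (intro mult_right_mono)
        then have "s * (1 + \<epsilon> n * Cst) \<le> s * (1 + Cst)" using s0 by (intro mult_left_mono) auto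
        then have "norm (Y (\<epsilon> n) x) \<le> s * (1 + Cst)" using Ynorm[OF \<epsilon>, of n x] by linarith
        then have "\<bar>Y (\<epsilon> n) x \<bullet> G x\<bar> \<le> s * (1 + Cst) * norm (G x)"
          using Cauchy_Schwarz_ineq2[of "Y (\<epsilon> n) x" "G x"] mult_right_mono[of "norm (Y (\<epsilon> n) x)" "s * (1 + Cst)" "norm (G x)"] by simp
        then have "T' (z x) * \<bar>Y (\<epsilon> n) x \<bullet> G x\<bar> \<le> 1 * (s * (1 + Cst) * norm (G x))"
          by (intro mult_mono T'_le) auto
        then show "norm (T' (z x) * (Y (\<epsilon> n) x \<bullet> G x)) \<le> s * (1 + Cst) * norm (G x)" using T'_nonneg[of "z x"] by (simp add: abs_mult)
      qed
      show "AE x in lborel. (\<lambda>n. T' (z x) * (Y (\<epsilon> n) x \<bullet> G x)) \<longlonglongrightarrow> T' (z x) * (X x \<bullet> G x)"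
      proof (intro AE_I2)
        fix x
        show "(\<lambda>n. T' (z x) * (Y (\<epsilon> n) x \<bullet> G x)) \<longlonglongrightarrow> T' (z x) * (X x \<bullet> G x)"
        proof (cases "x \<in> \<Omega>")
          case True
          have "(\<lambda>n. Y (\<epsilon> n) x) \<longlonglongrightarrow> (\<Sum>j<N. XZ j x)"
            unfolding Y_def
          proof (rule tendsto_sum)
            fix j assume "j \<in> {..<N}"
            then have jN: "j < N" by simp
            have "continuous_on \<Omega> (XZ j)" unfolding XZ_def
              by (intro continuous_intros X(2) C1_with_grad_continuous[OF pu(2)[OF jN]])
            then have cont: "isCont (XZ j) x" using True open_domain continuous_on_eq_continuous_at by blast
            show "(\<lambda>n. smear (\<epsilon> n) (XZ j) (x - \<epsilon> n *\<^sub>R wj j)) \<longlonglongrightarrow> XZ j x"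
              unfolding tendsto_iff
            proof (intro allI impI)
              fix \<delta> :: real assume \<delta>: "\<delta> > 0"
              then have "\<delta> / 2 > 0" by simp
              then obtain \<rho> where \<rho>: "\<rho> > 0" "\<And>y. dist y x < \<rho> \<Longrightarrow> dist (XZ j y) (XZ j x) < \<delta> / 2"
                using cont unfolding continuous_at_eps_delta by blast
              have "(\<lambda>n. \<epsilon> n * (1 + norm (wj j))) \<longlonglongrightarrow> 0 * (1 + norm (wj j))" by (intro tendsto_intros \<epsilon>_lim0)
              then have "eventually (\<lambda>n. \<epsilon> n * (1 + norm (wj j)) < \<rho>) sequentially" using \<rho>(1) by (intro order_tendstoD(2)) auto
              then show "eventually (\<lambda>n. dist (smear (\<epsilon> n) (XZ j) (x - \<epsilon> n *\<^sub>R wj j)) (XZ j x) < \<delta>) sequentially"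
              proof eventually_elim
                case (elim n)
                have "norm (smear (\<epsilon> n) (XZ j) (x - \<epsilon> n *\<^sub>R wj j) - XZ j x) \<le> \<delta> / 2"
                proof (rule norm_smear_diff_le[OF \<epsilon> XZm[OF jN] XZb[OF jN]])
                  fix y assume "dist y (x - \<epsilon> n *\<^sub>R wj j) < \<epsilon> n"
                  then have "norm (y - x) < \<epsilon> n + norm (\<epsilon> n *\<^sub>R wj j)"
                    using norm_triangle_ineq4[of "y - (x - \<epsilon> n *\<^sub>R wj j)" "\<epsilon> n *\<^sub>R wj j"] by (simp add: dist_norm)
                  then have "dist y x < \<rho>" using elim \<epsilon>[of n] by (simp add: dist_norm algebra_simps)
                  from \<rho>(2)[OF this] show "norm (XZ j y - XZ j x) \<le> \<delta> / 2" by (simp add: dist_norm)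
                qed
                then show ?case using \<delta> by (simp add: dist_norm)
              qed
            qed
          qed
          moreover have "(\<Sum>j<N. XZ j x) = X x"
            using pu(6)[of x] True \<Omega>C by (auto simp: XZ_def scaleR_sum_left[symmetric])
          ultimately show ?thesis by (intro tendsto_mult tendsto_inner tendsto_const) simp
        next
          case False
          then show ?thesis using G_zero by simp
        qed
      qed
    qed
    have ev: "eventually (\<lambda>n. - (\<Sum>j<N. LINT y|lborel. g j y * mollify (\<epsilon> n) W (y + \<epsilon> n *\<^sub>R wj j))
        \<le> (LINT x|lborel. T' (z x) * (Y (\<epsilon> n) x \<bullet> G x)) + s * (1 + \<epsilon> n * Cst) * (c * h)) sequentially"
      using small
    proof eventually_elim
      case (elim n)
      have KK1: "KK (\<epsilon> n) \<subseteq> \<Omega>" by (rule KK\<Omega>[OF \<epsilon>]) (use elim in \<open>auto intro: less_imp_le\<close>)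
      have "- (LINT x|lborel. T (z x) * (\<Sum>i\<in>Basis. DY (\<epsilon> n) i x \<bullet> i))
          \<le> (LINT x|lborel. T' (z x) * (Y (\<epsilon> n) x \<bullet> G x)) + s * (1 + \<epsilon> n * Cst) * (c * h)"
        by (rule flux_inequality[OF YC1[OF _ \<epsilon>] KKc KK1 Y0[OF \<epsilon>] Ynorm[OF \<epsilon>]])
      then show ?case unfolding dvint[OF KK1] .
    qed
    show ?thesis
    proof (rule tendsto_le[OF _ _ _ ev])
      show "(\<lambda>n. - (\<Sum>j<N. LINT y|lborel. g j y * mollify (\<epsilon> n) W (y + \<epsilon> n *\<^sub>R wj j))) \<longlonglongrightarrow> - (LINT x|lborel. f x * T (z x))"
        using tendsto_minus[OF lim1] by (simp add: lim1')
      have "(\<lambda>n. (LINT x|lborel. T' (z x) * (Y (\<epsilon> n) x \<bullet> G x)) + s * (1 + \<epsilon> n * Cst) * (c * h)) \<longlonglongrightarrow> (LINT x|lborel. T' (z x) * (X x \<bullet> G x)) + s * (1 + 0 * Cst) * (c * h)"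
        by (intro tendsto_intros lim2 \<epsilon>_lim0)
      then show "(\<lambda>n. (LINT x|lborel. T' (z x) * (Y (\<epsilon> n) x \<bullet> G x)) + s * (1 + \<epsilon> n * Cst) * (c * h)) \<longlonglongrightarrow> (LINT x|lborel. T' (z x) * (X x \<bullet> G x)) + s * (c * h)" by simp
    qed simp
  qed
qed

end

section \<open>Borel representatives\<close>

text \<open>Coordinatewise, a Lebesgue measurable function agrees almost everywhere with a Borel
  one. The extension by zero turns integrals over \<open>lebesgue_on \<Omega>\<close> into integrals
  over \<open>lborel\<close>, where all analysis takes place.\<close>

lemma borel_representative:
  fixes f :: "'a::euclidean_space \<Rightarrow> 'b::euclidean_space"
  assumes \<Omega>: "\<Omega> \<in> sets borel" and f: "f \<in> borel_measurable (lebesgue_on \<Omega>)"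
  obtains f' where "f' \<in> borel_measurable borel" "\<And>x. x \<notin> \<Omega> \<Longrightarrow> f' x = 0" "AE x in lborel. x \<in> \<Omega> \<longrightarrow> f x = f' x"
proof -
  have fm: "(\<lambda>x. indicator \<Omega> x *\<^sub>R f x) \<in> borel_measurable lebesgue"
    using f \<Omega> by (subst (asm) borel_measurable_restrict_space_iff) auto
  have "\<exists>g\<in>borel_measurable lborel. AE x in lborel. (indicator \<Omega> x *\<^sub>R f x) \<bullet> i = g x" for i
    by (rule completion_ex_borel_measurable_real) (intro borel_measurable_inner fm borel_measurable_const)
  then obtain g where g: "\<And>i. g i \<in> borel_measurable lborel" "\<And>i. AE x in lborel. (indicator \<Omega> x *\<^sub>R f x) \<bullet> i = g i x"
    by metis
  show thesis
  proof (rule that[of "\<lambda>x. indicator \<Omega> x *\<^sub>R (\<Sum>i\<in>Basis. g i x *\<^sub>R i)"])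
    show "(\<lambda>x. indicator \<Omega> x *\<^sub>R (\<Sum>i\<in>Basis. g i x *\<^sub>R i)) \<in> borel_measurable borel"
      using g(1) \<Omega> by simp
    have "AE x in lborel. \<forall>i\<in>Basis. (indicator \<Omega> x *\<^sub>R f x) \<bullet> i = g i x"
      using g(2) by (intro AE_finite_allI) auto
    then show "AE x in lborel. x \<in> \<Omega> \<longrightarrow> f x = indicator \<Omega> x *\<^sub>R (\<Sum>i\<in>Basis. g i x *\<^sub>R i)"
    proof eventually_elim
      case (elim x)
      show ?case
      proof
        assume "x \<in> \<Omega>"
        then have "(\<Sum>i\<in>Basis. g i x *\<^sub>R i) = (\<Sum>i\<in>Basis. (f x \<bullet> i) *\<^sub>R i)"
          using elim by (intro sum.cong) auto
        then show "f x = indicator \<Omega> x *\<^sub>R (\<Sum>i\<in>Basis. g i x *\<^sub>R i)"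
          using \<open>x \<in> \<Omega>\<close> by (simp add: euclidean_representation)
      qed
    qed
  qed simp
qed

context
  fixes \<Omega> :: "'a::euclidean_space set" and q q' :: "'a \<Rightarrow> 'b::euclidean_space"
  assumes \<Omega>: "\<Omega> \<in> sets borel" and q': "q' \<in> borel_measurable borel" "\<And>x. x \<notin> \<Omega> \<Longrightarrow> q' x = 0"
    and ae: "AE x in lborel. x \<in> \<Omega> \<longrightarrow> q x = q' x"
begin

lemma representative_AE: "AE x in lebesgue. indicator \<Omega> x *\<^sub>R q x = q' x"
  by (rule AE_completion, use ae in eventually_elim) (auto simp: indicator_def q'(2))

lemma representative_measurable: "(\<lambda>x. indicator \<Omega> x *\<^sub>R q x) \<in> borel_measurable lebesgue"
proof (rule borel_measurable_AE)
  show "q' \<in> borel_measurable lebesgue" using q'(1) by (intro measurable_completion) simp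
  show "AE x in lebesgue. q' x = indicator \<Omega> x *\<^sub>R q x" using representative_AE by eventually_elim simp
qed

lemma measurable_lebesgue_on_representative: "q \<in> borel_measurable (lebesgue_on \<Omega>)"
  using representative_measurable \<Omega> by (subst borel_measurable_restrict_space_iff) auto

lemma integral_lebesgue_on_representative: "(LINT x|lebesgue_on \<Omega>. q x) = (LINT x|lborel. q' x)"
proof -
  have "(LINT x|lebesgue_on \<Omega>. q x) = (LINT x|lebesgue. indicator \<Omega> x *\<^sub>R q x)"
    using \<Omega> by (subst integral_restrict_space) auto
  also have "\<dots> = (LINT x|lebesgue. q' x)"
    by (rule integral_cong_AE[OF representative_measurable _ representative_AE]) (use q'(1) in \<open>auto intro: measurable_completion\<close>)
  also have "\<dots> = (LINT x|lborel. q' x)" using q'(1) by (intro integral_completion) simp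
  finally show ?thesis .
qed

lemma integrable_lebesgue_on_representative: "integrable (lebesgue_on \<Omega>) q \<longleftrightarrow> integrable lborel q'"
proof -
  have "integrable (lebesgue_on \<Omega>) q \<longleftrightarrow> integrable lebesgue (\<lambda>x. indicator \<Omega> x *\<^sub>R q x)"
    using \<Omega> by (intro integrable_restrict_space) auto
  also have "\<dots> \<longleftrightarrow> integrable lebesgue q'"
    by (rule integrable_cong_AE[OF representative_measurable _ representative_AE]) (use q'(1) in \<open>auto intro: measurable_completion\<close>)
  also have "\<dots> \<longleftrightarrow> integrable lborel q'" using q'(1) by (intro integrable_completion) simp
  finally show ?thesis .
qed

end

text \<open>For the bulk terms of the functional, which may be infinite and so are not covered by
  the Bochner version.\<close>

lemma nn_integral_lebesgue_on_representative:
  fixes q q' :: "'a::euclidean_space \<Rightarrow> real"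
  assumes \<Omega>: "\<Omega> \<in> sets borel" and z: "\<And>x. x \<notin> \<Omega> \<Longrightarrow> q' x = 0"
    and ae: "AE x in lborel. x \<in> \<Omega> \<longrightarrow> q x = q' x"
  shows "(\<integral>\<^sup>+x. ennreal (q x) \<partial>lebesgue_on \<Omega>) = (\<integral>\<^sup>+x. ennreal (q' x) \<partial>lborel)"
proof -
  have "(\<integral>\<^sup>+x. ennreal (q x) \<partial>lebesgue_on \<Omega>) = (\<integral>\<^sup>+x. ennreal (q x) * indicator \<Omega> x \<partial>lebesgue)"
    using \<Omega> by (intro nn_integral_restrict_space) auto
  also have "\<dots> = (\<integral>\<^sup>+x. ennreal (q' x) \<partial>lebesgue)"
    by (intro nn_integral_cong_AE AE_completion, use ae in eventually_elim) (auto simp: indicator_def z)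
  also have "\<dots> = (\<integral>\<^sup>+x. ennreal (q' x) \<partial>lborel)" by (rule nn_integral_completion)
  finally show ?thesis .
qed

lemma approx_limit_representative:
  fixes v v' :: "'a::euclidean_space \<Rightarrow> real"
  assumes \<Omega>: "open \<Omega>" and v': "v' \<in> borel_measurable borel" "\<And>x. x \<notin> \<Omega> \<Longrightarrow> v' x = 0"
    and ae: "AE x in lborel. x \<in> \<Omega> \<longrightarrow> v x = v' x" and x: "x \<in> \<Omega>"
  shows "approx_limit v x a \<longleftrightarrow> approx_limit v' x a"
  unfolding approx_limit_def
proof (rule filterlim_cong[OF refl refl])
  have \<Omega>B: "\<Omega> \<in> sets borel" using \<Omega> by simp
  have m: "(\<lambda>x. indicator \<Omega> x *\<^sub>R v x) \<in> borel_measurable lebesgue" by (rule representative_measurable[OF \<Omega>B v' ae])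
  have ae': "AE x in lebesgue. indicator \<Omega> x *\<^sub>R v x = v' x" by (rule representative_AE[OF \<Omega>B v' ae])
  obtain R where R: "R > 0" "ball x R \<subseteq> \<Omega>" using \<Omega> x open_contains_ball by blast
  have "eventually (\<lambda>r. r < R) (at_right (0::real))" using R(1) by (intro eventually_at_rightI[of _ R]) auto
  then show "\<forall>\<^sub>F r in at_right 0. (LINT y:ball x r|lebesgue. \<bar>v y - a\<bar>) / r ^ DIM('a) = (LINT y:ball x r|lebesgue. \<bar>v' y - a\<bar>) / r ^ DIM('a)"
  proof eventually_elim
    case (elim r)
    have sub: "y \<in> ball x r \<Longrightarrow> y \<in> \<Omega>" for y using elim R(2) by auto
    have ball: "ball x r \<in> sets lebesgue" by simp
    have eq: "(\<lambda>y. indicator (ball x r) y *\<^sub>R \<bar>v y - a\<bar>) = (\<lambda>y. indicator (ball x r) y *\<^sub>R \<bar>indicator \<Omega> y *\<^sub>R v y - a\<bar>)"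
      using sub by (auto simp: indicator_def fun_eq_iff)
    have "(LINT y|lebesgue. indicator (ball x r) y *\<^sub>R \<bar>indicator \<Omega> y *\<^sub>R v y - a\<bar>) = (LINT y|lebesgue. indicator (ball x r) y *\<^sub>R \<bar>v' y - a\<bar>)"
    proof (rule integral_cong_AE)
      have v'm: "v' \<in> borel_measurable lebesgue" using v'(1) by (intro measurable_completion) simp
      show "(\<lambda>y. indicator (ball x r) y *\<^sub>R \<bar>indicator \<Omega> y *\<^sub>R v y - a\<bar>) \<in> borel_measurable lebesgue"
        by (intro borel_measurable_scaleR borel_measurable_indicator borel_measurable_abs borel_measurable_diff m ball borel_measurable_const)
      show "(\<lambda>y. indicator (ball x r) y *\<^sub>R \<bar>v' y - a\<bar>) \<in> borel_measurable lebesgue"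
        by (intro borel_measurable_scaleR borel_measurable_indicator borel_measurable_abs borel_measurable_diff v'm ball borel_measurable_const)
      show "AE y in lebesgue. indicator (ball x r) y *\<^sub>R \<bar>indicator \<Omega> y *\<^sub>R v y - a\<bar> = indicator (ball x r) y *\<^sub>R \<bar>v' y - a\<bar>"
        using ae' by eventually_elim simp
    qed
    then show ?case unfolding set_lebesgue_integral_def eq by simp
  qed
qed

lemma approx_limit_continuous:
  fixes f :: "'a::euclidean_space \<Rightarrow> real"
  assumes f: "integrable lborel f" and c: "isCont f x"
  shows "approx_limit f x (f x)"
proof -
  have [measurable]: "f \<in> borel_measurable borel" using f by (auto dest: borel_measurable_integrable)
  define \<omega> where "\<omega> = unit_ball_vol (real DIM('a))"
  have \<omega>: "\<omega> > 0" by (simp add: \<omega>_def)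
  show ?thesis
    unfolding approx_limit_lborel[OF \<open>f \<in> _\<close>] tendsto_iff
  proof (intro allI impI)
    fix \<delta> :: real assume \<delta>: "\<delta> > 0"
    then have "\<delta> / (2 * \<omega>) > 0" using \<omega> by simp
    then obtain R where R: "R > 0" "\<And>y. dist y x < R \<Longrightarrow> dist (f y) (f x) < \<delta> / (2 * \<omega>)"
      using c unfolding continuous_at_eps_delta by blast
    show "\<forall>\<^sub>F r in at_right 0. dist ((LINT y:ball x r|lborel. \<bar>f y - f x\<bar>) / r ^ DIM('a)) 0 < \<delta>"
    proof (rule eventually_at_rightI[OF _ R(1)])
      fix r assume "r \<in> {0<..<R}"
      then have r: "0 < r" "r < R" by auto
      have "(LINT y:ball x r|lborel. \<bar>f y - f x\<bar>) \<le> (LINT y|lborel. indicator (ball x r) y * (\<delta> / (2 * \<omega>)))"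
        unfolding set_lebesgue_integral_def
      proof (rule integral_mono')
        show "integrable lborel (\<lambda>y. indicator (ball x r) y * (\<delta> / (2 * \<omega>)))"
          by (intro integrable_mult_left integrable_real_indicator) (auto intro: emeasure_lborel_bounded)
        fix y
        show "indicator (ball x r) y *\<^sub>R \<bar>f y - f x\<bar> \<le> indicator (ball x r) y * (\<delta> / (2 * \<omega>))"
          using R(2)[of y] r by (cases "y \<in> ball x r") (auto simp: dist_commute dist_real_def intro: less_imp_le)
        show "0 \<le> indicator (ball x r) y * (\<delta> / (2 * \<omega>))" using \<delta> \<omega> by simp
      qed
      also have "\<dots> = \<omega> * r ^ DIM('a) * (\<delta> / (2 * \<omega>))"
        using r by (simp add: content_ball \<omega>_def)
      finally have "(LINT y:ball x r|lborel. \<bar>f y - f x\<bar>) \<le> \<omega> * r ^ DIM('a) * (\<delta> / (2 * \<omega>))" .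
      then have "(LINT y:ball x r|lborel. \<bar>f y - f x\<bar>) / r ^ DIM('a) \<le> \<delta> / 2"
        using r \<omega> by (simp add: field_simps)
      moreover have "0 \<le> (LINT y:ball x r|lborel. \<bar>f y - f x\<bar>) / r ^ DIM('a)"
        using r by (intro divide_nonneg_nonneg) (auto simp: set_lebesgue_integral_def intro!: integral_nonneg_AE)
      ultimately show "dist ((LINT y:ball x r|lborel. \<bar>f y - f x\<bar>) / r ^ DIM('a)) 0 < \<delta>"
        using \<delta> unfolding dist_real_def by linarith
    qed
  qed
qed

lemma approx_limit_diff:
  fixes f g :: "'a::euclidean_space \<Rightarrow> real"
  assumes f: "integrable lborel f" "approx_limit f x a" and g: "integrable lborel g" "approx_limit g x b"
  shows "approx_limit (\<lambda>y. f y - g y) x (a - b)"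
proof -
  have [measurable]: "f \<in> borel_measurable borel" "g \<in> borel_measurable borel" using f g by (auto dest: borel_measurable_integrable)
  have lim: "((\<lambda>r. (LINT y:ball x r|lborel. \<bar>f y - a\<bar>) / r ^ DIM('a) + (LINT y:ball x r|lborel. \<bar>g y - b\<bar>) / r ^ DIM('a)) \<longlongrightarrow> 0 + 0) (at_right 0)"
    using f(2) g(2) by (intro tendsto_add) (simp_all add: approx_limit_lborel)
  have int: "integrable lborel (\<lambda>y. indicator (ball x r) y *\<^sub>R \<bar>h y - e\<bar>)" if h: "integrable lborel h" for h :: "'a \<Rightarrow> real" and e r
  proof -
    have "integrable lborel (\<lambda>y. indicator (ball x r) y *\<^sub>R h y)" using h by (intro integrable_mult_indicator) auto
    moreover have "integrable lborel (\<lambda>y. indicator (ball x r) y * e)"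
      by (intro integrable_mult_left integrable_real_indicator) (auto intro: emeasure_lborel_bounded)
    ultimately have "integrable lborel (\<lambda>y. \<bar>indicator (ball x r) y *\<^sub>R h y - indicator (ball x r) y * e\<bar>)" by auto
    also have "(\<lambda>y. \<bar>indicator (ball x r) y *\<^sub>R h y - indicator (ball x r) y * e\<bar>) = (\<lambda>y. indicator (ball x r) y *\<^sub>R \<bar>h y - e\<bar>)"
      by (auto simp: indicator_def fun_eq_iff)
    finally show ?thesis .
  qed
  have pos: "eventually (\<lambda>r. 0 < r) (at_right (0::real))" by (simp add: eventually_at_right_less)
  have "((\<lambda>r. (LINT y:ball x r|lborel. \<bar>(f y - g y) - (a - b)\<bar>) / r ^ DIM('a)) \<longlongrightarrow> 0) (at_right 0)"
  proof (rule tendsto_sandwich[OF _ _ tendsto_const lim[unfolded add_0_right]])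
    show "\<forall>\<^sub>F r in at_right 0. 0 \<le> (LINT y:ball x r|lborel. \<bar>(f y - g y) - (a - b)\<bar>) / r ^ DIM('a)"
      using pos by eventually_elim (auto simp: set_lebesgue_integral_def intro!: divide_nonneg_nonneg integral_nonneg_AE)
    show "\<forall>\<^sub>F r in at_right 0. (LINT y:ball x r|lborel. \<bar>(f y - g y) - (a - b)\<bar>) / r ^ DIM('a)
        \<le> (LINT y:ball x r|lborel. \<bar>f y - a\<bar>) / r ^ DIM('a) + (LINT y:ball x r|lborel. \<bar>g y - b\<bar>) / r ^ DIM('a)"
      using pos
    proof eventually_elim
      case (elim r)
      have "(LINT y:ball x r|lborel. \<bar>(f y - g y) - (a - b)\<bar>) \<le> (LINT y|lborel. indicator (ball x r) y *\<^sub>R \<bar>f y - a\<bar> + indicator (ball x r) y *\<^sub>R \<bar>g y - b\<bar>)"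
        unfolding set_lebesgue_integral_def
        by (rule integral_mono'[OF Bochner_Integration.integrable_add[OF int[OF f(1)] int[OF g(1)]]]) (auto simp: indicator_def)
      also have "\<dots> = (LINT y:ball x r|lborel. \<bar>f y - a\<bar>) + (LINT y:ball x r|lborel. \<bar>g y - b\<bar>)"
        unfolding set_lebesgue_integral_def by (rule Bochner_Integration.integral_add[OF int[OF f(1)] int[OF g(1)]])
      finally show ?case using elim by (simp add: divide_right_mono flip: add_divide_distrib)
    qed
  qed
  then show ?thesis by (subst approx_limit_lborel) auto
qed

text \<open>Comparing two representatives of \<open>arctan \<circ> v\<close> by testing replaces the Lebesgue differentiation
  theorem: the mollifications converge weakly to one of them and pointwise to the other.\<close>

lemma approx_limit_eq_value_AE:
  fixes v :: "'a::euclidean_space \<Rightarrow> real"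
  assumes \<Omega>: "open \<Omega>" "bounded \<Omega>" and v: "integrable lborel v"
    and lim: "AE x in lborel. x \<in> \<Omega> \<longrightarrow> (\<exists>a. approx_limit v x a)"
  shows "AE x in lborel. x \<in> \<Omega> \<longrightarrow> approx_limit v x (v x)"
proof -
  have [measurable]: "v \<in> borel_measurable borel" "\<Omega> \<in> sets borel" using v \<Omega> by (auto dest: borel_measurable_integrable)
  \<comment> \<open>\<open>arctan\<close> is bounded, so dominated convergence applies to an
    arbitrary integrable \<open>v\<close>; it is 1-Lipschitz, so it respects approximate limits; and
    it is injective, so it can be removed at the end.\<close>
  have arc: "(arctan :: real \<Rightarrow> real) \<in> borel_measurable borel" by (intro borel_measurable_continuous_onI continuous_intros)
  note arc[measurable]
  have arcl: "\<bar>arctan s - arctan t\<bar> \<le> \<bar>s - t\<bar>" for s t :: real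
  proof -
    have "norm (arctan s - arctan t) \<le> 1 * norm (s - t)"
    proof (rule field_differentiable_bound[where S=UNIV])
      show "(arctan has_field_derivative inverse (1 + x\<^sup>2)) (at x within UNIV)" for x :: real using DERIV_arctan by simp
      show "norm (inverse (1 + x\<^sup>2)) \<le> 1" for x :: real by (simp add: inverse_le_1_iff)
    qed auto
    then show ?thesis by simp
  qed
  define W where "W x = indicator \<Omega> x * arctan (v x)" for x
  have Wm[measurable]: "W \<in> borel_measurable borel" unfolding W_def by measurable
  have Wb: "norm (W x) \<le> pi / 2" for x
    using arctan_bounded[of "v x"] pi_gt_zero by (auto simp: W_def indicator_def abs_le_iff)
  have ind: "integrable lborel (\<lambda>x. indicator \<Omega> x * B)" for B :: real
    using \<Omega> by (intro integrable_mult_left integrable_real_indicator) (auto intro: emeasure_lborel_bounded)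
  have Wi: "integrable lborel W"
  proof (rule Bochner_Integration.integrable_bound[OF ind[of "pi/2"]])
    have "norm (W x) \<le> norm (indicator \<Omega> x * (pi / 2))" for x
      using Wb[of x] pi_gt_zero by (cases "x \<in> \<Omega>") (simp_all add: W_def)
    then show "AE x in lborel. norm (W x) \<le> norm (indicator \<Omega> x * (pi / 2))" by blast
  qed simp
  define \<epsilon> where "\<epsilon> n = inverse (real (Suc n))" for n
  have \<epsilon>: "\<epsilon> n > 0" for n by (simp add: \<epsilon>_def)
  have \<epsilon>_lim: "filterlim \<epsilon> (at_right 0) sequentially"
    unfolding \<epsilon>_def filterlim_at using LIMSEQ_inverse_real_of_nat by (simp del: of_nat_Suc)
  have mm[measurable]: "mollify (\<epsilon> n) W \<in> borel_measurable borel" for n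
    using C1_with_grad_measurable(1)[OF C1_with_grad_mollify[OF \<epsilon> Wi]] .
  have mb: "norm (mollify (\<epsilon> n) W x) \<le> pi / 2" for n x
    using norm_smear_le[OF \<epsilon> Wm Wb] by (simp add: smear_eq_mollify)
  \<comment> \<open>With \<open>lim\<close> this is Borel measurable everywhere, whatever value it
    takes where the sequence diverges; almost everywhere on \<Omega> it is the true limit.\<close>
  define L where "L x = indicator \<Omega> x * lim (\<lambda>n. mollify (\<epsilon> n) W x)" for x
  have Lm[measurable]: "L \<in> borel_measurable borel" unfolding L_def by measurable
  have conv: "(\<lambda>n. mollify (\<epsilon> n) W x) \<longlonglongrightarrow> arctan a" if x: "x \<in> \<Omega>" "approx_limit v x a" for x a
    unfolding tendsto_iff
  proof (intro allI impI)
    fix \<delta> :: real assume "\<delta> > 0"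
    have "approx_limit W x (arctan a)"
      unfolding W_def by (rule approx_limit_lipschitz_compose[OF v x(2) \<Omega>(1) x(1) arc arcl])
    from eventually_compose_filterlim[OF mollify_approx_limit[OF Wi this order_refl \<open>\<delta> > 0\<close>] \<epsilon>_lim]
    show "eventually (\<lambda>n. dist (mollify (\<epsilon> n) W x) (arctan a) < \<delta>) sequentially"
      by eventually_elim (simp add: dist_real_def)
  qed
  have Llim: "AE x in lborel. x \<in> \<Omega> \<longrightarrow> (\<lambda>n. mollify (\<epsilon> n) W x) \<longlonglongrightarrow> L x \<and> norm (L x) \<le> pi / 2"
    using lim
  proof eventually_elim
    case (elim x)
    show ?case
    proof
      assume x: "x \<in> \<Omega>"
      then obtain a where "approx_limit v x a" using elim by blast
      from conv[OF x this] have 1: "(\<lambda>n. mollify (\<epsilon> n) W x) \<longlonglongrightarrow> L x" by (simp add: L_def x limI)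
      then have "norm (L x) \<le> pi / 2" by (rule LIMSEQ_le_const2[OF tendsto_norm]) (use mb in auto)
      with 1 show "(\<lambda>n. mollify (\<epsilon> n) W x) \<longlonglongrightarrow> L x \<and> norm (L x) \<le> pi / 2" ..
    qed
  qed
  have Li: "integrable lborel L"
  proof (rule Bochner_Integration.integrable_bound[OF ind[of "pi/2"]])
    show "AE x in lborel. norm (L x) \<le> norm (indicator \<Omega> x * (pi / 2))"
      using Llim by eventually_elim (auto simp: L_def indicator_def)
  qed simp
  have "AE x in lborel. x \<in> \<Omega> \<longrightarrow> W x = L x"
  proof (rule AE_eq_of_test_functions[OF \<Omega>(1) Wi Li])
    fix \<phi> assume "\<phi> \<in> C1_compact_support \<Omega>"
    then obtain d K where \<phi>: "C1_with_grad \<phi> d" "compact K" "K \<subseteq> \<Omega>" "\<And>x. x \<notin> K \<Longrightarrow> \<phi> x = 0"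
      by (rule C1_compact_supportE) (rule that)
    have \<phi>c: "continuous_on UNIV \<phi>" by (rule C1_with_grad_continuous[OF \<phi>(1)])
    have \<phi>m[measurable]: "\<phi> \<in> borel_measurable borel" using C1_with_grad_measurable[OF \<phi>(1)] by simp
    have \<phi>i: "integrable lborel \<phi>" by (rule integrable_continuous_compact_support[OF \<phi>c \<phi>(2,4)])
    obtain B where B: "B > 0" "\<And>x. norm (\<phi> x) \<le> B"
      using bounded_continuous_compact_support[OF \<phi>c \<phi>(2,4)] by blast
    have swap: "(LINT x|lborel. \<phi> x * mollify (\<epsilon> n) W x) = (LINT x|lborel. W x * mollify (\<epsilon> n) \<phi> x)" for n
      using integral_mult_mollify[OF \<epsilon>[of n] Wi \<phi>m, where B=B and a=0] B(2) by simp
    have l1: "(\<lambda>n. LINT x|lborel. \<phi> x * mollify (\<epsilon> n) W x) \<longlonglongrightarrow> (LINT x|lborel. \<phi> x * L x)"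
    proof (rule integral_dominated_convergence[where w="\<lambda>x. \<bar>\<phi> x\<bar> * (pi / 2)"])
      show "integrable lborel (\<lambda>x. \<bar>\<phi> x\<bar> * (pi / 2))" using \<phi>i by auto
      show "AE x in lborel. (\<lambda>n. \<phi> x * mollify (\<epsilon> n) W x) \<longlonglongrightarrow> \<phi> x * L x"
        using Llim
      proof eventually_elim
        case (elim x)
        show ?case
        proof (cases "x \<in> \<Omega>")
          case True
          then show ?thesis using elim by (intro tendsto_mult tendsto_const) simp
        next
          case False
          then have "\<phi> x = 0" using \<phi>(3,4) by blast
          then show ?thesis by simp
        qed
      qed
      show "AE x in lborel. norm (\<phi> x * mollify (\<epsilon> n) W x) \<le> \<bar>\<phi> x\<bar> * (pi / 2)" for n
        using mb[of n] by (intro AE_I2) (simp only: real_norm_def abs_mult, intro mult_left_mono, auto)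
    qed auto
    have l2: "(\<lambda>n. LINT x|lborel. W x * mollify (\<epsilon> n) \<phi> x) \<longlonglongrightarrow> (LINT x|lborel. W x * \<phi> x)"
    proof (rule integral_dominated_convergence[where w="\<lambda>x. \<bar>W x\<bar> * B"])
      have [measurable]: "mollify (\<epsilon> n) \<phi> \<in> borel_measurable borel" for n
        using C1_with_grad_measurable(1)[OF C1_with_grad_mollify[OF \<epsilon> \<phi>i]] .
      show "(\<lambda>x. W x * mollify (\<epsilon> n) \<phi> x) \<in> borel_measurable lborel" for n by measurable
      show "integrable lborel (\<lambda>x. \<bar>W x\<bar> * B)" using Wi by auto
      have "norm (mollify (\<epsilon> n) \<phi> x) \<le> B" for n x using norm_smear_le[OF \<epsilon> \<phi>m B(2)] by (simp add: smear_eq_mollify)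
      then show "AE x in lborel. norm (W x * mollify (\<epsilon> n) \<phi> x) \<le> \<bar>W x\<bar> * B" for n
        by (intro AE_I2) (simp only: real_norm_def abs_mult, intro mult_left_mono, auto)
      show "AE x in lborel. (\<lambda>n. W x * mollify (\<epsilon> n) \<phi> x) \<longlonglongrightarrow> W x * \<phi> x"
      proof (intro AE_I2 tendsto_mult tendsto_const)
        fix x
        have "approx_limit \<phi> x (\<phi> x)"
          using \<phi>c by (intro approx_limit_continuous \<phi>i) (simp add: continuous_on_eq_continuous_at)
        show "(\<lambda>n. mollify (\<epsilon> n) \<phi> x) \<longlonglongrightarrow> \<phi> x"
          unfolding tendsto_iff
        proof (intro allI impI)
          fix \<delta> :: real assume "\<delta> > 0"
          from eventually_compose_filterlim[OF mollify_approx_limit[OF \<phi>i \<open>approx_limit \<phi> x (\<phi> x)\<close> order_refl this] \<epsilon>_lim]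
          show "eventually (\<lambda>n. dist (mollify (\<epsilon> n) \<phi> x) (\<phi> x) < \<delta>) sequentially"
            by eventually_elim (simp add: dist_real_def)
        qed
      qed
    qed simp
    have "(LINT x|lborel. \<phi> x * L x) = (LINT x|lborel. W x * \<phi> x)"
      using l1 l2 unfolding swap by (rule LIMSEQ_unique)
    then show "(LINT x|lborel. \<phi> x * W x) = (LINT x|lborel. \<phi> x * L x)" by (simp add: mult.commute)
  qed
  then show ?thesis
    using Llim lim
  proof eventually_elim
    case (elim x)
    show ?case
    proof
      assume x: "x \<in> \<Omega>"
      then obtain a where a: "approx_limit v x a" using elim by blast
      have "arctan a = L x" using conv[OF x a] elim(2) x LIMSEQ_unique by blast
      then have "arctan (v x) = arctan a" using elim(1) x by (simp add: W_def)
      then show "approx_limit v x (v x)" using a by (simp add: arctan_eq_iff)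
    qed
  qed
qed

text \<open>A set of diameter d lies in a ball of radius d about any of its points, and the volume
  of this ball is d times a constant times the gauge of the set. Covers by sets of diameter at most
  \<open>\<delta>\<close> thus give volume of order \<open>\<delta>\<close>.\<close>

lemma null_set_of_hausdorff_finite:
  fixes S :: "'a::euclidean_space set"
  assumes "hausdorff_outer (DIM('a) - 1) S < top"
  shows "S \<in> null_sets lebesgue"
proof -
  define k where "k = DIM('a) - 1"
  have n: "DIM('a) = Suc k" using DIM_positive[where 'a='a] by (simp add: k_def)
  define H where "H = enn2real (hausdorff_outer k S)"
  have H: "hausdorff_outer k S = ennreal H" "H \<ge> 0" using assms by (auto simp: H_def k_def)
  define \<omega> where "\<omega> = unit_ball_vol (real k)"
  define \<omega>n where "\<omega>n = unit_ball_vol (real DIM('a))"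
  have \<omega>: "\<omega> > 0" "\<omega>n > 0" by (auto simp: \<omega>_def \<omega>n_def)
  \<comment> \<open>Chosen so that
    \<open>\<omega>n * d ^ Suc k = A * d * (\<omega> * (d / 2) ^ k)\<close>.\<close>
  define A where "A = \<omega>n * 2 ^ k / \<omega>"
  have A: "A > 0" using \<omega> by (simp add: A_def)
  have "negligible S"
    unfolding negligible_outer_le
  proof (intro allI impI)
    fix e :: real assume e: "e > 0"
    define \<delta> where "\<delta> = e / (A * (H + 1))"
    have \<delta>: "\<delta> > 0" using e A H by (simp add: \<delta>_def)
    have "hausdorff_pre k \<delta> S \<le> hausdorff_outer k S"
      unfolding hausdorff_outer_def using \<delta> by (intro SUP_upper) auto
    also have "\<dots> < ennreal (H + 1)" using H by (simp add: ennreal_less_iff)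
    finally obtain C where C: "C \<in> hausdorff_covers \<delta> S" "(\<Sum>i. hausdorff_gauge k (C i)) < ennreal (H + 1)"
      unfolding hausdorff_pre_def INF_less_iff by blast
    have Cb: "bounded (C i)" "diameter (C i) \<le> \<delta>" for i using C(1) by (auto simp: hausdorff_covers_def)
    define Q where "Q i = (if C i = {} then {} else cball (SOME x. x \<in> C i) (diameter (C i)))" for i
    have QB: "Q i \<in> sets borel" for i by (simp add: Q_def)
    have CQ: "C i \<subseteq> Q i" for i
    proof
      fix y assume y: "y \<in> C i"
      then have "(SOME x. x \<in> C i) \<in> C i" by (rule someI)
      then have "dist (SOME x. x \<in> C i) y \<le> diameter (C i)" using y Cb by (intro diameter_bounded_bound)
      then show "y \<in> Q i" using y by (auto simp: Q_def)
    qed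
    have Qm: "emeasure lborel (Q i) \<le> ennreal (A * \<delta>) * hausdorff_gauge k (C i)" for i
    proof (cases "C i = {}")
      case False
      define d where "d = diameter (C i)"
      have d: "0 \<le> d" "d \<le> \<delta>" using Cb[of i] diameter_ge_0[of "C i"] by (auto simp: d_def)
      have "emeasure lborel (Q i) = ennreal (\<omega>n * d ^ Suc k)"
        using False d(1) emeasure_cball[of d "SOME x. x \<in> C i"] by (simp add: Q_def d_def \<omega>n_def n)
      also have "\<omega>n * d ^ Suc k = A * d * (\<omega> * (d / 2) ^ k)"
        using \<omega> by (simp add: A_def power_divide)
      also have "\<dots> \<le> A * \<delta> * (\<omega> * (d / 2) ^ k)" using A \<omega> d by (intro mult_right_mono mult_left_mono) auto
      finally show ?thesis
        using False A \<delta> \<omega> d(1) by (simp add: hausdorff_gauge_def d_def \<omega>_def ennreal_mult'[symmetric] ennreal_leI)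
    qed (simp add: Q_def)
    have UB: "(\<Union>i. Q i) \<in> sets lborel" using QB by auto
    have "emeasure lborel (\<Union>i. Q i) \<le> (\<Sum>i. emeasure lborel (Q i))"
      using QB by (intro emeasure_subadditive_countably) auto
    also have "\<dots> \<le> (\<Sum>i. ennreal (A * \<delta>) * hausdorff_gauge k (C i))" using Qm by (intro suminf_le) auto
    also have "\<dots> = ennreal (A * \<delta>) * (\<Sum>i. hausdorff_gauge k (C i))" by (rule ennreal_suminf_cmult)
    also have "\<dots> \<le> ennreal (A * \<delta>) * ennreal (H + 1)" using C(2) by (intro mult_left_mono) auto
    also have "\<dots> = ennreal e"
    proof -
      have "H + 1 \<noteq> 0" using H by simp
      then have "A * \<delta> * (H + 1) = e" using A by (simp add: \<delta>_def)
      then show ?thesis using A \<delta> H by (subst ennreal_mult[symmetric]) auto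
    qed
    finally have le: "emeasure lborel (\<Union>i. Q i) \<le> ennreal e" .
    show "\<exists>T. S \<subseteq> T \<and> T \<in> lmeasurable \<and> measure lebesgue T \<le> e"
    proof (intro exI conjI)
      have "S \<subseteq> (\<Union>i. C i)" using C(1) by (auto simp: hausdorff_covers_def)
      then show "S \<subseteq> (\<Union>i. Q i)" using CQ by blast
      show "(\<Union>i. Q i) \<in> lmeasurable"
        using UB le by (intro fmeasurableI) (auto simp: less_top[symmetric] top_unique intro: le_less_trans)
      show "measure lebesgue (\<Union>i. Q i) \<le> e"
        using UB le e by (simp add: measure_def enn2real_leI)
    qed
  qed
  then show ?thesis by (simp add: negligible_iff_null_sets)
qed

section \<open>Structure of the derivative measure\<close>

lemma set_integral_lebesgue_representative:
  fixes q q' :: "'a::euclidean_space \<Rightarrow> 'b::euclidean_space"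
  assumes \<Omega>: "\<Omega> \<in> sets borel" and q': "q' \<in> borel_measurable borel" "\<And>x. x \<notin> \<Omega> \<Longrightarrow> q' x = 0"
    and ae: "AE x in lborel. x \<in> \<Omega> \<longrightarrow> q x = q' x" and A: "A \<in> sets borel" "A \<subseteq> \<Omega>"
  shows "(LINT x:A|lebesgue. q x) = (LINT x:A|lborel. q' x)"
proof -
  have AL: "A \<in> sets lebesgue" using A(1) by simp
  have m: "(\<lambda>x. indicator \<Omega> x *\<^sub>R q x) \<in> borel_measurable lebesgue" by (rule representative_measurable[OF \<Omega> q' ae])
  have ae': "AE x in lebesgue. indicator \<Omega> x *\<^sub>R q x = q' x" by (rule representative_AE[OF \<Omega> q' ae])
  have q'l: "q' \<in> borel_measurable lebesgue" using q'(1) by (intro measurable_completion) simp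
  have "(\<lambda>x. indicator A x *\<^sub>R q x) = (\<lambda>x. indicator A x *\<^sub>R (indicator \<Omega> x *\<^sub>R q x))"
    using A(2) by (auto simp: indicator_def fun_eq_iff)
  then have "(LINT x:A|lebesgue. q x) = (LINT x|lebesgue. indicator A x *\<^sub>R (indicator \<Omega> x *\<^sub>R q x))"
    unfolding set_lebesgue_integral_def by simp
  also have "\<dots> = (LINT x|lebesgue. indicator A x *\<^sub>R q' x)"
  proof (rule integral_cong_AE)
    show "AE x in lebesgue. indicator A x *\<^sub>R (indicator \<Omega> x *\<^sub>R q x) = indicator A x *\<^sub>R q' x"
      using ae' by eventually_elim simp
  qed (intro borel_measurable_scaleR borel_measurable_indicator AL m q'l)+
  also have "\<dots> = (LINT x|lborel. indicator A x *\<^sub>R q' x)"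
    using A(1) q'(1) by (intro integral_completion) auto
  finally show ?thesis by (simp add: set_lebesgue_integral_def)
qed

text \<open>Fixes the very pair selected inside \<open>BV_deriv\<close> and pushes its measure
  forward to a Borel measure on the whole space, with \<open>\<sigma>\<close> extended by zero, so
  that total variation and \<open>BV_deriv\<close> refer to the same object.\<close>

lemma BV_polar_measure:
  fixes \<Omega> :: "'a::euclidean_space set"
  assumes \<Omega>: "open \<Omega>" and v: "v \<in> BV \<Omega>"
  obtains \<mu> \<sigma> where "sets \<mu> = sets borel" "finite_measure \<mu>" "\<sigma> \<in> borel_measurable borel"
    "\<And>x. x \<in> \<Omega> \<Longrightarrow> norm (\<sigma> x) = 1" "\<And>x. x \<notin> \<Omega> \<Longrightarrow> \<sigma> x = 0" "emeasure \<mu> (- \<Omega>) = 0"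
    "\<And>\<phi> i. \<phi> \<in> C1_compact_support \<Omega> \<Longrightarrow> i \<in> Basis \<Longrightarrow>
      (LINT x|lebesgue_on \<Omega>. v x * (grad \<phi> x \<bullet> i)) = - (LINT x|\<mu>. \<phi> x * (\<sigma> x \<bullet> i))"
    "\<And>A. A \<in> sets borel \<Longrightarrow> A \<subseteq> \<Omega> \<Longrightarrow> BV_deriv \<Omega> v A = (LINT x:A|\<mu>. \<sigma> x)"
proof -
  define p where "p = (SOME (\<mu>, \<sigma>). is_polar_deriv \<Omega> v \<mu> \<sigma>)"
  obtain \<mu> \<sigma> where p: "p = (\<mu>, \<sigma>)" by (cases p)
  have "\<exists>p. case p of (\<mu>, \<sigma>) \<Rightarrow> is_polar_deriv \<Omega> v \<mu> \<sigma>" using v by (auto simp: BV_def)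
  then have "case p of (\<mu>, \<sigma>) \<Rightarrow> is_polar_deriv \<Omega> v \<mu> \<sigma>" unfolding p_def by (rule someI_ex)
  then have pol: "is_polar_deriv \<Omega> v \<mu> \<sigma>" by (simp add: p)
  have BVd: "BV_deriv \<Omega> v A = (LINT x:A|\<mu>. \<sigma> x)" for A
    unfolding BV_deriv_def p_def[symmetric] p by simp
  have s\<mu>: "sets \<mu> = sets (restrict_space borel \<Omega>)" and fin: "finite_measure \<mu>" and \<sigma>m: "\<sigma> \<in> borel_measurable \<mu>"
    and \<sigma>1: "\<forall>x\<in>\<Omega>. norm (\<sigma> x) = 1"
    and parts: "\<forall>\<phi>\<in>C1_compact_support \<Omega>. \<forall>i\<in>Basis. (LINT x|lebesgue_on \<Omega>. v x * (grad \<phi> x \<bullet> i)) = - (LINT x|\<mu>. \<phi> x * (\<sigma> x \<bullet> i))"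
    using pol unfolding is_polar_deriv_def by auto
  interpret finite_measure \<mu> by fact
  have sp: "space \<mu> = \<Omega>" using sets_eq_imp_space_eq[OF s\<mu>] by (simp add: space_restrict_space)
  have id: "(\<lambda>x. x) \<in> measurable \<mu> borel"
    unfolding measurable_cong_sets[OF s\<mu> refl] by (intro measurable_restrict_space1) simp
  define \<mu>' where "\<mu>' = distr \<mu> borel (\<lambda>x. x)"
  define \<sigma>' where "\<sigma>' x = indicator \<Omega> x *\<^sub>R \<sigma> x" for x
  have \<sigma>'m: "\<sigma>' \<in> borel_measurable borel"
    using \<sigma>m \<Omega> unfolding measurable_cong_sets[OF s\<mu> refl] \<sigma>'_def by (subst (asm) borel_measurable_restrict_space_iff) auto
  have s': "sets \<mu>' = sets borel" by (simp add: \<mu>'_def)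
  have int': "(LINT x|\<mu>'. q x) = (LINT x|\<mu>. q x)" if "q \<in> borel_measurable borel" for q :: "'a \<Rightarrow> 'b::{banach, second_countable_topology}"
    unfolding \<mu>'_def using that id by (rule integral_distr[rotated])
  show thesis
  proof (rule that[OF s' _ \<sigma>'m])
    show "finite_measure \<mu>'" unfolding \<mu>'_def by (rule finite_measure_distr[OF id])
    show "norm (\<sigma>' x) = 1" if "x \<in> \<Omega>" for x using that \<sigma>1 by (simp add: \<sigma>'_def)
    show "\<sigma>' x = 0" if "x \<notin> \<Omega>" for x using that by (simp add: \<sigma>'_def)
    show "emeasure \<mu>' (- \<Omega>) = 0"
      unfolding \<mu>'_def using \<Omega> id by (subst emeasure_distr) (auto simp: sp)
    fix \<phi> :: "'a \<Rightarrow> real" and i :: 'a assume \<phi>: "\<phi> \<in> C1_compact_support \<Omega>" "i \<in> Basis"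
    obtain d where "C1_with_grad \<phi> d" using C1_compact_supportE[OF \<phi>(1)] by metis
    then have "\<phi> \<in> borel_measurable borel" using C1_with_grad_measurable by blast
    then have "(LINT x|\<mu>'. \<phi> x * (\<sigma>' x \<bullet> i)) = (LINT x|\<mu>. \<phi> x * (\<sigma>' x \<bullet> i))"
      using \<sigma>'m by (intro int') auto
    also have "\<dots> = (LINT x|\<mu>. \<phi> x * (\<sigma> x \<bullet> i))"
      by (intro Bochner_Integration.integral_cong refl) (simp add: sp \<sigma>'_def)
    finally show "(LINT x|lebesgue_on \<Omega>. v x * (grad \<phi> x \<bullet> i)) = - (LINT x|\<mu>'. \<phi> x * (\<sigma>' x \<bullet> i))"
      using parts \<phi> by simp
  next
    fix A :: "'a set" assume A: "A \<in> sets borel" "A \<subseteq> \<Omega>"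
    have "(LINT x:A|\<mu>'. \<sigma>' x) = (LINT x:A|\<mu>. \<sigma>' x)"
      unfolding set_lebesgue_integral_def using A(1) \<sigma>'m by (intro int') auto
    also have "\<dots> = (LINT x:A|\<mu>. \<sigma> x)"
      unfolding set_lebesgue_integral_def by (intro Bochner_Integration.integral_cong refl) (simp add: sp \<sigma>'_def)
    finally show "BV_deriv \<Omega> v A = (LINT x:A|\<mu>'. \<sigma>' x)" using BVd by simp
  qed
qed

lemma set_integral_inner:
  fixes f :: "'a \<Rightarrow> 'b::euclidean_space"
  assumes "integrable M f" "A \<in> sets M"
  shows "(LINT x:A|M. f x) \<bullet> i = (LINT x:A|M. f x \<bullet> i)"
  using integral_inner_left[of i M "\<lambda>x. indicator A x *\<^sub>R f x"] integrable_mult_indicator[OF assms(2,1)]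
  by (simp add: set_lebesgue_integral_def)

text \<open>The polar measure and the density \<open>F\<close> agree on test functions, hence on
  Borel subsets of \<Omega>, one component at a time.\<close>

lemma BV_deriv_of_density:
  fixes F :: "'a::euclidean_space \<Rightarrow> 'a"
  assumes \<Omega>: "open \<Omega>" and v: "v \<in> BV \<Omega>" and F: "integrable lborel F"
    and parts: "\<And>\<phi> i. \<phi> \<in> C1_compact_support \<Omega> \<Longrightarrow> i \<in> Basis \<Longrightarrow>
      (LINT x|lebesgue_on \<Omega>. v x * (grad \<phi> x \<bullet> i)) = - (LINT x|lborel. \<phi> x * (F x \<bullet> i))"
    and A: "A \<in> sets borel" "A \<subseteq> \<Omega>"
  shows "BV_deriv \<Omega> v A = (LINT x:A|lborel. F x)"
proof (rule BV_polar_measure[OF \<Omega> v])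
  fix \<mu> \<sigma> assume a: "sets \<mu> = sets borel" "finite_measure \<mu>" "\<sigma> \<in> borel_measurable borel"
    "\<And>x. x \<in> \<Omega> \<Longrightarrow> norm (\<sigma> x) = 1" "\<And>x. x \<notin> \<Omega> \<Longrightarrow> \<sigma> x = 0" "emeasure \<mu> (- \<Omega>) = 0"
    "\<And>\<phi> i. \<phi> \<in> C1_compact_support \<Omega> \<Longrightarrow> i \<in> Basis \<Longrightarrow>
      (LINT x|lebesgue_on \<Omega>. v x * (grad \<phi> x \<bullet> i)) = - (LINT x|\<mu>. \<phi> x * (\<sigma> x \<bullet> i))"
    "\<And>A. A \<in> sets borel \<Longrightarrow> A \<subseteq> \<Omega> \<Longrightarrow> BV_deriv \<Omega> v A = (LINT x:A|\<mu>. \<sigma> x)"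
  interpret finite_measure \<mu> by fact
  have "norm (\<sigma> x) \<le> 1" for x using a(4,5)[of x] by (cases "x \<in> \<Omega>") auto
  then have \<sigma>i: "integrable \<mu> \<sigma>" using a(1,3) by (intro integrable_const_bound[where B=1]) (auto cong: measurable_cong_sets)
  show ?thesis
  proof (rule euclidean_eqI)
    fix i :: 'a assume i: "i \<in> Basis"
    have "(LINT x:A|\<mu>. \<sigma> x \<bullet> i) = (LINT x:A|lborel. F x \<bullet> i)"
    proof (rule set_integral_eq_of_test_functions[OF \<Omega> a(1) sets_lborel _ _ _ A])
      show "(LINT x|\<mu>. \<phi> x * (\<sigma> x \<bullet> i)) = (LINT x|lborel. \<phi> x * (F x \<bullet> i))" if "\<phi> \<in> C1_compact_support \<Omega>" for \<phi>
        using a(7)[OF that i] parts[OF that i] by simp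
    qed (use \<sigma>i F in auto)
    then show "BV_deriv \<Omega> v A \<bullet> i = (LINT x:A|lborel. F x) \<bullet> i"
      using a(8)[OF A] set_integral_inner[OF \<sigma>i, of A i] set_integral_inner[OF F, of A i] A(1) a(1) by simp
  qed
qed

text \<open>\<open>G\<close> witnesses that the choice in \<open>approx_grad\<close> succeeds. Both
  fields represent the derivative off the union of two null sets, so their integrals over Borel sets
  agree there and the fields agree almost everywhere.\<close>

lemma approx_grad_AE_eq:
  fixes G :: "'a::euclidean_space \<Rightarrow> 'a"
  assumes \<Omega>: "open \<Omega>" and ag: "is_approx_grad \<Omega> v G" and G: "integrable lborel G" "\<And>x. x \<notin> \<Omega> \<Longrightarrow> G x = 0"
  shows "is_approx_grad \<Omega> v (approx_grad \<Omega> v)" "AE x in lborel. x \<in> \<Omega> \<longrightarrow> approx_grad \<Omega> v x = G x"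
proof -
  have \<Omega>B: "\<Omega> \<in> sets borel" using \<Omega> by simp
  have Gm: "G \<in> borel_measurable borel" using G by (auto dest: borel_measurable_integrable)
  show AG: "is_approx_grad \<Omega> v (approx_grad \<Omega> v)"
    unfolding approx_grad_def by (rule someI[of "is_approx_grad \<Omega> v", OF ag])
  obtain N1 where N1: "N1 \<in> null_sets lborel" "\<And>A. A \<in> sets borel \<Longrightarrow> A \<subseteq> \<Omega> - N1 \<Longrightarrow> BV_deriv \<Omega> v A = (LINT x:A|lebesgue. G x)"
    using ag unfolding is_approx_grad_def by blast
  obtain N2 where N2: "N2 \<in> null_sets lborel" "\<And>A. A \<in> sets borel \<Longrightarrow> A \<subseteq> \<Omega> - N2 \<Longrightarrow> BV_deriv \<Omega> v A = (LINT x:A|lebesgue. approx_grad \<Omega> v x)"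
    using AG unfolding is_approx_grad_def by blast
  have AGi: "integrable (lebesgue_on \<Omega>) (approx_grad \<Omega> v)" using AG unfolding is_approx_grad_def by blast
  obtain g where g: "g \<in> borel_measurable borel" "\<And>x. x \<notin> \<Omega> \<Longrightarrow> g x = 0" "AE x in lborel. x \<in> \<Omega> \<longrightarrow> approx_grad \<Omega> v x = g x"
    by (rule borel_representative[OF \<Omega>B borel_measurable_integrable[OF AGi]]) (rule that)
  have "integrable (lebesgue_on \<Omega>) (approx_grad \<Omega> v) \<longleftrightarrow> integrable lborel g"
    by (rule integrable_lebesgue_on_representative[OF \<Omega>B g])
  then have gi: "integrable lborel g" using AGi by simp
  define S where "S = \<Omega> - (N1 \<union> N2)"
  have S: "S \<in> sets lborel" using \<Omega>B null_setsD2[OF N1(1)] null_setsD2[OF N2(1)] unfolding S_def by auto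
  have "AE x in lborel. x \<in> S \<longrightarrow> g x \<bullet> i - G x \<bullet> i = 0" for i
  proof (rule AE_eq_0_of_set_integrals[OF _ _ S])
    show "integrable lborel (\<lambda>x. g x \<bullet> i - G x \<bullet> i)" using gi G by auto
    fix A assume A: "A \<in> sets lborel" "A \<subseteq> S"
    then have AB: "A \<in> sets borel" "A \<subseteq> \<Omega>" by (auto simp: S_def)
    have "(LINT x:A|lborel. g x) = (LINT x:A|lebesgue. approx_grad \<Omega> v x)"
      by (rule set_integral_lebesgue_representative[OF \<Omega>B g AB, symmetric])
    also have "\<dots> = (LINT x:A|lebesgue. G x)"
    proof -
      have "A \<subseteq> \<Omega> - N1" "A \<subseteq> \<Omega> - N2" using A(2) by (auto simp: S_def)
      then show ?thesis using N1(2)[OF AB(1)] N2(2)[OF AB(1)] by simp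
    qed
    also have "\<dots> = (LINT x:A|lborel. G x)"
      by (rule set_integral_lebesgue_representative[OF \<Omega>B Gm G(2) _ AB]) auto
    finally have "(LINT x:A|lborel. g x) \<bullet> i = (LINT x:A|lborel. G x) \<bullet> i" by simp
    then have "(LINT x:A|lborel. g x \<bullet> i) = (LINT x:A|lborel. G x \<bullet> i)"
      using set_integral_inner[OF gi A(1)] set_integral_inner[OF G(1) A(1)] by simp
    moreover have "set_integrable lborel A (\<lambda>x. g x \<bullet> i)" "set_integrable lborel A (\<lambda>x. G x \<bullet> i)"
      using gi G A(1) by (auto intro!: set_integrable_of_integrable)
    ultimately show "(LINT x:A|lborel. g x \<bullet> i - G x \<bullet> i) = 0" by (simp add: set_integral_diff)
  qed
  then have "AE x in lborel. \<forall>i\<in>Basis. x \<in> S \<longrightarrow> g x \<bullet> i - G x \<bullet> i = 0" by (intro AE_finite_allI) auto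
  moreover have "AE x in lborel. x \<notin> N1" "AE x in lborel. x \<notin> N2" using N1(1) N2(1) by (auto intro: AE_not_in)
  ultimately show "AE x in lborel. x \<in> \<Omega> \<longrightarrow> approx_grad \<Omega> v x = G x"
    using g(3)
  proof eventually_elim
    case (elim x)
    show ?case
    proof
      assume x: "x \<in> \<Omega>"
      then have "x \<in> S" using elim(2,3) by (simp add: S_def)
      then have "g x \<bullet> i = G x \<bullet> i" if "i \<in> Basis" for i using bspec[OF elim(1) that] by simp
      then have "g x = G x" by (rule euclidean_eqI)
      then show "approx_grad \<Omega> v x = G x" using elim(4) x by simp
    qed
  qed
qed

text \<open>The total variation is split into its restrictions to \<open>P\<close> and to
  \<open>\<Omega> - P\<close>. Off \<open>P\<close> the derivative is the integral of the
  approximate gradient, so this part is absolutely continuous, and Radon-Nikodym with the polar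
  direction rebuilds its density \<open>G\<close>. The size of the jumps is discarded: only the
  direction and the Hausdorff bound on \<open>P\<close> remain.\<close>

lemma SBV_jump_decomposition:
  fixes \<Omega> :: "'a::euclidean_space set"
  assumes \<Omega>: "open \<Omega>" "bounded \<Omega>" and v: "v \<in> SBV \<Omega>"
    and H: "hausdorff_outer (DIM('a) - 1) (singular_set \<Omega> v) \<le> ennreal h" "h \<ge> 0"
  shows "\<exists>P v' G \<sigma> \<nu>. jump_decomposition \<Omega> P v' G \<sigma> \<nu> h \<and> (\<forall>x. x \<notin> \<Omega> \<longrightarrow> v' x = 0) \<and>
    (AE x in lborel. x \<in> \<Omega> \<longrightarrow> v x = v' x) \<and> (AE x in lborel. x \<in> \<Omega> \<longrightarrow> approx_grad \<Omega> v x = G x)"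
proof -
  have \<Omega>B: "\<Omega> \<in> sets borel" using \<Omega> by simp
  define S where "S = singular_set \<Omega> v"
  define k where "k = DIM('a) - 1"
  have vBV: "v \<in> BV \<Omega>" and Jint: "set_integrable (hausdorff_measure k) S (jump_vector v)"
    and Dv: "\<And>A. A \<in> sets borel \<Longrightarrow> A \<subseteq> \<Omega> \<Longrightarrow> BV_deriv \<Omega> v A =
          (LINT x:A|lebesgue. approx_grad \<Omega> v x) + (LINT x:A \<inter> S|hausdorff_measure k. jump_vector v x)"
    using v unfolding SBV_def S_def k_def by auto
  have vi: "integrable (lebesgue_on \<Omega>) v" using vBV by (simp add: BV_def)
  have S\<Omega>: "S \<subseteq> \<Omega>" by (auto simp: S_def singular_set_def)
  have Snull: "S \<in> null_sets lebesgue"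
    using H by (intro null_set_of_hausdorff_finite) (auto simp: S_def intro: le_less_trans)
  \<comment> \<open>The integrability demanded in \<open>SBV\<close> makes this integrand Borel
    measurable, whence \<open>P\<close> is Borel.\<close>
  define P where "P = {x. indicator S x *\<^sub>R jump_vector v x \<noteq> 0}"
  have Jm: "(\<lambda>x. indicator S x *\<^sub>R jump_vector v x) \<in> borel_measurable borel"
    using Jint unfolding set_integrable_def
    by (auto dest!: borel_measurable_integrable simp: measurable_cong_sets[OF sets_hausdorff_measure refl])
  have PB: "P \<in> sets borel"
  proof -
    have "(\<lambda>x. indicator S x *\<^sub>R jump_vector v x) -` (- {0}) \<inter> space borel \<in> sets borel"
      by (rule measurable_sets[OF Jm]) simp
    also have "(\<lambda>x. indicator S x *\<^sub>R jump_vector v x) -` (- {0}) \<inter> space borel = P" by (auto simp: P_def)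
    finally show ?thesis .
  qed
  have PS: "P \<subseteq> S" by (auto simp: P_def indicator_def)
  have P\<Omega>: "P \<subseteq> \<Omega>" using PS S\<Omega> by blast
  have "P \<in> null_sets lebesgue"
    by (rule null_sets_subset[OF Snull _ PS]) (use PB in simp)
  then have Pnull: "P \<in> null_sets lborel" using PB by (simp add: null_sets_completion_iff)
  have Dv_off: "BV_deriv \<Omega> v A = (LINT x:A|lebesgue. approx_grad \<Omega> v x)" if A: "A \<in> sets borel" "A \<subseteq> \<Omega> - P" for A
  proof -
    have "(\<lambda>x. indicator (A \<inter> S) x *\<^sub>R jump_vector v x) = (\<lambda>x. 0)"
    proof
      fix x
      show "indicator (A \<inter> S) x *\<^sub>R jump_vector v x = 0"
        using A(2) by (cases "x \<in> A") (auto simp: P_def indicator_def)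
    qed
    then have "(LINT x:A \<inter> S|hausdorff_measure k. jump_vector v x) = 0" by (simp add: set_lebesgue_integral_def)
    then show ?thesis using Dv[OF A(1)] A(2) by auto
  qed
  show ?thesis
  proof (rule BV_polar_measure[OF \<Omega>(1) vBV])
    fix \<mu> \<sigma> assume a: "sets \<mu> = sets borel" "finite_measure \<mu>" "\<sigma> \<in> borel_measurable borel"
      "\<And>x. x \<in> \<Omega> \<Longrightarrow> norm (\<sigma> x) = 1" "\<And>x. x \<notin> \<Omega> \<Longrightarrow> \<sigma> x = 0" "emeasure \<mu> (- \<Omega>) = 0"
      "\<And>\<phi> i. \<phi> \<in> C1_compact_support \<Omega> \<Longrightarrow> i \<in> Basis \<Longrightarrow>
        (LINT x|lebesgue_on \<Omega>. v x * (grad \<phi> x \<bullet> i)) = - (LINT x|\<mu>. \<phi> x * (\<sigma> x \<bullet> i))"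
      "\<And>A. A \<in> sets borel \<Longrightarrow> A \<subseteq> \<Omega> \<Longrightarrow> BV_deriv \<Omega> v A = (LINT x:A|\<mu>. \<sigma> x)"
    interpret finite_measure \<mu> by fact
    note a(3)[measurable] a(1)[measurable_cong] PB[measurable] \<Omega>B[measurable]
    have \<sigma>le: "norm (\<sigma> x) \<le> 1" for x using a(4,5)[of x] by (cases "x \<in> \<Omega>") auto
    have \<sigma>i: "integrable \<mu> \<sigma>" using \<sigma>le by (intro integrable_const_bound[where B=1]) auto
    \<comment> \<open>On subsets of a Lebesgue null set off \<open>P\<close> the derivative
      vanishes, so the unit vector \<open>\<sigma>\<close> would be zero almost everywhere there;
      the total variation of the set must be zero.\<close>
    have ac: "emeasure \<mu> A = 0" if A: "A \<in> null_sets lborel" "A \<subseteq> \<Omega> - P" for A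
    proof -
      have AB: "A \<in> sets borel" using A(1) by auto
      have "AE x in \<mu>. x \<in> A \<longrightarrow> \<sigma> x \<bullet> i = 0" for i
      proof (rule AE_eq_0_of_set_integrals)
        show "integrable \<mu> (\<lambda>x. \<sigma> x \<bullet> i)" using \<sigma>i by auto
        show "A \<in> sets \<mu>" using AB a(1) by simp
        fix B assume B: "B \<in> sets \<mu>" "B \<subseteq> A"
        then have BB: "B \<in> sets borel" using a(1) by simp
        have "B \<in> null_sets lborel" by (rule null_sets_subset[OF A(1) _ B(2)]) (use BB in simp)
        then have "AE x in lebesgue. x \<notin> B" by (intro AE_completion AE_not_in)
        then have "AE x in lebesgue. indicator B x *\<^sub>R approx_grad \<Omega> v x = 0" by eventually_elim simp
        then have "(LINT x:B|lebesgue. approx_grad \<Omega> v x) = 0"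
          unfolding set_lebesgue_integral_def by (rule integral_eq_zero_AE)
        moreover have "B \<subseteq> \<Omega> - P" "B \<subseteq> \<Omega>" using B(2) A(2) by auto
        ultimately have "(LINT x:B|\<mu>. \<sigma> x) = 0" using Dv_off[OF BB] a(8)[OF BB] by simp
        then show "(LINT x:B|\<mu>. \<sigma> x \<bullet> i) = 0" using set_integral_inner[OF \<sigma>i B(1), of i] by simp
      qed
      then have "AE x in \<mu>. \<forall>i\<in>Basis. x \<in> A \<longrightarrow> \<sigma> x \<bullet> i = 0" by (intro AE_finite_allI) auto
      then have "AE x in \<mu>. x \<notin> A"
      proof eventually_elim
        case (elim x)
        show ?case
        proof
          assume "x \<in> A"
          have "\<sigma> x \<bullet> i = 0 \<bullet> i" if "i \<in> Basis" for i using bspec[OF elim that] \<open>x \<in> A\<close> by simp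
          then have "\<sigma> x = 0" by (rule euclidean_eqI)
          then show False using a(4)[of x] A(2) \<open>x \<in> A\<close> by auto
        qed
      qed
      then have "A \<in> null_sets \<mu>" using AB a(1) by (simp add: AE_iff_null_sets)
      then show ?thesis by auto
    qed
    define \<nu>a where "\<nu>a = density \<mu> (indicator (\<Omega> - P))"
    have \<nu>a_em: "emeasure \<nu>a A = emeasure \<mu> ((\<Omega> - P) \<inter> A)" if "A \<in> sets borel" for A
      unfolding \<nu>a_def using that by (subst emeasure_density) (auto simp: nn_integral_indicator[symmetric] indicator_inter_arith intro!: nn_integral_cong)
    have abs: "absolutely_continuous lborel \<nu>a"
      unfolding absolutely_continuous_def
    proof
      fix A :: "'a set" assume A: "A \<in> null_sets lborel"
      then have AB: "A \<in> sets borel" by auto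
      have "(\<Omega> - P) \<inter> A \<in> null_sets lborel" by (rule null_sets_subset[OF A]) (use AB in auto)
      then have "emeasure \<nu>a A = 0" using \<nu>a_em[OF AB] ac[of "(\<Omega> - P) \<inter> A"] by simp
      then show "A \<in> null_sets \<nu>a" using AB a(1) by (auto simp: null_sets_def \<nu>a_def)
    qed
    obtain f where f: "f \<in> borel_measurable lborel" "density lborel f = \<nu>a"
      using sigma_finite_measure.Radon_Nikodym[OF sigma_finite_lborel abs] a(1) by (auto simp: \<nu>a_def)
    have fint: "(\<integral>\<^sup>+x. f x \<partial>lborel) < top"
    proof -
      have "(\<integral>\<^sup>+x. f x \<partial>lborel) = emeasure (density lborel f) UNIV" using f(1) by (subst emeasure_density) auto
      also have "\<dots> = emeasure \<mu> (\<Omega> - P)" using \<nu>a_em[of UNIV] f(2) by simp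
      also have "\<dots> < top" by (simp add: less_top[symmetric] emeasure_eq_measure)
      finally show ?thesis .
    qed
    define r where "r x = enn2real (f x)" for x
    have rm[measurable]: "r \<in> borel_measurable borel" unfolding r_def using f(1) by simp
    have fr: "AE x in lborel. f x = ennreal (r x)"
    proof -
      have "AE x in lborel. f x \<noteq> \<infinity>" using f(1) fint by (intro nn_integral_noteq_infinite) auto
      then show ?thesis by eventually_elim (simp add: r_def less_top)
    qed
    have \<nu>a_r: "\<nu>a = density lborel (\<lambda>x. ennreal (r x))"
      unfolding f(2)[symmetric] using f(1) fr by (intro density_cong) auto
    have ri: "integrable lborel r"
    proof (rule integrableI_nonneg)
      have "(\<integral>\<^sup>+x. ennreal (r x) \<partial>lborel) = (\<integral>\<^sup>+x. f x \<partial>lborel)" using fr by (intro nn_integral_cong_AE) auto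
      then show "(\<integral>\<^sup>+x. ennreal (r x) \<partial>lborel) < \<infinity>" using fint by simp
    qed (auto simp: r_def)
    define G where "G x = r x *\<^sub>R \<sigma> x" for x
    have Gi: "integrable lborel G"
      unfolding G_def by (rule integrable_mult_bounded[OF ri _ \<sigma>le]) simp
    have G0: "G x = 0" if "x \<notin> \<Omega>" for x using that a(5) by (simp add: G_def)
    \<comment> \<open>Integration against the total variation: its restriction to \<open>P\<close>
      plus the part with Lebesgue density \<open>r\<close>.\<close>
    have split: "(LINT x|\<mu>. q x) = (LINT x|density \<mu> (\<lambda>x. ennreal (indicator P x)). q x) + (LINT x|lborel. r x *\<^sub>R q x)"
      if q: "q \<in> borel_measurable borel" "\<And>x. norm (q x) \<le> B" for q :: "'a \<Rightarrow> 'b::{banach, second_countable_topology}" and B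
    proof -
      note q(1)[measurable]
      have qi: "integrable \<mu> q" using q by (intro integrable_const_bound[where B=B]) auto
      have ind: "integrable \<mu> (\<lambda>x. indicator E x *\<^sub>R q x)" if "E \<in> sets borel" for E
        using qi that a(1) by (intro integrable_mult_indicator) auto
      have "- \<Omega> \<in> null_sets \<mu>" using a(1,6) \<Omega>B by (auto simp: null_sets_def)
      then have "AE x in \<mu>. x \<in> \<Omega>" using AE_not_in[of "- \<Omega>" \<mu>] by simp
      then have "(LINT x|\<mu>. q x) = (LINT x|\<mu>. indicator P x *\<^sub>R q x + indicator (\<Omega> - P) x *\<^sub>R q x)"
        by (intro integral_cong_AE) (auto simp: indicator_def elim!: eventually_mono)
      also have "\<dots> = (LINT x|\<mu>. indicator P x *\<^sub>R q x) + (LINT x|\<mu>. indicator (\<Omega> - P) x *\<^sub>R q x)"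
        by (intro Bochner_Integration.integral_add ind) auto
      also have "(LINT x|\<mu>. indicator P x *\<^sub>R q x) = (LINT x|density \<mu> (\<lambda>x. ennreal (indicator P x)). q x)"
        by (subst integral_density) auto
      also have "(LINT x|\<mu>. indicator (\<Omega> - P) x *\<^sub>R q x) = (LINT x|\<nu>a. q x)"
        unfolding \<nu>a_def using integral_density[of q \<mu> "indicator (\<Omega> - P)"] by (simp add: ennreal_indicator)
      also have "\<dots> = (LINT x|lborel. r x *\<^sub>R q x)"
        unfolding \<nu>a_r by (subst integral_density) (auto simp: r_def)
      finally show ?thesis .
    qed
    define \<nu> where "\<nu> = density \<mu> (\<lambda>x. ennreal (indicator P x))"
    have \<nu>_em: "emeasure \<nu> A = emeasure \<mu> (P \<inter> A)" if "A \<in> sets borel" for A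
      unfolding \<nu>_def using that by (subst emeasure_density) (auto simp: nn_integral_indicator[symmetric] indicator_inter_arith ennreal_indicator intro!: nn_integral_cong)
    have \<nu>s: "sets \<nu> = sets borel" by (simp add: \<nu>_def a(1))
    have \<nu>fin: "finite_measure \<nu>"
      by (rule finite_measureI) (use \<nu>_em[of UNIV] sets_eq_imp_space_eq[OF \<nu>s] in \<open>simp add: emeasure_eq_measure\<close>)
    interpret \<nu>: finite_measure \<nu> by (rule \<nu>fin)
    have \<sigma>\<nu>: "integrable \<nu> \<sigma>" using \<sigma>le a(3) \<nu>s by (intro \<nu>.integrable_const_bound[where B=1]) (auto cong: measurable_cong_sets)
    have ag: "is_approx_grad \<Omega> v G"
      unfolding is_approx_grad_def
    proof (intro conjI bexI[OF _ Pnull] ballI impI)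
      have Gm: "G \<in> borel_measurable borel" using Gi by (auto dest: borel_measurable_integrable)
      have "integrable (lebesgue_on \<Omega>) G \<longleftrightarrow> integrable lborel G"
        by (rule integrable_lebesgue_on_representative[OF \<Omega>B Gm G0]) auto
      then show "integrable (lebesgue_on \<Omega>) G" using Gi by simp
      fix A :: "'a set" assume A: "A \<in> sets borel" "A \<subseteq> \<Omega> - P"
      have "BV_deriv \<Omega> v A = (LINT x|\<mu>. indicator A x *\<^sub>R \<sigma> x)" using a(8)[OF A(1)] A(2) by (auto simp: set_lebesgue_integral_def)
      also have "\<dots> = (LINT x|\<nu>. indicator A x *\<^sub>R \<sigma> x) + (LINT x|lborel. r x *\<^sub>R (indicator A x *\<^sub>R \<sigma> x))"
        unfolding \<nu>_def by (rule split[of _ 1]) (use A(1) \<sigma>le in \<open>auto simp: indicator_def\<close>)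
      also have "(LINT x|\<nu>. indicator A x *\<^sub>R \<sigma> x) = (LINT x|\<mu>. indicator P x *\<^sub>R (indicator A x *\<^sub>R \<sigma> x))"
        unfolding \<nu>_def using A(1) by (subst integral_density) auto
      also have "(\<lambda>x. indicator P x *\<^sub>R (indicator A x *\<^sub>R \<sigma> x)) = (\<lambda>x. 0)" using A(2) by (auto simp: indicator_def fun_eq_iff)
      also have "(LINT x|\<mu>. (0::'a)) + (LINT x|lborel. r x *\<^sub>R (indicator A x *\<^sub>R \<sigma> x)) = (LINT x:A|lborel. G x)"
        by (simp add: set_lebesgue_integral_def G_def mult.commute)
      also have "\<dots> = (LINT x:A|lebesgue. G x)"
        by (rule set_integral_lebesgue_representative[OF \<Omega>B Gm G0 _ A(1), symmetric]) (use A(2) in auto)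
      finally show "BV_deriv \<Omega> v A = (LINT x:A|lebesgue. G x)" .
    qed
    obtain v' where v': "v' \<in> borel_measurable borel" "\<And>x. x \<notin> \<Omega> \<Longrightarrow> v' x = 0" "AE x in lborel. x \<in> \<Omega> \<longrightarrow> v x = v' x"
      by (rule borel_representative[OF \<Omega>B borel_measurable_integrable[OF vi]]) (rule that)
    have "integrable (lebesgue_on \<Omega>) v \<longleftrightarrow> integrable lborel v'"
      by (rule integrable_lebesgue_on_representative[OF \<Omega>B v'])
    then have v'i: "integrable lborel v'" using vi by simp
    have lim: "AE x in lborel. x \<in> \<Omega> \<longrightarrow> approx_limit v' x (v' x)"
    proof (rule approx_limit_eq_value_AE[OF \<Omega> v'i])
      have "AE x in lebesgue. x \<notin> S" using Snull by (rule AE_not_in)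
      then have "AE x in lborel. x \<notin> S" by (simp add: AE_completion_iff)
      then show "AE x in lborel. x \<in> \<Omega> \<longrightarrow> (\<exists>a. approx_limit v' x a)"
      proof eventually_elim
        case (elim x)
        show ?case
        proof
          assume x: "x \<in> \<Omega>"
          then obtain b where "approx_limit v x b" using elim by (auto simp: S_def singular_set_def)
          then have "approx_limit v' x b" using approx_limit_representative[OF \<Omega>(1) v' x] by simp
          then show "\<exists>a. approx_limit v' x a" by blast
        qed
      qed
    qed
    have "jump_decomposition \<Omega> P v' G \<sigma> \<nu> h"
    proof
      show "emeasure \<nu> (- P) = 0" using \<nu>_em[of "- P"] PB by simp
      show "hausdorff_outer (DIM('a) - 1) P \<le> ennreal h"
        using hausdorff_outer_mono[OF PS, of "DIM('a) - 1"] H(1) unfolding S_def by (rule order_trans)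
      show "norm (\<sigma> x) = 1" if "x \<in> P" for x using a(4) that P\<Omega> by blast
      fix \<phi> d assume \<phi>: "\<phi> \<in> C1_compact_support \<Omega>" "C1_with_grad \<phi> d"
      obtain d' K where K: "compact K" "K \<subseteq> \<Omega>" "\<And>x. x \<notin> K \<Longrightarrow> \<phi> x = 0"
        using C1_compact_supportE[OF \<phi>(1)] by metis
      have d0: "d x = 0" if "x \<notin> K" for x
        by (rule C1_with_grad_zero_outside[OF \<phi>(2) compact_imp_closed[OF K(1)] K(3) that])
      have dm[measurable]: "\<phi> \<in> borel_measurable borel" "d \<in> borel_measurable borel" using C1_with_grad_measurable[OF \<phi>(2)] by auto
      obtain B where B: "B > 0" "\<And>x. norm (d x) \<le> B"
        using bounded_continuous_compact_support[OF C1_with_grad_continuous_grad[OF \<phi>(2)] K(1) d0] by blast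
      obtain C where C: "C > 0" "\<And>x. norm (\<phi> x) \<le> C"
        using bounded_continuous_compact_support[OF C1_with_grad_continuous[OF \<phi>(2)] K(1,3)] by blast
      have i1: "integrable lborel (\<lambda>x. v' x *\<^sub>R d x)" by (rule integrable_mult_bounded[OF v'i _ B(2)]) simp
      have i2: "integrable \<nu> (\<lambda>x. \<phi> x *\<^sub>R \<sigma> x)"
        using C(2) \<nu>s by (intro integrable_scaleR_bounded[OF \<sigma>\<nu>, of _ C]) (auto cong: measurable_cong_sets)
      have i3: "integrable lborel (\<lambda>x. \<phi> x *\<^sub>R G x)" using C(2) by (intro integrable_scaleR_bounded[OF Gi, of _ C]) auto
      show "(LINT x|lborel. v' x *\<^sub>R d x) = - (LINT x|\<nu>. \<phi> x *\<^sub>R \<sigma> x) - (LINT x|lborel. \<phi> x *\<^sub>R G x)"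
      proof (rule euclidean_eqI)
        fix i :: 'a assume i: "i \<in> Basis"
        have "(LINT x|lborel. v' x *\<^sub>R d x) \<bullet> i = (LINT x|lborel. v' x * (d x \<bullet> i))"
          using integral_inner_left[OF i1, of i] by simp
        also have "\<dots> = (LINT x|lebesgue_on \<Omega>. v x * (grad \<phi> x \<bullet> i))"
        proof (rule integral_lebesgue_on_representative[OF \<Omega>B, symmetric])
          show "AE x in lborel. x \<in> \<Omega> \<longrightarrow> v x * (grad \<phi> x \<bullet> i) = v' x * (d x \<bullet> i)"
            using v'(3) by eventually_elim (simp add: C1_with_grad_grad[OF \<phi>(2)])
        qed (use v' in auto)
        also have "\<dots> = - (LINT x|\<mu>. \<phi> x * (\<sigma> x \<bullet> i))" by (rule a(7)[OF \<phi>(1) i])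
        also have "(LINT x|\<mu>. \<phi> x * (\<sigma> x \<bullet> i)) = (LINT x|\<nu>. \<phi> x * (\<sigma> x \<bullet> i)) + (LINT x|lborel. r x *\<^sub>R (\<phi> x * (\<sigma> x \<bullet> i)))"
          unfolding \<nu>_def
        proof (rule split[of _ "C * 1"])
          fix x
          have "\<bar>\<sigma> x \<bullet> i\<bar> \<le> 1" using Basis_le_norm[OF i, of "\<sigma> x"] \<sigma>le[of x] by linarith
          then show "norm (\<phi> x * (\<sigma> x \<bullet> i)) \<le> C * 1"
            unfolding real_norm_def abs_mult using C(1) C(2)[of x] by (intro mult_mono) auto
        qed simp
        also have "(LINT x|\<nu>. \<phi> x * (\<sigma> x \<bullet> i)) = (LINT x|\<nu>. \<phi> x *\<^sub>R \<sigma> x) \<bullet> i"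
          using integral_inner_left[OF i2, of i] by simp
        also have "(LINT x|lborel. r x *\<^sub>R (\<phi> x * (\<sigma> x \<bullet> i))) = (LINT x|lborel. \<phi> x *\<^sub>R G x) \<bullet> i"
          using integral_inner_left[OF i3, of i] by (simp add: G_def mult_ac)
        finally show "(LINT x|lborel. v' x *\<^sub>R d x) \<bullet> i = (- (LINT x|\<nu>. \<phi> x *\<^sub>R \<sigma> x) - (LINT x|lborel. \<phi> x *\<^sub>R G x)) \<bullet> i"
          by (simp add: inner_diff_left)
      qed
    qed (use \<Omega> v'i lim Gi G0 \<nu>fin \<nu>s a(3) \<sigma>le PB P\<Omega> Pnull H(2) in auto)
    moreover have "AE x in lborel. x \<in> \<Omega> \<longrightarrow> approx_grad \<Omega> v x = G x" by (rule approx_grad_AE_eq(2)[OF \<Omega>(1) ag Gi G0])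
    ultimately show ?thesis using v'(2,3) by blast
  qed
qed

text \<open>The derivative of \<open>u'\<close> has the Lebesgue density \<open>X\<close>, so
  subtracting \<open>u'\<close> changes \<open>G\<close> and leaves the singular data
  \<open>P\<close>, \<open>\<sigma>\<close>, \<open>\<nu>\<close> as they are.\<close>

lemma jump_decomposition_diff:
  fixes u' :: "'a::euclidean_space \<Rightarrow> real" and X :: "'a \<Rightarrow> 'a"
  assumes J: "jump_decomposition \<Omega> P v G \<sigma> \<nu> h"
    and u: "integrable lborel u'" "\<And>x. x \<in> \<Omega> \<Longrightarrow> approx_limit u' x (u' x)" and X: "integrable lborel X" "\<And>x. x \<notin> \<Omega> \<Longrightarrow> X x = 0"
    and parts: "\<And>\<phi> d. \<phi> \<in> C1_compact_support \<Omega> \<Longrightarrow> C1_with_grad \<phi> d \<Longrightarrow>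
      (LINT x|lborel. u' x *\<^sub>R d x) = - (LINT x|lborel. \<phi> x *\<^sub>R X x)"
  shows "jump_decomposition \<Omega> P (\<lambda>x. v x - u' x) (\<lambda>x. G x - X x) \<sigma> \<nu> h"
proof -
  interpret jump_decomposition \<Omega> P v G \<sigma> \<nu> h by fact
  show ?thesis
  proof
    show "AE x in lborel. x \<in> \<Omega> \<longrightarrow> approx_limit (\<lambda>x. v x - u' x) x (v x - u' x)"
      using z_approx_limit by eventually_elim (auto intro!: approx_limit_diff z_integrable u)
    fix \<phi> d assume \<phi>: "\<phi> \<in> C1_compact_support \<Omega>" "C1_with_grad \<phi> d"
    obtain d' K where K: "compact K" "K \<subseteq> \<Omega>" "\<And>x. x \<notin> K \<Longrightarrow> \<phi> x = 0"
      using C1_compact_supportE[OF \<phi>(1)] by metis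
    have d0: "d x = 0" if "x \<notin> K" for x
      by (rule C1_with_grad_zero_outside[OF \<phi>(2) compact_imp_closed[OF K(1)] K(3) that])
    have dm: "\<phi> \<in> borel_measurable borel" "d \<in> borel_measurable borel" using C1_with_grad_measurable[OF \<phi>(2)] by auto
    obtain B where B: "B > 0" "\<And>x. norm (d x) \<le> B"
      using bounded_continuous_compact_support[OF C1_with_grad_continuous_grad[OF \<phi>(2)] K(1) d0] by blast
    obtain C where C: "C > 0" "\<And>x. norm (\<phi> x) \<le> C"
      using bounded_continuous_compact_support[OF C1_with_grad_continuous[OF \<phi>(2)] K(1,3)] by blast
    have i1: "integrable lborel (\<lambda>x. f x *\<^sub>R d x)" if "integrable lborel f" for f :: "'a \<Rightarrow> real"
      by (rule integrable_mult_bounded[OF that _ B(2)]) (simp add: dm)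
    have i2: "integrable lborel (\<lambda>x. \<phi> x *\<^sub>R F x)" if "integrable lborel F" for F :: "'a \<Rightarrow> 'a"
      using C(2) dm by (intro integrable_scaleR_bounded[OF that, of _ C]) auto
    show "(LINT x|lborel. (v x - u' x) *\<^sub>R d x) = - (LINT x|\<nu>. \<phi> x *\<^sub>R \<sigma> x) - (LINT x|lborel. \<phi> x *\<^sub>R (G x - X x))"
      unfolding scaleR_diff_left scaleR_diff_right
      using deriv[OF \<phi>] parts[OF \<phi>] i1[OF z_integrable] i1[OF u(1)] i2[OF G_integrable] i2[OF X(1)] by simp
  qed (use open_domain z_integrable u(1) G_integrable X G_zero \<nu>_finite \<nu>_sets \<sigma>_measurable \<sigma>_le \<sigma>_unit P_borel P_subset P_null P_carrier P_hausdorff h_nonneg in auto)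
qed

section \<open>Classical functions on bounded domains\<close>

text \<open>A common setting for \<open>u\<close>, \<open>u / 2\<close>, restrictions of C^1
  functions on the whole space and the combinations of these that occur in the first
  variation.\<close>

locale bounded_C1 =
  fixes \<Omega> :: "'a::euclidean_space set" and w :: "'a \<Rightarrow> real" and X :: "'a \<Rightarrow> 'a"
  assumes \<Omega>: "open \<Omega>" "bounded \<Omega>" and deriv: "\<And>x. x \<in> \<Omega> \<Longrightarrow> GDERIV w x :> X x"
    and X_cont: "continuous_on \<Omega> X" and w_bounded: "bounded (w ` \<Omega>)" and X_bounded: "bounded (X ` \<Omega>)"
begin

definition w0 :: "'a \<Rightarrow> real" where "w0 x = indicator \<Omega> x *\<^sub>R w x"
definition X0 :: "'a \<Rightarrow> 'a" where "X0 x = indicator \<Omega> x *\<^sub>R X x"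

lemma w0_in: "x \<in> \<Omega> \<Longrightarrow> w0 x = w x" and X0_in: "x \<in> \<Omega> \<Longrightarrow> X0 x = X x"
  and w0_out: "x \<notin> \<Omega> \<Longrightarrow> w0 x = 0" and X0_out: "x \<notin> \<Omega> \<Longrightarrow> X0 x = 0"
  by (auto simp: w0_def X0_def)

lemma \<Omega>_borel [measurable]: "\<Omega> \<in> sets borel" using \<Omega> by simp

lemma w_cont: "continuous_on \<Omega> w"
  using deriv \<Omega>(1) unfolding gderiv_def
  by (intro differentiable_imp_continuous_on) (auto simp: differentiable_on_def differentiable_def intro: has_derivative_at_withinI)

lemma w0_measurable [measurable]: "w0 \<in> borel_measurable borel"
  unfolding w0_def by (rule borel_measurable_continuous_on_indicator) (auto intro: w_cont)

lemma X0_measurable [measurable]: "X0 \<in> borel_measurable borel"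
  unfolding X0_def by (rule borel_measurable_continuous_on_indicator) (auto intro: X_cont)

lemma w0_le: obtains B where "B > 0" "\<And>x. \<bar>w0 x\<bar> \<le> B"
proof -
  obtain B where B: "B > 0" "\<forall>y\<in>w ` \<Omega>. norm y \<le> B" using w_bounded by (auto simp: bounded_pos)
  have "\<bar>w0 x\<bar> \<le> B" for x using B by (cases "x \<in> \<Omega>") (auto simp: w0_in w0_out)
  with B show thesis by (auto intro: that)
qed

lemma X0_le: obtains B where "B > 0" "\<And>x. norm (X0 x) \<le> B"
proof -
  obtain B where B: "B > 0" "\<forall>y\<in>X ` \<Omega>. norm y \<le> B" using X_bounded by (auto simp: bounded_pos)
  have "norm (X0 x) \<le> B" for x using B by (cases "x \<in> \<Omega>") (auto simp: X0_in X0_out)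
  with B show thesis by (auto intro: that)
qed

lemma integrable_domain_bounded:
  fixes q :: "'a \<Rightarrow> 'b::{banach, second_countable_topology}"
  assumes q: "q \<in> borel_measurable borel" "\<And>x. norm (q x) \<le> B" "\<And>x. x \<notin> \<Omega> \<Longrightarrow> q x = 0"
  shows "integrable lborel q"
proof -
  have "integrable lborel (indicator \<Omega> :: 'a \<Rightarrow> real)"
    using emeasure_lborel_bounded[OF \<Omega>(2)] by (simp add: integrable_indicator_iff)
  then have "integrable lborel (\<lambda>x. indicator \<Omega> x *\<^sub>R q x)"
    using q(1,2) by (intro integrable_mult_bounded[where B=B]) auto
  also have "(\<lambda>x. indicator \<Omega> x *\<^sub>R q x) = q" using q(3) by (auto simp: indicator_def fun_eq_iff)
  finally show ?thesis .
qed

lemma w0_integrable: "integrable lborel w0"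
proof -
  obtain B where "\<And>x. \<bar>w0 x\<bar> \<le> B" by (rule w0_le) (rule that)
  then show ?thesis by (intro integrable_domain_bounded[where B=B]) (auto simp: w0_out)
qed

lemma X0_integrable: "integrable lborel X0"
proof -
  obtain B where "\<And>x. norm (X0 x) \<le> B" by (rule X0_le) (rule that)
  then show ?thesis by (intro integrable_domain_bounded[where B=B]) (auto simp: X0_out)
qed

lemma X0_square_integrable: "integrable lborel (\<lambda>x. (norm (X0 x))\<^sup>2)"
proof -
  obtain B where "B > 0" "\<And>x. norm (X0 x) \<le> B" by (rule X0_le) (rule that)
  then show ?thesis by (intro integrable_domain_bounded[where B="B\<^sup>2"]) (auto simp: X0_out power_mono)
qed

lemma w0_square_integrable:
  assumes "g \<in> borel_measurable borel" "\<And>x. \<bar>g x\<bar> \<le> C" "\<And>x. x \<notin> \<Omega> \<Longrightarrow> g x = 0"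
  shows "integrable lborel (\<lambda>x. (w0 x - g x)\<^sup>2)"
proof -
  obtain B where B: "B > 0" "\<And>x. \<bar>w0 x\<bar> \<le> B" by (rule w0_le) (rule that)
  have "norm ((w0 x - g x)\<^sup>2) \<le> (B + C)\<^sup>2" for x
  proof -
    have "\<bar>w0 x - g x\<bar> \<le> B + C" using B(2)[of x] assms(2)[of x] by linarith
    then show ?thesis using power_mono[of "\<bar>w0 x - g x\<bar>" "B + C" 2] by simp
  qed
  then show ?thesis using assms by (intro integrable_domain_bounded[where B="(B + C)\<^sup>2"]) (auto simp: w0_out)
qed

text \<open>\<Omega> and the complement of \<open>K\<close> are open and cover the space; on the
  first the product rule holds, on the second everything is zero.\<close>

lemma C1_with_grad_mult_test:
  assumes \<phi>: "C1_with_grad \<phi> d" "compact K" "K \<subseteq> \<Omega>" "\<And>x. x \<notin> K \<Longrightarrow> \<phi> x = 0"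
  shows "C1_with_grad (\<lambda>x. w0 x * \<phi> x) (\<lambda>x. w0 x *\<^sub>R d x + \<phi> x *\<^sub>R X0 x)"
proof -
  have clK: "closed K" using \<phi>(2) by (rule compact_imp_closed)
  have d0: "d x = 0" if "x \<notin> K" for x by (rule C1_with_grad_zero_outside[OF \<phi>(1) clK \<phi>(4) that])
  have "GDERIV (\<lambda>x. w0 x * \<phi> x) x :> w0 x *\<^sub>R d x + \<phi> x *\<^sub>R X0 x" for x
  proof (cases "x \<in> \<Omega>")
    case True
    have "GDERIV (\<lambda>x. w x * \<phi> x) x :> w x *\<^sub>R d x + \<phi> x *\<^sub>R X x"
      by (rule GDERIV_mult[OF deriv[OF True] C1_with_grad_GDERIV[OF \<phi>(1)]])
    then show ?thesis
      unfolding gderiv_def w0_in[OF True] X0_in[OF True]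
      by (rule has_derivative_transform_within_open[OF _ \<Omega>(1) True]) (simp add: w0_in)
  next
    case False
    then have x: "x \<in> - K" using \<phi>(3) by auto
    have "GDERIV (\<lambda>x. 0) x :> 0" by (simp add: gderiv_def)
    then have "GDERIV (\<lambda>x. w0 x * \<phi> x) x :> 0"
      unfolding gderiv_def
      by (rule has_derivative_transform_within_open[OF _ open_Compl[OF clK] x]) (simp add: \<phi>(4))
    then show ?thesis using x d0 \<phi>(4) by simp
  qed
  moreover have "continuous_on (\<Omega> \<union> - K) (\<lambda>x. w0 x *\<^sub>R d x + \<phi> x *\<^sub>R X0 x)"
  proof (rule continuous_on_open_Un[OF \<Omega>(1) open_Compl[OF clK]])
    have "continuous_on \<Omega> (\<lambda>x. w x *\<^sub>R d x + \<phi> x *\<^sub>R X x)"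
      by (intro continuous_intros w_cont X_cont C1_with_grad_continuous[OF \<phi>(1)] C1_with_grad_continuous_grad[OF \<phi>(1)])
    then show "continuous_on \<Omega> (\<lambda>x. w0 x *\<^sub>R d x + \<phi> x *\<^sub>R X0 x)"
      by (rule continuous_on_eq) (simp add: w0_in X0_in)
    show "continuous_on (- K) (\<lambda>x. w0 x *\<^sub>R d x + \<phi> x *\<^sub>R X0 x)"
      by (rule continuous_on_eq[OF continuous_on_const[of _ 0]]) (simp add: d0 \<phi>(4))
  qed
  moreover have "\<Omega> \<union> - K = UNIV" using \<phi>(3) by auto
  ultimately show ?thesis by (simp add: C1_with_grad_def)
qed

lemma integral_by_parts:
  assumes \<phi>: "\<phi> \<in> C1_compact_support \<Omega>" "C1_with_grad \<phi> d"
  shows "(LINT x|lborel. w0 x *\<^sub>R d x) = - (LINT x|lborel. \<phi> x *\<^sub>R X0 x)"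
proof -
  obtain d' K where K: "compact K" "K \<subseteq> \<Omega>" "\<And>x. x \<notin> K \<Longrightarrow> \<phi> x = 0"
    using C1_compact_supportE[OF \<phi>(1)] by metis
  have d0: "d x = 0" if "x \<notin> K" for x
    by (rule C1_with_grad_zero_outside[OF \<phi>(2) compact_imp_closed[OF K(1)] K(3) that])
  have dm[measurable]: "\<phi> \<in> borel_measurable borel" "d \<in> borel_measurable borel" using C1_with_grad_measurable[OF \<phi>(2)] by auto
  obtain B where B: "B > 0" "\<And>x. norm (d x) \<le> B"
    using bounded_continuous_compact_support[OF C1_with_grad_continuous_grad[OF \<phi>(2)] K(1) d0] by blast
  obtain C where C: "C > 0" "\<And>x. norm (\<phi> x) \<le> C"
    using bounded_continuous_compact_support[OF C1_with_grad_continuous[OF \<phi>(2)] K(1,3)] by blast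
  have i1: "integrable lborel (\<lambda>x. w0 x *\<^sub>R d x)"
    by (rule integrable_mult_bounded[OF w0_integrable _ B(2)]) simp
  have i2: "integrable lborel (\<lambda>x. \<phi> x *\<^sub>R X0 x)"
    using C(2) by (intro integrable_scaleR_bounded[OF X0_integrable, of _ C]) auto
  have C1: "C1_with_grad (\<lambda>x. w0 x * \<phi> x) (\<lambda>x. w0 x *\<^sub>R d x + \<phi> x *\<^sub>R X0 x)"
    by (rule C1_with_grad_mult_test[OF \<phi>(2) K])
  have K0: "w0 x * \<phi> x = 0" if "x \<notin> K" for x using K(3)[OF that] by simp
  have "(LINT x|lborel. (w0 x *\<^sub>R d x + \<phi> x *\<^sub>R X0 x) \<bullet> e) = 0" for e
    using integral_grad_compact_support[OF C1 K(1) K0, of e] by simp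
  then have "(LINT x|lborel. w0 x *\<^sub>R d x + \<phi> x *\<^sub>R X0 x) \<bullet> e = 0" for e
    using i1 i2 by (subst integral_inner_left[symmetric]) auto
  then have "(LINT x|lborel. w0 x *\<^sub>R d x + \<phi> x *\<^sub>R X0 x) = 0" by (metis inner_eq_zero_iff)
  then show ?thesis using i1 i2 by (simp add: eq_neg_iff_add_eq_0)
qed

lemma integral_by_parts_component:
  assumes \<phi>: "\<phi> \<in> C1_compact_support \<Omega>" and i: "i \<in> Basis"
  shows "(LINT x|lebesgue_on \<Omega>. w x * (grad \<phi> x \<bullet> i)) = - (LINT x|lborel. \<phi> x * (X0 x \<bullet> i))"
proof -
  obtain d K where K: "C1_with_grad \<phi> d" "compact K" "\<And>x. x \<notin> K \<Longrightarrow> \<phi> x = 0" "\<And>x. x \<notin> K \<Longrightarrow> d x = 0"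
    using C1_compact_supportE[OF \<phi>] by metis
  have dm[measurable]: "\<phi> \<in> borel_measurable borel" "d \<in> borel_measurable borel" using C1_with_grad_measurable[OF K(1)] by auto
  obtain B where B: "B > 0" "\<And>x. norm (d x) \<le> B"
    using bounded_continuous_compact_support[OF C1_with_grad_continuous_grad[OF K(1)] K(2,4)] by blast
  obtain C where C: "C > 0" "\<And>x. norm (\<phi> x) \<le> C"
    using bounded_continuous_compact_support[OF C1_with_grad_continuous[OF K(1)] K(2,3)] by blast
  have i1: "integrable lborel (\<lambda>x. w0 x *\<^sub>R d x)"
    by (rule integrable_mult_bounded[OF w0_integrable _ B(2)]) simp
  have i2: "integrable lborel (\<lambda>x. \<phi> x *\<^sub>R X0 x)"
    using C(2) by (intro integrable_scaleR_bounded[OF X0_integrable, of _ C]) auto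
  have "(LINT x|lebesgue_on \<Omega>. w x * (grad \<phi> x \<bullet> i)) = (LINT x|lborel. w0 x * (d x \<bullet> i))"
    by (rule integral_lebesgue_on_representative[OF \<Omega>_borel])
      (auto simp: w0_out w0_in C1_with_grad_grad[OF K(1)])
  also have "\<dots> = (LINT x|lborel. w0 x *\<^sub>R d x) \<bullet> i" using integral_inner_left[OF i1, of i] by simp
  also have "\<dots> = - ((LINT x|lborel. \<phi> x *\<^sub>R X0 x) \<bullet> i)" using integral_by_parts[OF \<phi> K(1)] by simp
  also have "(LINT x|lborel. \<phi> x *\<^sub>R X0 x) \<bullet> i = (LINT x|lborel. \<phi> x * (X0 x \<bullet> i))"
    using integral_inner_left[OF i2, of i] by simp
  finally show ?thesis .
qed

lemma approx_limit_w0: "x \<in> \<Omega> \<Longrightarrow> approx_limit w0 x (w0 x)"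
proof (rule approx_limit_continuous[OF w0_integrable])
  assume x: "x \<in> \<Omega>"
  have "continuous_on \<Omega> w0" by (rule continuous_on_eq[OF w_cont]) (simp add: w0_in)
  then show "isCont w0 x" using \<Omega>(1) x by (simp add: continuous_on_eq_continuous_at)
qed

lemma singular_set_empty: "singular_set \<Omega> w = {}"
proof -
  have "approx_limit w x (w0 x)" if "x \<in> \<Omega>" for x
  proof -
    have "approx_limit w x (w0 x) \<longleftrightarrow> approx_limit w0 x (w0 x)"
      by (rule approx_limit_representative[OF \<Omega>(1) w0_measurable w0_out _ that]) (auto simp: w0_in)
    then show ?thesis using approx_limit_w0[OF that] by simp
  qed
  then show ?thesis by (auto simp: singular_set_def)
qed

lemma in_BV: "w \<in> BV \<Omega>"
proof -
  obtain e :: 'a where e: "e \<in> Basis" using nonempty_Basis by blast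
  \<comment> \<open>The total variation has density \<open>norm (X0 x)\<close>. Where the gradient
    vanishes the direction is arbitrary, but the polar decomposition asks for a unit vector.\<close>
  define \<sigma> where "\<sigma> x = (if X0 x = 0 then e else X0 x /\<^sub>R norm (X0 x))" for x
  have \<sigma>m[measurable]: "\<sigma> \<in> borel_measurable borel" unfolding \<sigma>_def by measurable
  have \<sigma>1: "norm (\<sigma> x) = 1" for x using e by (auto simp: \<sigma>_def)
  have X\<sigma>: "norm (X0 x) *\<^sub>R \<sigma> x = X0 x" for x by (auto simp: \<sigma>_def)
  define R where "R = restrict_space lborel \<Omega>"
  define \<mu> where "\<mu> = density R (\<lambda>x. ennreal (norm (X0 x)))"
  have sR: "sets R = sets (restrict_space borel \<Omega>)" unfolding R_def by (intro sets_restrict_space_cong) simp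
  have mR: "q \<in> borel_measurable R" if "q \<in> borel_measurable borel" for q :: "'a \<Rightarrow> 'b::topological_space"
    using that unfolding measurable_cong_sets[OF sR refl] by (rule measurable_restrict_space1)
  have Rint: "(LINT x|\<mu>. q x) = (LINT x|lborel. norm (X0 x) *\<^sub>R q x)" if q: "q \<in> borel_measurable borel" for q :: "'a \<Rightarrow> real"
  proof -
    have "(LINT x|\<mu>. q x) = (LINT x|R. norm (X0 x) *\<^sub>R q x)"
      unfolding \<mu>_def using q by (intro integral_density mR) auto
    also have "\<dots> = (LINT x|lborel. indicator \<Omega> x *\<^sub>R (norm (X0 x) *\<^sub>R q x))"
      unfolding R_def by (subst integral_restrict_space) auto
    also have "(\<lambda>x. indicator \<Omega> x *\<^sub>R (norm (X0 x) *\<^sub>R q x)) = (\<lambda>x. norm (X0 x) *\<^sub>R q x)"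
      by (auto simp: indicator_def fun_eq_iff X0_out)
    finally show ?thesis .
  qed
  have "is_polar_deriv \<Omega> w \<mu> \<sigma>"
    unfolding is_polar_deriv_def
  proof (intro conjI ballI)
    show s\<mu>: "sets \<mu> = sets (restrict_space borel \<Omega>)" using sR by (simp add: \<mu>_def)
    show "finite_measure \<mu>"
    proof (rule finite_measureI)
      have "emeasure \<mu> (space \<mu>) = (\<integral>\<^sup>+x. ennreal (norm (X0 x)) \<partial>R)"
      proof -
        have "(\<lambda>x. ennreal (norm (X0 x))) \<in> borel_measurable R" by (rule mR) measurable
        then have "emeasure \<mu> (space \<mu>) = (\<integral>\<^sup>+x. ennreal (norm (X0 x)) * indicator (space R) x \<partial>R)"
          unfolding \<mu>_def by (subst emeasure_density) auto
        also have "\<dots> = (\<integral>\<^sup>+x. ennreal (norm (X0 x)) \<partial>R)" by (intro nn_integral_cong) simp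
        finally show ?thesis .
      qed
      also have "\<dots> = (\<integral>\<^sup>+x. ennreal (norm (X0 x)) * indicator \<Omega> x \<partial>lborel)"
        unfolding R_def by (subst nn_integral_restrict_space) auto
      also have "\<dots> \<le> (\<integral>\<^sup>+x. ennreal (norm (X0 x)) \<partial>lborel)"
        by (intro nn_integral_mono) (auto simp: indicator_def)
      also have "\<dots> < \<infinity>" using X0_integrable by (simp add: integrable_iff_bounded)
      finally show "emeasure \<mu> (space \<mu>) \<noteq> \<infinity>" by simp
    qed
    show "\<sigma> \<in> borel_measurable \<mu>" using mR[OF \<sigma>m] by (simp add: \<mu>_def)
    show "norm (\<sigma> x) = 1" for x by (rule \<sigma>1)
    fix \<phi> and i :: 'a assume \<phi>: "\<phi> \<in> C1_compact_support \<Omega>" and i: "i \<in> Basis"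
    obtain d where "C1_with_grad \<phi> d" using C1_compact_supportE[OF \<phi>] by metis
    then have [measurable]: "\<phi> \<in> borel_measurable borel" by (rule C1_with_grad_measurable)
    have "(LINT x|\<mu>. \<phi> x * (\<sigma> x \<bullet> i)) = (LINT x|lborel. norm (X0 x) *\<^sub>R (\<phi> x * (\<sigma> x \<bullet> i)))"
      by (rule Rint) measurable
    also have "(\<lambda>x. norm (X0 x) *\<^sub>R (\<phi> x * (\<sigma> x \<bullet> i))) = (\<lambda>x. \<phi> x * (X0 x \<bullet> i))"
    proof
      fix x
      have "norm (X0 x) * (\<sigma> x \<bullet> i) = X0 x \<bullet> i" using X\<sigma>[of x] by (metis inner_scaleR_left)
      then show "norm (X0 x) *\<^sub>R (\<phi> x * (\<sigma> x \<bullet> i)) = \<phi> x * (X0 x \<bullet> i)" by (simp add: mult.left_commute)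
    qed
    finally show "(LINT x|lebesgue_on \<Omega>. w x * (grad \<phi> x \<bullet> i)) = - (LINT x|\<mu>. \<phi> x * (\<sigma> x \<bullet> i))"
      using integral_by_parts_component[OF \<phi> i] by simp
  qed
  moreover have "integrable (lebesgue_on \<Omega>) w \<longleftrightarrow> integrable lborel w0"
    by (rule integrable_lebesgue_on_representative[OF \<Omega>_borel w0_measurable w0_out]) (auto simp: w0_in)
  ultimately show ?thesis using w0_integrable unfolding BV_def by blast
qed

lemma BV_deriv_eq:
  assumes "A \<in> sets borel" "A \<subseteq> \<Omega>"
  shows "BV_deriv \<Omega> w A = (LINT x:A|lborel. X0 x)"
  by (rule BV_deriv_of_density[OF \<Omega>(1) in_BV X0_integrable integral_by_parts_component assms])

lemma approx_grad_eq: "AE x in lborel. x \<in> \<Omega> \<longrightarrow> approx_grad \<Omega> w x = X0 x"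
proof (rule approx_grad_AE_eq(2)[OF \<Omega>(1) _ X0_integrable X0_out])
  show "is_approx_grad \<Omega> w X0"
    unfolding is_approx_grad_def
  proof (intro conjI bexI[of _ "{}"] ballI impI)
    have "integrable (lebesgue_on \<Omega>) X0 \<longleftrightarrow> integrable lborel X0"
      by (rule integrable_lebesgue_on_representative[OF \<Omega>_borel X0_measurable X0_out]) auto
    then show "integrable (lebesgue_on \<Omega>) X0" using X0_integrable by simp
    fix A :: "'a set" assume A: "A \<in> sets borel" "A \<subseteq> \<Omega> - {}"
    then have "A \<subseteq> \<Omega>" by simp
    have "(LINT x:A|lebesgue. X0 x) = (LINT x:A|lborel. X0 x)"
      by (rule set_integral_lebesgue_representative[OF \<Omega>_borel X0_measurable X0_out _ A(1) \<open>A \<subseteq> \<Omega>\<close>]) auto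
    then show "BV_deriv \<Omega> w A = (LINT x:A|lebesgue. X0 x)" using BV_deriv_eq[OF A(1) \<open>A \<subseteq> \<Omega>\<close>] by simp
  qed simp
qed

lemma in_SBV: "w \<in> SBV \<Omega>"
proof -
  have "BV_deriv \<Omega> w A = (LINT x:A|lebesgue. approx_grad \<Omega> w x)" if A: "A \<in> sets borel" "A \<subseteq> \<Omega>" for A
    using BV_deriv_eq[OF A] set_integral_lebesgue_representative[OF \<Omega>_borel X0_measurable X0_out approx_grad_eq A] by simp
  then show ?thesis
    using in_BV by (simp add: SBV_def singular_set_empty set_integrable_def set_lebesgue_integral_def)
qed

lemma mumford_shah_eq:
  assumes g: "g0 \<in> borel_measurable borel" "\<And>x. \<bar>g0 x\<bar> \<le> C" "\<And>x. x \<notin> \<Omega> \<Longrightarrow> g0 x = 0"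
    and ae: "AE x in lborel. x \<in> \<Omega> \<longrightarrow> g x = g0 x" and \<beta>: "\<beta> \<ge> 0"
  shows "mumford_shah \<Omega> \<alpha> \<beta> g w = ennreal ((LINT x|lborel. (norm (X0 x))\<^sup>2) + \<beta> * (LINT x|lborel. (w0 x - g0 x)\<^sup>2))"
proof -
  have "(\<integral>\<^sup>+x. ennreal ((norm (approx_grad \<Omega> w x))\<^sup>2) \<partial>lebesgue_on \<Omega>) = (\<integral>\<^sup>+x. ennreal ((norm (X0 x))\<^sup>2) \<partial>lborel)"
    by (rule nn_integral_lebesgue_on_representative[OF \<Omega>_borel], simp add: X0_out, use approx_grad_eq in eventually_elim) simp
  also have "\<dots> = ennreal (LINT x|lborel. (norm (X0 x))\<^sup>2)"
    by (rule nn_integral_eq_integral[OF X0_square_integrable]) simp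
  finally have 1: "(\<integral>\<^sup>+x. ennreal ((norm (approx_grad \<Omega> w x))\<^sup>2) \<partial>lebesgue_on \<Omega>) = ennreal (LINT x|lborel. (norm (X0 x))\<^sup>2)" .
  have "(\<integral>\<^sup>+x. ennreal ((w x - g x)\<^sup>2) \<partial>lebesgue_on \<Omega>) = (\<integral>\<^sup>+x. ennreal ((w0 x - g0 x)\<^sup>2) \<partial>lborel)"
    by (rule nn_integral_lebesgue_on_representative[OF \<Omega>_borel], simp add: w0_out g(3), use ae in eventually_elim) (simp add: w0_in)
  also have "\<dots> = ennreal (LINT x|lborel. (w0 x - g0 x)\<^sup>2)"
    by (rule nn_integral_eq_integral[OF w0_square_integrable[OF g]]) auto
  finally have 2: "(\<integral>\<^sup>+x. ennreal ((w x - g x)\<^sup>2) \<partial>lebesgue_on \<Omega>) = ennreal (LINT x|lborel. (w0 x - g0 x)\<^sup>2)" .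
  show ?thesis
    unfolding mumford_shah_def 1 2 singular_set_empty using \<beta> by (simp add: ennreal_mult' ennreal_plus)
qed

lemma L2_representative:
  fixes q q' :: "'a \<Rightarrow> 'b::euclidean_space"
  assumes "q' \<in> borel_measurable borel" "\<And>x. x \<notin> \<Omega> \<Longrightarrow> q' x = 0" "AE x in lborel. x \<in> \<Omega> \<longrightarrow> q x = q' x"
  shows "q \<in> L2 \<Omega> \<longleftrightarrow> integrable lborel (\<lambda>x. (norm (q' x))\<^sup>2)"
proof -
  have "q \<in> borel_measurable (lebesgue_on \<Omega>)" by (rule measurable_lebesgue_on_representative[OF \<Omega>_borel assms])
  moreover have "integrable (lebesgue_on \<Omega>) (\<lambda>x. (norm (q x))\<^sup>2) \<longleftrightarrow> integrable lborel (\<lambda>x. (norm (q' x))\<^sup>2)"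
    by (rule integrable_lebesgue_on_representative[OF \<Omega>_borel]) (use assms in \<open>auto elim!: eventually_mono\<close>)
  ultimately show ?thesis by (simp add: L2_def)
qed

lemma weak_grad_X: "w \<in> L2 \<Omega>" "X \<in> L2 \<Omega>" "is_weak_grad \<Omega> w X"
proof -
  have "w \<in> L2 \<Omega> \<longleftrightarrow> integrable lborel (\<lambda>x. (norm (w0 x))\<^sup>2)" by (rule L2_representative) (auto simp: w0_in w0_out)
  then show "w \<in> L2 \<Omega>" using w0_square_integrable[of "\<lambda>x. 0" 0] by simp
  have "X \<in> L2 \<Omega> \<longleftrightarrow> integrable lborel (\<lambda>x. (norm (X0 x))\<^sup>2)" by (rule L2_representative) (auto simp: X0_in X0_out)
  then show "X \<in> L2 \<Omega>" using X0_square_integrable by simp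
  show "is_weak_grad \<Omega> w X"
    unfolding is_weak_grad_def
  proof (intro ballI)
    fix \<phi> and i :: 'a assume \<phi>: "\<phi> \<in> C1_compact_support \<Omega>" and i: "i \<in> Basis"
    obtain d where "C1_with_grad \<phi> d" using C1_compact_supportE[OF \<phi>] by metis
    then have [measurable]: "\<phi> \<in> borel_measurable borel" by (rule C1_with_grad_measurable)
    have "(LINT x|lebesgue_on \<Omega>. \<phi> x * (X x \<bullet> i)) = (LINT x|lborel. \<phi> x * (X0 x \<bullet> i))"
      by (rule integral_lebesgue_on_representative[OF \<Omega>_borel]) (auto simp: X0_in X0_out)
    then show "(LINT x|lebesgue_on \<Omega>. w x * (grad \<phi> x \<bullet> i)) = - (LINT x|lebesgue_on \<Omega>. \<phi> x * (X x \<bullet> i))"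
      using integral_by_parts_component[OF \<phi> i] by simp
  qed
qed

lemma in_W12: "w \<in> W12 \<Omega>"
  using weak_grad_X by (auto simp: W12_def)

text \<open>Square integrability of the chosen weak gradient implies integrability, since
  \<bar>H\<bar> \<le> 1 + \<bar>H\<bar>^2 on the bounded set \<Omega>; then test functions identify
  it with the classical gradient.\<close>

lemma weak_grad_eq: "AE x in lborel. x \<in> \<Omega> \<longrightarrow> weak_grad \<Omega> w x = X0 x"
proof -
  have "weak_grad \<Omega> w \<in> L2 \<Omega> \<and> is_weak_grad \<Omega> w (weak_grad \<Omega> w)"
    unfolding weak_grad_def by (rule someI[of "\<lambda>G. G \<in> L2 \<Omega> \<and> is_weak_grad \<Omega> w G" X]) (use weak_grad_X in simp)
  then have W: "weak_grad \<Omega> w \<in> L2 \<Omega>" "is_weak_grad \<Omega> w (weak_grad \<Omega> w)" by auto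
  have "weak_grad \<Omega> w \<in> borel_measurable (lebesgue_on \<Omega>)" using W(1) by (simp add: L2_def)
  then obtain H where H: "H \<in> borel_measurable borel" "\<And>x. x \<notin> \<Omega> \<Longrightarrow> H x = 0" "AE x in lborel. x \<in> \<Omega> \<longrightarrow> weak_grad \<Omega> w x = H x"
    by (rule borel_representative[OF \<Omega>_borel]) (rule that)
  note H(1)[measurable]
  have H2: "integrable lborel (\<lambda>x. (norm (H x))\<^sup>2)" using L2_representative[OF H] W(1) by simp
  have Hi: "integrable lborel H"
  proof (rule Bochner_Integration.integrable_bound)
    have "integrable lborel (indicator \<Omega> :: 'a \<Rightarrow> real)"
      by (rule integrable_domain_bounded[where B=1]) (auto simp: indicator_def)
    then show "integrable lborel (\<lambda>x. indicator \<Omega> x + (norm (H x))\<^sup>2 :: real)" using H2 by simp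
    have "norm (H x) \<le> norm (indicator \<Omega> x + (norm (H x))\<^sup>2 :: real)" for x
    proof (cases "x \<in> \<Omega>")
      case True
      have "0 \<le> (norm (H x) - 1)\<^sup>2" by simp
      then have "2 * norm (H x) \<le> 1 + (norm (H x))\<^sup>2" by (simp add: power2_eq_square algebra_simps)
      moreover have "0 \<le> norm (H x)" by simp
      ultimately have "norm (H x) \<le> 1 + (norm (H x))\<^sup>2" by linarith
      then show ?thesis using True by simp
    qed (simp add: H(2))
    then show "AE x in lborel. norm (H x) \<le> norm (indicator \<Omega> x + (norm (H x))\<^sup>2 :: real)" by simp
  qed simp
  have "AE x in lborel. x \<in> \<Omega> \<longrightarrow> H x \<bullet> i = X0 x \<bullet> i" if i: "i \<in> Basis" for i
  proof (rule AE_eq_of_test_functions[OF \<Omega>(1)])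
    fix \<phi> assume \<phi>: "\<phi> \<in> C1_compact_support \<Omega>"
    obtain d where "C1_with_grad \<phi> d" using C1_compact_supportE[OF \<phi>] by metis
    then have [measurable]: "\<phi> \<in> borel_measurable borel" by (rule C1_with_grad_measurable)
    have "(LINT x|lebesgue_on \<Omega>. \<phi> x * (weak_grad \<Omega> w x \<bullet> i)) = (LINT x|lborel. \<phi> x * (H x \<bullet> i))"
      by (rule integral_lebesgue_on_representative[OF \<Omega>_borel]) (use H in \<open>auto elim!: eventually_mono\<close>)
    then show "(LINT x|lborel. \<phi> x * (H x \<bullet> i)) = (LINT x|lborel. \<phi> x * (X0 x \<bullet> i))"
      using W(2) \<phi> i integral_by_parts_component[OF \<phi> i] by (simp add: is_weak_grad_def)
  qed (use Hi X0_integrable in auto)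
  then have "AE x in lborel. \<forall>i\<in>Basis. x \<in> \<Omega> \<longrightarrow> H x \<bullet> i = X0 x \<bullet> i" by (intro AE_finite_allI) auto
  then show ?thesis
    using H(3)
  proof eventually_elim
    case (elim x)
    show ?case
    proof
      assume x: "x \<in> \<Omega>"
      then have "H x \<bullet> i = X0 x \<bullet> i" if "i \<in> Basis" for i using bspec[OF elim(1) that] by simp
      then have "H x = X0 x" by (rule euclidean_eqI)
      then show "weak_grad \<Omega> w x = X0 x" using elim(2) x by simp
    qed
  qed
qed

lemma neumann_energy_eq:
  assumes g: "g0 \<in> borel_measurable borel" "\<And>x. x \<notin> \<Omega> \<Longrightarrow> g0 x = 0"
    and ae: "AE x in lborel. x \<in> \<Omega> \<longrightarrow> g x = g0 x"
  shows "neumann_energy \<Omega> \<beta> g w = (LINT x|lborel. (norm (X0 x))\<^sup>2 + \<beta> * (w0 x - g0 x)\<^sup>2)"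
  unfolding neumann_energy_def
proof (rule integral_lebesgue_on_representative[OF \<Omega>_borel])
  show "AE x in lborel. x \<in> \<Omega> \<longrightarrow> (norm (weak_grad \<Omega> w x))\<^sup>2 + \<beta> * (w x - g x)\<^sup>2 = (norm (X0 x))\<^sup>2 + \<beta> * (w0 x - g0 x)\<^sup>2"
    using ae weak_grad_eq by eventually_elim (auto simp: w0_in)
qed (use g in \<open>auto simp: X0_out w0_out\<close>)

end

section \<open>First variation of the Neumann energy\<close>

lemma linear_term_eq_0:
  fixes b c :: real
  assumes "\<And>t. 0 \<le> 2 * t * b + t\<^sup>2 * c"
  shows "b = 0"
proof (rule ccontr)
  assume b: "b \<noteq> 0"
  define k where "k = \<bar>c\<bar> + 1"
  have k: "k > 0" "c \<le> k" by (auto simp: k_def)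
  \<comment> \<open>The minimiser of the quadratic after \<open>c\<close> is replaced by the larger
    positive \<open>k\<close>.\<close>
  have "0 \<le> 2 * (- b / k) * b + (- b / k)\<^sup>2 * c" by (rule assms)
  also have "\<dots> \<le> 2 * (- b / k) * b + (- b / k)\<^sup>2 * k" using k by (intro add_left_mono mult_left_mono) auto
  also have "\<dots> = - (b\<^sup>2 / k)" using k by (simp add: field_simps power2_eq_square)
  also have "\<dots> < 0" using b k by simp
  finally show False by simp
qed

text \<open>Along u + t p the energy is a quadratic polynomial in t with minimum at 0, so its linear
  coefficient vanishes. \<open>p\<close> is not asked to vanish on the boundary; this is the weak
  form of the Neumann condition.\<close>

lemma euler_lagrange:
  fixes \<Omega> :: "'a::euclidean_space set"
  assumes u: "bounded_C1 \<Omega> u X" and p: "bounded_C1 \<Omega> p D" and sol: "neumann_solution \<Omega> \<beta> g u"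
    and g: "g0 \<in> borel_measurable borel" "\<And>x. \<bar>g0 x\<bar> \<le> C" "\<And>x. x \<notin> \<Omega> \<Longrightarrow> g0 x = 0"
    and ae: "AE x in lborel. x \<in> \<Omega> \<longrightarrow> g x = g0 x"
  shows "(LINT x|lborel. bounded_C1.X0 \<Omega> X x \<bullet> bounded_C1.X0 \<Omega> D x)
    = - (LINT x|lborel. \<beta> * (bounded_C1.w0 \<Omega> u x - g0 x) * bounded_C1.w0 \<Omega> p x)"
proof -
  interpret u: bounded_C1 \<Omega> u X by fact
  interpret p: bounded_C1 \<Omega> p D by fact
  note g(1)[measurable]
  obtain Bu where Bu: "\<And>x. \<bar>u.w0 x\<bar> \<le> Bu" by (rule u.w0_le) (rule that)
  obtain Bp where Bp: "Bp > 0" "\<And>x. \<bar>p.w0 x\<bar> \<le> Bp" by (rule p.w0_le) (rule that)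
  obtain Cu where Cu: "\<And>x. norm (u.X0 x) \<le> Cu" by (rule u.X0_le) (rule that)
  obtain Cp where Cp: "Cp > 0" "\<And>x. norm (p.X0 x) \<le> Cp" by (rule p.X0_le) (rule that)
  have i1: "integrable lborel (\<lambda>x. u.X0 x \<bullet> p.X0 x)"
  proof (rule u.integrable_domain_bounded)
    fix x
    have "\<bar>u.X0 x \<bullet> p.X0 x\<bar> \<le> norm (u.X0 x) * norm (p.X0 x)" by (rule Cauchy_Schwarz_ineq2)
    also have "\<dots> \<le> Cu * Cp" using Cu[of x] Cp(2)[of x] by (intro mult_mono) (auto intro: order_trans[OF norm_ge_zero])
    finally show "norm (u.X0 x \<bullet> p.X0 x) \<le> Cu * Cp" by simp
  qed (auto simp: u.X0_out)
  have i2: "integrable lborel (\<lambda>x. (u.w0 x - g0 x) * p.w0 x)"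
  proof (rule u.integrable_domain_bounded)
    fix x
    have "\<bar>u.w0 x - g0 x\<bar> \<le> Bu + C" using Bu[of x] g(2)[of x] by linarith
    then show "norm ((u.w0 x - g0 x) * p.w0 x) \<le> (Bu + C) * Bp"
      unfolding real_norm_def abs_mult using Bp(2)[of x] by (intro mult_mono) auto
  qed (auto simp: p.w0_out)
  have i3: "integrable lborel (\<lambda>x. (norm (u.X0 x))\<^sup>2 + \<beta> * (u.w0 x - g0 x)\<^sup>2)"
    using u.X0_square_integrable u.w0_square_integrable[OF g] by simp
  have i4: "integrable lborel (\<lambda>x. (norm (p.X0 x))\<^sup>2 + \<beta> * (p.w0 x - 0)\<^sup>2)"
    using p.X0_square_integrable p.w0_square_integrable[of "\<lambda>x. 0" 0] by simp
  define b where "b = (LINT x|lborel. u.X0 x \<bullet> p.X0 x) + \<beta> * (LINT x|lborel. (u.w0 x - g0 x) * p.w0 x)"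
  define c where "c = (LINT x|lborel. (norm (p.X0 x))\<^sup>2 + \<beta> * (p.w0 x - 0)\<^sup>2)"
  have "0 \<le> 2 * t * b + t\<^sup>2 * c" for t
  proof -
    interpret t: bounded_C1 \<Omega> "\<lambda>x. u x + t * p x" "\<lambda>x. X x + t *\<^sub>R D x"
    proof
      show "open \<Omega>" "bounded \<Omega>" by (rule u.\<Omega>)+
      show "GDERIV (\<lambda>x. u x + t * p x) x :> X x + t *\<^sub>R D x" if "x \<in> \<Omega>" for x
        using u.deriv[OF that] p.deriv[OF that] unfolding gderiv_def
        by (auto intro!: derivative_eq_intros simp: inner_add_right)
      show "continuous_on \<Omega> (\<lambda>x. X x + t *\<^sub>R D x)" by (intro continuous_intros u.X_cont p.X_cont)
      show "bounded ((\<lambda>x. u x + t * p x) ` \<Omega>)"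
        using bounded_plus_comp[OF u.w_bounded bounded_scaleR_comp[OF p.w_bounded, of t]] by simp
      show "bounded ((\<lambda>x. X x + t *\<^sub>R D x) ` \<Omega>)"
        by (intro bounded_plus_comp u.X_bounded bounded_scaleR_comp p.X_bounded)
    qed
    have "neumann_energy \<Omega> \<beta> g u \<le> neumann_energy \<Omega> \<beta> g (\<lambda>x. u x + t * p x)"
      using sol t.in_W12 by (simp add: neumann_solution_def)
    also have "\<dots> = (LINT x|lborel. (norm (t.X0 x))\<^sup>2 + \<beta> * (t.w0 x - g0 x)\<^sup>2)"
      by (rule t.neumann_energy_eq[OF g(1,3) ae])
    also have "(\<lambda>x. (norm (t.X0 x))\<^sup>2 + \<beta> * (t.w0 x - g0 x)\<^sup>2) =
      (\<lambda>x. ((norm (u.X0 x))\<^sup>2 + \<beta> * (u.w0 x - g0 x)\<^sup>2) + ((2 * t) * (u.X0 x \<bullet> p.X0 x) + (2 * t * \<beta>) * ((u.w0 x - g0 x) * p.w0 x)) +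
        t\<^sup>2 * ((norm (p.X0 x))\<^sup>2 + \<beta> * (p.w0 x - 0)\<^sup>2))"
    proof
      fix x
      have "t.X0 x = u.X0 x + t *\<^sub>R p.X0 x" "t.w0 x = u.w0 x + t * p.w0 x"
        by (auto simp: t.X0_def u.X0_def p.X0_def t.w0_def u.w0_def p.w0_def indicator_def)
      then show "(norm (t.X0 x))\<^sup>2 + \<beta> * (t.w0 x - g0 x)\<^sup>2 =
        ((norm (u.X0 x))\<^sup>2 + \<beta> * (u.w0 x - g0 x)\<^sup>2) + ((2 * t) * (u.X0 x \<bullet> p.X0 x) + (2 * t * \<beta>) * ((u.w0 x - g0 x) * p.w0 x)) +
        t\<^sup>2 * ((norm (p.X0 x))\<^sup>2 + \<beta> * (p.w0 x - 0)\<^sup>2)"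
        by (simp only: power2_norm_eq_inner inner_add_left inner_add_right inner_commute[of "p.X0 x" "u.X0 x"] inner_scaleR_left inner_scaleR_right) (simp add: power2_eq_square algebra_simps)
    qed
    also have "(LINT x|lborel. ((norm (u.X0 x))\<^sup>2 + \<beta> * (u.w0 x - g0 x)\<^sup>2) + ((2 * t) * (u.X0 x \<bullet> p.X0 x) + (2 * t * \<beta>) * ((u.w0 x - g0 x) * p.w0 x)) +
        t\<^sup>2 * ((norm (p.X0 x))\<^sup>2 + \<beta> * (p.w0 x - 0)\<^sup>2)) =
      (LINT x|lborel. (norm (u.X0 x))\<^sup>2 + \<beta> * (u.w0 x - g0 x)\<^sup>2) +
        ((2 * t) * (LINT x|lborel. u.X0 x \<bullet> p.X0 x) + (2 * t * \<beta>) * (LINT x|lborel. (u.w0 x - g0 x) * p.w0 x)) + t\<^sup>2 * c"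
      unfolding c_def
      by (simp only: Bochner_Integration.integral_add Bochner_Integration.integrable_add integrable_mult_right integral_mult_right_zero i1 i2 i3 i4)
    also have "(LINT x|lborel. (norm (u.X0 x))\<^sup>2 + \<beta> * (u.w0 x - g0 x)\<^sup>2) = neumann_energy \<Omega> \<beta> g u"
      by (rule u.neumann_energy_eq[OF g(1,3) ae, symmetric])
    finally show ?thesis by (simp add: b_def algebra_simps)
  qed
  then have "b = 0" by (rule linear_term_eq_0)
  then show ?thesis
    unfolding b_def by (simp add: mult.assoc)
qed

section \<open>Boundedness of the data\<close>

lemma C1_up_to_boundary_bounded:
  assumes "open \<Omega>" "bounded \<Omega>" "C1_up_to_boundary \<Omega> u"
  shows "bounded_C1 \<Omega> u (grad u)"
proof -
  obtain U G where U: "continuous_on (closure \<Omega>) U" "continuous_on (closure \<Omega>) G" "\<And>x. x \<in> \<Omega> \<Longrightarrow> u x = U x" "\<And>x. x \<in> \<Omega> \<Longrightarrow> GDERIV u x :> G x"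
    using assms(3) unfolding C1_up_to_boundary_def by blast
  have gr: "grad u x = G x" if "x \<in> \<Omega>" for x by (rule grad_eq[OF U(4)[OF that]])
  have cpt: "compact (closure \<Omega>)" using assms(2) by (simp add: compact_closure)
  show ?thesis
  proof
    show "open \<Omega>" "bounded \<Omega>" by fact+
    show "GDERIV u x :> grad u x" if "x \<in> \<Omega>" for x using U(4)[OF that] gr[OF that] by simp
    show "continuous_on \<Omega> (grad u)"
      by (rule continuous_on_eq[OF continuous_on_subset[OF U(2) closure_subset]]) (simp add: gr)
    have "bounded (U ` \<Omega>)" "bounded (G ` \<Omega>)"
      using compact_imp_bounded[OF compact_continuous_image[OF U(1) cpt]] compact_imp_bounded[OF compact_continuous_image[OF U(2) cpt]]
      by (meson bounded_subset closure_subset image_mono)+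
    then show "bounded (u ` \<Omega>)" "bounded (grad u ` \<Omega>)" using U(3) gr by simp_all
  qed
qed

lemma C1_with_grad_bounded_C1:
  assumes "open \<Omega>" "bounded \<Omega>" "C1_with_grad \<phi> d"
  shows "bounded_C1 \<Omega> \<phi> d"
proof
  show "open \<Omega>" "bounded \<Omega>" by fact+
  show "GDERIV \<phi> x :> d x" for x by (rule C1_with_grad_GDERIV[OF assms(3)])
  show "continuous_on \<Omega> d" by (rule C1_with_grad_continuous_grad[OF assms(3)])
  have cpt: "compact (closure \<Omega>)" using assms(2) by (simp add: compact_closure)
  show "bounded (\<phi> ` \<Omega>)"
    using compact_imp_bounded[OF compact_continuous_image[OF C1_with_grad_continuous[OF assms(3)] cpt]]
    by (meson bounded_subset closure_subset image_mono)
  show "bounded (d ` \<Omega>)"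
    using compact_imp_bounded[OF compact_continuous_image[OF C1_with_grad_continuous_grad[OF assms(3)] cpt]]
    by (meson bounded_subset closure_subset image_mono)
qed

lemma AE_lebesgue_on_iff:
  assumes "\<Omega> \<in> sets borel"
  shows "(AE x in lebesgue_on \<Omega>. Q x) \<longleftrightarrow> (AE x in lborel. x \<in> \<Omega> \<longrightarrow> Q x)"
  using assms by (subst AE_restrict_space_iff) (auto simp: AE_completion_iff)

text \<open>\<open>real_of_ereal\<close> sends infinite values to 0, so the bound rests on
  finiteness of the essential supremum: it is at most \<open>C\<close>, and it is not minus infinity
  because a nonempty open set is not null.\<close>

lemma ess_sup_on_AE:
  fixes \<Omega> :: "'a::euclidean_space set"
  assumes \<Omega>: "open \<Omega>" "\<Omega> \<noteq> {}" and g: "g \<in> L_infinity \<Omega>"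
  shows "AE x in lebesgue_on \<Omega>. g x \<le> ess_sup_on \<Omega> g"
proof -
  obtain C where C: "AE x in lebesgue_on \<Omega>. \<bar>g x\<bar> \<le> C" and gm: "g \<in> borel_measurable (lebesgue_on \<Omega>)"
    using g by (auto simp: L_infinity_def)
  define e where "e = esssup (lebesgue_on \<Omega>) (\<lambda>x. ereal (g x))"
  have ae: "AE x in lebesgue_on \<Omega>. ereal (g x) \<le> e" unfolding e_def by (rule esssup_AE)
  have "e \<le> ereal C" unfolding e_def
    by (rule esssup_I) (use gm C in \<open>auto elim!: eventually_mono\<close>)
  then have 1: "e \<noteq> \<infinity>" by auto
  have 2: "e \<noteq> - \<infinity>"
  proof
    assume "e = - \<infinity>"
    then have "AE x in lebesgue_on \<Omega>. False" using ae by (auto elim!: eventually_mono)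
    then have "AE x in lborel. x \<notin> \<Omega>" using \<Omega>(1) by (subst (asm) AE_lebesgue_on_iff) auto
    then have "\<Omega> \<in> null_sets lborel" using \<Omega>(1) by (subst AE_iff_null_sets) auto
    then have "negligible \<Omega>" by (simp add: negligible_iff_null_sets null_sets_completionI)
    then show False using open_not_negligible[OF \<Omega>] by simp
  qed
  have "e = ereal (ess_sup_on \<Omega> g)" using 1 2 unfolding ess_sup_on_def e_def[symmetric] by (cases e) auto
  then show ?thesis using ae by (auto elim!: eventually_mono)
qed

text \<open>Clamping a Borel representative to the essential bounds alters it only on a null set and
  makes the bounds hold at every point of \<Omega>, as the pointwise inequality in the final
  estimate requires.\<close>

lemma L_infinity_representative:
  fixes \<Omega> :: "'a::euclidean_space set"
  assumes \<Omega>: "open \<Omega>" "\<Omega> \<noteq> {}" and g: "g \<in> L_infinity \<Omega>"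
  obtains g0 where "g0 \<in> borel_measurable borel" "\<And>x. x \<notin> \<Omega> \<Longrightarrow> g0 x = 0"
    "\<And>x. x \<in> \<Omega> \<Longrightarrow> ess_inf_on \<Omega> g \<le> g0 x" "\<And>x. x \<in> \<Omega> \<Longrightarrow> g0 x \<le> ess_sup_on \<Omega> g"
    "AE x in lborel. x \<in> \<Omega> \<longrightarrow> g x = g0 x"
proof -
  have \<Omega>B[measurable]: "\<Omega> \<in> sets borel" using \<Omega> by simp
  define m M where "m = ess_inf_on \<Omega> g" and "M = ess_sup_on \<Omega> g"
  have gm: "g \<in> borel_measurable (lebesgue_on \<Omega>)" using g by (simp add: L_infinity_def)
  have "(\<lambda>x. - g x) \<in> L_infinity \<Omega>" using g by (auto simp: L_infinity_def)
  then have "AE x in lebesgue_on \<Omega>. - g x \<le> - m" unfolding m_def ess_inf_on_def by (simp add: ess_sup_on_AE[OF \<Omega>])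
  moreover have "AE x in lebesgue_on \<Omega>. g x \<le> M" unfolding M_def by (rule ess_sup_on_AE[OF \<Omega> g])
  ultimately have "AE x in lebesgue_on \<Omega>. m \<le> g x \<and> g x \<le> M" by eventually_elim simp
  then have ae: "AE x in lborel. x \<in> \<Omega> \<longrightarrow> m \<le> g x \<and> g x \<le> M" unfolding AE_lebesgue_on_iff[OF \<Omega>B] .
  have "m \<le> M"
  proof (rule ccontr)
    assume "\<not> m \<le> M"
    then have "AE x in lborel. x \<notin> \<Omega>" using ae by (auto elim!: eventually_mono)
    then have "\<Omega> \<in> null_sets lborel" by (subst AE_iff_null_sets) auto
    then have "negligible \<Omega>" by (simp add: negligible_iff_null_sets null_sets_completionI)
    then show False using open_not_negligible[OF \<Omega>] by simp
  qed
  obtain g' where g': "g' \<in> borel_measurable borel" "AE x in lborel. x \<in> \<Omega> \<longrightarrow> g x = g' x"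
    using borel_representative[OF \<Omega>B gm] by metis
  note g'(1)[measurable]
  show thesis
  proof (rule that[of "\<lambda>x. indicator \<Omega> x * max m (min M (g' x))"])
    show "AE x in lborel. x \<in> \<Omega> \<longrightarrow> g x = indicator \<Omega> x * max m (min M (g' x))"
      using ae g'(2) by eventually_elim auto
  qed (use \<open>m \<le> M\<close> in \<open>auto simp: m_def M_def\<close>)
qed

section \<open>The Mumford--Shah inequality\<close>

text \<open>The clamp is averaged over [t, t + \<eta>]. The average has the difference quotient of
  the clamp as its derivative, which lies between 0 and 1 and is continuous. By the mean value
  theorem the average is a value of the clamp at distance less than \<eta>; subtracting the midpoint
  centres it.\<close>

lemma smooth_clamp:
  fixes a b \<eta> :: real
  assumes ab: "a \<le> b" and \<eta>: "\<eta> > 0"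
  obtains T T' where "\<And>t. (T has_real_derivative T' t) (at t)" "continuous_on UNIV T'" "\<And>t. 0 \<le> T' t" "\<And>t. T' t \<le> 1"
    "\<And>t. \<bar>T t\<bar> \<le> (b - a) / 2" "\<And>t. \<bar>T t - (max a (min b t) - (a + b) / 2)\<bar> \<le> \<eta>"
proof -
  define k where "k t = max a (min b t)" for t :: real
  \<comment> \<open>An antiderivative of the clamp, which equals a + max 0 (t - a) - max 0 (t -
    b).\<close>
  define Q where "Q t = ((max 0 (t - a))\<^sup>2 - (max 0 (t - b))\<^sup>2) / 2 + a * t" for t :: real
  have sq: "((\<lambda>t. (max 0 t)\<^sup>2) has_real_derivative 2 * max 0 t) (at t)" for t :: real
  proof -
    have "GDERIV (\<lambda>t::real. (max 0 t)\<^sup>2) t :> 2 * max 0 t"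
    proof (rule GDERIV_of_quadratic_bound)
      fix s :: real
      show "\<bar>(max 0 (t + s))\<^sup>2 - (max 0 t)\<^sup>2 - s \<bullet> (2 * max 0 t)\<bar> \<le> 1 * (norm s)\<^sup>2"
        using max_square_taylor[of t s] by (simp add: mult.commute)
    qed
    then show ?thesis by simp
  qed
  have sq': "((\<lambda>t. (max 0 (t - e))\<^sup>2) has_real_derivative 2 * max 0 (t - e)) (at t)" for t e :: real
    using sq[of "t + - e"] unfolding DERIV_shift by simp
  have Q: "(Q has_real_derivative k t) (at t)" for t
  proof -
    have "(Q has_real_derivative (2 * max 0 (t - a) - 2 * max 0 (t - b)) / 2 + a) (at t)"
      unfolding Q_def by (rule derivative_eq_intros sq' refl | simp)+
    also have "(2 * max 0 (t - a) - 2 * max 0 (t - b)) / 2 + a = k t" using ab by (auto simp: k_def max_def min_def field_simps)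
    finally show ?thesis .
  qed
  have k: "k s \<le> k t" "k t \<le> k s + (t - s)" if "s \<le> t" for s t using that ab by (auto simp: k_def max_def min_def)
  have kab: "a \<le> k t" "k t \<le> b" for t using ab by (auto simp: k_def)
  have mv: "\<exists>\<xi>. t < \<xi> \<and> \<xi> < t + \<eta> \<and> (Q (t + \<eta>) - Q t) / \<eta> = k \<xi>" for t
  proof -
    obtain \<xi> where "t < \<xi>" "\<xi> < t + \<eta>" "Q (t + \<eta>) - Q t = (t + \<eta> - t) * k \<xi>"
      using MVT2[of t "t + \<eta>" Q k] \<eta> Q by auto
    then show ?thesis using \<eta> by (intro exI[of _ \<xi>]) auto
  qed
  show thesis
  proof (rule that[of "\<lambda>t. (Q (t + \<eta>) - Q t) / \<eta> - (a + b) / 2" "\<lambda>t. (k (t + \<eta>) - k t) / \<eta>"])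
    fix t
    have "((\<lambda>t. Q (t + \<eta>)) has_real_derivative k (t + \<eta>)) (at t)"
      using Q[of "t + \<eta>"] unfolding DERIV_shift .
    then show "((\<lambda>t. (Q (t + \<eta>) - Q t) / \<eta> - (a + b) / 2) has_real_derivative (k (t + \<eta>) - k t) / \<eta>) (at t)"
      using Q[of t] \<eta> by (auto intro!: derivative_eq_intros)
    show "0 \<le> (k (t + \<eta>) - k t) / \<eta>" "(k (t + \<eta>) - k t) / \<eta> \<le> 1" using k[of t "t + \<eta>"] \<eta> by auto
    obtain \<xi> where \<xi>: "t < \<xi>" "\<xi> < t + \<eta>" "(Q (t + \<eta>) - Q t) / \<eta> = k \<xi>" using mv by blast
    show "\<bar>(Q (t + \<eta>) - Q t) / \<eta> - (a + b) / 2\<bar> \<le> (b - a) / 2"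
      using kab[of \<xi>] unfolding \<xi>(3) by (simp add: abs_le_iff field_simps)
    show "\<bar>(Q (t + \<eta>) - Q t) / \<eta> - (a + b) / 2 - (max a (min b t) - (a + b) / 2)\<bar> \<le> \<eta>"
      using k[of t \<xi>] \<xi>(1,2) unfolding \<xi>(3) k_def[symmetric] by auto
  next
    show "continuous_on UNIV (\<lambda>t. (k (t + \<eta>) - k t) / \<eta>)" unfolding k_def using \<eta> by (intro continuous_intros) auto
  qed
qed

text \<open>Where the truncation is inactive the expression is (v - u)^2. Where it acts from above
  it equals (v - g)^2 - (u - g)(M - g), and v - g exceeds the mean of the two factors, so the
  inequality of arithmetic and geometric means applies; from below it is symmetric.\<close>

lemma square_distance_clamp:
  fixes u v g m M :: real
  assumes "m \<le> g" "g \<le> M"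
  defines "w \<equiv> u / 2 + max (m / 2) (min (M / 2) (v - u / 2))"
  shows "0 \<le> (v - g)\<^sup>2 - (u - g)\<^sup>2 + 2 * (u - g) * (u - w)"
proof -
  \<comment> \<open>\<open>p\<close> can have either sign; the sign condition is on \<open>q\<close>
    alone.\<close>
  have amgm: "p * q \<le> r\<^sup>2" if "q \<ge> 0" "(p + q) / 2 \<le> r" for p q r :: real
  proof (cases "p < 0")
    case True
    then have "p * q \<le> 0" using that by (intro mult_nonpos_nonneg) auto
    then show ?thesis by (rule order_trans) simp
  next
    case False
    have "0 \<le> ((p - q) / 2)\<^sup>2" by simp
    then have "p * q \<le> ((p + q) / 2)\<^sup>2" by (simp add: power2_eq_square field_simps)
    also have "\<dots> \<le> r\<^sup>2" using that False by (intro power_mono) auto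
    finally show ?thesis .
  qed
  consider "v - u / 2 > M / 2" | "v - u / 2 < m / 2" | "m / 2 \<le> v - u / 2" "v - u / 2 \<le> M / 2" by linarith
  then show ?thesis
  proof cases
    case 1
    then have w: "w = u / 2 + M / 2" using assms by (simp add: w_def)
    have "(u - g) * (M - g) \<le> (v - g)\<^sup>2" using assms 1 by (intro amgm) auto
    then show ?thesis unfolding w by (simp add: power2_eq_square algebra_simps)
  next
    case 2
    then have w: "w = u / 2 + m / 2" using assms by (simp add: w_def)
    have "(g - u) * (g - m) \<le> (g - v)\<^sup>2" using assms 2 by (intro amgm) auto
    then show ?thesis unfolding w by (simp add: power2_eq_square algebra_simps)
  next
    case 3
    then have w: "w = v" by (simp add: w_def)
    have "0 \<le> (v - u)\<^sup>2" by simp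
    then show ?thesis unfolding w by (simp add: power2_eq_square algebra_simps)
  qed
qed

text \<open>The comparison for finite energy, in real numbers and for Borel representatives;
  \<open>h\<close> takes the place of the Hausdorff measure of the jump set.\<close>

lemma mumford_shah_comparison:
  fixes \<Omega> :: "'a::euclidean_space set"
  assumes u: "bounded_C1 \<Omega> u X" and lip: "lipschitz_boundary \<Omega>" and s: "\<And>x. x \<in> \<Omega> \<Longrightarrow> norm (X x) \<le> s" "s \<ge> 0"
    and sol: "neumann_solution \<Omega> \<beta> g u" and \<beta>: "\<beta> > 0"
    and g0: "g0 \<in> borel_measurable borel" "\<And>x. x \<notin> \<Omega> \<Longrightarrow> g0 x = 0" "\<And>x. x \<in> \<Omega> \<Longrightarrow> m \<le> g0 x" "\<And>x. x \<in> \<Omega> \<Longrightarrow> g0 x \<le> M"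
      "AE x in lborel. x \<in> \<Omega> \<longrightarrow> g x = g0 x" and mM: "m \<le> M"
    and J: "jump_decomposition \<Omega> P v G \<sigma> \<nu> h" and v: "\<And>x. x \<notin> \<Omega> \<Longrightarrow> v x = 0"
    and fin: "integrable lborel (\<lambda>x. (norm (G x))\<^sup>2)" "integrable lborel (\<lambda>x. (v x - g0 x)\<^sup>2)"
    and \<alpha>: "(M - m) * s \<le> \<alpha>"
  shows "(LINT x|lborel. (norm (bounded_C1.X0 \<Omega> X x))\<^sup>2) + \<beta> * (LINT x|lborel. (bounded_C1.w0 \<Omega> u x - g0 x)\<^sup>2)
    \<le> (LINT x|lborel. (norm (G x))\<^sup>2) + \<alpha> * h + \<beta> * (LINT x|lborel. (v x - g0 x)\<^sup>2)"
proof -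
  interpret u: bounded_C1 \<Omega> u X by fact
  interpret J: jump_decomposition \<Omega> P v G \<sigma> \<nu> h by fact
  note g0(1)[measurable]
  have Gm[measurable]: "G \<in> borel_measurable borel" and vm[measurable]: "v \<in> borel_measurable borel"
    using J.G_integrable J.z_integrable by (auto dest: borel_measurable_integrable)
  define C where "C = \<bar>m\<bar> + \<bar>M\<bar>"
  have g0le: "\<bar>g0 x\<bar> \<le> C" for x
    using g0(2-4)[of x] by (cases "x \<in> \<Omega>") (auto simp: C_def)
  obtain B where B: "\<And>x. \<bar>u.w0 x\<bar> \<le> B" by (rule u.w0_le) (rule that)
  define f where "f x = \<beta> * (u.w0 x - g0 x)" for x
  have fm[measurable]: "f \<in> borel_measurable borel" unfolding f_def by measurable
  have f0: "f x = 0" if "x \<notin> \<Omega>" for x using that by (simp add: f_def u.w0_out g0(2))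
  have fle: "\<bar>f x\<bar> \<le> \<beta> * (B + C)" for x
  proof -
    have "\<bar>u.w0 x - g0 x\<bar> \<le> B + C" using B[of x] g0le[of x] by linarith
    then show ?thesis using \<beta> by (simp add: f_def abs_mult)
  qed
  have fi: "integrable lborel f" by (rule u.integrable_domain_bounded[OF fm _ f0]) (use fle in auto)
  have fb: "integrable lborel (\<lambda>x. f x * q x)" if "q \<in> borel_measurable borel" "\<And>x. \<bar>q x\<bar> \<le> K" for q K
    using integrable_mult_bounded[OF fi, of q K] that by simp
  have weak: "(LINT x|lborel. u.X0 x \<bullet> d x) = - (LINT x|lborel. f x * \<phi> x)" if \<phi>: "C1_with_grad \<phi> d" for \<phi> d
  proof -
    interpret p: bounded_C1 \<Omega> \<phi> d by (rule C1_with_grad_bounded_C1[OF u.\<Omega> \<phi>])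
    have "(\<lambda>x. u.X0 x \<bullet> p.X0 x) = (\<lambda>x. u.X0 x \<bullet> d x)"
      by (auto simp: u.X0_def p.X0_def indicator_def)
    moreover have "(\<lambda>x. \<beta> * (u.w0 x - g0 x) * p.w0 x) = (\<lambda>x. f x * \<phi> x)"
    proof
      fix x show "\<beta> * (u.w0 x - g0 x) * p.w0 x = f x * \<phi> x"
        by (cases "x \<in> \<Omega>") (auto simp: f_def p.w0_in p.w0_out u.w0_out g0(2))
    qed
    ultimately show ?thesis
      using euler_lagrange[OF u p.bounded_C1_axioms sol g0(1) g0le g0(2,5)] by simp
  qed
  \<comment> \<open>The test function is the constant 1. This makes the constant subtracted to
    centre the truncation invisible under the integral against \<open>f\<close>.\<close>
  have f_mean: "(LINT x|lborel. f x) = 0" using weak[OF C1_with_grad_const[of 1]] by simp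
  have self: "(LINT x|lborel. (norm (u.X0 x))\<^sup>2) = - (LINT x|lborel. f x * u.w0 x)"
    using euler_lagrange[OF u u sol g0(1) g0le g0(2,5)] by (simp add: f_def power2_norm_eq_inner)
  interpret h: bounded_C1 \<Omega> "\<lambda>x. u x / 2" "\<lambda>x. X x /\<^sub>R 2"
  proof
    show "open \<Omega>" "bounded \<Omega>" by (rule u.\<Omega>)+
    show "GDERIV (\<lambda>x. u x / 2) x :> X x /\<^sub>R 2" if "x \<in> \<Omega>" for x
      using u.deriv[OF that] unfolding gderiv_def by (auto intro!: derivative_eq_intros simp: field_simps)
    show "continuous_on \<Omega> (\<lambda>x. X x /\<^sub>R 2)" by (intro continuous_intros u.X_cont)
    show "bounded ((\<lambda>x. u x / 2) ` \<Omega>)" using bounded_scaleR_comp[OF u.w_bounded, of "1/2"] by simp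
    show "bounded ((\<lambda>x. X x /\<^sub>R 2) ` \<Omega>)" by (intro bounded_scaleR_comp u.X_bounded)
  qed
  have hw: "h.w0 x = u.w0 x / 2" and hX: "h.X0 x = u.X0 x /\<^sub>R 2" for x
    unfolding h.w0_def u.w0_def h.X0_def u.X0_def by auto
  define z where "z x = v x - h.w0 x" for x
  define Z where "Z x = G x - h.X0 x" for x
  have Jz: "jump_decomposition \<Omega> P z Z \<sigma> \<nu> h"
    unfolding z_def Z_def
    by (rule jump_decomposition_diff[OF J h.w0_integrable h.approx_limit_w0 h.X0_integrable h.X0_out h.integral_by_parts])
  have zm[measurable]: "z \<in> borel_measurable borel" unfolding z_def by measurable
  have Zi: "integrable lborel Z" unfolding Z_def using J.G_integrable h.X0_integrable by simp
  have Xs: "norm (u.X0 x) \<le> s" for x using s by (cases "x \<in> \<Omega>") (auto simp: u.X0_in u.X0_out)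
  define k where "k t = max (m / 2) (min (M / 2) t)" for t :: real
  have km[measurable]: "k \<in> borel_measurable borel" unfolding k_def by measurable
  have kle: "\<bar>k t\<bar> \<le> C" for t using mM by (auto simp: k_def C_def max_def min_def)
  have mM': "m / 2 \<le> M / 2" using mM by simp
  \<comment> \<open>For the smooth truncation, which is within \<eta> of the centred clamp; the last
    term pays for the replacement and disappears as \<eta> tends to 0.\<close>
  have approx: "- 2 * (LINT x|lborel. f x * k (z x)) \<le> ((LINT x|lborel. (norm (G x))\<^sup>2) + \<alpha> * h) + \<eta> * (2 * (LINT x|lborel. \<bar>f x\<bar>))"
    if \<eta>: "\<eta> > 0" for \<eta>
  proof (rule smooth_clamp[OF mM' \<eta>])
    fix T T' assume T: "\<And>t. (T has_real_derivative T' t) (at t)" "continuous_on UNIV T'" "\<And>t. 0 \<le> T' t" "\<And>t. T' t \<le> 1"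
      "\<And>t. \<bar>T t\<bar> \<le> (M / 2 - m / 2) / 2" "\<And>t. \<bar>T t - (max (m / 2) (min (M / 2) t) - (m / 2 + M / 2) / 2)\<bar> \<le> \<eta>"
    have "continuous_on UNIV T" using DERIV_isCont[OF T(1)] by (simp add: continuous_on_eq_continuous_at)
    then have Tm[measurable]: "T \<in> borel_measurable borel" by (rule borel_measurable_continuous_onI)
    have T'm[measurable]: "T' \<in> borel_measurable borel" by (rule borel_measurable_continuous_onI[OF T(2)])
    interpret J': jump_decomposition \<Omega> P z Z \<sigma> \<nu> h by (rule Jz)
    interpret tj: truncated_jump \<Omega> P z Z \<sigma> \<nu> h T T' "M / 2 - m / 2"
      by unfold_locales (rule T)+
    have flux: "- (LINT x|lborel. f x * T (z x)) \<le> (LINT x|lborel. T' (z x) * (u.X0 x \<bullet> Z x)) + s * ((M / 2 - m / 2) * h)"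
    proof (rule tj.neumann_flux_inequality[OF u.\<Omega>(2) lip u.X0_measurable _ u.X0_out Xs fm f0 fle weak])
      show "continuous_on \<Omega> u.X0" by (rule continuous_on_eq[OF u.X_cont]) (simp add: u.X0_in)
    qed
    have XZ: "integrable lborel (\<lambda>x. u.X0 x \<bullet> Z x)"
    proof (rule Bochner_Integration.integrable_bound)
      show "integrable lborel (\<lambda>x. s * norm (Z x))" using Zi by simp
      have "norm (u.X0 x \<bullet> Z x) \<le> norm (s * norm (Z x))" for x
      proof -
        have "\<bar>u.X0 x \<bullet> Z x\<bar> \<le> norm (u.X0 x) * norm (Z x)" by (rule Cauchy_Schwarz_ineq2)
        also have "\<dots> \<le> s * norm (Z x)" using Xs[of x] by (rule mult_right_mono) simp
        finally show ?thesis using s(2) by (simp add: abs_mult)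
      qed
      then show "AE x in lborel. norm (u.X0 x \<bullet> Z x) \<le> norm (s * norm (Z x))" by simp
    qed (use Zi in auto)
    have "integrable lborel (\<lambda>x. (u.X0 x \<bullet> Z x) *\<^sub>R T' (z x))"
      by (rule integrable_mult_bounded[OF XZ, where B=1]) (use T(3,4) in auto)
    then have i: "integrable lborel (\<lambda>x. T' (z x) * (u.X0 x \<bullet> Z x))" by (simp add: mult.commute)
    have "2 * (LINT x|lborel. T' (z x) * (u.X0 x \<bullet> Z x)) = (LINT x|lborel. 2 * (T' (z x) * (u.X0 x \<bullet> Z x)))" by simp
    also have "\<dots> \<le> (LINT x|lborel. (norm (G x))\<^sup>2)"
    proof (rule Bochner_Integration.integral_mono)
      show "integrable lborel (\<lambda>x. 2 * (T' (z x) * (u.X0 x \<bullet> Z x)))" using i by simp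
      fix x
      have "0 \<le> (norm (G x - u.X0 x))\<^sup>2" by simp
      then have "2 * (u.X0 x \<bullet> Z x) \<le> (norm (G x))\<^sup>2"
        unfolding power2_norm_eq_inner Z_def hX by (simp add: inner_diff_left inner_diff_right inner_commute)
      \<comment> \<open>The left side may be negative, so \<open>T'\<close> is multiplied on both
        sides first and then dropped from the nonnegative right side.\<close>
      then have "T' (z x) * (2 * (u.X0 x \<bullet> Z x)) \<le> T' (z x) * (norm (G x))\<^sup>2" using T(3) by (rule mult_left_mono)
      also have "\<dots> \<le> 1 * (norm (G x))\<^sup>2" using T(4) by (rule mult_right_mono) simp
      finally show "2 * (T' (z x) * (u.X0 x \<bullet> Z x)) \<le> (norm (G x))\<^sup>2" by simp
    qed (rule fin)
    finally have e1: "2 * (LINT x|lborel. T' (z x) * (u.X0 x \<bullet> Z x)) \<le> (LINT x|lborel. (norm (G x))\<^sup>2)" .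
    have "(M - m) * s * h \<le> \<alpha> * h" using \<alpha> J.h_nonneg by (rule mult_right_mono)
    \<comment> \<open>Twice the oscillation (M - m)/2 times the sup of the gradient: the hypothesis
      on \<alpha> is used exactly here.\<close>
    then have e2: "2 * (s * ((M / 2 - m / 2) * h)) \<le> \<alpha> * h" by (simp add: algebra_simps)
    have iT: "integrable lborel (\<lambda>x. f x * T (z x))" by (rule fb[where K="(M / 2 - m / 2) / 2"]) (use T(5) in auto)
    have ik: "integrable lborel (\<lambda>x. f x * k (z x))" by (rule fb[where K=C]) (use kle in auto)
    have "(LINT x|lborel. f x * T (z x)) - (LINT x|lborel. f x * k (z x)) =
      (LINT x|lborel. f x * T (z x) - f x * k (z x) + (m / 2 + M / 2) / 2 * f x)"
      using iT ik fi f_mean by simp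
    also have "\<dots> = (LINT x|lborel. f x * (T (z x) - (k (z x) - (m / 2 + M / 2) / 2)))"
      by (simp add: algebra_simps)
    also have "\<dots> \<le> (LINT x|lborel. \<eta> * \<bar>f x\<bar>)"
    proof (rule Bochner_Integration.integral_mono)
      have "\<bar>T (z x) - (k (z x) - (m / 2 + M / 2) / 2)\<bar> \<le> \<eta>" for x using T(6)[of "z x"] by (simp only: k_def)
      then show "integrable lborel (\<lambda>x. f x * (T (z x) - (k (z x) - (m / 2 + M / 2) / 2)))"
        by (intro fb[where K=\<eta>]) auto
      show "integrable lborel (\<lambda>x. \<eta> * \<bar>f x\<bar>)" using fi by auto
      fix x
      have "f x * (T (z x) - (k (z x) - (m / 2 + M / 2) / 2)) \<le> \<bar>f x\<bar> * \<bar>T (z x) - (k (z x) - (m / 2 + M / 2) / 2)\<bar>"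
        by (metis abs_ge_self abs_mult)
      also have "\<dots> \<le> \<bar>f x\<bar> * \<eta>" using T(6)[of "z x"] by (intro mult_left_mono) (simp_all only: k_def abs_ge_zero)
      finally show "f x * (T (z x) - (k (z x) - (m / 2 + M / 2) / 2)) \<le> \<eta> * \<bar>f x\<bar>" by (simp add: mult.commute)
    qed
    also have "\<dots> = \<eta> * (LINT x|lborel. \<bar>f x\<bar>)" by simp
    finally show ?thesis using flux e1 e2 by linarith
  qed
  have main: "- 2 * (LINT x|lborel. f x * k (z x)) \<le> (LINT x|lborel. (norm (G x))\<^sup>2) + \<alpha> * h"
  proof (rule field_le_epsilon)
    fix e :: real assume e: "e > 0"
    define F where "F = 2 * (LINT x|lborel. \<bar>f x\<bar>)"
    have F: "F \<ge> 0" by (simp add: F_def)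
    have "e / (F + 1) * F \<le> e" using e F by (simp add: field_simps)
    then show "- 2 * (LINT x|lborel. f x * k (z x)) \<le> (LINT x|lborel. (norm (G x))\<^sup>2) + \<alpha> * h + e"
      using approx[of "e / (F + 1)", folded F_def] e F by simp
  qed
  have ik: "integrable lborel (\<lambda>x. f x * k (z x))" by (rule fb[where K=C]) (use kle in auto)
  have iu: "integrable lborel (\<lambda>x. f x * u.w0 x)" by (rule fb[OF _ B]) simp
  have i2: "integrable lborel (\<lambda>x. (u.w0 x - g0 x)\<^sup>2)" by (rule u.w0_square_integrable[OF g0(1) g0le g0(2)])
  \<comment> \<open>The pointwise inequality multiplied by \<beta>: with w = u/2 + k(z) its last
    term becomes f u - 2 f k(z). The integral of the first summand is minus the Dirichlet energy of
    u, and \<open>main\<close> bounds the second.\<close>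
  have "0 \<le> (LINT x|lborel. \<beta> * (v x - g0 x)\<^sup>2 - \<beta> * (u.w0 x - g0 x)\<^sup>2 + (f x * u.w0 x - 2 * (f x * k (z x))))"
  proof (rule Bochner_Integration.integral_nonneg)
    fix x
    show "0 \<le> \<beta> * (v x - g0 x)\<^sup>2 - \<beta> * (u.w0 x - g0 x)\<^sup>2 + (f x * u.w0 x - 2 * (f x * k (z x)))"
    proof (cases "x \<in> \<Omega>")
      case True
      have "0 \<le> \<beta> * ((v x - g0 x)\<^sup>2 - (u.w0 x - g0 x)\<^sup>2 + 2 * (u.w0 x - g0 x) * (u.w0 x - (u.w0 x / 2 + k (z x))))"
        using \<beta> square_distance_clamp[OF g0(3,4)[OF True], of "v x" "u.w0 x"]
        by (intro mult_nonneg_nonneg) (auto simp: k_def z_def hw)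
      also have "\<dots> = \<beta> * (v x - g0 x)\<^sup>2 - \<beta> * (u.w0 x - g0 x)\<^sup>2 + (f x * u.w0 x - 2 * (f x * k (z x)))"
        by (simp add: f_def algebra_simps)
      finally show ?thesis .
    qed (simp add: u.w0_out g0(2) v f0)
  qed
  also have "\<dots> = \<beta> * (LINT x|lborel. (v x - g0 x)\<^sup>2) - \<beta> * (LINT x|lborel. (u.w0 x - g0 x)\<^sup>2)
      + ((LINT x|lborel. f x * u.w0 x) - 2 * (LINT x|lborel. f x * k (z x)))"
    using fin(2) i2 ik iu by simp
  finally show ?thesis using main self by linarith
qed

theorem mainTheorem7:
  fixes \<Omega> :: "'a::euclidean_space set"
    and \<alpha> \<beta> m M :: real
    and g u :: "'a \<Rightarrow> real"
  assumes "bounded \<Omega>" and "open \<Omega>" and "lipschitz_boundary \<Omega>"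
    and "\<alpha> > 0" and "\<beta> > 0"
    and "g \<in> L_infinity \<Omega>"
    and "m = ess_inf_on \<Omega> g" and "M = ess_sup_on \<Omega> g"
    and "neumann_solution \<Omega> \<beta> g u"
    and "C1_up_to_boundary \<Omega> u"
    and "(M - m) * (SUP x\<in>\<Omega>. norm (grad u x)) \<le> \<alpha>"
  shows "u \<in> SBV \<Omega> \<and> (\<forall>v\<in>SBV \<Omega>. mumford_shah \<Omega> \<alpha> \<beta> g u \<le> mumford_shah \<Omega> \<alpha> \<beta> g v)"
proof
  interpret u: bounded_C1 \<Omega> u "grad u" by (rule C1_up_to_boundary_bounded[OF assms(2,1,10)])
  show "u \<in> SBV \<Omega>" by (rule u.in_SBV)
  show "\<forall>v\<in>SBV \<Omega>. mumford_shah \<Omega> \<alpha> \<beta> g u \<le> mumford_shah \<Omega> \<alpha> \<beta> g v"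
  proof (cases "\<Omega> = {}")
    \<comment> \<open>On the empty domain the supremum and the essential bounds carry no
      information, but both sides of the claim are trivial.\<close>
    case True
    then have "mumford_shah \<Omega> \<alpha> \<beta> g u = 0"
      by (simp add: mumford_shah_def singular_set_def nn_integral_empty space_restrict_space)
    then show ?thesis by simp
  next
    case False
    then obtain x0 where x0: "x0 \<in> \<Omega>" by blast
    obtain g0 where g0: "g0 \<in> borel_measurable borel" "\<And>x. x \<notin> \<Omega> \<Longrightarrow> g0 x = 0" "\<And>x. x \<in> \<Omega> \<Longrightarrow> m \<le> g0 x" "\<And>x. x \<in> \<Omega> \<Longrightarrow> g0 x \<le> M"
        "AE x in lborel. x \<in> \<Omega> \<longrightarrow> g x = g0 x"
      by (rule L_infinity_representative[OF assms(2) False assms(6), folded assms(7,8)]) (rule that)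
    have mM: "m \<le> M" using g0(3,4)[OF x0] by linarith
    have g0le: "\<bar>g0 x\<bar> \<le> \<bar>m\<bar> + \<bar>M\<bar>" for x using g0(2-4)[of x] by (cases "x \<in> \<Omega>") auto
    note g0(1)[measurable]
    define s where "s = (SUP x\<in>\<Omega>. norm (grad u x))"
    have bdd: "bdd_above ((\<lambda>x. norm (grad u x)) ` \<Omega>)"
      using u.X_bounded by (auto simp: bounded_iff bdd_above_def)
    have s: "norm (grad u x) \<le> s" if "x \<in> \<Omega>" for x unfolding s_def using that bdd by (rule cSUP_upper)
    have s0: "s \<ge> 0" using s[OF x0] by (rule order_trans[rotated]) simp
    have \<alpha>: "(M - m) * s \<le> \<alpha>" using assms(11) by (simp add: s_def)
    have Fu: "mumford_shah \<Omega> \<alpha> \<beta> g u = ennreal ((LINT x|lborel. (norm (u.X0 x))\<^sup>2) + \<beta> * (LINT x|lborel. (u.w0 x - g0 x)\<^sup>2))"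
      by (rule u.mumford_shah_eq[OF g0(1) g0le g0(2,5) less_imp_le[OF assms(5)]])
    show ?thesis
    proof
      fix v assume v: "v \<in> SBV \<Omega>"
      define H where "H = hausdorff_outer (DIM('a) - 1) (singular_set \<Omega> v)"
      show "mumford_shah \<Omega> \<alpha> \<beta> g u \<le> mumford_shah \<Omega> \<alpha> \<beta> g v"
      proof (cases "H = top")
        case True
        then have "mumford_shah \<Omega> \<alpha> \<beta> g v = top"
          unfolding mumford_shah_def H_def[symmetric] using assms(4) by (simp add: ennreal_mult_top)
        then show ?thesis by simp
      next
        case False
        define h where "h = enn2real H"
        have h: "H = ennreal h" "h \<ge> 0" using False by (auto simp: h_def less_top)
        have "hausdorff_outer (DIM('a) - 1) (singular_set \<Omega> v) \<le> ennreal h" using h(1) by (simp add: H_def)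
        from SBV_jump_decomposition[OF assms(2,1) v this h(2)]
        obtain P v' G \<sigma> \<nu> where J: "jump_decomposition \<Omega> P v' G \<sigma> \<nu> h" and v': "\<And>x. x \<notin> \<Omega> \<Longrightarrow> v' x = 0"
          "AE x in lborel. x \<in> \<Omega> \<longrightarrow> v x = v' x" and G: "AE x in lborel. x \<in> \<Omega> \<longrightarrow> approx_grad \<Omega> v x = G x" by blast
        interpret J: jump_decomposition \<Omega> P v' G \<sigma> \<nu> h by (rule J)
        have Gm[measurable]: "G \<in> borel_measurable borel" and vm[measurable]: "v' \<in> borel_measurable borel"
          using J.G_integrable J.z_integrable by (auto dest: borel_measurable_integrable)
        have 1: "(\<integral>\<^sup>+x. ennreal ((norm (approx_grad \<Omega> v x))\<^sup>2) \<partial>lebesgue_on \<Omega>) = (\<integral>\<^sup>+x. ennreal ((norm (G x))\<^sup>2) \<partial>lborel)"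
          by (rule nn_integral_lebesgue_on_representative[OF u.\<Omega>_borel], simp add: J.G_zero, use G in eventually_elim) simp
        have 2: "(\<integral>\<^sup>+x. ennreal ((v x - g x)\<^sup>2) \<partial>lebesgue_on \<Omega>) = (\<integral>\<^sup>+x. ennreal ((v' x - g0 x)\<^sup>2) \<partial>lborel)"
          by (rule nn_integral_lebesgue_on_representative[OF u.\<Omega>_borel], simp add: v'(1) g0(2), use v'(2) g0(5) in eventually_elim) simp
        have Fv: "mumford_shah \<Omega> \<alpha> \<beta> g v = (\<integral>\<^sup>+x. ennreal ((norm (G x))\<^sup>2) \<partial>lborel) + ennreal (\<alpha> * h) + ennreal \<beta> * (\<integral>\<^sup>+x. ennreal ((v' x - g0 x)\<^sup>2) \<partial>lborel)"
          unfolding mumford_shah_def 1 2 H_def[symmetric] h(1) using assms(4) h(2) by (simp add: ennreal_mult)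
        show ?thesis
        \<comment> \<open>If either bulk term is infinite, so is the functional at \<open>v\<close>,
          since \<beta> > 0; otherwise the extended integrals are ordinary ones and the real
          comparison applies.\<close>
        proof (cases "(\<integral>\<^sup>+x. ennreal ((norm (G x))\<^sup>2) \<partial>lborel) = top \<or> (\<integral>\<^sup>+x. ennreal ((v' x - g0 x)\<^sup>2) \<partial>lborel) = top")
          case True
          then show ?thesis unfolding Fv using assms(5) by (elim disjE) (simp_all add: ennreal_mult_top)
        next
          case False
          have i1: "integrable lborel (\<lambda>x. (norm (G x))\<^sup>2)" using False by (intro integrableI_nonneg) (auto simp: less_top)
          have i2: "integrable lborel (\<lambda>x. (v' x - g0 x)\<^sup>2)" using False by (intro integrableI_nonneg) (auto simp: less_top)
          have n1: "(\<integral>\<^sup>+x. ennreal ((norm (G x))\<^sup>2) \<partial>lborel) = ennreal (LINT x|lborel. (norm (G x))\<^sup>2)"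
            by (rule nn_integral_eq_integral[OF i1]) simp
          have n2: "(\<integral>\<^sup>+x. ennreal ((v' x - g0 x)\<^sup>2) \<partial>lborel) = ennreal (LINT x|lborel. (v' x - g0 x)\<^sup>2)"
            by (rule nn_integral_eq_integral[OF i2]) simp
          have "(LINT x|lborel. (norm (u.X0 x))\<^sup>2) + \<beta> * (LINT x|lborel. (u.w0 x - g0 x)\<^sup>2)
            \<le> (LINT x|lborel. (norm (G x))\<^sup>2) + \<alpha> * h + \<beta> * (LINT x|lborel. (v' x - g0 x)\<^sup>2)"
            by (rule mumford_shah_comparison[OF u.bounded_C1_axioms assms(3) s s0 assms(9,5) g0 mM J v'(1) i1 i2 \<alpha>])
          moreover have "mumford_shah \<Omega> \<alpha> \<beta> g v = ennreal ((LINT x|lborel. (norm (G x))\<^sup>2) + \<alpha> * h + \<beta> * (LINT x|lborel. (v' x - g0 x)\<^sup>2))"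
            unfolding Fv n1 n2 using assms(4,5) h(2) by (simp add: ennreal_mult' ennreal_plus)
          ultimately show ?thesis unfolding Fu by (simp add: ennreal_leI)
        qed
      qed
    qed
  qed
qed

end
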